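(* Let $n\ge2$, $0<p,q\le\infty$ and $s\ge0$. Then for every $\varepsilon>0$ the trace operator $\mathrm{Tr}: f(x)\mapsto f(\bar x,0)$, $\bar x=(x_1,\dots,x_{n-1})$, is bounded $$\mathrm{Tr}:\ M_{p,q}^{\,s+\frac{1}{p\wedge q\wedge1}-\frac1q+\varepsilon}(\mathbb{R}^n)\to M^s_{p,q}(\mathbb{R}^{n-1}),$$ i.e. it maps the first space into the second and there is a constant $C>0$ such that $\|\mathrm{Tr}f\|_{M^s_{p,q}(\mathbb{R}^{n-1})}\le C\|f\|_{M_{p,q}^{s+1/(p\wedge q\wedge1)-1/q+\varepsilon}(\mathbb{R}^n)}$ for all $f$ in the first space.
   Context: Notation: $a\wedge b=\min(a,b)$, $\langle x\rangle=(1+|x|^2)^{1/2}$; $\mathscr{F},\mathscr{F}^{-1}$ are the Fourier transform and its inverse. Frequency-uniform decomposition: let $\eta:\mathbb{R}\to[0,1]$ be a smooth function with $\eta(t)=1$ for $|t|\le1$ and $\eta(t)=0$ for $|t|\ge2$. In dimension $d$, for $k\in\mathbb{Z}^d$ put $$\psi_k(\xi)=\frac{\prod_{i=1}^d\eta(2(\xi_i-k_i))}{\sum_{m\in\mathbb{Z}^d}\prod_{i=1}^d\eta(2(\xi_i-m_i))},\qquad \Box_k=\mathscr{F}^{-1}\psi_k\mathscr{F}.$$ Modulation space $M^s_{p,q}(\mathbb{R}^d)$: all tempered distributions $f$ with $$\|f\|_{M^s_{p,q}}=\Big(\sum_{k\in\mathbb{Z}^d}\langle k\rangle^{qs}\|\Box_kf\|_{L^p(\mathbb{R}^d)}^q\Big)^{1/q}<\infty$$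 (supremum if $q=\infty$). Trace: each $\Box_kf$ is a smooth function, and for a tempered distribution $f$ the trace $f(\bar x,0)$ is understood as $\sum_{k\in\mathbb{Z}^n}(\Box_kf)(\bar x,0)$, with convergence in $\mathscr{S}'(\mathbb{R}^{n-1})$. *)

theory Defs
  imports "HOL-Analysis.Analysis" "HOL-Probability.Essential_Supremum"
begin

section \<open>Schwartz functions and tempered distributions\<close>

definition partial_deriv ::
    "'a::euclidean_space \<Rightarrow> ('a \<Rightarrow> 'b::real_normed_vector) \<Rightarrow> 'a \<Rightarrow> 'b" where
  "partial_deriv b f = (\<lambda>x. frechet_derivative f (at x) b)"

text \<open>The list \<open>bs\<close> of basis vectors plays the role of a multi-index; its length is the order.\<close>

definition partial_derivs ::
    "'a::euclidean_space list \<Rightarrow> ('a \<Rightarrow> 'b::real_normed_vector) \<Rightarrow> 'a \<Rightarrow> 'b" where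
  "partial_derivs bs f = foldr partial_deriv bs f"

definition smooth_fun :: "('a::euclidean_space \<Rightarrow> 'b::real_normed_vector) \<Rightarrow> bool" where
  "smooth_fun f \<longleftrightarrow>
     (\<forall>bs. set bs \<subseteq> Basis \<longrightarrow> partial_derivs bs f differentiable_on UNIV)"

definition schwartz :: "('a::euclidean_space \<Rightarrow> complex) set" where
  "schwartz = {\<phi>. smooth_fun \<phi> \<and>
     (\<forall>N bs. set bs \<subseteq> Basis \<longrightarrow>
        bdd_above (range (\<lambda>x. (1 + norm x) ^ N * norm (partial_derivs bs \<phi> x))))}"

definition schwartz_seminorm :: "nat \<Rightarrow> ('a::euclidean_space \<Rightarrow> complex) \<Rightarrow> real" where
  "schwartz_seminorm N \<phi> =
     (SUP (bs, x) \<in> {bs. set bs \<subseteq> Basis \<and> length bs \<le> N} \<times> UNIV.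
        (1 + norm x) ^ N * norm (partial_derivs bs \<phi> x))"

text \<open>A distribution is a functional on all functions, but only its values on \<open>schwartz\<close> matter.
  None of the notions below depends on the other values.\<close>

type_synonym 'a dist = "('a \<Rightarrow> complex) \<Rightarrow> complex"

definition tempered_distributions :: "'a::euclidean_space dist set" where
  "tempered_distributions = {u.
     (\<forall>\<phi>\<in>schwartz. \<forall>\<psi>\<in>schwartz. u (\<lambda>x. \<phi> x + \<psi> x) = u \<phi> + u \<psi>) \<and>
     (\<forall>c. \<forall>\<phi>\<in>schwartz. u (\<lambda>x. c * \<phi> x) = c * u \<phi>) \<and>
     (\<exists>N C. \<forall>\<phi>\<in>schwartz. norm (u \<phi>) \<le> C * schwartz_seminorm N \<phi>)}"

definition dist_of_fun :: "('a::euclidean_space \<Rightarrow> complex) \<Rightarrow> 'a dist" where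
  "dist_of_fun h = (\<lambda>\<phi>. integral\<^sup>L lborel (\<lambda>x. h x * \<phi> x))"

text \<open>Convergence of a (multiply indexed) series in the space of tempered distributions:
  unordered summation, tested against every Schwartz function.\<close>

definition tempered_has_sum ::
    "('k \<Rightarrow> 'a::euclidean_space dist) \<Rightarrow> 'a dist \<Rightarrow> 'k set \<Rightarrow> bool" where
  "tempered_has_sum u U K \<longleftrightarrow>
     (\<forall>k\<in>K. u k \<in> tempered_distributions) \<and> U \<in> tempered_distributions \<and>
     (\<forall>\<phi>\<in>schwartz. ((\<lambda>k. u k \<phi>) has_sum U \<phi>) K)"

section \<open>Fourier transform\<close>

definition fourier :: "('a::euclidean_space \<Rightarrow> complex) \<Rightarrow> 'a \<Rightarrow> complex" where
  "fourier \<phi> = (\<lambda>\<xi>. integral\<^sup>L lborel (\<lambda>x. cis (- (x \<bullet> \<xi>)) * \<phi> x))"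

definition inv_fourier :: "('a::euclidean_space \<Rightarrow> complex) \<Rightarrow> 'a \<Rightarrow> complex" where
  "inv_fourier \<phi> = (\<lambda>x. complex_of_real (1 / (2 * pi) ^ DIM('a)) *
     integral\<^sup>L lborel (\<lambda>\<xi>. cis (x \<bullet> \<xi>) * \<phi> \<xi>))"

definition dist_fourier :: "'a::euclidean_space dist \<Rightarrow> 'a dist" where
  "dist_fourier u = (\<lambda>\<phi>. u (fourier \<phi>))"

definition dist_inv_fourier :: "'a::euclidean_space dist \<Rightarrow> 'a dist" where
  "dist_inv_fourier u = (\<lambda>\<phi>. u (inv_fourier \<phi>))"

definition dist_mult :: "('a::euclidean_space \<Rightarrow> real) \<Rightarrow> 'a dist \<Rightarrow> 'a dist" where
  "dist_mult m u = (\<lambda>\<phi>. u (\<lambda>\<xi>. complex_of_real (m \<xi>) * \<phi> \<xi>))"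

section \<open>Frequency-uniform decomposition\<close>

definition cutoff :: "(real \<Rightarrow> real) \<Rightarrow> bool" where
  "cutoff \<eta> \<longleftrightarrow> smooth_fun \<eta> \<and> (\<forall>t. 0 \<le> \<eta> t \<and> \<eta> t \<le> 1) \<and>
     (\<forall>t. \<bar>t\<bar> \<le> 1 \<longrightarrow> \<eta> t = 1) \<and> (\<forall>t. \<bar>t\<bar> \<ge> 2 \<longrightarrow> \<eta> t = 0)"

definition int_lattice :: "'a::euclidean_space set" where
  "int_lattice = {k. \<forall>b\<in>Basis. k \<bullet> b \<in> \<int>}"

text \<open>At each point only finitely many terms of the denominator are nonzero.\<close>

definition freq_window :: "(real \<Rightarrow> real) \<Rightarrow> 'a::euclidean_space \<Rightarrow> 'a \<Rightarrow> real" where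
  "freq_window \<eta> k \<xi> =
     (\<Prod>b\<in>Basis. \<eta> (2 * (\<xi> \<bullet> b - k \<bullet> b))) /
     (\<Sum>\<^sub>\<infinity>m\<in>int_lattice. \<Prod>b\<in>Basis. \<eta> (2 * (\<xi> \<bullet> b - m \<bullet> b)))"

definition box_dist :: "(real \<Rightarrow> real) \<Rightarrow> 'a::euclidean_space \<Rightarrow> 'a dist \<Rightarrow> 'a dist" where
  "box_dist \<eta> k f = dist_inv_fourier (dist_mult (freq_window \<eta> k) (dist_fourier f))"

text \<open>\<open>box_dist \<eta> k f\<close> has compactly supported Fourier transform, hence is given by a smooth
  function; \<open>box \<eta> k f\<close> is that function. A distribution has at most one continuous
  representative, so asking for continuity already singles it out.\<close>

definition box :: "(real \<Rightarrow> real) \<Rightarrow> 'a::euclidean_space \<Rightarrow> 'a dist \<Rightarrow> 'a \<Rightarrow> complex" where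
  "box \<eta> k f = (THE h. continuous_on UNIV h \<and>
     (\<forall>\<phi>\<in>schwartz. integrable lborel (\<lambda>x. h x * \<phi> x) \<and> box_dist \<eta> k f \<phi> = dist_of_fun h \<phi>))"

section \<open>Modulation spaces\<close>

text \<open>Real powers of extended nonnegative numbers, meant for exponents \<open>r > 0\<close>.\<close>

definition ennpowr :: "ennreal \<Rightarrow> real \<Rightarrow> ennreal" where
  "ennpowr a r = (if a = \<infinity> then \<infinity> else ennreal (enn2real a powr r))"

text \<open>Exponents range over \<open>(0, \<infinity>]\<close> and are elements of \<open>ennreal\<close>.\<close>

definition Lp_norm :: "ennreal \<Rightarrow> ('a::euclidean_space \<Rightarrow> complex) \<Rightarrow> ennreal" where
  "Lp_norm p h =
     (if p = \<infinity> then esssup lborel (\<lambda>x. ennreal (norm (h x)))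
      else ennpowr (\<integral>\<^sup>+ x. ennreal (norm (h x) powr enn2real p) \<partial>lborel) (1 / enn2real p))"

definition japanese_bracket :: "'a::euclidean_space \<Rightarrow> real" where
  "japanese_bracket x = sqrt (1 + (norm x)\<^sup>2)"

definition modulation_norm ::
    "(real \<Rightarrow> real) \<Rightarrow> real \<Rightarrow> ennreal \<Rightarrow> ennreal \<Rightarrow> 'a::euclidean_space dist \<Rightarrow> ennreal" where
  "modulation_norm \<eta> s p q f =
     (if q = \<infinity> then
        (SUP k\<in>int_lattice. ennreal (japanese_bracket k powr s) * Lp_norm p (box \<eta> k f))
      else
        ennpowr
          (\<Sum>\<^sub>\<infinity>k\<in>int_lattice. ennreal (japanese_bracket k powr (enn2real q * s)) *
             ennpowr (Lp_norm p (box \<eta> k f)) (enn2real q))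
          (1 / enn2real q))"

definition modulation_space ::
    "(real \<Rightarrow> real) \<Rightarrow> real \<Rightarrow> ennreal \<Rightarrow> ennreal \<Rightarrow> 'a::euclidean_space dist set" where
  "modulation_space \<eta> s p q =
     {f \<in> tempered_distributions. modulation_norm \<eta> s p q f < \<infinity>}"

section \<open>Trace on the hyperplane where the last coordinate vanishes\<close>

text \<open>The space \<open>\<real>\<^sup>n\<close> is modelled as the Euclidean space \<open>'a \<times> real\<close> with \<open>'a\<close> of dimension
  \<open>n - 1\<close>, a point being written \<open>(y, t)\<close> with \<open>t\<close> the last coordinate.\<close>

definition trace_term ::
    "(real \<Rightarrow> real) \<Rightarrow> ('a::euclidean_space \<times> real) dist \<Rightarrow> 'a \<times> real \<Rightarrow> 'a dist" where
  "trace_term \<eta> f k = dist_of_fun (\<lambda>y. box \<eta> k f (y, 0))"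

definition Tr :: "(real \<Rightarrow> real) \<Rightarrow> ('a::euclidean_space \<times> real) dist \<Rightarrow> 'a dist" where
  "Tr \<eta> f = (\<lambda>\<phi>. \<Sum>\<^sub>\<infinity>k\<in>int_lattice. trace_term \<eta> f k \<phi>)"

definition has_trace :: "(real \<Rightarrow> real) \<Rightarrow> ('a::euclidean_space \<times> real) dist \<Rightarrow> bool" where
  "has_trace \<eta> f \<longleftrightarrow> tempered_has_sum (trace_term \<eta> f) (Tr \<eta> f) int_lattice"

end

theory Submission
  imports Defs "HOL-Probability.Probability"
begin

text \<open>On frequencies, \<open>\<box>\<^sub>j\<close> of the trace only sees the pieces \<open>\<box>\<^sub>(\<^sub>k\<^sub>,\<^sub>l\<^sub>) f\<close> with \<open>k\<close> near \<open>j\<close>,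
  but all \<open>l\<close>. Each piece is band-limited, so its Peetre maximal function is bounded in \<open>L\<^sup>p\<close> by the
  piece itself; averaging over a unit interval in the last variable bounds its restriction to the
  hyperplane, convolved with the window kernel, by \<open>C \<parallel>\<box>\<^sub>(\<^sub>k\<^sub>,\<^sub>l\<^sub>) f\<parallel>\<^sub>p\<close> with \<open>C\<close> independent of \<open>k\<close> and \<open>l\<close>.
  Summing over \<open>l\<close> with the quasi-triangle inequality for \<open>\<parallel>\<cdot>\<parallel>\<^sub>p\<close> raised to \<open>p \<and> 1\<close>, and then
  comparing with the \<open>\<ell>\<^sup>q\<close> norm by Hoelder's inequality, costs the weight \<open>\<langle>l\<rangle>\<close> to the power
  \<open>1/(p \<and> q \<and> 1) - 1/q + \<epsilon>\<close>. The sum defining the trace converges in the tempered distributions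
  because the pairing of a slice with a Schwartz function decays rapidly in \<open>k\<close>.\<close>

section \<open>Towers of partial derivatives\<close>

text \<open>A tower lists a function \<open>D []\<close> together with candidates \<open>D bs\<close> for all its iterated partial
  derivatives, so that smoothness is proved by exhibiting formulas instead of differentiating.\<close>

definition deriv_tower :: "('a::euclidean_space list \<Rightarrow> 'a \<Rightarrow> complex) \<Rightarrow> bool" where
  "deriv_tower D \<longleftrightarrow> (\<forall>bs y. set bs \<subseteq> Basis \<longrightarrow>
     (D bs has_derivative (\<lambda>v. \<Sum>b\<in>Basis. (v \<bullet> b) *\<^sub>R D (b # bs) y)) (at y))"

definition rapidly_decreasing :: "('a::real_normed_vector \<Rightarrow> 'b::real_normed_vector) \<Rightarrow> bool" where
  "rapidly_decreasing f \<longleftrightarrow> (\<forall>N. \<exists>C. \<forall>x. (1 + norm x) ^ N * norm (f x) \<le> C)"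

definition schwartz_tower :: "('a::euclidean_space list \<Rightarrow> 'a \<Rightarrow> complex) \<Rightarrow> bool" where
  "schwartz_tower D \<longleftrightarrow> deriv_tower D \<and> (\<forall>bs. set bs \<subseteq> Basis \<longrightarrow> rapidly_decreasing (D bs))"

lemma deriv_towerD:
  "deriv_tower D \<Longrightarrow> set bs \<subseteq> Basis \<Longrightarrow>
    (D bs has_derivative (\<lambda>v. \<Sum>b\<in>Basis. (v \<bullet> b) *\<^sub>R D (b # bs) y)) (at y)"
  by (auto simp: deriv_tower_def)

lemma deriv_tower_continuous: "deriv_tower D \<Longrightarrow> set bs \<subseteq> Basis \<Longrightarrow> continuous_on UNIV (D bs)"
  by (meson deriv_towerD continuous_at_imp_continuous_on has_derivative_continuous)

lemma deriv_tower_partial_derivs: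
  assumes "deriv_tower D" "set bs \<subseteq> Basis"
  shows "partial_derivs bs (D []) = D bs"
  using assms(2)
proof (induction bs)
  case Nil
  then show ?case by (simp add: partial_derivs_def)
next
  case (Cons b bs)
  have "partial_deriv b (D bs) y = D (b # bs) y" for y
  proof -
    have "frechet_derivative (D bs) (at y) = (\<lambda>v. \<Sum>c\<in>Basis. (v \<bullet> c) *\<^sub>R D (c # bs) y)"
      using deriv_towerD[OF assms(1), of bs y] Cons.prems
      by (intro frechet_derivative_at[symmetric]) auto
    moreover have "(\<Sum>c\<in>Basis. (b \<bullet> c) *\<^sub>R D (c # bs) y) = (\<Sum>c\<in>Basis. if c = b then D (c # bs) y else 0)"
      using Cons.prems by (intro sum.cong) (auto simp: inner_Basis)
    ultimately show ?thesis using Cons.prems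
      by (simp add: partial_deriv_def)
  qed
  then show ?case using Cons by (auto simp: partial_derivs_def)
qed

lemma smooth_fun_deriv_tower:
  assumes "smooth_fun (f :: 'a::euclidean_space \<Rightarrow> complex)"
  shows "deriv_tower (\<lambda>bs. partial_derivs bs f)"
  unfolding deriv_tower_def
proof (intro allI impI)
  fix bs :: "'a list" and y :: 'a assume bs: "set bs \<subseteq> Basis"
  let ?g = "partial_derivs bs f"
  have "?g differentiable (at y)"
    using assms bs unfolding smooth_fun_def differentiable_on_def by blast
  then have d: "(?g has_derivative frechet_derivative ?g (at y)) (at y)"
    by (simp add: frechet_derivative_works)
  then interpret bounded_linear "frechet_derivative ?g (at y)"
    by (rule has_derivative_bounded_linear)
  have "frechet_derivative ?g (at y) v = (\<Sum>b\<in>Basis. (v \<bullet> b) *\<^sub>R partial_derivs (b # bs) f y)" for v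
  proof -
    have "frechet_derivative ?g (at y) (\<Sum>b\<in>Basis. (v \<bullet> b) *\<^sub>R b)
        = (\<Sum>b\<in>Basis. (v \<bullet> b) *\<^sub>R frechet_derivative ?g (at y) b)"
      by (simp only: sum scale)
    then show ?thesis by (simp add: euclidean_representation partial_derivs_def partial_deriv_def)
  qed
  with d show "(?g has_derivative (\<lambda>v. \<Sum>b\<in>Basis. (v \<bullet> b) *\<^sub>R partial_derivs (b # bs) f y)) (at y)"
    by (metis (no_types, lifting) ext)
qed

lemma schwartz_tower_in_schwartz:
  assumes "schwartz_tower D"
  shows "D [] \<in> schwartz"
proof -
  have t: "deriv_tower D" and r: "\<And>bs. set bs \<subseteq> Basis \<Longrightarrow> rapidly_decreasing (D bs)"
    using assms by (auto simp: schwartz_tower_def)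
  have "smooth_fun (D [])"
    unfolding smooth_fun_def differentiable_on_def
  proof (intro allI impI ballI)
    fix bs :: "'a list" and x assume bs: "set bs \<subseteq> Basis"
    show "partial_derivs bs (D []) differentiable at x"
      unfolding deriv_tower_partial_derivs[OF t bs] differentiable_def
      using deriv_towerD[OF t bs] by blast
  qed
  moreover have "bdd_above (range (\<lambda>x. (1 + norm x) ^ N * norm (partial_derivs bs (D []) x)))"
    if bs: "set bs \<subseteq> Basis" for N bs
    unfolding bdd_above_def
    using r[OF bs] by (simp add: rapidly_decreasing_def deriv_tower_partial_derivs[OF t bs])
  ultimately show ?thesis by (auto simp: schwartz_def)
qed

lemma schwartz_tower_of_schwartz:
  assumes "\<phi> \<in> schwartz"
  shows "schwartz_tower (\<lambda>bs. partial_derivs bs \<phi>)"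
proof -
  have "smooth_fun \<phi>" using assms by (auto simp: schwartz_def)
  moreover have "rapidly_decreasing (partial_derivs bs \<phi>)" if "set bs \<subseteq> Basis" for bs
    unfolding rapidly_decreasing_def
  proof
    fix N
    have "bdd_above (range (\<lambda>x. (1 + norm x) ^ N * norm (partial_derivs bs \<phi> x)))"
      using assms that by (auto simp: schwartz_def)
    then show "\<exists>C. \<forall>x. (1 + norm x) ^ N * norm (partial_derivs bs \<phi> x) \<le> C"
      by (auto simp: bdd_above_def)
  qed
  ultimately show ?thesis using smooth_fun_deriv_tower by (auto simp: schwartz_tower_def)
qed

lemma partial_derivs_Nil [simp]: "partial_derivs [] f = f"
  by (simp add: partial_derivs_def)

lemma finite_basis_lists: "finite {bs :: 'a::euclidean_space list. set bs \<subseteq> Basis \<and> length bs \<le> N}"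
  by (rule finite_lists_length_le) simp

lemma schwartz_seminorm_ge:
  fixes D :: "'a::euclidean_space list \<Rightarrow> 'a \<Rightarrow> complex"
  assumes "schwartz_tower D" "set bs \<subseteq> Basis" "length bs \<le> N"
  shows "(1 + norm x) ^ N * norm (D bs x) \<le> schwartz_seminorm N (D [])"
proof -
  have t: "deriv_tower D" and r: "\<And>bs. set bs \<subseteq> Basis \<Longrightarrow> rapidly_decreasing (D bs)"
    using assms by (auto simp: schwartz_tower_def)
  obtain C where C: "\<And>bs x. set bs \<subseteq> Basis \<Longrightarrow> (1 + norm x) ^ N * norm (D bs x) \<le> C bs"
  proof -
    have "\<forall>bs. \<exists>C. set bs \<subseteq> Basis \<longrightarrow> (\<forall>x. (1 + norm x) ^ N * norm (D bs x) \<le> C)"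
      using r by (auto simp: rapidly_decreasing_def)
    from choice[OF this] show ?thesis using that by blast
  qed
  let ?L = "{bs :: 'a list. set bs \<subseteq> Basis \<and> length bs \<le> N}"
  have "(\<lambda>(bs, x). (1 + norm x) ^ N * norm (partial_derivs bs (D []) x)) (bs, x)
      \<le> (SUP (bs, x)\<in>?L \<times> UNIV. (1 + norm x) ^ N * norm (partial_derivs bs (D []) x))"
  proof (rule cSUP_upper)
    show "(bs, x) \<in> ?L \<times> UNIV" using assms by auto
    show "bdd_above ((\<lambda>(bs, x). (1 + norm x) ^ N * norm (partial_derivs bs (D []) x)) ` (?L \<times> UNIV))"
    proof (rule bdd_aboveI)
      fix r assume "r \<in> (\<lambda>(bs, x). (1 + norm x) ^ N * norm (partial_derivs bs (D []) x)) ` (?L \<times> UNIV)"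
      then obtain cs z where cs: "cs \<in> ?L" and r: "r = (1 + norm z) ^ N * norm (D cs z)"
        using deriv_tower_partial_derivs[OF t] by auto
      have "r \<le> \<bar>C cs\<bar>" using r C[of cs z] cs by auto
      also have "\<dots> \<le> (\<Sum>cs\<in>?L. \<bar>C cs\<bar>)"
        using finite_basis_lists cs by (intro member_le_sum) auto
      finally show "r \<le> (\<Sum>cs\<in>?L. \<bar>C cs\<bar>)" .
    qed
  qed
  then show ?thesis
    using deriv_tower_partial_derivs[OF t assms(2)] by (simp add: schwartz_seminorm_def)
qed

lemma schwartz_seminorm_le:
  fixes D :: "'a::euclidean_space list \<Rightarrow> 'a \<Rightarrow> complex"
  assumes "deriv_tower D"
    and "\<And>bs x. set bs \<subseteq> Basis \<Longrightarrow> length bs \<le> N \<Longrightarrow> (1 + norm x) ^ N * norm (D bs x) \<le> B"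
  shows "schwartz_seminorm N (D []) \<le> B"
  unfolding schwartz_seminorm_def
  using assms by (intro cSUP_least) (auto simp: deriv_tower_partial_derivs intro!: exI[of _ "[]"])

lemma schwartz_seminorm_nonneg: "\<phi> \<in> schwartz \<Longrightarrow> 0 \<le> schwartz_seminorm N \<phi>"
  using schwartz_seminorm_ge[OF schwartz_tower_of_schwartz, of \<phi> "[]" N 0]
    order_trans[OF norm_ge_zero[of "\<phi> 0"]] by auto

subsection \<open>Leibniz rule\<close>

fun splits :: "'a list \<Rightarrow> ('a list \<times> 'a list) list" where
  "splits [] = [([], [])]"
| "splits (b # bs) = map (\<lambda>(cs, ds). (b # cs, ds)) (splits bs) @ map (\<lambda>(cs, ds). (cs, b # ds)) (splits bs)"

lemma splits_subset:
  "(cs, ds) \<in> set (splits bs) \<Longrightarrow> set cs \<subseteq> set bs \<and> set ds \<subseteq> set bs \<and> length cs \<le> length bs \<and> length ds \<le> length bs"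
  by (induction bs arbitrary: cs ds) fastforce+

lemma length_splits: "length (splits bs) = 2 ^ length bs"
  by (induction bs) auto

definition prod_tower :: "('a list \<Rightarrow> 'a \<Rightarrow> complex) \<Rightarrow> ('a list \<Rightarrow> 'a \<Rightarrow> complex) \<Rightarrow> 'a list \<Rightarrow> 'a \<Rightarrow> complex" where
  "prod_tower A B bs y = (\<Sum>(cs, ds)\<leftarrow>splits bs. A cs y * B ds y)"

lemma prod_tower_Nil [simp]: "prod_tower A B [] = (\<lambda>y. A [] y * B [] y)"
  by (simp add: prod_tower_def fun_eq_iff)

lemma has_derivative_sum_list:
  assumes "\<And>x. x \<in> set xs \<Longrightarrow> (f x has_derivative f' x) F"
  shows "((\<lambda>y. \<Sum>x\<leftarrow>xs. f x y) has_derivative (\<lambda>v. \<Sum>x\<leftarrow>xs. f' x v)) F"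
  using assms by (induction xs) (auto intro!: derivative_intros)

lemma sum_sum_list_swap: "(\<Sum>b\<in>I. \<Sum>x\<leftarrow>xs. g b x) = (\<Sum>x\<leftarrow>xs. \<Sum>b\<in>I. (g b x :: 'b::comm_monoid_add))"
  by (induction xs) (auto simp: sum.distrib)

lemma deriv_tower_prod:
  fixes A B :: "'a::euclidean_space list \<Rightarrow> 'a \<Rightarrow> complex"
  assumes A: "deriv_tower A" and B: "deriv_tower B"
  shows "deriv_tower (prod_tower A B)"
  unfolding deriv_tower_def
proof (intro allI impI)
  fix bs :: "'a list" and y :: 'a assume bs: "set bs \<subseteq> Basis"
  have "((\<lambda>y. \<Sum>(cs, ds)\<leftarrow>splits bs. A cs y * B ds y) has_derivative
    (\<lambda>v. \<Sum>(cs, ds)\<leftarrow>splits bs. A cs y * (\<Sum>b\<in>Basis. (v \<bullet> b) *\<^sub>R B (b # ds) y) +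
       (\<Sum>b\<in>Basis. (v \<bullet> b) *\<^sub>R A (b # cs) y) * B ds y)) (at y)"
    unfolding case_prod_beta
  proof (rule has_derivative_sum_list)
    fix x assume "x \<in> set (splits bs)"
    then have "set (fst x) \<subseteq> Basis" "set (snd x) \<subseteq> Basis"
      using bs splits_subset[of "fst x" "snd x" bs] by auto
    then show "((\<lambda>y. A (fst x) y * B (snd x) y) has_derivative
       (\<lambda>v. A (fst x) y * (\<Sum>b\<in>Basis. (v \<bullet> b) *\<^sub>R B (b # snd x) y) +
         (\<Sum>b\<in>Basis. (v \<bullet> b) *\<^sub>R A (b # fst x) y) * B (snd x) y)) (at y)"
      by (intro has_derivative_mult deriv_towerD A B)
  qed
  moreover have "(\<Sum>(cs, ds)\<leftarrow>splits bs. A cs y * (\<Sum>b\<in>Basis. (v \<bullet> b) *\<^sub>R B (b # ds) y) +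
       (\<Sum>b\<in>Basis. (v \<bullet> b) *\<^sub>R A (b # cs) y) * B ds y) = (\<Sum>b\<in>Basis. (v \<bullet> b) *\<^sub>R prod_tower A B (b # bs) y)" for v
  proof -
    have "prod_tower A B (b # bs) y = (\<Sum>x\<leftarrow>splits bs. A (b # fst x) y * B (snd x) y + A (fst x) y * B (b # snd x) y)" for b
      by (simp add: prod_tower_def case_prod_beta comp_def sum_list_addf)
    then have "(\<Sum>b\<in>Basis. (v \<bullet> b) *\<^sub>R prod_tower A B (b # bs) y) =
      (\<Sum>x\<leftarrow>splits bs. \<Sum>b\<in>Basis. (v \<bullet> b) *\<^sub>R (A (b # fst x) y * B (snd x) y + A (fst x) y * B (b # snd x) y))"
      by (simp add: sum_list_const_mult[symmetric] scaleR_conv_of_real sum_sum_list_swap)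
    also have "\<dots> = (\<Sum>x\<leftarrow>splits bs. A (fst x) y * (\<Sum>b\<in>Basis. (v \<bullet> b) *\<^sub>R B (b # snd x) y) +
       (\<Sum>b\<in>Basis. (v \<bullet> b) *\<^sub>R A (b # fst x) y) * B (snd x) y)"
      by (intro arg_cong[where f=sum_list] map_cong refl)
        (simp add: scaleR_right_distrib sum.distrib sum_distrib_left sum_distrib_right algebra_simps)
    finally show ?thesis by (simp add: case_prod_unfold)
  qed
  ultimately show "(prod_tower A B bs has_derivative (\<lambda>v. \<Sum>b\<in>Basis. (v \<bullet> b) *\<^sub>R prod_tower A B (b # bs) y)) (at y)"
    by (simp add: prod_tower_def[abs_def])
qed

lemma norm_sum_list_le: "norm (\<Sum>x\<leftarrow>xs. f x :: 'b::real_normed_vector) \<le> (\<Sum>x\<leftarrow>xs. norm (f x))"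
  by (induction xs) (auto intro: order_trans[OF norm_triangle_ineq])

lemma norm_prod_tower_le:
  assumes "\<And>cs. set cs \<subseteq> set bs \<Longrightarrow> length cs \<le> length bs \<Longrightarrow> norm (A cs y) \<le> a"
    and "\<And>ds. set ds \<subseteq> set bs \<Longrightarrow> length ds \<le> length bs \<Longrightarrow> norm (B ds y) \<le> b"
  shows "norm (prod_tower A B bs y) \<le> 2 ^ length bs * (a * b)"
proof -
  have a: "0 \<le> a" using assms(1)[of "[]"] order_trans[OF norm_ge_zero] by auto
  have "norm (prod_tower A B bs y) \<le> (\<Sum>x\<leftarrow>splits bs. norm (case x of (cs, ds) \<Rightarrow> A cs y * B ds y))"
    unfolding prod_tower_def by (rule norm_sum_list_le)
  also have "\<dots> \<le> (\<Sum>x\<leftarrow>splits bs. a * b)"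
  proof (rule sum_list_mono)
    fix x assume x: "x \<in> set (splits bs)"
    obtain cs ds where [simp]: "x = (cs, ds)" by force
    show "norm (case x of (cs, ds) \<Rightarrow> A cs y * B ds y) \<le> a * b"
      using splits_subset[of cs ds bs] x assms a by (simp add: norm_mult mult_mono)
  qed
  also have "\<dots> = 2 ^ length bs * (a * b)" by (simp add: sum_list_triv length_splits)
  finally show ?thesis .
qed

section \<open>Tensor products\<close>

definition tensor :: "('a::euclidean_space \<Rightarrow> real \<Rightarrow> 'b::comm_monoid_mult) \<Rightarrow> 'a \<Rightarrow> 'b" where
  "tensor h y = (\<Prod>b\<in>Basis. h b (y \<bullet> b))"

definition tensor_tower :: "('a::euclidean_space \<Rightarrow> nat \<Rightarrow> real \<Rightarrow> complex) \<Rightarrow> 'a list \<Rightarrow> 'a \<Rightarrow> complex" where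
  "tensor_tower t bs = tensor (\<lambda>b. t b (count_list bs b))"

definition line_tower :: "(nat \<Rightarrow> real \<Rightarrow> complex) \<Rightarrow> bool" where
  "line_tower t \<longleftrightarrow> (\<forall>m r. (t m has_vector_derivative t (Suc m) r) (at r))"

definition schwartz_line_tower :: "(nat \<Rightarrow> real \<Rightarrow> complex) \<Rightarrow> bool" where
  "schwartz_line_tower t \<longleftrightarrow> line_tower t \<and> (\<forall>m. rapidly_decreasing (t m))"

lemma tensor_tower_Nil [simp]: "tensor_tower t [] = tensor (\<lambda>b. t b 0)"
  by (simp add: tensor_tower_def)

lemma deriv_tower_tensor:
  fixes t :: "'a::euclidean_space \<Rightarrow> nat \<Rightarrow> real \<Rightarrow> complex"
  assumes "\<And>b. b \<in> Basis \<Longrightarrow> line_tower (t b)"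
  shows "deriv_tower (tensor_tower t)"
  unfolding deriv_tower_def
proof (intro allI impI)
  fix bs :: "'a list" and y :: 'a
  let ?m = "count_list bs"
  have "((\<lambda>y. \<Prod>b\<in>Basis. t b (?m b) (y \<bullet> b)) has_derivative
    (\<lambda>v. \<Sum>b\<in>Basis. ((v \<bullet> b) *\<^sub>R t b (Suc (?m b)) (y \<bullet> b)) * (\<Prod>c\<in>Basis - {b}. t c (?m c) (y \<bullet> c)))) (at y)"
  proof (rule has_derivative_prod)
    fix b :: 'a assume "b \<in> Basis"
    then have "(t b (?m b) has_derivative (\<lambda>x. x *\<^sub>R t b (Suc (?m b)) (y \<bullet> b))) (at (y \<bullet> b))"
      using assms by (auto simp: line_tower_def has_vector_derivative_def)
    then show "((\<lambda>y. t b (?m b) (y \<bullet> b)) has_derivative (\<lambda>v. (v \<bullet> b) *\<^sub>R t b (Suc (?m b)) (y \<bullet> b))) (at y)"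
      by (rule has_derivative_compose[rotated]) (auto intro!: derivative_eq_intros)
  qed
  moreover have "((v \<bullet> b) *\<^sub>R t b (Suc (?m b)) (y \<bullet> b)) * (\<Prod>c\<in>Basis - {b}. t c (?m c) (y \<bullet> c))
      = (v \<bullet> b) *\<^sub>R tensor_tower t (b # bs) y" if "b \<in> Basis" for v b
  proof -
    have "tensor_tower t (b # bs) y = t b (Suc (?m b)) (y \<bullet> b) * (\<Prod>c\<in>Basis - {b}. t c (count_list (b # bs) c) (y \<bullet> c))"
      unfolding tensor_tower_def tensor_def using that by (subst prod.remove[of _ b]) auto
    also have "(\<Prod>c\<in>Basis - {b}. t c (count_list (b # bs) c) (y \<bullet> c)) = (\<Prod>c\<in>Basis - {b}. t c (?m c) (y \<bullet> c))"
      by (intro prod.cong) auto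
    finally show ?thesis by simp
  qed
  then have "(\<lambda>v. \<Sum>b\<in>Basis. ((v \<bullet> b) *\<^sub>R t b (Suc (?m b)) (y \<bullet> b)) * (\<Prod>c\<in>Basis - {b}. t c (?m c) (y \<bullet> c)))
      = (\<lambda>v. \<Sum>b\<in>Basis. (v \<bullet> b) *\<^sub>R tensor_tower t (b # bs) y)"
    by (intro ext sum.cong refl)
  moreover have "tensor_tower t bs = (\<lambda>y. \<Prod>b\<in>Basis. t b (?m b) (y \<bullet> b))"
    by (simp add: tensor_tower_def tensor_def[abs_def])
  ultimately show "(tensor_tower t bs has_derivative (\<lambda>v. \<Sum>b\<in>Basis. (v \<bullet> b) *\<^sub>R tensor_tower t (b # bs) y)) (at y)"
    by (simp only:)
qed

lemma one_plus_sum_le_prod: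
  assumes "finite A" "\<And>a. a \<in> A \<Longrightarrow> 0 \<le> (f a :: real)"
  shows "1 + (\<Sum>a\<in>A. f a) \<le> (\<Prod>a\<in>A. 1 + f a)"
  using assms
proof (induction A)
  case (insert x A)
  have "1 + (\<Sum>a\<in>insert x A. f a) \<le> (1 + f x) * (1 + (\<Sum>a\<in>A. f a))"
    using insert by (simp add: algebra_simps sum_nonneg)
  also have "\<dots> \<le> (1 + f x) * (\<Prod>a\<in>A. 1 + f a)"
    using insert by (intro mult_left_mono) auto
  finally show ?case using insert by simp
qed simp

lemma one_plus_norm_le_prod: "1 + norm (y::'a::euclidean_space) \<le> (\<Prod>b\<in>Basis. 1 + \<bar>y \<bullet> b\<bar>)"
  using norm_le_l1[of y] one_plus_sum_le_prod[of Basis "\<lambda>b. \<bar>y \<bullet> b\<bar>"] by auto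

lemma tensor_decay:
  fixes h :: "'a::euclidean_space \<Rightarrow> real \<Rightarrow> 'b::{real_normed_field}"
  assumes "\<And>b r. b \<in> Basis \<Longrightarrow> (1 + \<bar>r\<bar>) ^ N * norm (h b r) \<le> C b"
  shows "(1 + norm y) ^ N * norm (tensor h y) \<le> (\<Prod>b\<in>Basis. C b)"
proof -
  have "(1 + norm y) ^ N * norm (tensor h y) \<le> (\<Prod>b\<in>Basis. 1 + \<bar>y \<bullet> b\<bar>) ^ N * norm (tensor h y)"
    by (intro mult_right_mono power_mono one_plus_norm_le_prod) auto
  also have "\<dots> = (\<Prod>b\<in>Basis. (1 + \<bar>y \<bullet> b\<bar>) ^ N * norm (h b (y \<bullet> b)))"
    by (simp add: tensor_def prod_norm prod.distrib prod_power_distrib)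
  also have "\<dots> \<le> (\<Prod>b\<in>Basis. C b)"
    using assms by (intro prod_mono) auto
  finally show ?thesis .
qed

lemma rapidly_decreasing_tensor:
  fixes h :: "'a::euclidean_space \<Rightarrow> real \<Rightarrow> 'b::{real_normed_field}"
  assumes "\<And>b. b \<in> Basis \<Longrightarrow> rapidly_decreasing (h b)"
  shows "rapidly_decreasing (tensor h)"
  unfolding rapidly_decreasing_def
proof
  fix N
  have "\<forall>b. \<exists>C. b \<in> Basis \<longrightarrow> (\<forall>r. (1 + \<bar>r\<bar>) ^ N * norm (h b r) \<le> C)"
    using assms by (auto simp: rapidly_decreasing_def)
  from choice[OF this] show "\<exists>C. \<forall>y. (1 + norm y) ^ N * norm (tensor h y) \<le> C"
    using tensor_decay by blast
qed

lemma schwartz_tower_tensor: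
  assumes "\<And>b. b \<in> Basis \<Longrightarrow> schwartz_line_tower (t b)"
  shows "schwartz_tower (tensor_tower t)"
  using assms deriv_tower_tensor[of t]
  by (auto simp: schwartz_tower_def schwartz_line_tower_def tensor_tower_def intro!: rapidly_decreasing_tensor)

lemma borel_measurable_tensor [measurable (raw)]:
  fixes h :: "'a::euclidean_space \<Rightarrow> real \<Rightarrow> 'b::{real_normed_field, second_countable_topology}"
  assumes [measurable]: "\<And>b. b \<in> Basis \<Longrightarrow> h b \<in> borel_measurable borel"
  shows "tensor h \<in> borel_measurable borel"
  unfolding tensor_def[abs_def] by measurable

lemma
  fixes h :: "'a::euclidean_space \<Rightarrow> real \<Rightarrow> 'b::{real_normed_field, banach, second_countable_topology}"
  assumes "\<And>b. b \<in> Basis \<Longrightarrow> integrable lborel (h b)"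
  shows integrable_tensor: "integrable lborel (tensor h)"
    and integral_tensor: "integral\<^sup>L lborel (tensor h) = (\<Prod>b\<in>Basis. integral\<^sup>L lborel (h b))"
proof -
  interpret product_sigma_finite "\<lambda>_::'a. lborel :: real measure"
    by standard
  have [measurable]: "\<And>b. b \<in> Basis \<Longrightarrow> h b \<in> borel_measurable borel"
    using assms borel_measurable_integrable by fastforce
  have eq: "tensor h (\<Sum>b\<in>Basis. f b *\<^sub>R b) = (\<Prod>b\<in>Basis. h b (f b))" for f
    by (simp add: tensor_def inner_sum_left inner_Basis if_distrib[of "\<lambda>x. _ * x"] cong: if_cong)
  show "integrable lborel (tensor h)"
    unfolding lborel_eq[where 'a='a]
    by (subst integrable_distr_eq) (auto simp: eq assms product_integrable_prod)
  show "integral\<^sup>L lborel (tensor h) = (\<Prod>b\<in>Basis. integral\<^sup>L lborel (h b))"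
    unfolding lborel_eq[where 'a='a]
    by (subst integral_distr) (auto simp: eq assms product_integral_prod)
qed

subsection \<open>Integrability of rapidly decreasing functions\<close>

lemma integrable_inverse_one_plus_abs_square: "integrable lborel (\<lambda>x::real. inverse ((1 + \<bar>x\<bar>) ^ 2))"
proof (rule Bochner_Integration.integrable_bound)
  show "integrable lborel (\<lambda>x::real. inverse (1 + x ^ 2))"
    using integrable_inverse_1_plus_square by (simp add: set_integrable_def)
  show "AE x in lborel. norm (inverse ((1 + \<bar>x\<bar>) ^ 2)) \<le> norm (inverse (1 + x ^ 2 :: real))"
    by (auto intro!: AE_I2 le_imp_inverse_le simp: power2_eq_square algebra_simps add_pos_nonneg)
qed simp

lemma integrable_weight: "integrable lborel (\<lambda>x::'a::euclidean_space. inverse ((1 + norm x) ^ (2 * DIM('a))))"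
proof (rule Bochner_Integration.integrable_bound)
  show "integrable lborel (tensor (\<lambda>(b::'a) x::real. inverse ((1 + \<bar>x\<bar>) ^ 2)))"
    by (intro integrable_tensor integrable_inverse_one_plus_abs_square)
  have "norm (inverse ((1 + norm x) ^ (2 * DIM('a)))) \<le> norm (tensor (\<lambda>b x. inverse ((1 + \<bar>x\<bar>) ^ 2)) x)" for x :: 'a
  proof -
    have "(\<Prod>b\<in>(Basis::'a set). (1 + \<bar>x \<bullet> b\<bar>) ^ 2) \<le> (\<Prod>b\<in>(Basis::'a set). (1 + norm x) ^ 2)"
      by (intro prod_mono conjI power_mono) (auto simp: Basis_le_norm)
    then have "inverse ((1 + norm x) ^ (2 * DIM('a))) \<le> inverse (\<Prod>b\<in>(Basis::'a set). (1 + \<bar>x \<bullet> b\<bar>) ^ 2)"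
      by (intro le_imp_inverse_le) (auto simp: power_mult intro!: prod_pos add_pos_nonneg)
    then show ?thesis
      by (simp add: tensor_def prod_inversef[unfolded comp_def] prod_nonneg)
  qed
  then show "AE x in lborel. norm (inverse ((1 + norm x) ^ (2 * DIM('a)))) \<le> norm (tensor (\<lambda>(b::'a) x. inverse ((1 + \<bar>x\<bar>) ^ 2)) x)"
    by blast
qed simp

lemma integrable_decay:
  fixes f :: "'a::euclidean_space \<Rightarrow> 'b::{banach, second_countable_topology}"
  assumes [measurable]: "f \<in> borel_measurable borel"
    and "\<And>x. (1 + norm x) ^ (2 * DIM('a)) * norm (f x) \<le> C"
  shows "integrable lborel f"
proof (rule Bochner_Integration.integrable_bound)
  show "integrable lborel (\<lambda>x::'a. C * inverse ((1 + norm x) ^ (2 * DIM('a))))"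
    by (intro integrable_mult_right integrable_weight)
  have "norm (f x) \<le> C * inverse ((1 + norm x) ^ (2 * DIM('a)))" for x
    using assms(2)[of x] by (simp add: field_simps add_pos_nonneg)
  then show "AE x in lborel. norm (f x) \<le> norm (C * inverse ((1 + norm x) ^ (2 * DIM('a))))"
    unfolding real_norm_def by (intro AE_I2 order_trans[OF _ abs_ge_self])
qed simp

lemma integrable_rapidly_decreasing:
  fixes f :: "'a::euclidean_space \<Rightarrow> 'b::{banach, second_countable_topology}"
  assumes "f \<in> borel_measurable borel" "rapidly_decreasing f"
  shows "integrable lborel f" "integrable lborel (\<lambda>x. (1 + norm x) ^ N * norm (f x))"
proof -
  obtain C where "\<And>x. (1 + norm x) ^ (2 * DIM('a)) * norm (f x) \<le> C"
    using assms by (auto simp: rapidly_decreasing_def)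
  then show "integrable lborel f" using assms(1) by (rule integrable_decay[rotated])
  obtain C where "\<And>x. (1 + norm x) ^ (2 * DIM('a) + N) * norm (f x) \<le> C"
    using assms by (auto simp: rapidly_decreasing_def)
  then show "integrable lborel (\<lambda>x. (1 + norm x) ^ N * norm (f x))"
    using assms(1) by (intro integrable_decay[of _ C]) (auto simp: power_add mult.assoc)
qed

subsection \<open>Differentiation under the integral sign\<close>

lemma deriv_tower_increment:
  fixes D :: "'a::euclidean_space list \<Rightarrow> 'a \<Rightarrow> complex" and B :: real
  assumes "deriv_tower D" "set bs \<subseteq> Basis" "convex S" "x \<in> S" "y \<in> S"
    and B: "\<And>w b. w \<in> S \<Longrightarrow> b \<in> Basis \<Longrightarrow> norm (D (b # bs) w) \<le> B"
  shows "norm (D bs x - D bs y) \<le> DIM('a) * B * norm (x - y)"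
proof (rule differentiable_bound[OF \<open>convex S\<close> _ _ \<open>x \<in> S\<close> \<open>y \<in> S\<close>])
  fix w assume w: "w \<in> S"
  show "(D bs has_derivative (\<lambda>v. \<Sum>b\<in>Basis. (v \<bullet> b) *\<^sub>R D (b # bs) w)) (at w within S)"
    using deriv_towerD[OF assms(1,2)] has_derivative_at_withinI by blast
  show "onorm (\<lambda>v. \<Sum>b\<in>Basis. (v \<bullet> b) *\<^sub>R D (b # bs) w) \<le> DIM('a) * B"
  proof (rule onorm_le)
    fix v
    have "norm (\<Sum>b\<in>Basis. (v \<bullet> b) *\<^sub>R D (b # bs) w) \<le> (\<Sum>b\<in>(Basis::'a set). norm v * B)"
      using B[OF w] by (intro sum_norm_le) (auto intro!: mult_mono simp: Basis_le_norm)
    then show "norm (\<Sum>b\<in>Basis. (v \<bullet> b) *\<^sub>R D (b # bs) w) \<le> DIM('a) * B * norm v"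
      by (simp add: mult_ac)
  qed
qed

lemma deriv_tower_remainder:
  fixes D :: "'a::euclidean_space list \<Rightarrow> 'a \<Rightarrow> complex" and B :: real
  assumes D: "deriv_tower D" "set bs \<subseteq> Basis"
    and B: "\<And>w b c. w \<in> cball y (norm (y' - y)) \<Longrightarrow> b \<in> Basis \<Longrightarrow> c \<in> Basis \<Longrightarrow> norm (D (c # b # bs) w) \<le> B"
  shows "norm (D bs y' - D bs y - (\<Sum>b\<in>Basis. ((y' - y) \<bullet> b) *\<^sub>R D (b # bs) y))
    \<le> (DIM('a))\<^sup>2 * B * (norm (y' - y))\<^sup>2"
proof -
  let ?S = "cball y (norm (y' - y))" and ?d = "norm (y' - y)"
  let ?g = "\<lambda>w. D bs w - (\<Sum>b\<in>Basis. (w \<bullet> b) *\<^sub>R D (b # bs) y)"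
  have "norm (?g y' - ?g y) \<le> (DIM('a) * (DIM('a) * B * ?d)) * norm (y' - y)"
  proof (rule differentiable_bound[of ?S])
    fix w assume w: "w \<in> ?S"
    have "((\<lambda>w. \<Sum>b\<in>Basis. (w \<bullet> b) *\<^sub>R D (b # bs) y) has_derivative (\<lambda>v. \<Sum>b\<in>Basis. (v \<bullet> b) *\<^sub>R D (b # bs) y)) (at w within ?S)"
      by (auto intro!: derivative_eq_intros)
    then show "(?g has_derivative (\<lambda>v. (\<Sum>b\<in>Basis. (v \<bullet> b) *\<^sub>R D (b # bs) w) - (\<Sum>b\<in>Basis. (v \<bullet> b) *\<^sub>R D (b # bs) y))) (at w within ?S)"
      by (intro has_derivative_diff has_derivative_at_withinI[OF deriv_towerD[OF D]])
    have inc: "norm (D (b # bs) w - D (b # bs) y) \<le> DIM('a) * B * ?d" if b: "b \<in> Basis" for b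
    proof -
      have "norm (D (b # bs) w - D (b # bs) y) \<le> DIM('a) * B * norm (w - y)"
        using D b B w by (intro deriv_tower_increment[of D _ ?S]) auto
      also have "\<dots> \<le> DIM('a) * B * ?d"
        using w b order_trans[OF norm_ge_zero B[OF w b b]] by (intro mult_left_mono) (auto simp: dist_norm norm_minus_commute)
      finally show ?thesis .
    qed
    show "onorm (\<lambda>v. (\<Sum>b\<in>Basis. (v \<bullet> b) *\<^sub>R D (b # bs) w) - (\<Sum>b\<in>Basis. (v \<bullet> b) *\<^sub>R D (b # bs) y)) \<le> DIM('a) * (DIM('a) * B * ?d)"
    proof (rule onorm_le)
      fix v
      have "norm (\<Sum>b\<in>Basis. (v \<bullet> b) *\<^sub>R (D (b # bs) w - D (b # bs) y)) \<le> (\<Sum>b\<in>(Basis::'a set). norm v * (DIM('a) * B * ?d))"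
        using inc by (intro sum_norm_le) (auto intro!: mult_mono simp: Basis_le_norm)
      then show "norm ((\<Sum>b\<in>Basis. (v \<bullet> b) *\<^sub>R D (b # bs) w) - (\<Sum>b\<in>Basis. (v \<bullet> b) *\<^sub>R D (b # bs) y)) \<le> DIM('a) * (DIM('a) * B * ?d) * norm v"
        by (simp add: mult_ac scaleR_diff_right sum_subtractf)
    qed
  qed (auto simp: dist_norm norm_minus_commute)
  then show ?thesis
    by (simp add: inner_diff_left scaleR_diff_left sum_subtractf power2_eq_square algebra_simps)
qed

lemma deriv_tower_integral:
  fixes T :: "'z::euclidean_space \<Rightarrow> 'a::euclidean_space list \<Rightarrow> 'a \<Rightarrow> complex"
  assumes tower: "\<And>z. z \<in> space M \<Longrightarrow> deriv_tower (T z)"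
    and meas: "\<And>bs y. set bs \<subseteq> Basis \<Longrightarrow> (\<lambda>z. T z bs y) \<in> borel_measurable M"
    and dom: "\<And>bs y. set bs \<subseteq> Basis \<Longrightarrow> \<exists>B. integrable M B \<and> (\<forall>z\<in>space M. \<forall>y'\<in>ball y 1. norm (T z bs y') \<le> B z)"
  shows "deriv_tower (\<lambda>bs y. \<integral>z. T z bs y \<partial>M)"
  unfolding deriv_tower_def
proof (intro allI impI)
  fix bs :: "'a list" and y :: 'a assume bs: "set bs \<subseteq> Basis"
  have int: "integrable M (\<lambda>z. T z cs w)" if cs: "set cs \<subseteq> Basis" for cs w
  proof -
    obtain B where "integrable M B \<and> (\<forall>z\<in>space M. \<forall>y'\<in>ball w 1. norm (T z cs y') \<le> B z)" using dom[OF cs, of w] ..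
    then have B: "integrable M B" and *: "\<And>z. z \<in> space M \<Longrightarrow> norm (T z cs w) \<le> B z" by simp_all
    have "norm (T z cs w) \<le> norm (B z)" if "z \<in> space M" for z
      using *[OF that] by simp
    then show ?thesis
      by (intro Bochner_Integration.integrable_bound[OF B] meas cs AE_I2)
  qed
  have "\<forall>bc. \<exists>B. bc \<in> Basis \<times> Basis \<longrightarrow> integrable M B \<and> (\<forall>z\<in>space M. \<forall>y'\<in>ball y 1. norm (T z (fst bc # snd bc # bs) y') \<le> B z)"
  proof
    fix bc :: "'a \<times> 'a"
    show "\<exists>B. bc \<in> Basis \<times> Basis \<longrightarrow> integrable M B \<and> (\<forall>z\<in>space M. \<forall>y'\<in>ball y 1. norm (T z (fst bc # snd bc # bs) y') \<le> B z)"
      using dom[of "fst bc # snd bc # bs" y] bs by (cases "bc \<in> Basis \<times> Basis") auto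
  qed
  from choice[OF this] obtain B where B0: "\<forall>bc. bc \<in> Basis \<times> Basis \<longrightarrow> integrable M (B bc) \<and> (\<forall>z\<in>space M. \<forall>y'\<in>ball y 1. norm (T z (fst bc # snd bc # bs) y') \<le> B bc z)" ..
  have B: "integrable M (B bc)" if "bc \<in> Basis \<times> Basis" for bc
    using B0 that by blast
  have B': "norm (T z (c # b # bs) w) \<le> B (c, b) z" if "b \<in> Basis" "c \<in> Basis" "z \<in> space M" "w \<in> ball y 1" for b c z w
    using B0[rule_format, of "(c, b)"] that by auto
  define G where "G z = (\<Sum>bc\<in>Basis \<times> Basis. B bc z)" for z
  have intG: "integrable M G" unfolding G_def[abs_def] by (intro Bochner_Integration.integrable_sum B)
  have G: "norm (T z (c # b # bs) w) \<le> G z" if "b \<in> Basis" "c \<in> Basis" "z \<in> space M" "w \<in> ball y 1" for b c z w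
  proof -
    have "B (c, b) z \<le> G z" unfolding G_def
    proof (rule member_le_sum)
      fix bc :: "'a \<times> 'a" assume "bc \<in> Basis \<times> Basis - {(c, b)}"
      then have "norm (T z (fst bc # snd bc # bs) y) \<le> B bc z" using B'[of "snd bc" "fst bc" z y] that by auto
      then show "0 \<le> B bc z" using norm_ge_zero order_trans by blast
    qed (use that in auto)
    then show ?thesis using B'[OF that] by simp
  qed
  let ?K = "(DIM('a))\<^sup>2 * (\<integral>z. G z \<partial>M)"
  have rem: "norm ((\<integral>z. T z bs y' \<partial>M) - (\<integral>z. T z bs y \<partial>M) - (\<Sum>b\<in>Basis. ((y' - y) \<bullet> b) *\<^sub>R (\<integral>z. T z (b # bs) y \<partial>M)))
      \<le> ?K * (norm (y' - y))\<^sup>2" if y': "dist y' y < 1" for y'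
  proof -
    have "(\<integral>z. T z bs y' \<partial>M) - (\<integral>z. T z bs y \<partial>M) - (\<Sum>b\<in>Basis. ((y' - y) \<bullet> b) *\<^sub>R (\<integral>z. T z (b # bs) y \<partial>M))
      = (\<integral>z. T z bs y' - T z bs y - (\<Sum>b\<in>Basis. ((y' - y) \<bullet> b) *\<^sub>R T z (b # bs) y) \<partial>M)"
      using bs by (simp add: int)
    also have "norm \<dots> \<le> (\<integral>z. (DIM('a))\<^sup>2 * G z * (norm (y' - y))\<^sup>2 \<partial>M)"
    proof (rule Bochner_Integration.integral_norm_bound_integral)
      show "integrable M (\<lambda>z. T z bs y' - T z bs y - (\<Sum>b\<in>Basis. ((y' - y) \<bullet> b) *\<^sub>R T z (b # bs) y))"
        using bs by (intro Bochner_Integration.integrable_diff Bochner_Integration.integrable_sum integrable_scaleR_right int) auto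
      show "integrable M (\<lambda>z. (DIM('a))\<^sup>2 * G z * (norm (y' - y))\<^sup>2)"
        using intG by (intro integrable_mult_left integrable_mult_right) auto
      fix z assume z: "z \<in> space M"
      have "cball y (norm (y' - y)) \<subseteq> ball y 1" using y' by (auto simp: dist_norm)
      then show "norm (T z bs y' - T z bs y - (\<Sum>b\<in>Basis. ((y' - y) \<bullet> b) *\<^sub>R T z (b # bs) y)) \<le> (DIM('a))\<^sup>2 * G z * (norm (y' - y))\<^sup>2"
        using G z bs by (intro deriv_tower_remainder tower) auto
    qed
    also have "\<dots> = ?K * (norm (y' - y))\<^sup>2" by simp
    finally show ?thesis .
  qed
  show "((\<lambda>y. \<integral>z. T z bs y \<partial>M) has_derivative (\<lambda>v. \<Sum>b\<in>Basis. (v \<bullet> b) *\<^sub>R (\<integral>z. T z (b # bs) y \<partial>M))) (at y)"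
  proof (rule has_derivativeI_sandwich[where e = 1 and H = "\<lambda>y'. ?K * norm (y' - y)"])
    show "bounded_linear (\<lambda>v. \<Sum>b\<in>Basis. (v \<bullet> b) *\<^sub>R (\<integral>z. T z (b # bs) y \<partial>M))"
      by (intro bounded_linear_intros)
    show "((\<lambda>y'. ?K * norm (y' - y)) \<longlongrightarrow> 0) (at y)"
      by (rule tendsto_eq_intros refl | simp)+
    fix y' assume "y' \<noteq> y" "dist y' y < 1"
    with rem[of y'] show "norm ((\<integral>z. T z bs y' \<partial>M) - (\<integral>z. T z bs y \<partial>M) - (\<Sum>b\<in>Basis. ((y' - y) \<bullet> b) *\<^sub>R (\<integral>z. T z (b # bs) y \<partial>M))) / norm (y' - y)
        \<le> ?K * norm (y' - y)"
      by (simp add: field_simps power2_eq_square)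
  qed simp
qed

section \<open>Smooth functions of one variable\<close>

primrec Ck :: "nat \<Rightarrow> (real \<Rightarrow> real) \<Rightarrow> bool" where
  "Ck 0 f \<longleftrightarrow> continuous_on UNIV f"
| "Ck (Suc k) f \<longleftrightarrow> (\<exists>f'. (\<forall>x. (f has_real_derivative f' x) (at x)) \<and> Ck k f')"

definition test_fun :: "real \<Rightarrow> (real \<Rightarrow> real) \<Rightarrow> bool" where
  "test_fun R v \<longleftrightarrow> (\<forall>k. Ck k v) \<and> (\<forall>t. R \<le> \<bar>t\<bar> \<longrightarrow> v t = 0)"

declare Ck.simps(2) [simp del]

lemma Ck_SucI: "(\<And>x. (f has_real_derivative f' x) (at x)) \<Longrightarrow> Ck k f' \<Longrightarrow> Ck (Suc k) f"
  unfolding Ck.simps by (intro exI[of _ f'] conjI allI)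

lemma Ck_SucE:
  assumes "Ck (Suc k) f"
  obtains f' where "\<forall>x. (f has_real_derivative f' x) (at x)" "Ck k f'"
proof -
  obtain f' where "(\<forall>x. (f has_real_derivative f' x) (at x)) \<and> Ck k f'"
    using assms unfolding Ck.simps ..
  then show thesis by (intro that[of f']) simp_all
qed

lemma Ck_continuous:
  assumes "Ck k f" shows "continuous_on UNIV f"
proof (cases k)
  case (Suc n)
  obtain f' where d: "\<forall>x. (f has_real_derivative f' x) (at x)" "Ck n f'"
    using assms unfolding Suc by (rule Ck_SucE)
  have "isCont f x" for x using d(1)[rule_format, of x] by (rule DERIV_isCont)
  then show ?thesis by (intro continuous_at_imp_continuous_on) simp
qed (use assms in simp)

lemma Ck_SucD: "Ck (Suc k) f \<Longrightarrow> Ck k f"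
proof (induction k arbitrary: f)
  case 0
  then show ?case using Ck_continuous[OF 0] by simp
next
  case (Suc k)
  obtain f' where df0: "\<forall>x. (f has_real_derivative f' x) (at x)" and C: "Ck (Suc k) f'"
    using Suc.prems by (rule Ck_SucE)
  show ?case using df0[rule_format] Suc.IH[OF C] by (rule Ck_SucI)
qed

lemma Ck_const: "Ck k (\<lambda>_. c)"
proof (induction k arbitrary: c)
  case (Suc k)
  show ?case by (rule Ck_SucI[of _ "\<lambda>_. 0"]) (simp, rule Suc)
qed simp

lemma Ck_ident: "Ck k (\<lambda>x. x)"
proof (cases k)
  case (Suc n)
  show ?thesis unfolding Suc by (rule Ck_SucI[of _ "\<lambda>_. 1"]) (simp, rule Ck_const)
qed simp

lemma Ck_add: "Ck k f \<Longrightarrow> Ck k g \<Longrightarrow> Ck k (\<lambda>x. f x + g x)"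
proof (induction k arbitrary: f g)
  case 0
  then show ?case by (auto intro!: continuous_intros)
next
  case (Suc k)
  obtain f' where f0: "\<forall>x. (f has_real_derivative f' x) (at x)" "Ck k f'"
    using Suc.prems(1) by (rule Ck_SucE)
  note f = f0[rule_format]
  obtain g' where g0: "\<forall>x. (g has_real_derivative g' x) (at x)" "Ck k g'"
    using Suc.prems(2) by (rule Ck_SucE)
  note g = g0[rule_format]
  show ?case
    by (rule Ck_SucI[of _ "\<lambda>x. f' x + g' x"]) (intro DERIV_add f g, intro Suc.IH f g)
qed

lemma Ck_mult: "Ck k f \<Longrightarrow> Ck k g \<Longrightarrow> Ck k (\<lambda>x. f x * g x)"
proof (induction k arbitrary: f g)
  case 0
  then show ?case by (auto intro!: continuous_intros)
next
  case (Suc k)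
  obtain f' where f0: "\<forall>x. (f has_real_derivative f' x) (at x)" "Ck k f'"
    using Suc.prems(1) by (rule Ck_SucE)
  note f = f0[rule_format]
  obtain g' where g0: "\<forall>x. (g has_real_derivative g' x) (at x)" "Ck k g'"
    using Suc.prems(2) by (rule Ck_SucE)
  note g = g0[rule_format]
  show ?case
    by (rule Ck_SucI[of _ "\<lambda>x. f' x * g x + g' x * f x"])
      (intro DERIV_mult f g, intro Ck_add Suc.IH f g Suc.prems[THEN Ck_SucD])
qed

lemma Ck_inverse: "Ck k g \<Longrightarrow> (\<And>x. g x \<noteq> 0) \<Longrightarrow> Ck k (\<lambda>x. inverse (g x))"
proof (induction k)
  case 0
  then show ?case by (auto intro!: continuous_intros)
next
  case (Suc k)
  obtain g' where g0: "\<forall>x. (g has_real_derivative g' x) (at x)" "Ck k g'"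
    using Suc.prems(1) by (rule Ck_SucE)
  note g = g0[rule_format]
  show ?case
  proof (rule Ck_SucI)
    show "((\<lambda>x. inverse (g x)) has_real_derivative - (inverse (g x) * g' x * inverse (g x))) (at x)" for x
      by (rule DERIV_inverse'[OF g(1) Suc.prems(2)])
    have "Ck k (\<lambda>x. - 1 * (inverse (g x) * g' x * inverse (g x)))"
      by (intro Ck_mult Ck_const g Suc.IH Suc.prems(2) Suc.prems(1)[THEN Ck_SucD])
    then show "Ck k (\<lambda>x. - (inverse (g x) * g' x * inverse (g x)))" by simp
  qed
qed

lemma Ck_affine: "Ck k f \<Longrightarrow> Ck k (\<lambda>x. f (a * x + b))"
proof (induction k arbitrary: f)
  case 0
  then have "continuous_on UNIV f" by simp
  from continuous_on_compose2[OF this, of UNIV "\<lambda>x. a * x + b"] show ?case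
    by (simp add: continuous_intros)
next
  case (Suc k)
  obtain f' where f0: "\<forall>x. (f has_real_derivative f' x) (at x)" "Ck k f'"
    using Suc.prems by (rule Ck_SucE)
  note f = f0[rule_format]
  show ?case
  proof (rule Ck_SucI)
    show "((\<lambda>x. f (a * x + b)) has_real_derivative f' (a * x + b) * a) (at x)" for x
      by (rule DERIV_chain2[OF f(1)]) (auto intro!: derivative_eq_intros)
    show "Ck k (\<lambda>x. f' (a * x + b) * a)"
      by (intro Ck_mult Ck_const Suc.IH f)
  qed
qed

lemma Ck_sum: "(\<And>i. i \<in> I \<Longrightarrow> Ck k (f i)) \<Longrightarrow> Ck k (\<lambda>x. \<Sum>i\<in>I. f i x)"
  by (induction I rule: infinite_finite_induct) (simp_all add: Ck_const Ck_add)

lemma smooth_fun_imp_Ck: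
  assumes "smooth_fun (f :: real \<Rightarrow> real)"
  shows "Ck k f"
proof -
  have "Ck k (partial_derivs (replicate m 1) f)" for m
  proof (induction k arbitrary: m)
    case 0
    then show ?case
      using assms by (simp add: smooth_fun_def set_replicate_conv_if differentiable_imp_continuous_on)
  next
    case (Suc k)
    let ?g = "partial_derivs (replicate m 1) f"
    have "(?g has_real_derivative partial_derivs (replicate (Suc m) 1) f x) (at x)" for x
    proof -
      have "?g differentiable (at x)"
        using assms by (auto simp: smooth_fun_def differentiable_on_def set_replicate_conv_if)
      then have d: "(?g has_derivative frechet_derivative ?g (at x)) (at x)"
        by (simp add: frechet_derivative_works)
      then interpret bounded_linear "frechet_derivative ?g (at x)" by (rule has_derivative_bounded_linear)
      have "(*) (frechet_derivative ?g (at x) 1) = frechet_derivative ?g (at x)"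
      proof
        fix h show "frechet_derivative ?g (at x) 1 * h = frechet_derivative ?g (at x) h"
          using scale[of h 1] by (simp add: mult.commute)
      qed
      moreover have "partial_derivs (replicate (Suc m) 1) f x = frechet_derivative ?g (at x) 1"
        by (simp add: partial_derivs_def partial_deriv_def)
      ultimately have "(*) (partial_derivs (replicate (Suc m) 1) f x) = frechet_derivative ?g (at x)"
        by (simp only:)
      with d show ?thesis
        unfolding has_field_derivative_def by (simp only:)
    qed
    then show ?case by (rule Ck_SucI) (rule Suc)
  qed
  from this[of 0] show ?thesis by simp
qed

lemma test_fun_Ck: "test_fun R v \<Longrightarrow> Ck k v"
  by (simp add: test_fun_def)

lemma test_fun_continuous: "test_fun R v \<Longrightarrow> continuous_on UNIV v"
  by (rule Ck_continuous[OF test_fun_Ck])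

lemma test_fun_mult: "(\<And>k. Ck k u) \<Longrightarrow> test_fun R v \<Longrightarrow> test_fun R (\<lambda>t. u t * v t)"
  by (simp add: test_fun_def Ck_mult)

lemma test_fun_power_mult: "test_fun R v \<Longrightarrow> test_fun R (\<lambda>t. t ^ m * v t)"
proof (induction m)
  case (Suc m)
  from test_fun_mult[OF Ck_ident Suc.IH[OF Suc.prems]] show ?case by (simp add: mult.assoc)
qed simp

lemma test_fun_shift: "test_fun R v \<Longrightarrow> test_fun (R + \<bar>a\<bar>) (\<lambda>t. v (t - a))"
  unfolding test_fun_def
proof safe
  fix k assume "\<forall>k. Ck k v"
  then show "Ck k (\<lambda>t. v (t - a))" using Ck_affine[of k v 1 "- a"] by simp
next
  fix t assume "\<forall>t. R \<le> \<bar>t\<bar> \<longrightarrow> v t = 0" "R + \<bar>a\<bar> \<le> \<bar>t\<bar>"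
  then show "v (t - a) = 0" by simp
qed

lemma test_fun_deriv:
  assumes "test_fun R v"
  obtains v' where "\<forall>t. (v has_real_derivative v' t) (at t)" "test_fun R v'"
proof -
  obtain v' where d0: "\<forall>t. (v has_real_derivative v' t) (at t)" and c0: "Ck 0 v'"
    using test_fun_Ck[OF assms, of "Suc 0"] by (rule Ck_SucE)
  note d = d0[rule_format]
  have Ck: "Ck k v'" for k
  proof -
    obtain w where w: "\<forall>t. (v has_real_derivative w t) (at t)" "Ck k w"
      using test_fun_Ck[OF assms, of "Suc k"] by (rule Ck_SucE)
    have "w = v'" using DERIV_unique[OF w(1)[rule_format] d] by (rule ext)
    with w(2) show ?thesis by simp
  qed
  have "v' t = 0" if "R \<le> \<bar>t\<bar>" for t
  proof -
    have c: "continuous_on UNIV v'" using c0 by simp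
    have z: "v' r = 0" if "R < \<bar>r\<bar>" for r
    proof -
      have "open {r. R < \<bar>r\<bar>}" by (intro open_Collect_less continuous_intros)
      then have "\<forall>\<^sub>F x in nhds r. v x = 0"
        using that assms unfolding eventually_nhds test_fun_def by (intro exI[of _ "{r. R < \<bar>r\<bar>}"]) auto
      then have "(v has_real_derivative 0) (at r)"
        using DERIV_cong_ev[of r r v "\<lambda>_. 0" 0 0] by simp
      with d show ?thesis by (rule DERIV_unique)
    qed
    define s where "s = (if 0 \<le> t then 1 else - 1 :: real)"
    have "((\<lambda>n. v' (t + s * inverse (real (Suc n)))) \<longlongrightarrow> v' (t + s * 0)) sequentially"
      by (rule continuous_on_tendsto_compose[OF c tendsto_add[OF tendsto_const tendsto_mult[OF tendsto_const LIMSEQ_inverse_real_of_nat]]]) simp_all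
    moreover have "v' (t + s * inverse (real (Suc n))) = 0" for n
    proof -
      define i where "i = inverse (real (Suc n))"
      have "0 < i" by (simp add: i_def)
      then have "R < \<bar>t + s * i\<bar>" using that by (auto simp: s_def)
      then show ?thesis unfolding i_def by (rule z)
    qed
    ultimately show ?thesis by (simp add: LIMSEQ_const_iff)
  qed
  with d Ck show ?thesis by (intro that[of v']) (simp_all add: test_fun_def)
qed

lemma test_fun_integrable:
  assumes "test_fun R v"
  shows "integrable lborel v"
proof -
  have "integrable lborel (\<lambda>x. indicator {- R..R} x *\<^sub>R v x)"
    using assms by (intro borel_integrable_compact continuous_on_subset[OF test_fun_continuous]) auto
  also have "(\<lambda>x. indicator {- R..R} x *\<^sub>R v x) = v"
  proof
    fix x show "indicator {- R..R} x *\<^sub>R v x = v x"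
      using assms by (cases "R \<le> \<bar>x\<bar>") (auto simp: test_fun_def indicator_def abs_if split: if_splits)
  qed
  finally show ?thesis .
qed

lemma test_fun_measurable: "test_fun R v \<Longrightarrow> v \<in> borel_measurable borel"
  by (rule borel_measurable_continuous_onI[OF test_fun_continuous])

section \<open>Fourier integrals of test functions\<close>

definition osc :: "(real \<Rightarrow> real) \<Rightarrow> real \<Rightarrow> complex" where
  "osc v r = (\<integral>\<xi>. cis (r * \<xi>) * of_real (v \<xi>) \<partial>lborel)"

lemma borel_measurable_cis [measurable (raw)]:
  "f \<in> borel_measurable M \<Longrightarrow> (\<lambda>x. cis (f x)) \<in> borel_measurable M"
  by (rule borel_measurable_continuous_on[of cis]) (auto intro!: continuous_intros)

lemma osc_integrable:
  assumes "test_fun R v"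
  shows "integrable lborel (\<lambda>\<xi>. cis (r * \<xi>) * of_real (v \<xi>))"
proof (rule Bochner_Integration.integrable_bound[OF test_fun_integrable[OF assms]])
  have [measurable]: "v \<in> borel_measurable borel" using test_fun_measurable[OF assms] .
  show "(\<lambda>\<xi>. cis (r * \<xi>) * complex_of_real (v \<xi>)) \<in> borel_measurable lborel" by measurable
qed (simp add: norm_mult)

lemma norm_osc_le: "test_fun R v \<Longrightarrow> norm (osc v r) \<le> (\<integral>\<xi>. \<bar>v \<xi>\<bar> \<partial>lborel)"
  unfolding osc_def
  by (rule Bochner_Integration.integral_norm_bound_integral)
    (simp_all add: norm_mult osc_integrable[of R] integrable_abs test_fun_integrable[of R])

lemma has_vector_derivative_cis:
  "((\<lambda>\<xi>. cis (r * \<xi>)) has_vector_derivative \<i> * of_real r * cis (r * \<xi>)) (at \<xi> within S)"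
proof -
  have "((\<lambda>\<xi>. exp (\<i> * of_real r * complex_of_real \<xi>)) has_vector_derivative \<i> * of_real r * exp (\<i> * of_real r * complex_of_real \<xi>)) (at \<xi> within S)"
    by (intro has_vector_derivative_real_field) (auto intro!: derivative_eq_intros)
  then show ?thesis by (simp add: cis_conv_exp mult.assoc)
qed

lemma osc_has_vector_derivative:
  assumes v: "test_fun R v"
  shows "(osc v has_vector_derivative \<i> * osc (\<lambda>\<xi>. \<xi> * v \<xi>) r) (at r)"
proof -
  have [measurable]: "v \<in> borel_measurable borel" using test_fun_measurable[OF v] .
  define T where "T \<xi> (bs :: real list) r = (\<i> * of_real \<xi>) ^ length bs * cis (\<xi> * r) * complex_of_real (v \<xi>)" for \<xi> bs r
  have "deriv_tower (\<lambda>bs r. \<integral>\<xi>. T \<xi> bs r \<partial>lborel)"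
  proof (rule deriv_tower_integral)
    fix \<xi>
    have "(T \<xi> bs has_derivative (\<lambda>h. \<Sum>b\<in>Basis. (h \<bullet> b) *\<^sub>R T \<xi> (b # bs) r)) (at r)" for bs r
    proof -
      have "((\<lambda>r. (\<i> * of_real \<xi>) ^ length bs * complex_of_real (v \<xi>) * cis (\<xi> * r)) has_vector_derivative
        (\<i> * of_real \<xi>) ^ length bs * complex_of_real (v \<xi>) * (\<i> * of_real \<xi> * cis (\<xi> * r))) (at r)"
        by (intro has_vector_derivative_mult_right has_vector_derivative_cis)
      then show ?thesis
        by (simp add: has_vector_derivative_def T_def[abs_def] mult_ac)
    qed
    then show "deriv_tower (T \<xi>)" by (auto simp: deriv_tower_def)
  next
    fix bs :: "real list" and r :: real
    show "(\<lambda>\<xi>. T \<xi> bs r) \<in> borel_measurable lborel" by (simp add: T_def)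
    show "\<exists>B. integrable lborel B \<and> (\<forall>\<xi>\<in>space lborel. \<forall>y'\<in>ball r 1. norm (T \<xi> bs y') \<le> B \<xi>)"
      using integrable_abs[OF test_fun_integrable[OF test_fun_power_mult[OF v, of "length bs"]]]
      by (intro exI[of _ "\<lambda>\<xi>. \<bar>\<xi> ^ length bs * v \<xi>\<bar>"]) (auto simp: T_def norm_mult norm_power abs_mult power_abs)
  qed
  from deriv_towerD[OF this, of "[]" r] show ?thesis
    by (simp add: has_vector_derivative_def T_def osc_def[abs_def] mult_ac cong: Bochner_Integration.integral_cong)
qed

lemma osc_continuous: "test_fun R v \<Longrightarrow> continuous_on UNIV (osc v)"
  by (intro continuous_at_imp_continuous_on ballI has_vector_derivative_continuous[OF osc_has_vector_derivative])

lemma osc_by_parts: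
  assumes v: "test_fun R v" and d: "\<And>t. (v has_real_derivative v' t) (at t)" and v': "test_fun R v'"
  shows "of_real r * osc v r = \<i> * osc v' r"
proof -
  define a where "a = \<bar>R\<bar> + 1"
  let ?f = "\<lambda>\<xi>. cis (r * \<xi>) * of_real (v' \<xi>) + \<i> * of_real r * cis (r * \<xi>) * of_real (v \<xi>)"
  have "(\<integral>\<xi>. indicator {- a..a} \<xi> *\<^sub>R ?f \<xi> \<partial>lborel) = cis (r * a) * of_real (v a) - cis (r * (- a)) * of_real (v (- a))"
  proof (rule integral_FTC_Icc)
    show "continuous_on {- a..a} ?f"
      using test_fun_continuous[OF v] test_fun_continuous[OF v']
      by (auto intro!: continuous_intros intro: continuous_on_subset)
    fix \<xi>
    have "(v has_real_derivative v' \<xi>) (at \<xi> within {- a..a})"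
      using d[of \<xi>] by (rule has_field_derivative_at_within)
    then show "((\<lambda>\<xi>. cis (r * \<xi>) * of_real (v \<xi>)) has_vector_derivative ?f \<xi>) (at \<xi> within {- a..a})"
      by (intro has_vector_derivative_mult has_vector_derivative_cis has_vector_derivative_of_real)
  qed (simp add: a_def)
  also have "\<dots> = 0" using v by (simp add: a_def test_fun_def)
  also have "(\<lambda>\<xi>. indicator {- a..a} \<xi> *\<^sub>R ?f \<xi>) = ?f"
  proof
    fix \<xi> show "indicator {- a..a} \<xi> *\<^sub>R ?f \<xi> = ?f \<xi>"
      using v v' by (cases "\<xi> \<in> {- a..a}") (auto simp: test_fun_def a_def)
  qed
  also have "(\<integral>\<xi>. ?f \<xi> \<partial>lborel) = osc v' r + \<i> * of_real r * osc v r"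
    using osc_integrable[OF v] osc_integrable[OF v'] by (simp add: osc_def mult.assoc)
  finally have "osc v' r = - (\<i> * of_real r * osc v r)" by (simp add: eq_neg_iff_add_eq_0)
  then have "\<i> * osc v' r = - (\<i> * \<i>) * (of_real r * osc v r)" by (simp add: mult.assoc)
  then show ?thesis by simp
qed

lemma osc_power_bound: "test_fun R v \<Longrightarrow> \<exists>C. \<forall>r. \<bar>r\<bar> ^ N * norm (osc v r) \<le> C"
proof (induction N arbitrary: v)
  case 0
  then show ?case using norm_osc_le by auto
next
  case (Suc N)
  obtain v' where v0: "\<forall>t. (v has_real_derivative v' t) (at t)" "test_fun R v'"
    using Suc.prems by (rule test_fun_deriv)
  note v' = v0[rule_format]
  have "\<bar>r\<bar> ^ Suc N * norm (osc v r) = \<bar>r\<bar> ^ N * norm (osc v' r)" for r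
  proof -
    have "\<bar>r\<bar> * norm (osc v r) = norm (osc v' r)"
      using arg_cong[OF osc_by_parts[OF Suc.prems v', of r], of norm] by (simp add: norm_mult)
    then show ?thesis by (simp add: mult_ac)
  qed
  with Suc.IH[OF v'(2)] show ?case by (simp only:)
qed

lemma one_plus_power_le: "0 \<le> x \<Longrightarrow> (1 + x) ^ N \<le> 2 ^ N * (1 + x ^ N)" for x :: real
proof -
  assume x: "0 \<le> x"
  have "(1 + x) ^ N \<le> (2 * max 1 x) ^ N" using x by (intro power_mono) auto
  also have "\<dots> \<le> 2 ^ N * (1 + x ^ N)"
    using x by (auto simp: power_mult_distrib max_def)
  finally show ?thesis .
qed

lemma rapidly_decreasing_osc:
  assumes "test_fun R v"
  shows "rapidly_decreasing (osc v)"
  unfolding rapidly_decreasing_def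
proof
  fix N
  obtain C0 where C0: "\<And>r. norm (osc v r) \<le> C0" using norm_osc_le[OF assms] by blast
  obtain C where C: "\<And>r. \<bar>r\<bar> ^ N * norm (osc v r) \<le> C" using osc_power_bound[OF assms] by blast
  have "(1 + norm r) ^ N * norm (osc v r) \<le> 2 ^ N * (C0 + C)" for r
  proof -
    have "(1 + norm r) ^ N * norm (osc v r) \<le> 2 ^ N * (1 + \<bar>r\<bar> ^ N) * norm (osc v r)"
      using one_plus_power_le[of "\<bar>r\<bar>" N] by (intro mult_right_mono) auto
    also have "\<dots> = 2 ^ N * (norm (osc v r) + \<bar>r\<bar> ^ N * norm (osc v r))" by (simp add: algebra_simps)
    also have "\<dots> \<le> 2 ^ N * (C0 + C)" using C C0 by (intro mult_left_mono add_mono) auto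
    finally show ?thesis .
  qed
  then show "\<exists>C. \<forall>r. (1 + norm r) ^ N * norm (osc v r) \<le> C" by blast
qed

definition ift :: "(real \<Rightarrow> real) \<Rightarrow> nat \<Rightarrow> real \<Rightarrow> complex" where
  "ift v m r = \<i> ^ m / of_real (2 * pi) * osc (\<lambda>\<xi>. \<xi> ^ m * v \<xi>) r"

lemma rapidly_decreasing_cmult: "rapidly_decreasing f \<Longrightarrow> rapidly_decreasing (\<lambda>x. c * f x :: complex)"
  unfolding rapidly_decreasing_def
proof
  fix N assume "\<forall>N. \<exists>C. \<forall>x. (1 + norm x) ^ N * norm (f x) \<le> C"
  then obtain C where C: "\<And>x. (1 + norm x) ^ N * norm (f x) \<le> C" by blast
  have "(1 + norm x) ^ N * norm (c * f x) \<le> norm c * C" for x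
    using mult_left_mono[OF C[of x], of "norm c"] by (simp add: norm_mult mult_ac)
  then show "\<exists>C. \<forall>x. (1 + norm x) ^ N * norm (c * f x) \<le> C" by blast
qed

lemma schwartz_line_tower_ift:
  assumes "test_fun R v"
  shows "schwartz_line_tower (ift v)"
  unfolding schwartz_line_tower_def line_tower_def
proof safe
  fix m r
  have "((\<lambda>r. \<i> ^ m / of_real (2 * pi) * osc (\<lambda>\<xi>. \<xi> ^ m * v \<xi>) r) has_vector_derivative
     \<i> ^ m / of_real (2 * pi) * (\<i> * osc (\<lambda>\<xi>. \<xi> * (\<xi> ^ m * v \<xi>)) r)) (at r)"
    by (intro has_vector_derivative_mult_right osc_has_vector_derivative[where R=R] test_fun_power_mult assms)
  then show "(ift v m has_vector_derivative ift v (Suc m) r) (at r)"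
    by (simp add: ift_def[abs_def] mult_ac)
  show "rapidly_decreasing (ift v m)"
    unfolding ift_def[abs_def]
    by (intro rapidly_decreasing_cmult rapidly_decreasing_osc[where R=R] test_fun_power_mult assms)
qed

lemma osc_modulate: "osc (\<lambda>\<xi>. v (\<xi> - k)) r = cis (r * k) * osc v r"
proof -
  have "osc (\<lambda>\<xi>. v (\<xi> - k)) r = (\<integral>\<xi>. cis (r * (k + 1 * \<xi>)) * of_real (v (k + 1 * \<xi> - k)) \<partial>lborel)"
    unfolding osc_def by (subst lborel_integral_real_affine[where c=1 and t=k]) auto
  also have "\<dots> = (\<integral>\<xi>. cis (r * k) * (cis (r * \<xi>) * of_real (v \<xi>)) \<partial>lborel)"
  proof (rule Bochner_Integration.integral_cong)
    fix \<xi>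
    have "cis (r * (k + 1 * \<xi>)) = cis (r * k) * cis (r * \<xi>)" by (simp add: cis_mult distrib_left)
    then show "cis (r * (k + 1 * \<xi>)) * of_real (v (k + 1 * \<xi> - k)) = cis (r * k) * (cis (r * \<xi>) * of_real (v \<xi>))"
      by (simp add: mult.assoc)
  qed simp
  finally show ?thesis by (simp add: osc_def)
qed

lemma ift_modulate: "ift (\<lambda>\<xi>. v (\<xi> - k)) 0 r = cis (r * k) * ift v 0 r"
  by (simp add: ift_def osc_modulate)

section \<open>Fubini, translations and continuity of parameter integrals\<close>

lemma
  fixes F :: "'a::euclidean_space \<Rightarrow> 'b::euclidean_space \<Rightarrow> complex" and A :: "'a \<Rightarrow> real" and B :: "'b \<Rightarrow> real"
  assumes F: "(\<lambda>(x, y). F x y) \<in> borel_measurable (lborel \<Otimes>\<^sub>M lborel)"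
    and A: "integrable lborel A" and B: "integrable lborel B"
    and le: "\<And>x y. norm (F x y) \<le> A x * B y"
  shows integrable_pair_dominated: "integrable (lborel \<Otimes>\<^sub>M lborel) (\<lambda>(x, y). F x y)"
    and integral_swap_dominated: "(\<integral>x. \<integral>y. F x y \<partial>lborel \<partial>lborel) = (\<integral>y. \<integral>x. F x y \<partial>lborel \<partial>lborel)"
proof -
  have psf: "pair_sigma_finite (lborel :: 'a measure) (lborel :: 'b measure)" ..
  have [measurable]: "A \<in> borel_measurable borel" "B \<in> borel_measurable borel"
    using borel_measurable_integrable[OF A] borel_measurable_integrable[OF B] by simp_all
  have AB: "integrable (lborel \<Otimes>\<^sub>M lborel) (\<lambda>(x, y). A x * B y)"
    by (rule pair_sigma_finite.Fubini_integrable[OF psf]) (simp_all add: A B abs_mult)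
  show int: "integrable (lborel \<Otimes>\<^sub>M lborel) (\<lambda>(x, y). F x y)"
  proof (rule Bochner_Integration.integrable_bound[OF AB F], rule AE_I2)
    fix p :: "'a \<times> 'b"
    show "norm (case p of (x, y) \<Rightarrow> F x y) \<le> norm (case p of (x, y) \<Rightarrow> A x * B y)"
      using le[of "fst p" "snd p"] by (simp add: case_prod_beta)
  qed
  then show "(\<integral>x. \<integral>y. F x y \<partial>lborel \<partial>lborel) = (\<integral>y. \<integral>x. F x y \<partial>lborel \<partial>lborel)"
    by (rule pair_sigma_finite.Fubini_integral[OF psf, symmetric])
qed

lemma distr_lborel_isometry:
  fixes t :: "'a::euclidean_space"
  assumes "\<bar>c\<bar> = 1"
  shows "distr lborel borel (\<lambda>x. t + c *\<^sub>R x) = lborel"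
proof -
  have "(lborel :: 'a measure) = density (distr lborel borel (\<lambda>x. t + c *\<^sub>R x)) (\<lambda>_. ennreal (\<bar>c\<bar> ^ DIM('a)))"
    using assms by (intro lborel_affine) auto
  then show ?thesis using assms by (simp add: density_1)
qed

lemma
  fixes f :: "'a::euclidean_space \<Rightarrow> 'b::{banach, second_countable_topology}"
  assumes [measurable]: "f \<in> borel_measurable borel"
  shows lborel_integral_reflect: "(\<integral>x. f (t - x) \<partial>lborel) = (\<integral>x. f x \<partial>lborel)"
    and lborel_integral_translate: "(\<integral>x. f (t + x) \<partial>lborel) = (\<integral>x. f x \<partial>lborel)"
    and lborel_integrable_reflect: "integrable lborel (\<lambda>x. f (t - x)) \<longleftrightarrow> integrable lborel f"
    and lborel_integrable_translate: "integrable lborel (\<lambda>x. f (t + x)) \<longleftrightarrow> integrable lborel f"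
proof -
  have r: "distr lborel borel (\<lambda>x. t - x) = lborel" and s: "distr lborel borel (\<lambda>x. t + x) = lborel"
    using distr_lborel_isometry[of "- 1" t] distr_lborel_isometry[of 1 t] by simp_all
  show "(\<integral>x. f (t - x) \<partial>lborel) = (\<integral>x. f x \<partial>lborel)"
    by (subst (2) r[symmetric]) (simp add: integral_distr)
  show "(\<integral>x. f (t + x) \<partial>lborel) = (\<integral>x. f x \<partial>lborel)"
    by (subst (2) s[symmetric]) (simp add: integral_distr)
  show "integrable lborel (\<lambda>x. f (t - x)) \<longleftrightarrow> integrable lborel f"
    by (subst (2) r[symmetric]) (simp add: integrable_distr_eq)
  show "integrable lborel (\<lambda>x. f (t + x)) \<longleftrightarrow> integrable lborel f"
    by (subst (2) s[symmetric]) (simp add: integrable_distr_eq)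
qed

lemma
  fixes f :: "'a::euclidean_space \<Rightarrow> ennreal"
  assumes [measurable]: "f \<in> borel_measurable borel"
  shows lborel_nn_integral_reflect: "(\<integral>\<^sup>+x. f (t - x) \<partial>lborel) = (\<integral>\<^sup>+x. f x \<partial>lborel)"
    and lborel_nn_integral_translate: "(\<integral>\<^sup>+x. f (t + x) \<partial>lborel) = (\<integral>\<^sup>+x. f x \<partial>lborel)"
proof -
  have r: "distr lborel borel (\<lambda>x. t - x) = lborel" and s: "distr lborel borel (\<lambda>x. t + x) = lborel"
    using distr_lborel_isometry[of "- 1" t] distr_lborel_isometry[of 1 t] by simp_all
  show "(\<integral>\<^sup>+x. f (t - x) \<partial>lborel) = (\<integral>\<^sup>+x. f x \<partial>lborel)"
    by (subst (2) r[symmetric]) (simp add: nn_integral_distr)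
  show "(\<integral>\<^sup>+x. f (t + x) \<partial>lborel) = (\<integral>\<^sup>+x. f x \<partial>lborel)"
    by (subst (2) s[symmetric]) (simp add: nn_integral_distr)
qed

lemma continuous_on_integral_dominated:
  fixes F :: "'a \<Rightarrow> 'b::{first_countable_topology, t2_space} \<Rightarrow> 'c::{banach, second_countable_topology}"
  assumes meas: "\<And>y. (\<lambda>x. F x y) \<in> borel_measurable M"
    and cont: "\<And>x. x \<in> space M \<Longrightarrow> continuous_on UNIV (F x)"
    and B: "integrable M B" "\<And>x y. x \<in> space M \<Longrightarrow> norm (F x y) \<le> B x"
  shows "continuous_on UNIV (\<lambda>y. \<integral>x. F x y \<partial>M)"
proof (intro continuous_at_imp_continuous_on ballI continuous_at_sequentiallyI)
  fix y u assume u: "u \<longlonglongrightarrow> (y :: 'b)"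
  show "(\<lambda>n. \<integral>x. F x (u n) \<partial>M) \<longlonglongrightarrow> (\<integral>x. F x y \<partial>M)"
  proof (rule integral_dominated_convergence[where w = B])
    show "AE x in M. (\<lambda>n. F x (u n)) \<longlonglongrightarrow> F x y"
      using continuous_on_tendsto_compose[OF cont u] by (intro AE_I2) auto
  qed (use meas B in auto)
qed

section \<open>Fourier inversion for test functions\<close>

lemma ift_continuous: "test_fun R v \<Longrightarrow> continuous_on UNIV (ift v m)"
  unfolding ift_def[abs_def]
  by (intro continuous_intros osc_continuous[where R=R] test_fun_power_mult)

lemma ift_measurable: "test_fun R v \<Longrightarrow> ift v m \<in> borel_measurable borel"
  by (rule borel_measurable_continuous_onI[OF ift_continuous])

lemma rapidly_decreasing_ift: "test_fun R v \<Longrightarrow> rapidly_decreasing (ift v m)"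
  using schwartz_line_tower_ift by (auto simp: schwartz_line_tower_def)

lemma integrable_ift: "test_fun R v \<Longrightarrow> integrable lborel (ift v m)"
  by (rule integrable_rapidly_decreasing(1)[OF ift_measurable rapidly_decreasing_ift])

lemma continuous_integral_zero:
  fixes u :: "real \<Rightarrow> complex"
  assumes u: "continuous_on UNIV u"
    and zero: "\<And>a b. a \<le> b \<Longrightarrow> (\<integral>x. indicator {a..b} x *\<^sub>R u x \<partial>lborel) = 0"
  shows "u x = 0"
proof -
  have "integral {x - 1..y} u = 0" if "y \<in> {x - 1..x + 1}" for y
  proof -
    have "set_integrable lborel {x - 1..y} u"
      unfolding set_integrable_def by (intro borel_integrable_compact continuous_on_subset[OF u]) auto
    then have "integral {x - 1..y} u = (LINT t:{x - 1..y}|lborel. u t)"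
      by (simp add: set_borel_integral_eq_integral)
    also have "\<dots> = 0" using zero[of "x - 1" y] that by (simp add: set_lebesgue_integral_def)
    finally show ?thesis .
  qed
  moreover have "((\<lambda>y. integral {x - 1..y} u) has_vector_derivative u x) (at x within {x - 1..x + 1})"
    by (intro integral_has_vector_derivative continuous_on_subset[OF u]) auto
  ultimately have "((\<lambda>y. 0) has_vector_derivative u x) (at x within {x - 1..x + 1})"
    by (intro has_vector_derivative_transform[of x "{x - 1..x + 1}" "\<lambda>_. 0" "\<lambda>y. integral {x - 1..y} u"]) auto
  then show ?thesis
    using vector_derivative_unique_within_closed_interval[of "x - 1" "x + 1" x "\<lambda>_. 0" "u x" 0] by simp
qed

lemma osc_Levy:
  assumes v: "test_fun R v" and nonneg: "\<And>t. 0 \<le> v t" and pos: "0 < (\<integral>t. v t \<partial>lborel)" and "a \<le> b"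
  shows "(\<integral>t. (iexp (- (t * a)) - iexp (- (t * b))) / (\<i> * t) * (osc v t / of_real (2 * pi)) \<partial>lborel)
    = of_real (\<integral>x. indicator {a..b} x * v x \<partial>lborel)"
proof -
  define I where "I = (\<integral>t. v t \<partial>lborel)"
  have I: "0 < I" using pos by (simp add: I_def)
  have [measurable]: "v \<in> borel_measurable borel" using test_fun_measurable[OF v] .
  have [measurable]: "osc v \<in> borel_measurable borel"
    by (rule borel_measurable_continuous_onI[OF osc_continuous[OF v]])
  have iv: "integrable lborel v" using test_fun_integrable[OF v] .
  define M where "M = density lborel (\<lambda>x. ennreal (v x / I))"
  have [simp]: "sets M = sets borel" "space M = UNIV" by (simp_all add: M_def)
  have "(\<integral>\<^sup>+x. ennreal (v x / I) \<partial>lborel) = ennreal (\<integral>x. v x / I \<partial>lborel)"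
    using nonneg I iv by (intro nn_integral_eq_integral) auto
  also have "\<dots> = 1" using I by (simp add: I_def[symmetric])
  finally have "emeasure M (space M) = 1"
    unfolding M_def by (subst emeasure_density) auto
  then interpret prob_space M by (rule prob_spaceI)
  interpret real_distribution M by standard simp
  have meas: "measure M A = (\<integral>x. indicator A x * v x \<partial>lborel) / I" if [measurable]: "A \<in> sets borel" for A
  proof -
    have "emeasure M A = (\<integral>\<^sup>+x. ennreal (v x / I) * indicator A x \<partial>lborel)"
      unfolding M_def by (subst emeasure_density) auto
    also have "\<dots> = (\<integral>\<^sup>+x. ennreal (indicator A x * v x / I) \<partial>lborel)"
      by (intro nn_integral_cong) (auto simp: indicator_def)
    also have "\<dots> = ennreal (\<integral>x. indicator A x * v x / I \<partial>lborel)"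
      using nonneg I iv integrable_mult_indicator[OF _ iv, of A]
      by (intro nn_integral_eq_integral) auto
    finally have "emeasure M A = ennreal ((\<integral>x. indicator A x * v x \<partial>lborel) / I)" by simp
    moreover have "0 \<le> (\<integral>x. indicator A x * v x \<partial>lborel)" using nonneg by (intro integral_nonneg_AE) auto
    ultimately show ?thesis using I by (intro measure_eq_emeasure_eq_ennreal) auto
  qed
  have sing: "measure M {x} = 0" for x
  proof -
    have "(\<integral>t. indicator {x} t * v t \<partial>lborel) = 0"
    proof (rule integral_eq_zero_AE)
      show "AE t in lborel. indicator {x} t * v t = 0"
        using AE_lborel_singleton[of x] by eventually_elim (simp add: indicator_def)
    qed
    then show ?thesis using meas[of "{x}"] by simp
  qed
  have char: "char M t = osc v t / of_real I" for t
  proof -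
    have "char M t = (\<integral>x. (v x / I) *\<^sub>R iexp (t * x) \<partial>lborel)"
      unfolding char_def M_def using nonneg I by (subst integral_density) auto
    also have "\<dots> = (\<integral>x. cis (t * x) * of_real (v x) / of_real I \<partial>lborel)"
      by (intro Bochner_Integration.integral_cong) (auto simp: cis_conv_exp scaleR_conv_of_real)
    also have "\<dots> = osc v t / of_real I" by (simp add: osc_def)
    finally show ?thesis .
  qed
  let ?F = "\<lambda>t::real. (iexp (- (t * a)) - iexp (- (t * b))) / (\<i> * t)"
  have F: "norm (?F t) \<le> b - a" for t
    using Levy_Inversion_aux2[of "- b" "- a" t] \<open>a \<le> b\<close> by (cases "t = 0") auto
  have "(\<lambda>T::nat. CLBINT t=-real T..real T. ?F t * char M t) \<longlonglongrightarrow> (\<integral>t. ?F t * char M t \<partial>lborel)"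
  proof -
    have "(CLBINT t=- real T..real T. ?F t * char M t) = (\<integral>t. indicator {- real T<..<real T} t *\<^sub>R (?F t * char M t) \<partial>lborel)" for T
      by (simp add: interval_lebesgue_integral_def set_lebesgue_integral_def)
    moreover have "(\<lambda>T. \<integral>t. indicator {- real T<..<real T} t *\<^sub>R (?F t * char M t) \<partial>lborel) \<longlonglongrightarrow> (\<integral>t. ?F t * char M t \<partial>lborel)"
    proof (rule integral_dominated_convergence[where w = "\<lambda>t. (b - a) * norm (osc v t / of_real I)"])
      have "integrable lborel (osc v)"
        using rapidly_decreasing_osc[OF v] by (rule integrable_rapidly_decreasing(1)[rotated]) simp
      then show "integrable lborel (\<lambda>t. (b - a) * norm (osc v t / of_real I))"
        by (intro integrable_mult_right integrable_norm integrable_divide_zero)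
      show "AE t in lborel. (\<lambda>T. indicator {- real T<..<real T} t *\<^sub>R (?F t * char M t)) \<longlonglongrightarrow> ?F t * char M t"
      proof (rule AE_I2)
        fix t :: real
        have "eventually (\<lambda>T::nat. \<bar>t\<bar> < real T) sequentially"
          using filterlim_real_sequentially unfolding filterlim_at_top_dense by simp
        then have "eventually (\<lambda>T::nat. indicator {- real T<..<real T} t *\<^sub>R (?F t * char M t) = ?F t * char M t) sequentially"
          by eventually_elim (auto simp: indicator_def)
        then show "(\<lambda>T. indicator {- real T<..<real T} t *\<^sub>R (?F t * char M t)) \<longlonglongrightarrow> ?F t * char M t"
          by (rule tendsto_eventually)
      qed
      show "AE t in lborel. norm (indicator {- real T<..<real T} t *\<^sub>R (?F t * char M t)) \<le> (b - a) * norm (osc v t / of_real I)" for T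
      proof (rule AE_I2)
        fix t :: real
        have "norm (?F t * char M t) \<le> (b - a) * norm (osc v t / of_real I)"
          unfolding norm_mult char by (intro mult_right_mono F) simp
        moreover have "norm (indicator {- real T<..<real T} t *\<^sub>R (?F t * char M t)) \<le> norm (?F t * char M t)"
          by (auto simp: indicator_def)
        ultimately show "norm (indicator {- real T<..<real T} t *\<^sub>R (?F t * char M t)) \<le> (b - a) * norm (osc v t / of_real I)"
          by (rule order_trans[rotated])
      qed
    qed (simp_all add: char)
    ultimately show ?thesis by simp
  qed
  then have "(\<lambda>T::nat. 1 / (2 * pi) * (CLBINT t=-real T..real T. ?F t * char M t)) \<longlonglongrightarrow> 1 / (2 * pi) * (\<integral>t. ?F t * char M t \<partial>lborel)"
    by (intro tendsto_mult tendsto_const)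
  moreover have "(\<lambda>T::nat. 1 / (2 * pi) * (CLBINT t=-real T..real T. ?F t * char M t)) \<longlonglongrightarrow> measure M {a<..b}"
    using Levy_Inversion[OF \<open>a \<le> b\<close> sing sing] by simp
  ultimately have eq1: "1 / (2 * pi) * (\<integral>t. ?F t * char M t \<partial>lborel) = of_real (measure M {a<..b})"
    by (rule LIMSEQ_unique)
  have eq2: "(\<integral>t. ?F t * char M t \<partial>lborel) = (\<integral>t. ?F t * osc v t \<partial>lborel) / of_real I"
    by (simp only: char times_divide_eq_right integral_divide_zero)
  have eq3: "(\<integral>t. ?F t * (osc v t / of_real (2 * pi)) \<partial>lborel) = 1 / (2 * pi) * (\<integral>t. ?F t * osc v t \<partial>lborel)"
    by (simp only: times_divide_eq_right integral_divide_zero) simp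
  have eq4: "measure M {a<..b} = (\<integral>x. indicator {a..b} x * v x \<partial>lborel) / I"
  proof -
    have "(\<integral>x. indicator {a<..b} x * v x \<partial>lborel) = (\<integral>x. indicator {a..b} x * v x \<partial>lborel)"
      using AE_lborel_singleton[of a] by (intro Bochner_Integration.integral_cong_AE) (auto simp: indicator_def)
    then show ?thesis by (simp add: meas)
  qed
  have "Y = of_real J" if "c * L = of_real m" "L = X / of_real I" "Y = c * X" "m = J / I" for c L X Y :: complex and m J
  proof -
    have "X = L * of_real I" using that I by simp
    then have "Y = (c * L) * of_real I" using that(3) by (simp only: mult.assoc)
    also have "\<dots> = of_real (m * I)" using that(1) by simp
    finally show ?thesis using that(4) I by simp
  qed
  from this[OF eq1 eq2 eq3 eq4] show ?thesis .
qed

lemma integral_cis_Icc: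
  assumes "a \<le> b" "t \<noteq> 0"
  shows "(\<integral>x. indicator {a..b} x *\<^sub>R cis (- (t * x)) \<partial>lborel) = (iexp (- (t * a)) - iexp (- (t * b))) / (\<i> * t)"
proof -
  have "(\<integral>x. indicator {a..b} x *\<^sub>R cis ((- t) * x) \<partial>lborel)
    = cis ((- t) * b) / (- \<i> * of_real t) - cis ((- t) * a) / (- \<i> * of_real t)"
  proof (rule integral_FTC_Icc[OF \<open>a \<le> b\<close>])
    fix x
    have "((\<lambda>x. cis ((- t) * x) / (- \<i> * of_real t)) has_vector_derivative
      \<i> * of_real (- t) * cis ((- t) * x) / (- \<i> * of_real t)) (at x within {a..b})"
      by (rule has_vector_derivative_divide[OF has_vector_derivative_cis])
    then show "((\<lambda>x. cis ((- t) * x) / (- \<i> * of_real t)) has_vector_derivative cis ((- t) * x)) (at x within {a..b})"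
      using \<open>t \<noteq> 0\<close> by simp
  qed (auto intro!: continuous_intros)
  then show ?thesis using \<open>t \<noteq> 0\<close> by (simp add: cis_conv_exp field_simps)
qed

theorem ift_inversion:
  assumes v: "test_fun R v" and nonneg: "\<And>t. 0 \<le> v t" and pos: "0 < (\<integral>t. v t \<partial>lborel)"
  shows "(\<integral>r. cis (- (r * \<xi>)) * ift v 0 r \<partial>lborel) = of_real (v \<xi>)"
proof -
  note [measurable] = ift_measurable[OF v]
  have iw: "integrable lborel (ift v 0)" using integrable_ift[OF v] .
  define w where "w \<xi> = (\<integral>r. cis (- (r * \<xi>)) * ift v 0 r \<partial>lborel)" for \<xi>
  have cw: "continuous_on UNIV w"
    unfolding w_def[abs_def]
  proof (rule continuous_on_integral_dominated[where B = "\<lambda>r. norm (ift v 0 r)"])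
    show "integrable lborel (\<lambda>r. norm (ift v 0 r))" using iw by (rule integrable_norm)
  qed (auto intro!: continuous_intros simp: norm_mult)
  have "w \<xi> - of_real (v \<xi>) = 0"
  proof (rule continuous_integral_zero[where u = "\<lambda>\<xi>. w \<xi> - of_real (v \<xi>)"])
    show "continuous_on UNIV (\<lambda>\<xi>. w \<xi> - of_real (v \<xi>))"
      using cw test_fun_continuous[OF v] by (intro continuous_intros)
    fix a b :: real assume "a \<le> b"
    have "(\<integral>x. indicator {a..b} x *\<^sub>R w x \<partial>lborel) = (\<integral>x. \<integral>r. indicator {a..b} x *\<^sub>R (cis (- (r * x)) * ift v 0 r) \<partial>lborel \<partial>lborel)"
      by (simp add: w_def)
    also have "\<dots> = (\<integral>r. \<integral>x. indicator {a..b} x *\<^sub>R (cis (- (r * x)) * ift v 0 r) \<partial>lborel \<partial>lborel)"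
    proof (rule integral_swap_dominated[where A = "indicator {a..b}" and B = "\<lambda>r. norm (ift v 0 r)"])
      show "integrable lborel (\<lambda>r. norm (ift v 0 r))" using iw by (rule integrable_norm)
      show "integrable lborel (indicator {a..b} :: real \<Rightarrow> real)" by (simp add: emeasure_lborel_Icc_eq)
    qed (auto simp: norm_mult indicator_def)
    also have "\<dots> = (\<integral>r. (iexp (- (r * a)) - iexp (- (r * b))) / (\<i> * r) * (osc v r / of_real (2 * pi)) \<partial>lborel)"
    proof (rule Bochner_Integration.integral_cong_AE)
      have "AE r in lborel. r \<noteq> (0 :: real)" by (rule AE_lborel_singleton)
      then show "AE r in lborel. (\<integral>x. indicator {a..b} x *\<^sub>R (cis (- (r * x)) * ift v 0 r) \<partial>lborel)
        = (iexp (- (r * a)) - iexp (- (r * b))) / (\<i> * r) * (osc v r / of_real (2 * pi))"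
      proof eventually_elim
        case (elim r)
        have "(\<integral>x. indicator {a..b} x *\<^sub>R (cis (- (r * x)) * ift v 0 r) \<partial>lborel)
          = (\<integral>x. (indicator {a..b} x *\<^sub>R cis (- (r * x))) * ift v 0 r \<partial>lborel)" by simp
        also have "\<dots> = (\<integral>x. indicator {a..b} x *\<^sub>R cis (- (r * x)) \<partial>lborel) * ift v 0 r"
          by (rule integral_mult_left_zero)
        finally show ?case by (simp add: integral_cis_Icc[OF \<open>a \<le> b\<close> elim] ift_def)
      qed
      show "(\<lambda>r. \<integral>x. indicator {a..b} x *\<^sub>R (cis (- (r * x)) * ift v 0 r) \<partial>lborel) \<in> borel_measurable lborel"
        by measurable
      have [measurable]: "osc v \<in> borel_measurable borel"
        by (rule borel_measurable_continuous_onI[OF osc_continuous[OF v]])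
      show "(\<lambda>r. (iexp (- (r * a)) - iexp (- (r * b))) / (\<i> * r) * (osc v r / of_real (2 * pi))) \<in> borel_measurable lborel"
        by measurable
    qed
    also have "\<dots> = of_real (\<integral>x. indicator {a..b} x * v x \<partial>lborel)"
      by (rule osc_Levy[OF v nonneg pos \<open>a \<le> b\<close>])
    finally have eq: "(\<integral>x. indicator {a..b} x *\<^sub>R w x \<partial>lborel) = (\<integral>x. indicator {a..b} x *\<^sub>R complex_of_real (v x) \<partial>lborel)"
      by (simp add: scaleR_conv_of_real flip: integral_complex_of_real)
    have "integrable lborel (\<lambda>x. indicator {a..b} x *\<^sub>R w x)"
      by (intro borel_integrable_compact continuous_on_subset[OF cw]) auto
    moreover have "integrable lborel (\<lambda>x. indicator {a..b} x *\<^sub>R complex_of_real (v x))"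
      using test_fun_continuous[OF v]
      by (intro borel_integrable_compact continuous_intros) (auto intro: continuous_on_subset)
    ultimately show "(\<integral>x. indicator {a..b} x *\<^sub>R (w x - of_real (v x)) \<partial>lborel) = 0"
      using eq by (simp add: scaleR_diff_right)
  qed
  then show ?thesis by (simp add: w_def)
qed

lemma ift_convolution:
  assumes v: "test_fun R v" and nonneg: "\<And>t. 0 \<le> v t" and pos: "0 < (\<integral>t. v t \<partial>lborel)"
    and u: "test_fun S u"
  shows "(\<integral>r. ift v 0 (w - r) * ift u 0 (r - y) \<partial>lborel) = ift (\<lambda>\<xi>. v \<xi> * u \<xi>) 0 (w - y)"
proof -
  note [measurable] = ift_measurable[OF v] test_fun_measurable[OF u]
  let ?c = "complex_of_real (2 * pi)"
  have "(\<integral>r. ift v 0 (w - r) * ift u 0 (r - y) \<partial>lborel)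
    = (\<integral>r. \<integral>\<xi>. ift v 0 (w - r) * (cis ((r - y) * \<xi>) * of_real (u \<xi>)) / ?c \<partial>lborel \<partial>lborel)"
    by (simp add: ift_def[of u] osc_def)
  also have "\<dots> = (\<integral>\<xi>. \<integral>r. ift v 0 (w - r) * (cis ((r - y) * \<xi>) * of_real (u \<xi>)) / ?c \<partial>lborel \<partial>lborel)"
  proof (rule integral_swap_dominated[where A = "\<lambda>r. norm (ift v 0 (w - r))" and B = "\<lambda>\<xi>. \<bar>u \<xi>\<bar> / (2 * pi)"])
    show "integrable lborel (\<lambda>r. norm (ift v 0 (w - r)))"
      using integrable_ift[OF v] by (intro integrable_norm) (subst lborel_integrable_reflect, simp_all)
    show "integrable lborel (\<lambda>\<xi>. \<bar>u \<xi>\<bar> / (2 * pi))"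
      by (intro integrable_divide_zero integrable_abs test_fun_integrable[OF u])
  qed (simp_all add: norm_mult norm_divide)
  also have "\<dots> = (\<integral>\<xi>. cis ((w - y) * \<xi>) * of_real (v \<xi> * u \<xi>) / ?c \<partial>lborel)"
  proof (rule Bochner_Integration.integral_cong)
    fix \<xi>
    have "(\<integral>r. ift v 0 (w - r) * (cis ((r - y) * \<xi>) * of_real (u \<xi>)) / ?c \<partial>lborel)
      = (\<integral>r. cis ((w - r - y) * \<xi>) * ift v 0 r * (of_real (u \<xi>) / ?c) \<partial>lborel)"
      by (subst lborel_integral_reflect[of _ w, symmetric]) (simp_all add: mult_ac)
    also have "\<dots> = (\<integral>r. (cis (- (r * \<xi>)) * ift v 0 r) * (cis ((w - y) * \<xi>) * of_real (u \<xi>) / ?c) \<partial>lborel)"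
    proof (rule Bochner_Integration.integral_cong)
      fix r
      have "cis ((w - r - y) * \<xi>) = cis (- (r * \<xi>)) * cis ((w - y) * \<xi>)"
        by (simp add: cis_mult algebra_simps)
      then show "cis ((w - r - y) * \<xi>) * ift v 0 r * (of_real (u \<xi>) / ?c)
        = (cis (- (r * \<xi>)) * ift v 0 r) * (cis ((w - y) * \<xi>) * of_real (u \<xi>) / ?c)"
        by simp
    qed simp
    also have "\<dots> = of_real (v \<xi>) * (cis ((w - y) * \<xi>) * of_real (u \<xi>) / ?c)"
      unfolding integral_mult_left_zero ift_inversion[OF v nonneg pos] ..
    finally show "(\<integral>r. ift v 0 (w - r) * (cis ((r - y) * \<xi>) * of_real (u \<xi>)) / ?c \<partial>lborel)
      = cis ((w - y) * \<xi>) * of_real (v \<xi> * u \<xi>) / ?c" by simp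
  qed simp
  also have "\<dots> = ift (\<lambda>\<xi>. v \<xi> * u \<xi>) 0 (w - y)"
    by (simp add: ift_def osc_def)
  finally show ?thesis .
qed

section \<open>The frequency windows as tensor products\<close>

definition line_window :: "(real \<Rightarrow> real) \<Rightarrow> real \<Rightarrow> real" where
  "line_window \<eta> t = \<eta> (2 * t) / (\<Sum>\<^sub>\<infinity>j\<in>\<int>. \<eta> (2 * (t - j)))"

definition window_kernel :: "(real \<Rightarrow> real) \<Rightarrow> 'a::euclidean_space \<Rightarrow> 'a \<Rightarrow> complex" where
  "window_kernel \<eta> k = tensor (\<lambda>b. ift (\<lambda>\<xi>. line_window \<eta> (\<xi> - k \<bullet> b)) 0)"

definition cutoff_kernel :: "(real \<Rightarrow> real) \<Rightarrow> 'a::euclidean_space \<Rightarrow> 'a \<Rightarrow> complex" where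
  "cutoff_kernel \<eta> k = tensor (\<lambda>b. ift (\<lambda>\<xi>. \<eta> (\<xi> - k \<bullet> b)) 0)"

lemma finite_Ints_bounded: "finite {j\<in>\<int>. \<bar>t - j\<bar> < (c :: real)}"
proof (rule finite_subset)
  show "{j\<in>\<int>. \<bar>t - j\<bar> < c} \<subseteq> of_int ` {\<lfloor>t - c\<rfloor>..\<lceil>t + c\<rceil>}"
  proof safe
    fix j :: real assume "j \<in> \<int>" and j: "\<bar>t - j\<bar> < c"
    then obtain i where i: "j = of_int i" by (auto elim: Ints_cases)
    have "i \<in> {\<lfloor>t - c\<rfloor>..\<lceil>t + c\<rceil>}" using j unfolding i by (simp, linarith)
    then show "j \<in> of_int ` {\<lfloor>t - c\<rfloor>..\<lceil>t + c\<rceil>}" unfolding i by (rule imageI)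
  qed
qed simp

lemma coordinates_image:
  "{e :: 'a::euclidean_space. \<forall>b\<in>Basis. e \<bullet> b \<in> S} = (\<lambda>g. \<Sum>b\<in>Basis. g b *\<^sub>R b) ` (Basis \<rightarrow>\<^sub>E S)"
proof safe
  fix e :: 'a assume "\<forall>b\<in>Basis. e \<bullet> b \<in> S"
  then have "restrict (\<lambda>b. e \<bullet> b) Basis \<in> Basis \<rightarrow>\<^sub>E S" by auto
  moreover have "e = (\<Sum>b\<in>Basis. restrict (\<lambda>b. e \<bullet> b) Basis b *\<^sub>R b)" by (simp add: euclidean_representation)
  ultimately show "e \<in> (\<lambda>g. \<Sum>b\<in>Basis. g b *\<^sub>R b) ` (Basis \<rightarrow>\<^sub>E S)" by (intro image_eqI)
qed auto

lemma int_lattice_eq: "int_lattice = (\<lambda>g. \<Sum>b\<in>Basis. g b *\<^sub>R b) ` (Basis \<rightarrow>\<^sub>E (\<int> :: real set) :: ('a::euclidean_space \<Rightarrow> real) set)"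
  unfolding int_lattice_def by (rule coordinates_image)

lemma infsum_int_lattice_prod:
  fixes f :: "'a::euclidean_space \<Rightarrow> real \<Rightarrow> real"
  assumes "\<And>b. b \<in> Basis \<Longrightarrow> (\<lambda>j. norm (f b j)) summable_on \<int>"
  shows "(\<Sum>\<^sub>\<infinity>m\<in>int_lattice. \<Prod>b\<in>Basis. f b (m \<bullet> b)) = (\<Prod>b\<in>Basis. \<Sum>\<^sub>\<infinity>j\<in>\<int>. f b j)"
proof -
  let ?h = "\<lambda>g. \<Sum>b\<in>(Basis :: 'a set). g b *\<^sub>R b"
  have comp: "?h g \<bullet> b = g b" if "b \<in> Basis" for g b
    using that by simp
  have inj: "inj_on ?h (Basis \<rightarrow>\<^sub>E \<int>)"
  proof (rule inj_onI)
    fix g g' :: "'a \<Rightarrow> real" assume g: "g \<in> Basis \<rightarrow>\<^sub>E \<int>" "g' \<in> Basis \<rightarrow>\<^sub>E \<int>" and eq: "?h g = ?h g'"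
    have "g b = g' b" if "b \<in> Basis" for b using comp[OF that, of g] comp[OF that, of g'] eq by simp
    with g show "g = g'" by (rule PiE_ext)
  qed
  have "(\<Sum>\<^sub>\<infinity>m\<in>int_lattice. \<Prod>b\<in>Basis. f b (m \<bullet> b)) = (\<Sum>\<^sub>\<infinity>g\<in>Basis \<rightarrow>\<^sub>E \<int>. \<Prod>b\<in>Basis. f b (g b))"
    unfolding int_lattice_eq infsum_reindex[OF inj] comp_def
    by (intro infsum_cong prod.cong refl) (simp add: comp)
  also have "\<dots> = (\<Prod>b\<in>Basis. \<Sum>\<^sub>\<infinity>j\<in>\<int>. f b j)"
    using assms by (intro infsum_prod_PiE_abs) auto
  finally show ?thesis .
qed

lemma infsum_Ints_shift:
  assumes "k \<in> (\<int> :: real set)"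
  shows "(\<Sum>\<^sub>\<infinity>j\<in>\<int>. f (j + k)) = (\<Sum>\<^sub>\<infinity>j\<in>\<int>. f j :: real)"
proof (rule infsum_reindex_bij_betw)
  show "bij_betw (\<lambda>j. j + k) \<int> \<int>"
    using assms by (intro bij_betwI[where g = "\<lambda>j. j - k"]) auto
qed

lemma cis_inner_eq_tensor: "cis (\<xi> \<bullet> z) = tensor (\<lambda>b t. cis ((z \<bullet> b) * t)) (\<xi> :: 'a::euclidean_space)"
proof -
  have c: "(\<Prod>b\<in>A. cis (f b)) = cis (\<Sum>b\<in>A. f b)" if "finite A" for f and A :: "'a set"
    using that by (induction A) (auto simp: cis_mult)
  have "\<xi> \<bullet> z = (\<Sum>b\<in>Basis. (z \<bullet> b) * (\<xi> \<bullet> b))" by (subst euclidean_inner) (simp add: mult.commute)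
  then show ?thesis by (simp add: tensor_def c)
qed

context
  fixes \<eta> :: "real \<Rightarrow> real"
  assumes \<eta>: "cutoff \<eta>"
begin

lemma cutoff_test_fun: "test_fun 2 \<eta>"
  using \<eta> smooth_fun_imp_Ck by (simp add: cutoff_def test_fun_def)

lemma cutoff_nonneg: "0 \<le> \<eta> t"
  using \<eta> by (simp add: cutoff_def)

lemma cutoff_le_one: "\<eta> t \<le> 1"
  using \<eta> by (simp add: cutoff_def)

lemma cutoff_eq_one: "\<bar>t\<bar> \<le> 1 \<Longrightarrow> \<eta> t = 1"
  using \<eta> by (simp add: cutoff_def)

lemma cutoff_eq_zero: "2 \<le> \<bar>t\<bar> \<Longrightarrow> \<eta> t = 0"
  using \<eta> by (simp add: cutoff_def)

lemma cutoff_shift_integral_pos: "0 < (\<integral>t. \<eta> (t - k) \<partial>lborel)"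
proof -
  have tf: "test_fun (2 + \<bar>k\<bar>) (\<lambda>t. \<eta> (t - k))" by (rule test_fun_shift[OF cutoff_test_fun])
  have "(\<integral>t. indicator {k..k + 1} t \<partial>lborel) \<le> (\<integral>t. \<eta> (t - k) \<partial>lborel)"
  proof (rule integral_mono)
    show "integrable lborel (indicator {k..k + 1} :: real \<Rightarrow> real)" by (simp add: emeasure_lborel_Icc_eq)
    show "integrable lborel (\<lambda>t. \<eta> (t - k))" by (rule test_fun_integrable[OF tf])
    fix t show "indicator {k..k + 1} t \<le> \<eta> (t - k)"
      using cutoff_eq_one[of "t - k"] cutoff_nonneg[of "t - k"] by (auto simp: indicator_def)
  qed
  then show ?thesis by simp
qed

lemma window_terms_finite: "finite {j\<in>\<int>. \<eta> (2 * (t - j)) \<noteq> 0}"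
proof (rule finite_subset[OF _ finite_Ints_bounded[of t 1]], safe)
  fix j assume nz: "\<eta> (2 * (t - j)) \<noteq> 0"
  show "\<bar>t - j\<bar> < 1"
  proof (rule ccontr)
    assume "\<not> \<bar>t - j\<bar> < 1"
    then have "2 \<le> \<bar>2 * (t - j)\<bar>" by (simp only: abs_mult) simp
    with nz show False using cutoff_eq_zero by blast
  qed
qed

lemma window_terms_summable: "(\<lambda>j. norm (\<eta> (2 * (t - j)))) summable_on \<int>"
  using finite_nonzero_values_imp_summable_on[OF window_terms_finite[of t]] cutoff_nonneg by simp

lemma line_window_eq:
  "line_window \<eta> t = inverse ((\<Sum>j\<in>{-2..2::int}. \<eta> (2 * t + (- 2 * of_int j))) + (1 + (- 1) * \<eta> t)) * \<eta> (2 * t + 0)"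
proof (cases "\<bar>t\<bar> < 1")
  case False
  then show ?thesis using cutoff_eq_zero[of "2 * t"] by (simp add: line_window_def)
next
  case True
  have "(\<Sum>\<^sub>\<infinity>j\<in>\<int>. \<eta> (2 * (t - j))) = (\<Sum>\<^sub>\<infinity>j\<in>of_int ` {-2..2::int}. \<eta> (2 * (t - j)))"
  proof (rule infsum_cong_neutral)
    fix j :: real assume "j \<in> \<int> - of_int ` {-2..2::int}"
    then obtain i where i: "j = of_int i" by (auto elim: Ints_cases)
    with \<open>j \<in> \<int> - of_int ` {-2..2::int}\<close> have "i \<notin> {-2..2}" by auto
    with i have "2 \<le> \<bar>2 * (t - j)\<bar>" using True by auto
    then show "\<eta> (2 * (t - j)) = 0" by (rule cutoff_eq_zero)
  qed auto
  also have "\<dots> = (\<Sum>j\<in>{-2..2::int}. \<eta> (2 * (t - of_int j)))"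
    by (simp add: sum.reindex inj_on_def)
  finally show ?thesis using True cutoff_eq_one[of t]
    by (simp add: line_window_def divide_inverse algebra_simps)
qed

lemma line_window_denominator_pos:
  "0 < (\<Sum>j\<in>{-2..2::int}. \<eta> (2 * t + (- 2 * of_int j))) + (1 + (- 1) * \<eta> t)"
proof (cases "\<bar>t\<bar> < 2")
  case False
  then have "\<eta> t = 0" by (intro cutoff_eq_zero) simp
  then show ?thesis using sum_nonneg[of "{-2..2::int}" "\<lambda>j. \<eta> (2 * t + (- 2 * of_int j))"] cutoff_nonneg by simp
next
  case True
  define i where "i = round t"
  have i: "\<bar>of_int i - t\<bar> \<le> 1 / 2" unfolding i_def by (rule of_int_round_abs_le)
  then have "- (5 / 2) < real_of_int i" "real_of_int i < 5 / 2" using True by linarith+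
  then have "- 2 \<le> i" "i \<le> 2" by linarith+
  then have "i \<in> {-2..2}" by simp
  then have "\<eta> (2 * t + (- 2 * of_int i)) \<le> (\<Sum>j\<in>{-2..2::int}. \<eta> (2 * t + (- 2 * of_int j)))"
    using cutoff_nonneg by (intro member_le_sum) auto
  moreover have "\<eta> (2 * t + (- 2 * of_int i)) = 1" using i by (intro cutoff_eq_one) linarith
  ultimately show ?thesis using cutoff_le_one[of t] by simp
qed

lemma line_window_test_fun: "test_fun 1 (line_window \<eta>)"
  unfolding test_fun_def
proof safe
  fix k
  have "Ck k (\<lambda>t. inverse ((\<Sum>j\<in>{-2..2::int}. \<eta> (2 * t + (- 2 * of_int j))) + (1 + (- 1) * \<eta> t)) * \<eta> (2 * t + 0))"
  proof (rule Ck_mult)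
    show "Ck k (\<lambda>t. \<eta> (2 * t + 0))" by (rule Ck_affine[OF test_fun_Ck[OF cutoff_test_fun]])
    show "Ck k (\<lambda>t. inverse ((\<Sum>j\<in>{-2..2::int}. \<eta> (2 * t + (- 2 * of_int j))) + (1 + (- 1) * \<eta> t)))"
    proof (rule Ck_inverse)
      show "Ck k (\<lambda>t. (\<Sum>j\<in>{-2..2::int}. \<eta> (2 * t + (- 2 * of_int j))) + (1 + (- 1) * \<eta> t))"
        by (intro Ck_add Ck_sum Ck_mult Ck_const Ck_affine test_fun_Ck[OF cutoff_test_fun])
    qed (use line_window_denominator_pos in \<open>simp add: less_imp_neq[THEN not_sym]\<close>)
  qed
  then show "Ck k (line_window \<eta>)" unfolding line_window_eq[abs_def] .
next
  fix t :: real assume "1 \<le> \<bar>t\<bar>"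
  then show "line_window \<eta> t = 0" using cutoff_eq_zero[of "2 * t"] by (simp add: line_window_def)
qed

lemma line_window_nonneg: "0 \<le> line_window \<eta> t"
  unfolding line_window_def using cutoff_nonneg by (intro divide_nonneg_nonneg infsum_nonneg) auto

lemma cutoff_mult_window: "\<eta> (\<xi> - k) * line_window \<eta> (\<xi> - k) = line_window \<eta> (\<xi> - k)"
proof (cases "\<bar>\<xi> - k\<bar> < 1")
  case True
  then show ?thesis using cutoff_eq_one[of "\<xi> - k"] by simp
next
  case False
  then have "line_window \<eta> (\<xi> - k) = 0" using line_window_test_fun unfolding test_fun_def by simp
  then show ?thesis by simp
qed

lemma cutoff_mult_window_zero:
  "3 \<le> \<bar>k - j\<bar> \<Longrightarrow> \<eta> (\<xi> - k) * line_window \<eta> (\<xi> - j) = 0"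
proof (cases "\<bar>\<xi> - j\<bar> < 1")
  case True
  assume "3 \<le> \<bar>k - j\<bar>"
  with True have "\<eta> (\<xi> - k) = 0" by (intro cutoff_eq_zero) auto
  then show ?thesis by simp
next
  case False
  then have "line_window \<eta> (\<xi> - j) = 0" using line_window_test_fun unfolding test_fun_def by simp
  then show ?thesis by simp
qed

lemma freq_window_eq_tensor:
  fixes k \<xi> :: "'a::euclidean_space"
  assumes "k \<in> int_lattice"
  shows "freq_window \<eta> k \<xi> = tensor (\<lambda>b t. line_window \<eta> (t - k \<bullet> b)) \<xi>"
proof -
  have sh: "(\<Sum>\<^sub>\<infinity>j\<in>\<int>. \<eta> (2 * (\<xi> \<bullet> b - j))) = (\<Sum>\<^sub>\<infinity>j\<in>\<int>. \<eta> (2 * (\<xi> \<bullet> b - k \<bullet> b - j)))" if "b \<in> Basis" for b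
  proof -
    have "(\<Sum>\<^sub>\<infinity>j\<in>\<int>. \<eta> (2 * (\<xi> \<bullet> b - (j + k \<bullet> b)))) = (\<Sum>\<^sub>\<infinity>j\<in>\<int>. \<eta> (2 * (\<xi> \<bullet> b - j)))"
      using assms that by (intro infsum_Ints_shift) (simp add: int_lattice_def)
    moreover have "\<xi> \<bullet> b - (j + k \<bullet> b) = \<xi> \<bullet> b - k \<bullet> b - j" for j by simp
    ultimately show ?thesis by (simp only:)
  qed
  have "(\<Sum>\<^sub>\<infinity>m\<in>int_lattice. \<Prod>b\<in>Basis. \<eta> (2 * (\<xi> \<bullet> b - m \<bullet> b))) = (\<Prod>b\<in>Basis. \<Sum>\<^sub>\<infinity>j\<in>\<int>. \<eta> (2 * (\<xi> \<bullet> b - j)))"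
    by (rule infsum_int_lattice_prod[of "\<lambda>b j. \<eta> (2 * (\<xi> \<bullet> b - j))", OF window_terms_summable])
  also have "\<dots> = (\<Prod>b\<in>Basis. \<Sum>\<^sub>\<infinity>j\<in>\<int>. \<eta> (2 * (\<xi> \<bullet> b - k \<bullet> b - j)))"
    by (rule prod.cong[OF refl sh])
  finally show ?thesis
    unfolding freq_window_def tensor_def line_window_def prod_dividef by (rule arg_cong)
qed

subsection \<open>Kernels\<close>

lemma window_shift_test_fun: "test_fun (1 + \<bar>a\<bar>) (\<lambda>\<xi>. line_window \<eta> (\<xi> - a))"
  by (rule test_fun_shift[OF line_window_test_fun])

lemma cutoff_shift_test_fun: "test_fun (2 + \<bar>a\<bar>) (\<lambda>\<xi>. \<eta> (\<xi> - a))"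
  by (rule test_fun_shift[OF cutoff_test_fun])

lemma kernel_line_convolution:
  "(\<integral>r. ift (\<lambda>\<xi>. \<eta> (\<xi> - k)) 0 (w - r) * ift (\<lambda>\<xi>. line_window \<eta> (\<xi> - j)) 0 (r - y) \<partial>lborel)
    = ift (\<lambda>\<xi>. \<eta> (\<xi> - k) * line_window \<eta> (\<xi> - j)) 0 (w - y)"
  by (rule ift_convolution[OF cutoff_shift_test_fun cutoff_nonneg cutoff_shift_integral_pos window_shift_test_fun])

lemma integrable_kernel_line_convolution:
  "integrable lborel (\<lambda>r. ift (\<lambda>\<xi>. \<eta> (\<xi> - k)) 0 (w - r) * ift (\<lambda>\<xi>. line_window \<eta> (\<xi> - j)) 0 (r - y))"
proof -
  note [measurable] = ift_measurable[OF cutoff_shift_test_fun] ift_measurable[OF window_shift_test_fun]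
  obtain C where C: "\<And>r. (1 + norm r) ^ 0 * norm (ift (\<lambda>\<xi>. line_window \<eta> (\<xi> - j)) 0 r) \<le> C"
    using rapidly_decreasing_ift[OF window_shift_test_fun[of j], of 0] unfolding rapidly_decreasing_def by blast
  show ?thesis
  proof (rule Bochner_Integration.integrable_bound)
    show "integrable lborel (\<lambda>r. C *\<^sub>R ift (\<lambda>\<xi>. \<eta> (\<xi> - k)) 0 (w - r))"
      using integrable_ift[OF cutoff_shift_test_fun]
      by (intro integrable_scaleR_right) (subst lborel_integrable_reflect, simp_all)
    show "AE r in lborel. norm (ift (\<lambda>\<xi>. \<eta> (\<xi> - k)) 0 (w - r) * ift (\<lambda>\<xi>. line_window \<eta> (\<xi> - j)) 0 (r - y))
      \<le> norm (C *\<^sub>R ift (\<lambda>\<xi>. \<eta> (\<xi> - k)) 0 (w - r))"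
    proof (rule AE_I2)
      fix r
      have "norm (ift (\<lambda>\<xi>. line_window \<eta> (\<xi> - j)) 0 (r - y)) \<le> \<bar>C\<bar>" using C[of "r - y"] by simp
      then show "norm (ift (\<lambda>\<xi>. \<eta> (\<xi> - k)) 0 (w - r) * ift (\<lambda>\<xi>. line_window \<eta> (\<xi> - j)) 0 (r - y))
      \<le> norm (C *\<^sub>R ift (\<lambda>\<xi>. \<eta> (\<xi> - k)) 0 (w - r))"
        by (simp add: norm_mult mult.commute[of "\<bar>C\<bar>"] mult_left_mono)
    qed
  qed simp
qed

lemma kernel_convolution:
  fixes k :: "'a::euclidean_space"
  shows "(\<integral>x. cutoff_kernel \<eta> k (w - x) * window_kernel \<eta> j (x - y) \<partial>lborel)
    = tensor (\<lambda>b. ift (\<lambda>\<xi>. \<eta> (\<xi> - k \<bullet> b) * line_window \<eta> (\<xi> - j \<bullet> b)) 0) (w - y)"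
proof -
  let ?h = "\<lambda>b r. ift (\<lambda>\<xi>. \<eta> (\<xi> - k \<bullet> b)) 0 (w \<bullet> b - r) * ift (\<lambda>\<xi>. line_window \<eta> (\<xi> - j \<bullet> b)) 0 (r - y \<bullet> b)"
  have "(\<lambda>x. cutoff_kernel \<eta> k (w - x) * window_kernel \<eta> j (x - y)) = tensor ?h"
    by (simp add: fun_eq_iff cutoff_kernel_def window_kernel_def tensor_def inner_diff_left prod.distrib)
  then show ?thesis
    by (simp only: integral_tensor[OF integrable_kernel_line_convolution] kernel_line_convolution)
      (simp add: tensor_def inner_diff_left)
qed

lemma kernel_reproduce:
  "(\<integral>x. cutoff_kernel \<eta> k (w - x) * window_kernel \<eta> k (x - y) \<partial>lborel) = window_kernel \<eta> k (w - y)"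
  using kernel_convolution[of k w k y] unfolding cutoff_mult_window window_kernel_def[symmetric] .

lemma kernel_orthogonal:
  assumes "b \<in> Basis" "3 \<le> \<bar>k \<bullet> b - j \<bullet> b\<bar>"
  shows "(\<integral>x. cutoff_kernel \<eta> k (w - x) * window_kernel \<eta> j (x - y) \<partial>lborel) = 0"
proof -
  have "ift (\<lambda>\<xi>. \<eta> (\<xi> - k \<bullet> b) * line_window \<eta> (\<xi> - j \<bullet> b)) 0 ((w - y) \<bullet> b) = 0"
    using assms(2) by (simp add: cutoff_mult_window_zero ift_def osc_def)
  then show ?thesis
    unfolding kernel_convolution tensor_def using assms(1) by (intro prod_zero) auto
qed

lemma cutoff_kernel_modulate: "cutoff_kernel \<eta> k x = cis (k \<bullet> x) * cutoff_kernel \<eta> 0 (x :: 'a::euclidean_space)"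
  by (simp add: cutoff_kernel_def cis_inner_eq_tensor[of k x] ift_modulate[of \<eta>] tensor_def prod.distrib)

lemma window_kernel_modulate: "window_kernel \<eta> k x = cis (k \<bullet> x) * window_kernel \<eta> 0 (x :: 'a::euclidean_space)"
  by (simp add: window_kernel_def cis_inner_eq_tensor[of k x] ift_modulate[of "line_window \<eta>"] tensor_def prod.distrib)

end

section \<open>Tempered distributions applied to parameter integrals\<close>

lemma rapidly_decreasing_add:
  assumes "rapidly_decreasing f" "rapidly_decreasing g"
  shows "rapidly_decreasing (\<lambda>x. f x + g x)"
  unfolding rapidly_decreasing_def
proof
  fix N
  obtain C where C: "\<And>x. (1 + norm x) ^ N * norm (f x) \<le> C" using assms(1) unfolding rapidly_decreasing_def by blast
  obtain D where D: "\<And>x. (1 + norm x) ^ N * norm (g x) \<le> D" using assms(2) unfolding rapidly_decreasing_def by blast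
  have "(1 + norm x) ^ N * norm (f x + g x) \<le> C + D" for x
  proof -
    have "(1 + norm x) ^ N * norm (f x + g x) \<le> (1 + norm x) ^ N * (norm (f x) + norm (g x))"
      by (intro mult_left_mono norm_triangle_ineq) simp
    also have "\<dots> \<le> C + D" using C[of x] D[of x] by (simp add: distrib_left)
    finally show ?thesis .
  qed
  then show "\<exists>C. \<forall>x. (1 + norm x) ^ N * norm (f x + g x) \<le> C" by blast
qed

lemma schwartz_tower_add:
  assumes "schwartz_tower A" "schwartz_tower B"
  shows "schwartz_tower (\<lambda>bs y. A bs y + B bs y)"
proof -
  have "((\<lambda>y. A bs y + B bs y) has_derivative (\<lambda>v. \<Sum>b\<in>Basis. (v \<bullet> b) *\<^sub>R (A (b # bs) y + B (b # bs) y))) (at y)"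
    if "set bs \<subseteq> Basis" for bs y
    using has_derivative_add[OF deriv_towerD[of A bs y] deriv_towerD[of B bs y]] assms that
    by (simp add: schwartz_tower_def scaleR_add_right sum.distrib)
  moreover have "rapidly_decreasing (\<lambda>y. A bs y + B bs y)" if "set bs \<subseteq> Basis" for bs
    using assms that by (intro rapidly_decreasing_add) (simp_all add: schwartz_tower_def)
  ultimately show ?thesis
    by (simp add: schwartz_tower_def deriv_tower_def)
qed

lemma schwartz_tower_cmult:
  assumes "schwartz_tower A"
  shows "schwartz_tower (\<lambda>bs y. c * A bs y)"
proof -
  have "((\<lambda>y. c * A bs y) has_derivative (\<lambda>v. \<Sum>b\<in>Basis. (v \<bullet> b) *\<^sub>R (c * A (b # bs) y))) (at y)"
    if "set bs \<subseteq> Basis" for bs y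
    using has_derivative_mult_right[OF deriv_towerD[of A bs y], of c] assms that
    by (simp add: schwartz_tower_def sum_distrib_left)
  moreover have "rapidly_decreasing (\<lambda>y. c * A bs y)" if "set bs \<subseteq> Basis" for bs
    using assms that by (intro rapidly_decreasing_cmult) (simp_all add: schwartz_tower_def)
  ultimately show ?thesis
    by (simp add: schwartz_tower_def deriv_tower_def)
qed

lemma schwartz_tower_zero: "schwartz_tower (\<lambda>bs y. 0)"
  by (auto simp: schwartz_tower_def deriv_tower_def rapidly_decreasing_def)

lemma schwartz_tower_sum:
  assumes "finite I" "\<And>i. i \<in> I \<Longrightarrow> schwartz_tower (A i)"
  shows "schwartz_tower (\<lambda>bs y. \<Sum>i\<in>I. c i * A i bs y)"
  using assms by (induction I) (simp_all add: schwartz_tower_zero schwartz_tower_add schwartz_tower_cmult)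

lemma schwartz_cmult: "\<phi> \<in> schwartz \<Longrightarrow> (\<lambda>x. c * \<phi> x) \<in> schwartz"
  using schwartz_tower_in_schwartz[OF schwartz_tower_cmult[OF schwartz_tower_of_schwartz]]
  by simp

lemma schwartz_tower_reflect:
  fixes E :: "'a::euclidean_space list \<Rightarrow> 'a \<Rightarrow> complex"
  assumes E: "schwartz_tower E"
  shows "schwartz_tower (\<lambda>bs y. (- 1) ^ length bs * E bs (x - y))"
  unfolding schwartz_tower_def deriv_tower_def
proof safe
  fix bs :: "'a list" and y :: 'a assume bs: "set bs \<subseteq> Basis"
  have "deriv_tower E" using E by (simp add: schwartz_tower_def)
  have "((\<lambda>y. x - y) has_derivative (\<lambda>v. - v)) (at y)"
    by (auto intro!: derivative_eq_intros)
  from has_derivative_compose[OF this deriv_towerD[OF \<open>deriv_tower E\<close> bs]]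
  have "((\<lambda>y. E bs (x - y)) has_derivative (\<lambda>v. \<Sum>b\<in>Basis. (- v \<bullet> b) *\<^sub>R E (b # bs) (x - y))) (at y)" .
  from has_derivative_mult_right[OF this, of "(- 1) ^ length bs"]
  show "((\<lambda>y. (- 1) ^ length bs * E bs (x - y)) has_derivative
      (\<lambda>v. \<Sum>b\<in>Basis. (v \<bullet> b) *\<^sub>R ((- 1) ^ length (b # bs) * E (b # bs) (x - y)))) (at y)"
    by (simp add: sum_distrib_left)
next
  fix bs :: "'a list" assume bs: "set bs \<subseteq> Basis"
  show "rapidly_decreasing (\<lambda>y. (- 1) ^ length bs * E bs (x - y))"
    unfolding rapidly_decreasing_def
  proof
    fix N
    have "rapidly_decreasing (E bs)" using E bs by (simp add: schwartz_tower_def)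
    then obtain C where C: "\<And>y. (1 + norm y) ^ N * norm (E bs y) \<le> C" unfolding rapidly_decreasing_def by blast
    have "(1 + norm y) ^ N * norm ((- 1) ^ length bs * E bs (x - y)) \<le> (1 + norm x) ^ N * C" for y
    proof -
      have "1 + norm y \<le> 1 + norm x + norm (x - y)" using norm_triangle_sub[of y x] by (simp add: norm_minus_commute)
      also have "\<dots> \<le> (1 + norm x) * (1 + norm (x - y))" by (simp add: algebra_simps)
      finally have "(1 + norm y) ^ N \<le> (1 + norm x) ^ N * (1 + norm (x - y)) ^ N"
        unfolding power_mult_distrib[symmetric] by (intro power_mono) auto
      then have "(1 + norm y) ^ N * norm (E bs (x - y)) \<le> (1 + norm x) ^ N * ((1 + norm (x - y)) ^ N * norm (E bs (x - y)))"
        unfolding mult.assoc[symmetric] by (intro mult_right_mono) auto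
      also have "\<dots> \<le> (1 + norm x) ^ N * C" by (intro mult_left_mono C) simp
      finally show ?thesis by (simp add: norm_mult norm_power)
    qed
    then show "\<exists>C. \<forall>y. (1 + norm y) ^ N * norm ((- 1) ^ length bs * E bs (x - y)) \<le> C" by blast
  qed
qed

lemma weight_shift_le: "(1 + norm (y :: 'a::real_normed_vector)) ^ N \<le> (1 + norm x) ^ N * (1 + norm (x - y)) ^ N"
proof -
  have "1 + norm y \<le> 1 + norm x + norm (x - y)" using norm_triangle_sub[of y x] by (simp add: norm_minus_commute)
  also have "\<dots> \<le> (1 + norm x) * (1 + norm (x - y))" by (simp add: algebra_simps)
  finally show ?thesis
    unfolding power_mult_distrib[symmetric] by (intro power_mono) auto
qed

lemma rapidly_decreasing_reflect:
  assumes "rapidly_decreasing (f :: 'a::real_normed_vector \<Rightarrow> 'b::real_normed_vector)"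
  shows "rapidly_decreasing (\<lambda>x. f (w - x))"
  unfolding rapidly_decreasing_def
proof
  fix N
  obtain C where C: "\<And>z. (1 + norm z) ^ N * norm (f z) \<le> C"
    using assms unfolding rapidly_decreasing_def by blast
  have "(1 + norm x) ^ N * norm (f (w - x)) \<le> (1 + norm w) ^ N * C" for x
  proof -
    have "(1 + norm x) ^ N * norm (f (w - x)) \<le> (1 + norm w) ^ N * ((1 + norm (w - x)) ^ N * norm (f (w - x)))"
      unfolding mult.assoc[symmetric] by (intro mult_right_mono weight_shift_le) simp
    also have "\<dots> \<le> (1 + norm w) ^ N * C" by (intro mult_left_mono C) simp
    finally show ?thesis .
  qed
  then show "\<exists>C. \<forall>x. (1 + norm x) ^ N * norm (f (w - x)) \<le> C" by blast
qed

lemma schwartz_tower_uniform: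
  fixes E :: "'a::euclidean_space list \<Rightarrow> 'a \<Rightarrow> complex"
  assumes E: "schwartz_tower E"
  obtains C where "0 \<le> C" "\<And>bs x. set bs \<subseteq> Basis \<Longrightarrow> length bs \<le> N \<Longrightarrow> (1 + norm x) ^ N * norm (E bs x) \<le> C"
  using that[OF schwartz_seminorm_nonneg[OF schwartz_tower_in_schwartz[OF E]] schwartz_seminorm_ge[OF E]] by blast

lemma schwartz_tower_reflect_bound:
  fixes E :: "'a::euclidean_space list \<Rightarrow> 'a \<Rightarrow> complex"
  assumes E: "schwartz_tower E"
  obtains C where "0 \<le> C" "\<And>bs x y. set bs \<subseteq> Basis \<Longrightarrow> length bs \<le> N \<Longrightarrow>
      (1 + norm y) ^ N * norm (E bs (x - y)) \<le> C * (1 + norm x) ^ N"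
    "\<And>bs x x' y. set bs \<subseteq> Basis \<Longrightarrow> length bs \<le> N \<Longrightarrow>
      (1 + norm y) ^ N * norm (E bs (x - y) - E bs (x' - y)) \<le> C * ((1 + norm x + norm x') ^ N * norm (x - x'))"
proof -
  obtain C where C: "0 \<le> C" "\<And>bs x. set bs \<subseteq> Basis \<Longrightarrow> length bs \<le> Suc N \<Longrightarrow> (1 + norm x) ^ Suc N * norm (E bs x) \<le> C"
    using schwartz_tower_uniform[OF E, of "Suc N"] by metis
  have C': "(1 + norm x) ^ N * norm (E bs x) \<le> C" if "set bs \<subseteq> Basis" "length bs \<le> Suc N" for bs x
  proof -
    have "(1 + norm x) ^ N * norm (E bs x) \<le> (1 + norm x) ^ Suc N * norm (E bs x)"
      by (intro mult_right_mono power_increasing) auto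
    with C(2)[OF that, of x] show ?thesis by linarith
  qed
  define K where "K = real DIM('a) * C"
  have K: "C \<le> K" using C(1) DIM_positive[where 'a='a] unfolding K_def
    by (metis One_nat_def Suc_leI le_num_One_iff mult_le_cancel_right1 not_less of_nat_1 of_nat_le_iff)
  show thesis
  proof (rule that[of K])
    show "0 \<le> K" using C(1) by (simp add: K_def)
    fix bs :: "'a list" and x x' y :: 'a assume bs: "set bs \<subseteq> Basis" "length bs \<le> N"
    have "(1 + norm y) ^ N * norm (E bs (x - y)) \<le> (1 + norm x) ^ N * ((1 + norm (x - y)) ^ N * norm (E bs (x - y)))"
      unfolding mult.assoc[symmetric] by (intro mult_right_mono weight_shift_le) simp
    also have "\<dots> \<le> (1 + norm x) ^ N * K"
      using C'[of bs "x - y"] bs K by (intro mult_left_mono) auto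
    finally show "(1 + norm y) ^ N * norm (E bs (x - y)) \<le> K * (1 + norm x) ^ N" by (simp add: mult.commute)
    define B where "B = C * (1 + norm x + norm x') ^ N / (1 + norm y) ^ N"
    have py: "0 < (1 + norm y) ^ N" by (intro zero_less_power) (simp add: add_pos_nonneg)
    have "norm (E bs (x - y) - E bs (x' - y)) \<le> DIM('a) * B * norm ((x - y) - (x' - y))"
    proof (rule deriv_tower_increment[of E bs "closed_segment (x - y) (x' - y)"])
      show "deriv_tower E" using E by (simp add: schwartz_tower_def)
      fix w b assume w: "w \<in> closed_segment (x - y) (x' - y)" and b: "b \<in> (Basis :: 'a set)"
      obtain t where t: "0 \<le> t" "t \<le> 1" "w = (1 - t) *\<^sub>R (x - y) + t *\<^sub>R (x' - y)"
        using w unfolding in_segment by blast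
      define z where "z = (1 - t) *\<^sub>R x + t *\<^sub>R x'"
      have wz: "w = z - y" unfolding t(3) z_def by (simp add: algebra_simps)
      have "norm z \<le> (1 - t) * norm x + t * norm x'"
        unfolding z_def using t by (intro order_trans[OF norm_triangle_ineq]) simp
      also have "\<dots> \<le> norm x + norm x'"
        using t mult_right_mono[of "1 - t" 1 "norm x"] mult_right_mono[of t 1 "norm x'"] by simp
      finally have z: "norm z \<le> norm x + norm x'" .
      have "(1 + norm y) ^ N * norm (E (b # bs) w) \<le> (1 + norm z) ^ N * ((1 + norm w) ^ N * norm (E (b # bs) w))"
        unfolding mult.assoc[symmetric] wz by (intro mult_right_mono weight_shift_le) simp
      also have "\<dots> \<le> (1 + norm x + norm x') ^ N * C"
        using C'[of "b # bs" w] bs b z by (intro mult_mono power_mono) auto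
      finally show "norm (E (b # bs) w) \<le> B" using py by (simp add: B_def field_simps)
    qed (use bs in auto)
    then have "(1 + norm y) ^ N * norm (E bs (x - y) - E bs (x' - y)) \<le> (1 + norm y) ^ N * (DIM('a) * B * norm (x - x'))"
      using py by (intro mult_left_mono) auto
    also have "\<dots> = K * ((1 + norm x + norm x') ^ N * norm (x - x'))"
      using less_imp_neq[OF py] by (simp add: B_def K_def del: power_eq_0_iff)
    finally show "(1 + norm y) ^ N * norm (E bs (x - y) - E bs (x' - y)) \<le> K * ((1 + norm x + norm x') ^ N * norm (x - x'))" .
  qed
qed

lemma temperedD:
  assumes "u \<in> tempered_distributions"
  shows tempered_add: "\<phi> \<in> schwartz \<Longrightarrow> \<psi> \<in> schwartz \<Longrightarrow> u (\<lambda>x. \<phi> x + \<psi> x) = u \<phi> + u \<psi>"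
    and tempered_cmult: "\<phi> \<in> schwartz \<Longrightarrow> u (\<lambda>x. c * \<phi> x) = c * u \<phi>"
  using assms by (auto simp: tempered_distributions_def)

lemma tempered_bound:
  assumes "u \<in> tempered_distributions"
  obtains N C where "0 \<le> C" "\<And>\<phi>. \<phi> \<in> schwartz \<Longrightarrow> norm (u \<phi>) \<le> C * schwartz_seminorm N \<phi>"
proof -
  obtain N C where C: "\<forall>\<phi>\<in>schwartz. norm (u \<phi>) \<le> C * schwartz_seminorm N \<phi>"
    using assms unfolding tempered_distributions_def by blast
  have "norm (u \<phi>) \<le> \<bar>C\<bar> * schwartz_seminorm N \<phi>" if "\<phi> \<in> schwartz" for \<phi>
    using C[rule_format, OF that] mult_right_mono[OF abs_ge_self[of C] schwartz_seminorm_nonneg[OF that, of N]] by linarith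
  then show thesis by (intro that[of "\<bar>C\<bar>" N]) simp_all
qed

lemma tempered_diff:
  assumes "u \<in> tempered_distributions" "\<phi> \<in> schwartz" "\<psi> \<in> schwartz"
  shows "u (\<lambda>x. \<phi> x - \<psi> x) = u \<phi> - u \<psi>"
  using tempered_add[OF assms(1,2) schwartz_cmult[OF assms(3), of "- 1"]] tempered_cmult[OF assms(1,3), of "- 1"] by simp

lemma tempered_sum:
  assumes u: "u \<in> tempered_distributions" and "finite I" "\<And>i. i \<in> I \<Longrightarrow> schwartz_tower (A i)"
  shows "u (\<lambda>y. \<Sum>i\<in>I. c i * A i [] y) = (\<Sum>i\<in>I. c i * u (A i []))"
  using assms(2,3)
proof (induction I)
  case empty
  have "(\<lambda>_. 0) \<in> schwartz" using schwartz_tower_in_schwartz[OF schwartz_tower_zero] .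
  from tempered_cmult[OF u this, of 0] show ?case by simp
next
  case (insert i I)
  have "(\<lambda>y. c i * A i [] y) \<in> schwartz" "(\<lambda>y. \<Sum>i\<in>I. c i * A i [] y) \<in> schwartz"
    using schwartz_tower_in_schwartz[OF schwartz_tower_cmult[of "A i" "c i"]]
      schwartz_tower_in_schwartz[OF schwartz_tower_sum[of I A c]] insert by auto
  then have "u (\<lambda>y. c i * A i [] y + (\<Sum>i\<in>I. c i * A i [] y)) = u (\<lambda>y. c i * A i [] y) + u (\<lambda>y. \<Sum>i\<in>I. c i * A i [] y)"
    by (rule tempered_add[OF u])
  moreover have "A i [] \<in> schwartz" using insert by (simp add: schwartz_tower_in_schwartz)
  ultimately show ?case using insert tempered_cmult[OF u] by simp
qed

lemma integral_simple_function_factor: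
  fixes \<phi> :: "'a::euclidean_space \<Rightarrow> complex" and G :: "'b \<Rightarrow> complex"
  assumes s: "simple_function lborel s" and \<phi>: "integrable lborel \<phi>"
  shows "(\<integral>x. \<phi> x * G (s x) \<partial>lborel) = (\<Sum>v\<in>range s. (\<integral>x. indicator (s -` {v}) x *\<^sub>R \<phi> x \<partial>lborel) * G v)"
    and "integrable lborel (\<lambda>x. \<phi> x * G (s x))"
proof -
  have fin: "finite (range s)" using s by (simp add: simple_function_def)
  have meas: "s -` {v} \<in> sets lborel" if "v \<in> range s" for v
    using s that by (auto simp: simple_function_def)
  have eq: "\<phi> x * G (s x) = (\<Sum>v\<in>range s. (indicator (s -` {v}) x *\<^sub>R \<phi> x) * G v)" for x
  proof -
    have "(\<Sum>v\<in>range s. (indicator (s -` {v}) x *\<^sub>R \<phi> x) * G v) = (\<Sum>v\<in>range s. if v = s x then \<phi> x * G v else 0)"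
      by (intro sum.cong) (auto simp: indicator_def)
    then show ?thesis using fin by simp
  qed
  have int: "integrable lborel (\<lambda>x. (indicator (s -` {v}) x *\<^sub>R \<phi> x) * G v)" if "v \<in> range s" for v
    using integrable_mult_indicator[OF meas[OF that] \<phi>] by (rule integrable_mult_left)
  show "(\<integral>x. \<phi> x * G (s x) \<partial>lborel) = (\<Sum>v\<in>range s. (\<integral>x. indicator (s -` {v}) x *\<^sub>R \<phi> x \<partial>lborel) * G v)"
    unfolding eq integral_mult_left_zero[symmetric] by (rule Bochner_Integration.integral_sum) (rule int)
  show "integrable lborel (\<lambda>x. \<phi> x * G (s x))"
    unfolding eq using int by (rule Bochner_Integration.integrable_sum)
qed

text \<open>A tempered distribution commutes with the integral defining a convolution: replacing the
  integration variable by simple functions turns that integral into a finite linear combination of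
  translates, and the error is controlled in every Schwartz seminorm.\<close>

theorem tempered_convolution:
  fixes u :: "'a::euclidean_space dist" and E :: "'a list \<Rightarrow> 'a \<Rightarrow> complex"
  assumes u: "u \<in> tempered_distributions" and E: "schwartz_tower E"
  defines "h \<equiv> \<lambda>x. u (\<lambda>y. E [] (x - y))"
  shows tempered_convolution_continuous: "continuous_on UNIV h"
    and tempered_convolution_growth: "\<exists>N C. \<forall>x. norm (h x) \<le> C * (1 + norm x) ^ N"
    and tempered_convolution_commute:
      "\<And>\<phi>. \<phi> \<in> borel_measurable borel \<Longrightarrow> rapidly_decreasing \<phi> \<Longrightarrow>
        integrable lborel (\<lambda>x. h x * \<phi> x) \<and> (\<lambda>y. \<integral>x. \<phi> x * E [] (x - y) \<partial>lborel) \<in> schwartz \<and>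
        u (\<lambda>y. \<integral>x. \<phi> x * E [] (x - y) \<partial>lborel) = (\<integral>x. h x * \<phi> x \<partial>lborel)"
proof -
  obtain N Cu where Cu: "0 \<le> Cu" "\<And>\<phi>. \<phi> \<in> schwartz \<Longrightarrow> norm (u \<phi>) \<le> Cu * schwartz_seminorm N \<phi>"
    using tempered_bound[OF u] by metis
  let ?R = "\<lambda>x bs y. (- 1) ^ length bs * E bs (x - y)"
  have R: "schwartz_tower (?R x)" for x by (rule schwartz_tower_reflect[OF E])
  have Rs: "(\<lambda>y. E [] (x - y)) \<in> schwartz" for x using schwartz_tower_in_schwartz[OF R[of x]] by simp
  obtain C where C: "0 \<le> C"
    "\<And>bs x y. set bs \<subseteq> Basis \<Longrightarrow> length bs \<le> N \<Longrightarrow> (1 + norm y) ^ N * norm (E bs (x - y)) \<le> C * (1 + norm x) ^ N"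
    "\<And>bs x x' y. set bs \<subseteq> Basis \<Longrightarrow> length bs \<le> N \<Longrightarrow>
      (1 + norm y) ^ N * norm (E bs (x - y) - E bs (x' - y)) \<le> C * ((1 + norm x + norm x') ^ N * norm (x - x'))"
    using schwartz_tower_reflect_bound[OF E, of N] by metis
  have growth: "norm (h x) \<le> (Cu * C) * (1 + norm x) ^ N" for x
  proof -
    have "schwartz_seminorm N (?R x []) \<le> C * (1 + norm x) ^ N"
      using R[of x] C(2) by (intro schwartz_seminorm_le) (auto simp: schwartz_tower_def norm_mult norm_power)
    then have "Cu * schwartz_seminorm N (\<lambda>y. E [] (x - y)) \<le> Cu * (C * (1 + norm x) ^ N)"
      using Cu(1) by (intro mult_left_mono) auto
    with Cu(2)[OF Rs[of x]] show ?thesis by (simp add: h_def mult.assoc)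
  qed
  then show "\<exists>N C. \<forall>x. norm (h x) \<le> C * (1 + norm x) ^ N" by blast
  have lip: "norm (h x - h x') \<le> Cu * (C * ((1 + norm x + norm x') ^ N * norm (x - x')))" for x x'
  proof -
    have t: "schwartz_tower (\<lambda>bs y. ?R x bs y + (- 1) * ?R x' bs y)"
      by (intro schwartz_tower_add schwartz_tower_cmult R)
    have "schwartz_seminorm N (\<lambda>y. E [] (x - y) - E [] (x' - y)) \<le> C * ((1 + norm x + norm x') ^ N * norm (x - x'))"
    proof (rule schwartz_seminorm_le[of "\<lambda>bs y. ?R x bs y + (- 1) * ?R x' bs y", simplified])
      show "deriv_tower (\<lambda>bs y. ?R x bs y - ?R x' bs y)" using t by (simp add: schwartz_tower_def)
      fix bs :: "'a list" and y :: 'a assume "set bs \<subseteq> Basis" "length bs \<le> N"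
      from C(3)[OF this, of y x x'] show "(1 + norm y) ^ N * norm (?R x bs y - ?R x' bs y) \<le> C * ((1 + norm x + norm x') ^ N * norm (x - x'))"
        by (simp add: norm_mult norm_power flip: right_diff_distrib)
    qed
    then have "Cu * schwartz_seminorm N (\<lambda>y. E [] (x - y) - E [] (x' - y)) \<le> Cu * (C * ((1 + norm x + norm x') ^ N * norm (x - x')))"
      using Cu(1) by (rule mult_left_mono)
    moreover have "(\<lambda>y. E [] (x - y) - E [] (x' - y)) \<in> schwartz"
      using schwartz_tower_in_schwartz[OF t] by simp
    from Cu(2)[OF this] have "norm (h x - h x') \<le> Cu * schwartz_seminorm N (\<lambda>y. E [] (x - y) - E [] (x' - y))"
      by (simp add: h_def tempered_diff[OF u Rs Rs])
    ultimately show ?thesis by linarith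
  qed
  show cont: "continuous_on UNIV h"
  proof (intro continuous_at_imp_continuous_on ballI continuous_at_sequentiallyI)
    fix x :: 'a and v assume v: "v \<longlonglongrightarrow> x"
    have "(\<lambda>n. Cu * (C * ((1 + norm (v n) + norm x) ^ N * norm (v n - x)))) \<longlonglongrightarrow> Cu * (C * ((1 + norm x + norm x) ^ N * norm (x - x)))"
      by (intro tendsto_intros v)
    then have "(\<lambda>n. h (v n) - h x) \<longlonglongrightarrow> 0"
      by (intro Lim_null_comparison[OF always_eventually[OF allI[OF lip]]]) simp
    then show "(\<lambda>n. h (v n)) \<longlonglongrightarrow> h x" by (simp add: LIM_zero_iff)
  qed
  fix \<phi> :: "'a \<Rightarrow> complex" assume \<phi>m [measurable]: "\<phi> \<in> borel_measurable borel" and \<phi>: "rapidly_decreasing \<phi>"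
  have i\<phi>: "integrable lborel \<phi>" and iw: "\<And>N. integrable lborel (\<lambda>x. (1 + norm x) ^ N * norm (\<phi> x))"
    using integrable_rapidly_decreasing[OF \<phi>m \<phi>] by simp_all
  have [measurable]: "h \<in> borel_measurable borel" by (rule borel_measurable_continuous_onI[OF cont])
  have Em: "E bs \<in> borel_measurable borel" if "set bs \<subseteq> Basis" for bs
    using E that by (intro borel_measurable_continuous_onI deriv_tower_continuous) (auto simp: schwartz_tower_def)
  have ih: "integrable lborel (\<lambda>x. h x * \<phi> x)"
  proof (rule Bochner_Integration.integrable_bound[OF integrable_mult_right[OF iw[of N], of "Cu * C"]])
    show "AE x in lborel. norm (h x * \<phi> x) \<le> norm (Cu * C * ((1 + norm x) ^ N * norm (\<phi> x)))"
    proof (rule AE_I2)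
      fix x
      have "norm (h x * \<phi> x) \<le> (Cu * C * (1 + norm x) ^ N) * norm (\<phi> x)"
        unfolding norm_mult by (intro mult_right_mono growth) simp
      then show "norm (h x * \<phi> x) \<le> norm (Cu * C * ((1 + norm x) ^ N * norm (\<phi> x)))"
        by (simp add: mult.assoc)
    qed
  qed simp
  define V where "V bs y = (\<integral>x. \<phi> x * ?R x bs y \<partial>lborel)" for bs y
  have bound: "\<exists>C. \<forall>x y. (1 + norm y) ^ M * norm (E bs (x - y)) \<le> C * (1 + norm x) ^ M" if bs: "set bs \<subseteq> Basis" for bs M
  proof -
    obtain C where C: "\<And>z. (1 + norm z) ^ M * norm (E bs z) \<le> C"
      using E bs unfolding schwartz_tower_def rapidly_decreasing_def by blast
    have "(1 + norm y) ^ M * norm (E bs (x - y)) \<le> C * (1 + norm x) ^ M" for x y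
    proof -
      have "(1 + norm y) ^ M * norm (E bs (x - y)) \<le> (1 + norm x) ^ M * ((1 + norm (x - y)) ^ M * norm (E bs (x - y)))"
        unfolding mult.assoc[symmetric] by (intro mult_right_mono weight_shift_le) simp
      also have "\<dots> \<le> (1 + norm x) ^ M * C" by (intro mult_left_mono C) simp
      finally show ?thesis by (simp add: mult.commute)
    qed
    then show ?thesis by blast
  qed
  have Rmeas: "(\<lambda>x. \<phi> x * ?R x bs y) \<in> borel_measurable borel" if "set bs \<subseteq> Basis" for bs y
  proof -
    have [measurable]: "E bs \<in> borel_measurable borel" using Em[OF that] .
    show ?thesis by measurable
  qed
  have Rint: "integrable lborel (\<lambda>x. \<phi> x * ?R x bs y)" if bs: "set bs \<subseteq> Basis" for bs y
  proof -
    obtain C0 where C0: "\<And>x y. (1 + norm y) ^ 0 * norm (E bs (x - y)) \<le> C0 * (1 + norm x) ^ 0"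
      using bound[OF bs, of 0] by blast
    show ?thesis
    proof (rule Bochner_Integration.integrable_bound[OF integrable_mult_right[OF i\<phi>, of "of_real C0"]])
      show "(\<lambda>x. \<phi> x * ?R x bs y) \<in> borel_measurable lborel" using Rmeas[OF bs] by simp
      show "AE x in lborel. norm (\<phi> x * ?R x bs y) \<le> norm (complex_of_real C0 * \<phi> x)"
      proof (rule AE_I2)
        fix x
        have "norm (E bs (x - y)) \<le> \<bar>C0\<bar>" using C0[of y x] by simp
        then show "norm (\<phi> x * ?R x bs y) \<le> norm (complex_of_real C0 * \<phi> x)"
          by (simp add: norm_mult norm_power mult.commute[of "\<bar>C0\<bar>"] mult_left_mono)
      qed
    qed
  qed
  have V: "schwartz_tower V"
    unfolding schwartz_tower_def
  proof safe
    show "deriv_tower V" unfolding V_def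
    proof (rule deriv_tower_integral)
      fix x show "deriv_tower (\<lambda>bs y. \<phi> x * ?R x bs y)"
        using schwartz_tower_cmult[OF R] by (simp add: schwartz_tower_def)
    next
      fix bs :: "'a list" and y :: 'a assume bs: "set bs \<subseteq> Basis"
      show "(\<lambda>x. \<phi> x * ?R x bs y) \<in> borel_measurable lborel" using Rmeas[OF bs] by simp
      obtain C0 where C0: "\<And>x y. (1 + norm y) ^ 0 * norm (E bs (x - y)) \<le> C0 * (1 + norm x) ^ 0"
        using bound[OF bs, of 0] by blast
      have "norm (\<phi> x * ?R x bs y') \<le> norm (\<phi> x) * \<bar>C0\<bar>" for x y'
        using C0[of y' x] by (simp add: norm_mult norm_power mult_left_mono)
      moreover have "integrable lborel (\<lambda>x. norm (\<phi> x) * \<bar>C0\<bar>)"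
        by (intro integrable_mult_left integrable_norm i\<phi>)
      ultimately show "\<exists>B. integrable lborel B \<and> (\<forall>x\<in>space lborel. \<forall>y'\<in>ball y 1. norm (\<phi> x * ?R x bs y') \<le> B x)"
        by blast
    qed
    fix bs :: "'a list" assume bs: "set bs \<subseteq> Basis"
    show "rapidly_decreasing (V bs)"
      unfolding rapidly_decreasing_def
    proof
      fix M
      obtain C0 where C0: "\<And>x y. (1 + norm y) ^ M * norm (E bs (x - y)) \<le> C0 * (1 + norm x) ^ M"
        using bound[OF bs, of M] by blast
      have "(1 + norm y) ^ M * norm (V bs y) \<le> (\<integral>x. C0 * ((1 + norm x) ^ M * norm (\<phi> x)) \<partial>lborel)" for y
      proof -
        have "(1 + norm y) ^ M * norm (V bs y) = norm (\<integral>x. complex_of_real ((1 + norm y) ^ M) * (\<phi> x * ?R x bs y) \<partial>lborel)"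
          unfolding V_def integral_mult_right_zero norm_mult by (simp only: norm_of_real) simp
        also have "\<dots> \<le> (\<integral>x. C0 * ((1 + norm x) ^ M * norm (\<phi> x)) \<partial>lborel)"
        proof (rule Bochner_Integration.integral_norm_bound_integral)
          show "integrable lborel (\<lambda>x. complex_of_real ((1 + norm y) ^ M) * (\<phi> x * ?R x bs y))"
            by (intro integrable_mult_right Rint bs)
          show "integrable lborel (\<lambda>x. C0 * ((1 + norm x) ^ M * norm (\<phi> x)))"
            by (intro integrable_mult_right iw)
          fix x
          have "norm (complex_of_real ((1 + norm y) ^ M) * (\<phi> x * ?R x bs y)) = norm (\<phi> x) * ((1 + norm y) ^ M * norm (E bs (x - y)))"
            by (simp only: norm_mult norm_power norm_of_real norm_minus_cancel norm_one power_one) (simp add: mult_ac)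
          also have "\<dots> \<le> norm (\<phi> x) * (C0 * (1 + norm x) ^ M)" by (intro mult_left_mono C0) simp
          finally show "norm (complex_of_real ((1 + norm y) ^ M) * (\<phi> x * ?R x bs y)) \<le> C0 * ((1 + norm x) ^ M * norm (\<phi> x))"
            by (simp only: mult_ac)
        qed
        finally show ?thesis .
      qed
      then show "\<exists>C. \<forall>y. (1 + norm y) ^ M * norm (V bs y) \<le> C" by blast
    qed
  qed
  have V0: "V [] = (\<lambda>y. \<integral>x. \<phi> x * E [] (x - y) \<partial>lborel)" by (simp add: V_def fun_eq_iff)
  obtain s :: "nat \<Rightarrow> 'a \<Rightarrow> 'a" where s: "\<And>i. simple_function lborel (s i)"
    and slim: "\<And>x. (\<lambda>i. s i x) \<longlonglongrightarrow> x" and sle: "\<And>i x. dist (s i x) 0 \<le> 2 * dist x 0"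
    using borel_measurable_implies_sequence_metric[of "\<lambda>x::'a. x" lborel 0] by auto
  define W where "W i bs y = (\<Sum>v\<in>range (s i). (\<integral>x. indicator (s i -` {v}) x *\<^sub>R \<phi> x \<partial>lborel) * ?R v bs y)" for i bs y
  have fin: "finite (range (s i))" for i using s[of i] by (simp add: simple_function_def)
  have W: "schwartz_tower (W i)" for i
    unfolding W_def by (rule schwartz_tower_sum[OF fin R])
  have Weq: "W i bs y = (\<integral>x. \<phi> x * ?R (s i x) bs y \<partial>lborel)" and Wint: "integrable lborel (\<lambda>x. \<phi> x * ?R (s i x) bs y)" for i bs y
    unfolding W_def using integral_simple_function_factor[where s = "s i" and G = "\<lambda>v. ?R v bs y", OF s i\<phi>] by simp_all
  have uW: "u (W i []) = (\<integral>x. h (s i x) * \<phi> x \<partial>lborel)" for i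
  proof -
    have "u (W i []) = (\<Sum>v\<in>range (s i). (\<integral>x. indicator (s i -` {v}) x *\<^sub>R \<phi> x \<partial>lborel) * u (?R v []))"
      unfolding W_def by (rule tempered_sum[OF u fin R])
    also have "\<dots> = (\<Sum>v\<in>range (s i). (\<integral>x. indicator (s i -` {v}) x *\<^sub>R \<phi> x \<partial>lborel) * h v)"
      by (simp add: h_def)
    also have "\<dots> = (\<integral>x. \<phi> x * h (s i x) \<partial>lborel)"
      by (rule integral_simple_function_factor(1)[OF s i\<phi>, symmetric])
    finally show ?thesis by (simp add: mult.commute)
  qed
  have sn: "norm (s i x) \<le> 2 * norm x" for i x using sle[of i x] by simp
  define e where "e i = (\<integral>x. C * ((1 + 3 * norm x) ^ N * norm (x - s i x)) * norm (\<phi> x) \<partial>lborel)" for i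
  have sm [measurable]: "s i \<in> borel_measurable borel" for i using borel_measurable_simple_function[OF s[of i]] by simp
  have eb: "C * ((1 + 3 * norm x) ^ N * norm (x - s i x)) * norm (\<phi> x) \<le> C * (3 ^ Suc N * ((1 + norm x) ^ Suc N * norm (\<phi> x)))" for i x
  proof -
    have "norm (x - s i x) \<le> 3 * (1 + norm x)" using norm_triangle_ineq4[of x "s i x"] sn[of i x] by simp
    moreover have "(1 + 3 * norm x) ^ N \<le> (3 * (1 + norm x)) ^ N" by (intro power_mono) auto
    ultimately have "(1 + 3 * norm x) ^ N * norm (x - s i x) \<le> (3 * (1 + norm x)) ^ N * (3 * (1 + norm x))"
      by (intro mult_mono) auto
    then have "C * ((1 + 3 * norm x) ^ N * norm (x - s i x)) * norm (\<phi> x) \<le> C * ((3 * (1 + norm x)) ^ N * (3 * (1 + norm x))) * norm (\<phi> x)"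
      using C(1) by (intro mult_right_mono mult_left_mono) auto
    then show ?thesis by (simp only: power_mult_distrib power_Suc mult_ac)
  qed
  have ib: "integrable lborel (\<lambda>x. C * (3 ^ Suc N * ((1 + norm x) ^ Suc N * norm (\<phi> x))))"
    by (intro integrable_mult_right iw)
  have ei: "integrable lborel (\<lambda>x. C * ((1 + 3 * norm x) ^ N * norm (x - s i x)) * norm (\<phi> x))" for i
  proof (rule Bochner_Integration.integrable_bound[OF ib])
    show "AE x in lborel. norm (C * ((1 + 3 * norm x) ^ N * norm (x - s i x)) * norm (\<phi> x)) \<le> norm (C * (3 ^ Suc N * ((1 + norm x) ^ Suc N * norm (\<phi> x))))"
    proof (rule AE_I2)
      fix x
      have "0 \<le> C * ((1 + 3 * norm x) ^ N * norm (x - s i x)) * norm (\<phi> x)" using C(1) by simp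
      with eb[where x=x and i=i] show "norm (C * ((1 + 3 * norm x) ^ N * norm (x - s i x)) * norm (\<phi> x)) \<le> norm (C * (3 ^ Suc N * ((1 + norm x) ^ Suc N * norm (\<phi> x))))"
        unfolding real_norm_def by linarith
    qed
  qed simp
  have e0: "e \<longlonglongrightarrow> 0"
  proof -
    have "e \<longlonglongrightarrow> integral\<^sup>L lborel (\<lambda>x :: 'a. 0)"
      unfolding e_def
    proof (rule integral_dominated_convergence[where w = "\<lambda>x. C * (3 ^ Suc N * ((1 + norm x) ^ Suc N * norm (\<phi> x)))"])
      show "AE x in lborel. (\<lambda>i. C * ((1 + 3 * norm x) ^ N * norm (x - s i x)) * norm (\<phi> x)) \<longlonglongrightarrow> 0"
      proof (rule AE_I2)
        fix x :: 'a
        have "(\<lambda>i. C * ((1 + 3 * norm x) ^ N * norm (x - s i x)) * norm (\<phi> x)) \<longlonglongrightarrow> C * ((1 + 3 * norm x) ^ N * norm (x - x)) * norm (\<phi> x)"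
          by (intro tendsto_intros slim)
        then show "(\<lambda>i. C * ((1 + 3 * norm x) ^ N * norm (x - s i x)) * norm (\<phi> x)) \<longlonglongrightarrow> 0" by simp
      qed
      show "AE x in lborel. norm (C * ((1 + 3 * norm x) ^ N * norm (x - s i x)) * norm (\<phi> x)) \<le> C * (3 ^ Suc N * ((1 + norm x) ^ Suc N * norm (\<phi> x)))" for i
      proof (rule AE_I2)
        fix x
        have "0 \<le> C * ((1 + 3 * norm x) ^ N * norm (x - s i x)) * norm (\<phi> x)" using C(1) by simp
        with eb[where x=x and i=i] show "norm (C * ((1 + 3 * norm x) ^ N * norm (x - s i x)) * norm (\<phi> x)) \<le> C * (3 ^ Suc N * ((1 + norm x) ^ Suc N * norm (\<phi> x)))"
          unfolding real_norm_def by linarith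
      qed
    qed (use ib in simp_all)
    then show ?thesis by simp
  qed
  have VW: "norm (u (V []) - u (W i [])) \<le> Cu * e i" for i
  proof -
    have t: "schwartz_tower (\<lambda>bs y. V bs y + (- 1) * W i bs y)"
      by (intro schwartz_tower_add schwartz_tower_cmult V W)
    have "schwartz_seminorm N ((\<lambda>bs y. V bs y + (- 1) * W i bs y) []) \<le> e i"
    proof (rule schwartz_seminorm_le)
      show "deriv_tower (\<lambda>bs y. V bs y + (- 1) * W i bs y)" using t by (simp add: schwartz_tower_def)
      fix bs :: "'a list" and y :: 'a assume bs: "set bs \<subseteq> Basis" "length bs \<le> N"
      have "(1 + norm y) ^ N * norm (V bs y + (- 1) * W i bs y)
        = norm (\<integral>x. complex_of_real ((1 + norm y) ^ N) * (\<phi> x * ?R x bs y - \<phi> x * ?R (s i x) bs y) \<partial>lborel)"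
        unfolding integral_mult_right_zero norm_mult norm_of_real
        using Rint[OF bs(1), of y] Wint[where i = i and bs = bs and y = y] by (simp add: V_def Weq)
      also have "\<dots> \<le> e i" unfolding e_def
      proof (rule Bochner_Integration.integral_norm_bound_integral[OF _ ei])
        show "integrable lborel (\<lambda>x. complex_of_real ((1 + norm y) ^ N) * (\<phi> x * ?R x bs y - \<phi> x * ?R (s i x) bs y))"
          by (intro integrable_mult_right Bochner_Integration.integrable_diff Rint bs Wint)
        fix x
        have "norm (complex_of_real ((1 + norm y) ^ N) * (\<phi> x * ?R x bs y - \<phi> x * ?R (s i x) bs y))
          = norm (\<phi> x) * ((1 + norm y) ^ N * norm (E bs (x - y) - E bs (s i x - y)))"
          unfolding right_diff_distrib[symmetric]
          by (simp only: norm_mult norm_power norm_of_real norm_minus_cancel norm_one power_one) (simp add: mult_ac)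
        also have "\<dots> \<le> norm (\<phi> x) * (C * ((1 + norm x + norm (s i x)) ^ N * norm (x - s i x)))"
          using bs by (intro mult_left_mono C(3)) auto
        also have "\<dots> \<le> norm (\<phi> x) * (C * ((1 + 3 * norm x) ^ N * norm (x - s i x)))"
          using C(1) sn[of i x] by (intro mult_left_mono mult_right_mono power_mono) auto
        finally show "norm (complex_of_real ((1 + norm y) ^ N) * (\<phi> x * ?R x bs y - \<phi> x * ?R (s i x) bs y))
          \<le> C * ((1 + 3 * norm x) ^ N * norm (x - s i x)) * norm (\<phi> x)"
          by (simp only: mult_ac)
      qed
      finally show "(1 + norm y) ^ N * norm (V bs y + (- 1) * W i bs y) \<le> e i" .
    qed
    then have "Cu * schwartz_seminorm N (\<lambda>y. V [] y + (- 1) * W i [] y) \<le> Cu * e i"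
      using Cu(1) by (rule mult_left_mono)
    moreover have "norm (u (\<lambda>y. V [] y - W i [] y)) \<le> Cu * schwartz_seminorm N (\<lambda>y. V [] y + (- 1) * W i [] y)"
      using Cu(2)[OF schwartz_tower_in_schwartz[OF t]] by simp
    moreover have "u (\<lambda>y. V [] y - W i [] y) = u (V []) - u (W i [])"
      using tempered_diff[OF u schwartz_tower_in_schwartz[OF V] schwartz_tower_in_schwartz[OF W[of i]]] by simp
    ultimately show ?thesis by simp
  qed
  have "(\<lambda>i. u (V []) - u (W i [])) \<longlonglongrightarrow> 0"
    by (rule Lim_null_comparison[OF always_eventually[OF allI[OF VW]] tendsto_mult_right_zero[OF e0]])
  from tendsto_diff[OF tendsto_const[of "u (V [])"] this] have lim1: "(\<lambda>i. u (W i [])) \<longlonglongrightarrow> u (V [])" by simp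
  have lim2: "(\<lambda>i. u (W i [])) \<longlonglongrightarrow> (\<integral>x. h x * \<phi> x \<partial>lborel)"
    unfolding uW
  proof (rule integral_dominated_convergence[where w = "\<lambda>x. Cu * C * 2 ^ N * ((1 + norm x) ^ N * norm (\<phi> x))"])
    show "AE x in lborel. (\<lambda>i. h (s i x) * \<phi> x) \<longlonglongrightarrow> h x * \<phi> x"
      using continuous_on_tendsto_compose[OF cont slim] by (intro AE_I2 tendsto_mult tendsto_const) auto
    show "AE x in lborel. norm (h (s i x) * \<phi> x) \<le> Cu * C * 2 ^ N * ((1 + norm x) ^ N * norm (\<phi> x))" for i
    proof (rule AE_I2)
      fix x
      have "norm (h (s i x)) \<le> (Cu * C) * (1 + norm (s i x)) ^ N" by (rule growth)
      also have "\<dots> \<le> (Cu * C) * (2 * (1 + norm x)) ^ N"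
        using Cu(1) C(1) sn[of i x] by (intro mult_left_mono power_mono) auto
      finally have "norm (h (s i x)) * norm (\<phi> x) \<le> (Cu * C) * (2 * (1 + norm x)) ^ N * norm (\<phi> x)"
        by (rule mult_right_mono) simp
      then show "norm (h (s i x) * \<phi> x) \<le> Cu * C * 2 ^ N * ((1 + norm x) ^ N * norm (\<phi> x))"
        by (simp only: norm_mult power_mult_distrib mult_ac)
    qed
    show "integrable lborel (\<lambda>x. Cu * C * 2 ^ N * ((1 + norm x) ^ N * norm (\<phi> x)))"
      by (intro integrable_mult_right iw)
  qed simp_all
  from LIMSEQ_unique[OF lim1 lim2] ih schwartz_tower_in_schwartz[OF V]
  show "integrable lborel (\<lambda>x. h x * \<phi> x) \<and> (\<lambda>y. \<integral>x. \<phi> x * E [] (x - y) \<partial>lborel) \<in> schwartz \<and>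
        u (\<lambda>y. \<integral>x. \<phi> x * E [] (x - y) \<partial>lborel) = (\<integral>x. h x * \<phi> x \<partial>lborel)"
    unfolding V0 by simp
qed

section \<open>Identification of the localized pieces\<close>

lemma test_fun_deriv_power: "test_fun R v \<Longrightarrow> test_fun R ((deriv ^^ m) v)"
  and has_deriv_power: "test_fun R v \<Longrightarrow> ((deriv ^^ m) v has_real_derivative (deriv ^^ Suc m) v t) (at t)"
proof -
  have step: "test_fun R (deriv w) \<and> (\<forall>t. (w has_real_derivative deriv w t) (at t))" if w: "test_fun R w" for w
  proof -
    obtain w' where w': "\<forall>t. (w has_real_derivative w' t) (at t)" "test_fun R w'"
      using w by (rule test_fun_deriv)
    have "deriv w = w'" using w'(1) by (intro ext DERIV_imp_deriv) simp
    with w' show ?thesis by simp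
  qed
  show tf: "test_fun R ((deriv ^^ m) v)" if "test_fun R v" for m
    using that step by (induction m) simp_all
  show "((deriv ^^ m) v has_real_derivative (deriv ^^ Suc m) v t) (at t)" if "test_fun R v"
    using step[OF tf[OF that, of m]] by simp
qed

lemma schwartz_line_tower_test_fun:
  assumes v: "test_fun R v"
  shows "schwartz_line_tower (\<lambda>m r. of_real ((deriv ^^ m) v r))"
  unfolding schwartz_line_tower_def line_tower_def
proof safe
  fix m r
  show "((\<lambda>r. of_real ((deriv ^^ m) v r)) has_vector_derivative of_real ((deriv ^^ Suc m) v r)) (at r)"
    by (rule has_vector_derivative_of_real[OF has_deriv_power[OF v]])
  let ?w = "(deriv ^^ m) v"
  have w: "test_fun R ?w" by (rule test_fun_deriv_power[OF v])
  have "compact (?w ` {- \<bar>R\<bar>..\<bar>R\<bar>})"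
    by (intro compact_continuous_image continuous_on_subset[OF test_fun_continuous[OF w]]) auto
  then obtain B where B: "\<forall>x\<in>?w ` {- \<bar>R\<bar>..\<bar>R\<bar>}. norm x \<le> B" using compact_imp_bounded bounded_iff by blast
  show "rapidly_decreasing (\<lambda>r. complex_of_real (?w r))"
    unfolding rapidly_decreasing_def
  proof
    fix N
    have "(1 + norm r) ^ N * norm (complex_of_real (?w r)) \<le> (1 + \<bar>R\<bar>) ^ N * \<bar>B\<bar>" for r
    proof (cases "\<bar>r\<bar> \<le> \<bar>R\<bar>")
      case True
      then have "r \<in> {- \<bar>R\<bar>..\<bar>R\<bar>}" by auto
      then have "norm (?w r) \<le> B" using B by blast
      then show ?thesis using True by (intro mult_mono power_mono) auto
    next
      case False
      then have "?w r = 0" using w unfolding test_fun_def by simp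
      then show ?thesis by simp
    qed
    then show "\<exists>C. \<forall>r. (1 + norm r) ^ N * norm (complex_of_real (?w r)) \<le> C" by blast
  qed
qed

lemma schwartz_separates:
  fixes u :: "'a::euclidean_space \<Rightarrow> complex"
  assumes \<eta>: "cutoff \<eta>" and u: "continuous_on UNIV u"
    and int: "\<And>\<phi>. \<phi> \<in> schwartz \<Longrightarrow> integrable lborel (\<lambda>x. u x * \<phi> x)"
    and zero: "\<And>\<phi>. \<phi> \<in> schwartz \<Longrightarrow> (\<integral>x. u x * \<phi> x \<partial>lborel) = 0"
  shows "u x0 = 0"
proof (rule ccontr)
  assume nz: "u x0 \<noteq> 0"
  define c where "c = u x0"
  let ?g = "\<lambda>y. Re (cnj c * u y)"
  have cg: "continuous_on UNIV ?g" using u by (intro continuous_intros)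
  have "0 < ?g x0"
    using nz unfolding c_def by (subst mult.commute, subst complex_mult_cnj) (simp add: sum_power2_gt_zero_iff complex_eq_iff)
  have "open {y. 0 < ?g y}" by (intro open_Collect_less continuous_on_const cg)
  then obtain \<delta> where \<delta>: "0 < \<delta>" "ball x0 \<delta> \<subseteq> {y. 0 < ?g y}"
    using \<open>0 < ?g x0\<close> open_contains_ball by blast
  define l where "l = 2 * real DIM('a) / \<delta>"
  have l: "0 < l" using \<delta> by (simp add: l_def)
  have labs: "l * \<bar>r - t\<bar> = \<bar>l * r + - (l * t)\<bar>" for r t
  proof -
    have "l * r + - (l * t) = l * (r - t)" by (simp add: right_diff_distrib)
    then show ?thesis using l by (simp only: abs_mult abs_of_pos)
  qed
  define v where "v b r = \<eta> (l * r + - (l * (x0 \<bullet> b)))" for b r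
  have v: "test_fun (2 / l + \<bar>x0 \<bullet> b\<bar>) (v b)" for b
    unfolding test_fun_def v_def
  proof safe
    fix k show "Ck k (\<lambda>r. \<eta> (l * r + - (l * (x0 \<bullet> b))))"
      by (rule Ck_affine[OF test_fun_Ck[OF cutoff_test_fun[OF \<eta>]]])
  next
    fix t assume t: "2 / l + \<bar>x0 \<bullet> b\<bar> \<le> \<bar>t\<bar>"
    then have "2 / l \<le> \<bar>t - x0 \<bullet> b\<bar>" by linarith
    then have "2 \<le> l * \<bar>t - x0 \<bullet> b\<bar>" using l by (simp add: field_simps)
    also have "\<dots> = \<bar>l * t + - (l * (x0 \<bullet> b))\<bar>" by (rule labs)
    finally show "\<eta> (l * t + - (l * (x0 \<bullet> b))) = 0" by (rule cutoff_eq_zero[OF \<eta>])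
  qed
  let ?D = "tensor_tower (\<lambda>b m r. complex_of_real ((deriv ^^ m) (v b) r))"
  have D: "schwartz_tower ?D" by (intro schwartz_tower_tensor schwartz_line_tower_test_fun[OF v])
  define B where "B y = (\<Prod>b\<in>Basis. v b (y \<bullet> b))" for y
  have DB: "?D [] = (\<lambda>y. complex_of_real (B y))" by (simp add: tensor_def B_def fun_eq_iff)
  have Bs: "(\<lambda>y. complex_of_real (B y)) \<in> schwartz" using schwartz_tower_in_schwartz[OF D] DB by simp
  have Bnn: "0 \<le> B y" for y unfolding B_def v_def by (intro prod_nonneg cutoff_nonneg[OF \<eta>] ballI)
  have B0: "B x0 = 1" by (simp add: B_def v_def cutoff_eq_one[OF \<eta>])
  have cB: "continuous_on UNIV B"
    using v unfolding B_def
    by (intro continuous_intros continuous_on_compose2[OF test_fun_continuous[OF v]]) auto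
  have Bz: "y \<in> ball x0 \<delta>" if "B y \<noteq> 0" for y
  proof -
    have "\<bar>(y - x0) \<bullet> b\<bar> < \<delta> / DIM('a)" if b: "b \<in> Basis" for b
    proof (rule ccontr)
      assume "\<not> \<bar>(y - x0) \<bullet> b\<bar> < \<delta> / DIM('a)"
      then have "l * (\<delta> / DIM('a)) \<le> l * \<bar>(y - x0) \<bullet> b\<bar>" using l by (intro mult_left_mono) auto
      also have "\<dots> = \<bar>l * (y \<bullet> b) + - (l * (x0 \<bullet> b))\<bar>"
        using labs[of "y \<bullet> b" "x0 \<bullet> b"] by (simp only: inner_diff_left)
      finally have "2 \<le> \<bar>l * (y \<bullet> b) + - (l * (x0 \<bullet> b))\<bar>" using \<delta> by (simp add: l_def)
      then have "v b (y \<bullet> b) = 0" unfolding v_def by (rule cutoff_eq_zero[OF \<eta>])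
      then show False using \<open>B y \<noteq> 0\<close> b unfolding B_def by auto
    qed
    then have "(\<Sum>b\<in>Basis. \<bar>(y - x0) \<bullet> b\<bar>) < (\<Sum>b\<in>(Basis::'a set). \<delta> / DIM('a))"
      by (intro sum_strict_mono) auto
    then have "norm (y - x0) < \<delta>" using norm_le_l1[of "y - x0"] by simp
    then show ?thesis by (simp add: dist_norm norm_minus_commute)
  qed
  let ?W = "\<lambda>y. ?g y * B y"
  have Wnn: "0 \<le> ?W y" for y
  proof (cases "B y = 0")
    case False
    then have "0 < ?g y" using Bz \<delta>(2) by blast
    then show ?thesis using Bnn[of y] by (intro mult_nonneg_nonneg) auto
  qed simp
  have Weq: "?W y = Re (cnj c * (u y * complex_of_real (B y)))" for y
    by (simp add: mult.assoc[symmetric])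
  have iW: "integrable lborel ?W"
    unfolding Weq by (intro integrable_Re integrable_mult_right int Bs)
  have "integral\<^sup>L lborel ?W = Re (cnj c * (\<integral>y. u y * complex_of_real (B y) \<partial>lborel))"
    unfolding Weq using int[OF Bs] by (subst integral_Re) (simp_all only: integrable_mult_right integral_mult_right_zero)
  also have "\<dots> = 0" by (simp add: zero[OF Bs])
  finally have "AE y in lborel. ?W y = 0"
    using integral_nonneg_eq_0_iff_AE[OF iW] Wnn by simp
  moreover have "open {y. 0 < ?W y}"
    using cg cB by (intro open_Collect_less continuous_on_const continuous_on_mult)
  moreover have "{y. 0 < ?W y} \<in> sets lborel" using \<open>open {y. 0 < ?W y}\<close> by simp
  moreover have "AE y in lborel. y \<notin> {y. 0 < ?W y}" using \<open>AE y in lborel. ?W y = 0\<close> by eventually_elim (simp only: mem_Collect_eq less_irrefl not_False_eq_True)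
  ultimately have "{y. 0 < ?W y} \<in> null_sets lborel" by (simp add: AE_iff_null_sets)
  then have "negligible {y. 0 < ?W y}" by (simp add: negligible_iff_null_sets null_sets_completionI)
  moreover have "x0 \<in> {y. 0 < ?W y}" using \<open>0 < ?g x0\<close> B0 by simp
  ultimately show False using open_not_negligible[OF \<open>open {y. 0 < ?W y}\<close>] by blast
qed

lemma schwartz_measurable: "\<phi> \<in> schwartz \<Longrightarrow> \<phi> \<in> borel_measurable borel"
  using deriv_tower_continuous[of "\<lambda>bs. partial_derivs bs \<phi>" "[]"] schwartz_tower_of_schwartz[of \<phi>]
  by (auto simp: schwartz_tower_def intro: borel_measurable_continuous_onI)

lemma schwartz_rapidly_decreasing: "\<phi> \<in> schwartz \<Longrightarrow> rapidly_decreasing \<phi>"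
  using schwartz_tower_of_schwartz[of \<phi>] by (auto simp: schwartz_tower_def dest!: spec[of _ "[]"])

definition window_tower :: "(real \<Rightarrow> real) \<Rightarrow> 'a::euclidean_space \<Rightarrow> 'a list \<Rightarrow> 'a \<Rightarrow> complex" where
  "window_tower \<eta> k = tensor_tower (\<lambda>b. ift (\<lambda>\<xi>. line_window \<eta> (\<xi> - k \<bullet> b)))"

definition cutoff_tower :: "(real \<Rightarrow> real) \<Rightarrow> 'a::euclidean_space \<Rightarrow> 'a list \<Rightarrow> 'a \<Rightarrow> complex" where
  "cutoff_tower \<eta> k = tensor_tower (\<lambda>b. ift (\<lambda>\<xi>. \<eta> (\<xi> - k \<bullet> b)))"

context
  fixes \<eta> :: "real \<Rightarrow> real"
  assumes \<eta>: "cutoff \<eta>"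
begin

lemma freq_window_cis_tensor:
  assumes "k \<in> int_lattice"
  shows "cis (\<xi> \<bullet> z) * of_real (freq_window \<eta> k \<xi>)
    = tensor (\<lambda>b t. cis ((z \<bullet> b) * t) * of_real (line_window \<eta> (t - k \<bullet> b))) (\<xi> :: 'a::euclidean_space)"
  by (simp add: cis_inner_eq_tensor freq_window_eq_tensor[OF \<eta> assms] tensor_def prod.distrib)

lemma window_kernel_eq_integral:
  fixes z :: "'a::euclidean_space"
  assumes "k \<in> int_lattice"
  shows "window_kernel \<eta> k z = complex_of_real (1 / (2 * pi) ^ DIM('a)) *
    (\<integral>\<xi>. cis (\<xi> \<bullet> z) * of_real (freq_window \<eta> k \<xi>) \<partial>lborel)"
proof -
  have "(\<integral>\<xi>. cis (\<xi> \<bullet> z) * of_real (freq_window \<eta> k \<xi>) \<partial>lborel) = (\<Prod>b\<in>Basis. osc (\<lambda>t. line_window \<eta> (t - k \<bullet> b)) (z \<bullet> b))"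
    unfolding freq_window_cis_tensor[OF assms] osc_def
    by (rule integral_tensor[OF osc_integrable[OF window_shift_test_fun[OF \<eta>]]])
  then show ?thesis
    by (simp add: window_kernel_def tensor_def ift_def prod_dividef)
qed

lemma freq_window_integrable:
  assumes "k \<in> int_lattice"
  shows "integrable lborel (freq_window \<eta> (k :: 'a::euclidean_space))"
proof -
  have "integrable lborel (tensor (\<lambda>b t. line_window \<eta> (t - k \<bullet> b)))"
    by (intro integrable_tensor test_fun_integrable[OF window_shift_test_fun[OF \<eta>]])
  moreover have "freq_window \<eta> k = tensor (\<lambda>b t. line_window \<eta> (t - k \<bullet> b))"
    by (rule ext) (rule freq_window_eq_tensor[OF \<eta> assms])
  ultimately show ?thesis by (simp only:)
qed

lemma freq_window_nonneg:
  assumes "k \<in> int_lattice"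
  shows "0 \<le> freq_window \<eta> k (\<xi> :: 'a::euclidean_space)"
  unfolding freq_window_eq_tensor[OF \<eta> assms] tensor_def by (intro prod_nonneg ballI line_window_nonneg[OF \<eta>])

lemma box_dist_eq:
  fixes k :: "'a::euclidean_space"
  assumes k: "k \<in> int_lattice" and \<phi>: "integrable lborel \<phi>"
  shows "box_dist \<eta> k f \<phi> = f (\<lambda>y. \<integral>x. \<phi> x * window_kernel \<eta> k (x - y) \<partial>lborel)"
proof -
  let ?c = "complex_of_real (1 / (2 * pi) ^ DIM('a))"
  have [measurable]: "\<phi> \<in> borel_measurable borel" "freq_window \<eta> k \<in> borel_measurable borel"
    using borel_measurable_integrable[OF \<phi>] borel_measurable_integrable[OF freq_window_integrable[OF k]] by simp_all
  have "fourier (\<lambda>\<xi>. complex_of_real (freq_window \<eta> k \<xi>) * inv_fourier \<phi> \<xi>) y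
    = (\<integral>x. \<phi> x * window_kernel \<eta> k (x - y) \<partial>lborel)" for y
  proof -
    have "fourier (\<lambda>\<xi>. complex_of_real (freq_window \<eta> k \<xi>) * inv_fourier \<phi> \<xi>) y
      = (\<integral>\<xi>. \<integral>x. cis (- (\<xi> \<bullet> y)) * (complex_of_real (freq_window \<eta> k \<xi>) * (?c * (cis (\<xi> \<bullet> x) * \<phi> x))) \<partial>lborel \<partial>lborel)"
      by (simp add: fourier_def inv_fourier_def)
    also have "\<dots> = (\<integral>x. \<integral>\<xi>. cis (- (\<xi> \<bullet> y)) * (complex_of_real (freq_window \<eta> k \<xi>) * (?c * (cis (\<xi> \<bullet> x) * \<phi> x))) \<partial>lborel \<partial>lborel)"
    proof (rule integral_swap_dominated[where A = "\<lambda>\<xi>. norm ?c * freq_window \<eta> k \<xi>" and B = "\<lambda>x. norm (\<phi> x)"])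
      show "integrable lborel (\<lambda>\<xi>. norm ?c * freq_window \<eta> k \<xi>)" by (intro integrable_mult_right freq_window_integrable k)
      show "integrable lborel (\<lambda>x. norm (\<phi> x))" by (intro integrable_norm \<phi>)
      fix \<xi> x :: 'a
      show "norm (cis (- (\<xi> \<bullet> y)) * (complex_of_real (freq_window \<eta> k \<xi>) * (?c * (cis (\<xi> \<bullet> x) * \<phi> x))))
        \<le> norm ?c * freq_window \<eta> k \<xi> * norm (\<phi> x)"
        using freq_window_nonneg[OF k, of \<xi>] by (simp only: norm_mult norm_cis norm_of_real) simp
    qed measurable
    also have "\<dots> = (\<integral>x. \<phi> x * window_kernel \<eta> k (x - y) \<partial>lborel)"
    proof (rule Bochner_Integration.integral_cong)
      fix x
      have "(\<integral>\<xi>. cis (- (\<xi> \<bullet> y)) * (complex_of_real (freq_window \<eta> k \<xi>) * (?c * (cis (\<xi> \<bullet> x) * \<phi> x))) \<partial>lborel)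
        = (\<integral>\<xi>. (\<phi> x * ?c) * (cis (\<xi> \<bullet> (x - y)) * complex_of_real (freq_window \<eta> k \<xi>)) \<partial>lborel)"
      proof (rule Bochner_Integration.integral_cong)
        fix \<xi>
        have "cis (\<xi> \<bullet> (x - y)) = cis (- (\<xi> \<bullet> y)) * cis (\<xi> \<bullet> x)" by (simp add: cis_mult inner_diff_right)
        then show "cis (- (\<xi> \<bullet> y)) * (complex_of_real (freq_window \<eta> k \<xi>) * (?c * (cis (\<xi> \<bullet> x) * \<phi> x)))
          = (\<phi> x * ?c) * (cis (\<xi> \<bullet> (x - y)) * complex_of_real (freq_window \<eta> k \<xi>))"
          by (simp only: mult_ac)
      qed simp
      also have "\<dots> = \<phi> x * window_kernel \<eta> k (x - y)"
        unfolding window_kernel_eq_integral[OF k] integral_mult_right_zero by (simp only: mult.assoc)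
      finally show "(\<integral>\<xi>. cis (- (\<xi> \<bullet> y)) * (complex_of_real (freq_window \<eta> k \<xi>) * (?c * (cis (\<xi> \<bullet> x) * \<phi> x))) \<partial>lborel)
        = \<phi> x * window_kernel \<eta> k (x - y)" .
    qed simp
    finally show ?thesis .
  qed
  then have "fourier (\<lambda>\<xi>. complex_of_real (freq_window \<eta> k \<xi>) * inv_fourier \<phi> \<xi>)
    = (\<lambda>y. \<integral>x. \<phi> x * window_kernel \<eta> k (x - y) \<partial>lborel)" by (rule ext)
  then show ?thesis
    by (simp add: box_dist_def dist_inv_fourier_def dist_mult_def dist_fourier_def)
qed

lemma schwartz_tower_window: "schwartz_tower (window_tower \<eta> k)"
  unfolding window_tower_def
  by (intro schwartz_tower_tensor schwartz_line_tower_ift[OF window_shift_test_fun[OF \<eta>]])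

lemma window_tower_Nil: "window_tower \<eta> k [] = window_kernel \<eta> k"
  by (simp add: window_tower_def window_kernel_def)

lemma schwartz_tower_cutoff: "schwartz_tower (cutoff_tower \<eta> k)"
  unfolding cutoff_tower_def
  by (intro schwartz_tower_tensor schwartz_line_tower_ift[OF cutoff_shift_test_fun[OF \<eta>]])

lemma cutoff_tower_Nil: "cutoff_tower \<eta> k [] = cutoff_kernel \<eta> k"
  by (simp add: cutoff_tower_def cutoff_kernel_def)

lemma window_kernel_schwartz: "window_kernel \<eta> k \<in> schwartz"
  using schwartz_tower_in_schwartz[OF schwartz_tower_window[of k]] by (simp add: window_tower_Nil)

lemma cutoff_kernel_schwartz: "cutoff_kernel \<eta> k \<in> schwartz"
  using schwartz_tower_in_schwartz[OF schwartz_tower_cutoff[of k]] by (simp add: cutoff_tower_Nil)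

theorem
  fixes f :: "'a::euclidean_space dist"
  assumes k: "k \<in> int_lattice" and f: "f \<in> tempered_distributions"
  shows box_eq: "box \<eta> k f = (\<lambda>x. f (\<lambda>y. window_kernel \<eta> k (x - y)))"
    and box_continuous: "continuous_on UNIV (box \<eta> k f)"
    and box_growth: "\<exists>N C. \<forall>x. norm (box \<eta> k f x) \<le> C * (1 + norm x) ^ N"
    and box_reproduce: "\<And>w. box \<eta> k f w = (\<integral>x. cutoff_kernel \<eta> k (w - x) * box \<eta> k f x \<partial>lborel)"
proof -
  let ?h = "\<lambda>x. f (\<lambda>y. window_kernel \<eta> k (x - y))"
  note conv = tempered_convolution[OF f schwartz_tower_window[of k], unfolded window_tower_Nil]
  have rep: "integrable lborel (\<lambda>x. ?h x * \<phi> x) \<and> box_dist \<eta> k f \<phi> = dist_of_fun ?h \<phi>"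
    if p: "\<phi> \<in> schwartz" for \<phi>
    using conv(3)[OF schwartz_measurable[OF p] schwartz_rapidly_decreasing[OF p]]
      box_dist_eq[OF k integrable_rapidly_decreasing(1)[OF schwartz_measurable[OF p] schwartz_rapidly_decreasing[OF p]], of f]
    by (simp add: dist_of_fun_def)
  show eq: "box \<eta> k f = ?h"
    unfolding box_def
  proof (rule the_equality)
    show "continuous_on UNIV ?h \<and> (\<forall>\<phi>\<in>schwartz. integrable lborel (\<lambda>x. ?h x * \<phi> x) \<and> box_dist \<eta> k f \<phi> = dist_of_fun ?h \<phi>)"
      using conv(1) rep by simp
    fix g assume g: "continuous_on UNIV g \<and> (\<forall>\<phi>\<in>schwartz. integrable lborel (\<lambda>x. g x * \<phi> x) \<and> box_dist \<eta> k f \<phi> = dist_of_fun g \<phi>)"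
    show "g = ?h"
    proof
      fix x
      have "g x - ?h x = 0"
      proof (rule schwartz_separates[OF \<eta>, where u = "\<lambda>x. g x - ?h x"])
        show "continuous_on UNIV (\<lambda>x. g x - ?h x)" using g conv(1) by (intro continuous_on_diff) auto
        fix \<phi> :: "'a \<Rightarrow> complex" assume \<phi>: "\<phi> \<in> schwartz"
        have i: "integrable lborel (\<lambda>x. g x * \<phi> x)" "integrable lborel (\<lambda>x. ?h x * \<phi> x)"
          and e: "dist_of_fun g \<phi> = dist_of_fun ?h \<phi>" using g rep[OF \<phi>] \<phi> by auto
        show "integrable lborel (\<lambda>x. (g x - ?h x) * \<phi> x)"
          unfolding left_diff_distrib by (rule Bochner_Integration.integrable_diff[OF i])
        show "(\<integral>x. (g x - ?h x) * \<phi> x \<partial>lborel) = 0"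
          unfolding left_diff_distrib Bochner_Integration.integral_diff[OF i] using e by (simp add: dist_of_fun_def)
      qed
      then show "g x = ?h x" by simp
    qed
  qed
  show "continuous_on UNIV (box \<eta> k f)" unfolding eq by (rule conv(1))
  show "\<exists>N C. \<forall>x. norm (box \<eta> k f x) \<le> C * (1 + norm x) ^ N" unfolding eq by (rule conv(2))
  fix w
  have m: "(\<lambda>x. cutoff_kernel \<eta> k (w - x)) \<in> borel_measurable borel"
    using schwartz_measurable[OF cutoff_kernel_schwartz[of k]] by measurable
  have "f (\<lambda>y. \<integral>x. cutoff_kernel \<eta> k (w - x) * window_kernel \<eta> k (x - y) \<partial>lborel) = (\<integral>x. ?h x * cutoff_kernel \<eta> k (w - x) \<partial>lborel)"
    using conv(3)[OF m rapidly_decreasing_reflect[OF schwartz_rapidly_decreasing[OF cutoff_kernel_schwartz]]] by simp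
  then show "box \<eta> k f w = (\<integral>x. cutoff_kernel \<eta> k (w - x) * box \<eta> k f x \<partial>lborel)"
    unfolding eq kernel_reproduce[OF \<eta>] by (simp add: mult.commute)
qed

end

section \<open>The Peetre maximal inequality for band-limited functions\<close>

lemma powr_weight_shift_le:
  assumes "0 \<le> a"
  shows "(1 + norm (y :: 'a::real_normed_vector)) powr a \<le> (1 + norm z) powr a * (1 + norm (y - z)) powr a"
proof -
  have "1 + norm y \<le> 1 + norm z + norm (y - z)" using norm_triangle_sub[of y z] by simp
  also have "\<dots> \<le> (1 + norm z) * (1 + norm (y - z))" by (simp add: algebra_simps)
  finally have "(1 + norm y) powr a \<le> ((1 + norm z) * (1 + norm (y - z))) powr a"
    using assms by (intro powr_mono2) auto
  then show ?thesis by (simp add: powr_mult)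
qed

lemma powr_weight_le_one: "0 \<le> b \<Longrightarrow> (1 + norm (y :: 'a::real_normed_vector)) powr (- b) \<le> 1"
  using powr_mono[of "- b" 0 "1 + norm y"] add_pos_nonneg[OF zero_less_one norm_ge_zero[of y]] by simp

lemma rapidly_decreasing_powr_bound:
  fixes \<Phi> :: "'a::euclidean_space \<Rightarrow> complex"
  assumes m [measurable]: "\<Phi> \<in> borel_measurable borel" and \<Phi>: "rapidly_decreasing \<Phi>"
  shows "\<exists>S>0. \<forall>z. (1 + norm z) powr a * norm (\<Phi> z) \<le> S"
    and "integrable lborel (\<lambda>z. (1 + norm z) powr a * norm (\<Phi> z))"
proof -
  define n where "n = nat \<lceil>a\<rceil>"
  have le: "(1 + norm z) powr a \<le> (1 + norm z) ^ n" for z :: 'a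
  proof -
    have "a \<le> real n" unfolding n_def by linarith
    then have "(1 + norm z) powr a \<le> (1 + norm z) powr real n" by (intro powr_mono) auto
    also have "\<dots> = (1 + norm z) ^ n" by (rule powr_realpow) (simp add: add_pos_nonneg)
    finally show ?thesis .
  qed
  then have le': "(1 + norm z) powr a * norm (\<Phi> z) \<le> (1 + norm z) ^ n * norm (\<Phi> z)" for z
    by (intro mult_right_mono) auto
  obtain S where S: "\<And>z. (1 + norm z) ^ n * norm (\<Phi> z) \<le> S"
    using \<Phi> unfolding rapidly_decreasing_def by blast
  have "(1 + norm z) powr a * norm (\<Phi> z) \<le> \<bar>S\<bar> + 1" for z
    using le'[of z] S[of z] by linarith
  then show "\<exists>S>0. \<forall>z. (1 + norm z) powr a * norm (\<Phi> z) \<le> S" by (intro exI[of _ "\<bar>S\<bar> + 1"]) auto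
  show "integrable lborel (\<lambda>z. (1 + norm z) powr a * norm (\<Phi> z))"
  proof (rule Bochner_Integration.integrable_bound[OF integrable_rapidly_decreasing(2)[OF m \<Phi>, of n]])
    show "AE z in lborel. norm ((1 + norm z) powr a * norm (\<Phi> z)) \<le> norm ((1 + norm z) ^ n * norm (\<Phi> z))"
      using le' by (intro AE_I2) simp
  qed simp
qed

lemma integrable_powr_weight:
  fixes g :: "'a::euclidean_space \<Rightarrow> complex"
  assumes m [measurable]: "g \<in> borel_measurable borel" and i: "integrable lborel (\<lambda>x. norm (g x) powr p)" and "0 \<le> b"
  shows "integrable lborel (\<lambda>y. norm (g (x - y)) powr p * (1 + norm y) powr (- b))"
proof (rule Bochner_Integration.integrable_bound)
  show "integrable lborel (\<lambda>y. norm (g (x - y)) powr p)"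
    using i by (subst lborel_integrable_reflect[of "\<lambda>y. norm (g y) powr p"]) simp_all
  show "AE y in lborel. norm (norm (g (x - y)) powr p * (1 + norm y) powr (- b)) \<le> norm (norm (g (x - y)) powr p)"
  proof (rule AE_I2)
    fix y :: 'a
    have "(1 + norm y) powr (- b) \<le> 1" by (rule powr_weight_le_one[OF \<open>0 \<le> b\<close>])
    then show "norm (norm (g (x - y)) powr p * (1 + norm y) powr (- b)) \<le> norm (norm (g (x - y)) powr p)"
      by (simp add: mult_left_le)
  qed
qed simp

lemma peetre_small:
  fixes g \<Phi> :: "'a::euclidean_space \<Rightarrow> complex"
  assumes p: "0 < p" "p \<le> 1" and a: "0 \<le> a"
    and gm [measurable]: "g \<in> borel_measurable borel" and \<Phi>m [measurable]: "\<Phi> \<in> borel_measurable borel"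
    and rep: "\<And>w. norm (g w) \<le> (\<integral>x. norm (\<Phi> (w - x)) * norm (g x) \<partial>lborel)"
    and S: "0 < S" "\<And>z. (1 + norm z) powr a * norm (\<Phi> z) \<le> S"
    and bdd: "\<And>y. norm (g (x - y)) \<le> M * (1 + norm y) powr a"
    and i: "integrable lborel (\<lambda>x. norm (g x) powr p)"
  shows "norm (g (x - z)) \<le> S powr (1 / p) * (1 + norm z) powr a
    * (\<integral>y. norm (g (x - y)) powr p * (1 + norm y) powr (- (a * p)) \<partial>lborel) powr (1 / p)"
proof -
  define I where "I = (\<integral>y. norm (g (x - y)) powr p * (1 + norm y) powr (- (a * p)) \<partial>lborel)"
  have iI: "integrable lborel (\<lambda>y. norm (g (x - y)) powr p * (1 + norm y) powr (- (a * p)))"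
    using a p by (intro integrable_powr_weight gm i) simp
  have I0: "0 \<le> I" unfolding I_def by (intro integral_nonneg_AE) simp
  let ?q = "\<lambda>z. norm (g (x - z)) / (1 + norm z) powr a"
  have pos: "0 < (1 + norm (y :: 'a)) powr a" for y by (simp add: add_pos_nonneg less_imp_neq[THEN not_sym])
  define m where "m = (SUP z. ?q z)"
  have "bdd_above (range ?q)"
    using bdd pos by (intro bdd_aboveI[of _ M]) (auto simp: field_simps)
  then have qm: "?q z \<le> m" for z unfolding m_def by (intro cSUP_upper) auto
  have m0: "0 \<le> m" using qm[of 0] order_trans[OF _ qm[of 0]] by simp
  have gle: "norm (g (x - y)) \<le> m * (1 + norm y) powr a" for y
    using qm[of y] pos[of y] by (simp add: field_simps)
  have main: "m \<le> S powr (1 / p) * I powr (1 / p)"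
  proof (cases "m = 0")
    case False
    then have m: "0 < m" using m0 by simp
    have "?q z \<le> m powr (1 - p) * S * I" for z
    proof -
      have "norm (g (x - z)) \<le> (\<integral>x'. norm (\<Phi> (x - z - x')) * norm (g x') \<partial>lborel)" by (rule rep)
      also have "\<dots> = (\<integral>y. norm (\<Phi> (x - z - (x - y))) * norm (g (x - y)) \<partial>lborel)"
        by (rule lborel_integral_reflect[symmetric]) measurable
      also have "\<dots> \<le> (\<integral>y. (m powr (1 - p) * (1 + norm z) powr a * S) * (norm (g (x - y)) powr p * (1 + norm y) powr (- (a * p))) \<partial>lborel)"
      proof (rule integral_mono')
        show "integrable lborel (\<lambda>y. (m powr (1 - p) * (1 + norm z) powr a * S) * (norm (g (x - y)) powr p * (1 + norm y) powr (- (a * p))))"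
          by (intro integrable_mult_right iI)
        fix y :: 'a
        show "0 \<le> (m powr (1 - p) * (1 + norm z) powr a * S) * (norm (g (x - y)) powr p * (1 + norm y) powr (- (a * p)))"
          using S(1) by simp
        have e: "x - z - (x - y) = y - z" by simp
        have "norm (g (x - y)) = norm (g (x - y)) powr p * norm (g (x - y)) powr (1 - p)"
          by (cases "g (x - y) = 0") (simp_all flip: powr_add)
        also have "\<dots> \<le> norm (g (x - y)) powr p * (m * (1 + norm y) powr a) powr (1 - p)"
          using p gle[of y] by (intro mult_left_mono powr_mono2) auto
        also have "(m * (1 + norm y) powr a) powr (1 - p) = m powr (1 - p) * ((1 + norm y) powr a * (1 + norm y) powr (- (a * p)))"
          using m by (simp add: powr_mult powr_powr right_diff_distrib flip: powr_add)
        finally have "norm (\<Phi> (y - z)) * norm (g (x - y)) \<le>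
          norm (\<Phi> (y - z)) * (norm (g (x - y)) powr p * (m powr (1 - p) * ((1 + norm y) powr a * (1 + norm y) powr (- (a * p)))))"
          by (intro mult_left_mono) auto
        also have "\<dots> = ((1 + norm y) powr a * norm (\<Phi> (y - z))) * (m powr (1 - p) * (norm (g (x - y)) powr p * (1 + norm y) powr (- (a * p))))"
          by (simp only: mult_ac)
        also have "\<dots> \<le> ((1 + norm z) powr a * S) * (m powr (1 - p) * (norm (g (x - y)) powr p * (1 + norm y) powr (- (a * p))))"
        proof (rule mult_right_mono)
          have "(1 + norm y) powr a * norm (\<Phi> (y - z)) \<le> (1 + norm z) powr a * ((1 + norm (y - z)) powr a * norm (\<Phi> (y - z)))"
            unfolding mult.assoc[symmetric] by (intro mult_right_mono powr_weight_shift_le a) simp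
          also have "\<dots> \<le> (1 + norm z) powr a * S" by (intro mult_left_mono S) simp
          finally show "(1 + norm y) powr a * norm (\<Phi> (y - z)) \<le> (1 + norm z) powr a * S" .
        qed simp
        finally show "norm (\<Phi> (x - z - (x - y))) * norm (g (x - y)) \<le> (m powr (1 - p) * (1 + norm z) powr a * S) * (norm (g (x - y)) powr p * (1 + norm y) powr (- (a * p)))"
          unfolding e by (simp only: mult_ac)
      qed
      also have "\<dots> = (m powr (1 - p) * (1 + norm z) powr a * S) * I"
        unfolding I_def by (rule integral_mult_right_zero)
      finally show ?thesis using pos[of z] by (simp add: field_simps)
    qed
    then have "m \<le> m powr (1 - p) * S * I" unfolding m_def by (intro cSUP_least) auto
    then have "m powr p * m powr (1 - p) \<le> (S * I) * m powr (1 - p)"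
      using m by (simp add: mult_ac flip: powr_add)
    then have "m powr p \<le> S * I" using m by simp
    then have "(m powr p) powr (1 / p) \<le> (S * I) powr (1 / p)" using p m by (intro powr_mono2) auto
    then show ?thesis using m p S(1) I0 by (simp add: powr_powr powr_mult)
  qed simp
  have "norm (g (x - z)) \<le> m * (1 + norm z) powr a" by (rule gle)
  also have "\<dots> \<le> (S powr (1 / p) * I powr (1 / p)) * (1 + norm z) powr a"
    by (intro mult_right_mono main) simp
  finally show ?thesis unfolding I_def by (simp only: mult_ac)
qed

lemma peetre_large:
  fixes g \<Phi> :: "'a::euclidean_space \<Rightarrow> complex"
  assumes p: "1 \<le> p" and a: "0 \<le> a"
    and gm [measurable]: "g \<in> borel_measurable borel" and \<Phi>m [measurable]: "\<Phi> \<in> borel_measurable borel"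
    and rep: "\<And>w. norm (g w) \<le> (\<integral>x. norm (\<Phi> (w - x)) * norm (g x) \<partial>lborel)"
    and S: "0 < S" "\<And>z. (1 + norm z) powr a * norm (\<Phi> z) \<le> S"
    and J: "integrable lborel (\<lambda>z. (1 + norm z) powr a * norm (\<Phi> z))"
    and i: "integrable lborel (\<lambda>x. norm (g x) powr p)"
  shows "norm (g (x - z)) \<le> ((\<integral>z. (1 + norm z) powr a * norm (\<Phi> z) \<partial>lborel) + S) * (1 + norm z) powr a
    * (\<integral>y. norm (g (x - y)) powr p * (1 + norm y) powr (- (a * p)) \<partial>lborel) powr (1 / p)"
proof -
  define I where "I = (\<integral>y. norm (g (x - y)) powr p * (1 + norm y) powr (- (a * p)) \<partial>lborel)"
  define j where "j = (\<integral>z. (1 + norm z) powr a * norm (\<Phi> z) \<partial>lborel)"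
  have iI: "integrable lborel (\<lambda>y. norm (g (x - y)) powr p * (1 + norm y) powr (- (a * p)))"
    using a p by (intro integrable_powr_weight gm i) simp
  have I0: "0 \<le> I" unfolding I_def by (intro integral_nonneg_AE) simp
  have j0: "0 \<le> j" unfolding j_def by (intro integral_nonneg_AE) simp
  let ?m = "\<lambda>y. (1 + norm (y - z)) powr a * norm (\<Phi> (y - z))"
  have im: "integrable lborel ?m"
    using J lborel_integrable_translate[of "\<lambda>z. (1 + norm z) powr a * norm (\<Phi> z)" "- z"] by simp
  have jm: "(\<integral>y. ?m y \<partial>lborel) = j"
    using lborel_integral_translate[of "\<lambda>z. (1 + norm z) powr a * norm (\<Phi> z)" "- z"] by (simp add: j_def)
  have key: "norm (g (x - z)) \<le> (1 + norm z) powr a * (l * j + l powr (1 - p) * S * I)" if l: "0 < l" for l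
  proof -
    have "norm (g (x - z)) \<le> (\<integral>x'. norm (\<Phi> (x - z - x')) * norm (g x') \<partial>lborel)" by (rule rep)
    also have "\<dots> = (\<integral>y. norm (\<Phi> (x - z - (x - y))) * norm (g (x - y)) \<partial>lborel)"
      by (rule lborel_integral_reflect[symmetric]) measurable
    also have "\<dots> \<le> (\<integral>y. (1 + norm z) powr a * (l * ?m y + (l powr (1 - p) * S) * (norm (g (x - y)) powr p * (1 + norm y) powr (- (a * p)))) \<partial>lborel)"
    proof (rule integral_mono')
      show "integrable lborel (\<lambda>y. (1 + norm z) powr a * (l * ?m y + (l powr (1 - p) * S) * (norm (g (x - y)) powr p * (1 + norm y) powr (- (a * p)))))"
        by (intro integrable_mult_right Bochner_Integration.integrable_add iI im)
      fix y :: 'a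
      show "0 \<le> (1 + norm z) powr a * (l * ?m y + (l powr (1 - p) * S) * (norm (g (x - y)) powr p * (1 + norm y) powr (- (a * p))))"
        using S(1) l by (intro mult_nonneg_nonneg add_nonneg_nonneg) auto
      have e: "x - z - (x - y) = y - z" by simp
      define F where "F = norm (g (x - y)) * (1 + norm y) powr (- a)"
      have F0: "0 \<le> F" by (simp add: F_def)
      have Fp: "F powr p = norm (g (x - y)) powr p * (1 + norm y) powr (- (a * p))"
        by (simp add: F_def powr_mult powr_powr)
      have gF: "norm (g (x - y)) = F * (1 + norm y) powr a"
        using add_pos_nonneg[OF zero_less_one norm_ge_zero[of y]] by (simp add: F_def powr_minus)
      have Fle: "F * ?m y \<le> l * ?m y + (l powr (1 - p) * S) * F powr p"
      proof (cases "F \<le> l")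
        case True
        then have "F * ?m y \<le> l * ?m y" by (intro mult_right_mono) auto
        moreover have "0 \<le> (l powr (1 - p) * S) * F powr p" using S(1) by simp
        ultimately show ?thesis by linarith
      next
        case False
        then have F: "0 < F" "l \<le> F" using l by auto
        have "F = F powr p * F powr (1 - p)" using F by (simp flip: powr_add)
        also have "\<dots> \<le> F powr p * l powr (1 - p)"
          using F l p by (intro mult_left_mono powr_mono2') auto
        finally have "F * ?m y \<le> (F powr p * l powr (1 - p)) * S" using S F0 by (intro mult_mono) auto
        moreover have "0 \<le> l * ?m y" using l by simp
        ultimately show ?thesis by (simp add: mult_ac)
      qed
      have "norm (\<Phi> (y - z)) * norm (g (x - y)) = F * ((1 + norm y) powr a * norm (\<Phi> (y - z)))"
        unfolding gF by (simp only: mult_ac)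
      also have "\<dots> \<le> F * ((1 + norm z) powr a * (1 + norm (y - z)) powr a * norm (\<Phi> (y - z)))"
        using F0 by (intro mult_left_mono mult_right_mono powr_weight_shift_le a) auto
      also have "\<dots> = (1 + norm z) powr a * (F * ?m y)" by (simp only: mult_ac)
      also have "\<dots> \<le> (1 + norm z) powr a * (l * ?m y + (l powr (1 - p) * S) * F powr p)"
        by (intro mult_left_mono Fle) simp
      finally show "norm (\<Phi> (x - z - (x - y))) * norm (g (x - y)) \<le>
        (1 + norm z) powr a * (l * ?m y + (l powr (1 - p) * S) * (norm (g (x - y)) powr p * (1 + norm y) powr (- (a * p))))"
        unfolding e Fp .
    qed
    also have "\<dots> = (1 + norm z) powr a * (l * j + (l powr (1 - p) * S) * I)"
      using iI im by (simp add: I_def jm)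
    finally show ?thesis .
  qed
  have "norm (g (x - z)) \<le> (1 + norm z) powr a * ((j + S) * I powr (1 / p))"
  proof (cases "I = 0")
    case True
    have "norm (g (x - z)) \<le> 0"
    proof (rule field_le_epsilon)
      fix e :: real assume e: "0 < e"
      define K where "K = (1 + norm z) powr a * j + 1"
      have K: "0 < K" using j0 by (simp add: K_def add_nonneg_pos)
      have "norm (g (x - z)) \<le> (1 + norm z) powr a * (e / K * j)"
        using key[of "e / K"] e K True by simp
      also have "\<dots> \<le> e" using e K by (simp add: K_def field_simps)
      finally show "norm (g (x - z)) \<le> 0 + e" by simp
    qed
    then show ?thesis using j0 S(1) by (intro order_trans[OF _ mult_nonneg_nonneg]) auto
  next
    case False
    then have I: "0 < I" using I0 by simp
    have "(I powr (1 / p)) powr (1 - p) * I = I powr (1 / p)"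
    proof -
      have "(I powr (1 / p)) powr (1 - p) * I = I powr (1 / p * (1 - p)) * I powr 1"
        using I by (simp add: powr_powr)
      also have "\<dots> = I powr (1 / p * (1 - p) + 1)" by (simp only: powr_add)
      also have "1 / p * (1 - p) + 1 = 1 / p" using p by (simp add: field_simps)
      finally show ?thesis .
    qed
    then have "(I powr (1 / p)) powr (1 - p) * S * I = S * I powr (1 / p)" by (metis mult.assoc mult.commute)
    moreover have "0 < I powr (1 / p)" using I by simp
    ultimately show ?thesis using key[of "I powr (1 / p)"] by (simp only: distrib_right mult.commute[of _ j])
  qed
  then show ?thesis by (simp only: I_def j_def mult_ac)
qed

definition reproduced_by :: "('a::euclidean_space \<Rightarrow> complex) \<Rightarrow> ('a \<Rightarrow> complex) \<Rightarrow> bool" where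
  "reproduced_by \<Phi> g \<longleftrightarrow> continuous_on UNIV g \<and> (\<exists>N C. \<forall>x. norm (g x) \<le> C * (1 + norm x) ^ N) \<and>
     (\<forall>w. norm (g w) \<le> (\<integral>x. norm (\<Phi> (w - x)) * norm (g x) \<partial>lborel))"

text \<open>For \<open>p \<le> 1\<close> the maximal function has to be finite before it can be absorbed. This is known only
  for an exponent dominating the growth of \<open>g\<close>; that case shows that \<open>g\<close> is bounded, after which every
  exponent is admissible.\<close>

theorem peetre:
  fixes \<Phi> :: "'a::euclidean_space \<Rightarrow> complex"
  assumes m: "\<Phi> \<in> borel_measurable borel" and \<Phi>: "rapidly_decreasing \<Phi>" and p: "0 < p" and a: "0 \<le> a"
  shows "\<exists>C>0. \<forall>g. reproduced_by \<Phi> g \<longrightarrow> integrable lborel (\<lambda>x. norm (g x) powr p) \<longrightarrow>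
    (\<forall>x z. norm (g (x - z)) \<le> C * (1 + norm z) powr a
      * (\<integral>y. norm (g (x - y)) powr p * (1 + norm y) powr (- (a * p)) \<partial>lborel) powr (1 / p))"
proof -
  obtain S where S: "0 < S" "\<And>z. (1 + norm z) powr a * norm (\<Phi> z) \<le> S"
    using rapidly_decreasing_powr_bound(1)[OF m \<Phi>, of a] by blast
  note J = rapidly_decreasing_powr_bound(2)[OF m \<Phi>, of a]
  show ?thesis
  proof (cases "p \<le> 1")
    case False
    define j where "j = (\<integral>z. (1 + norm z) powr a * norm (\<Phi> z) \<partial>lborel)"
    have "0 \<le> j" unfolding j_def by (intro integral_nonneg_AE) simp
    then have "0 < j + S" using S(1) by simp
    moreover have "norm (g (x - z)) \<le> (j + S) * (1 + norm z) powr a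
      * (\<integral>y. norm (g (x - y)) powr p * (1 + norm y) powr (- (a * p)) \<partial>lborel) powr (1 / p)"
      if g: "reproduced_by \<Phi> g" and i: "integrable lborel (\<lambda>x. norm (g x) powr p)" for g x z
      unfolding j_def
      by (rule peetre_large[OF _ a _ m _ S J i])
        (use False g in \<open>auto simp: reproduced_by_def intro: borel_measurable_continuous_onI\<close>)
    ultimately show ?thesis by blast
  next
    case True
    have "norm (g (x - z)) \<le> S powr (1 / p) * (1 + norm z) powr a
      * (\<integral>y. norm (g (x - y)) powr p * (1 + norm y) powr (- (a * p)) \<partial>lborel) powr (1 / p)"
      if g: "reproduced_by \<Phi> g" and i: "integrable lborel (\<lambda>x. norm (g x) powr p)" for g x z
    proof -
      have gm: "g \<in> borel_measurable borel" using g by (auto simp: reproduced_by_def intro: borel_measurable_continuous_onI)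
      have rep: "\<And>w. norm (g w) \<le> (\<integral>x. norm (\<Phi> (w - x)) * norm (g x) \<partial>lborel)"
        using g by (simp add: reproduced_by_def)
      obtain N C where C: "\<And>x. norm (g x) \<le> C * (1 + norm x) ^ N"
        using g unfolding reproduced_by_def by blast
      have C0: "0 \<le> C" using order_trans[OF norm_ge_zero C[of 0]] by simp
      obtain S' where S': "0 < S'" "\<And>z. (1 + norm z) powr real N * norm (\<Phi> z) \<le> S'"
        using rapidly_decreasing_powr_bound(1)[OF m \<Phi>, of "real N"] by blast
      have bdd: "norm (g (x - y)) \<le> (C * (1 + norm x) ^ N) * (1 + norm y) powr real N" for x y
      proof -
        have "norm (g (x - y)) \<le> C * (1 + norm (x - y)) ^ N" by (rule C)
        also have "\<dots> \<le> C * ((1 + norm x) * (1 + norm y)) ^ N"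
        proof (intro mult_left_mono power_mono C0)
          have "1 + norm (x - y) \<le> 1 + norm x + norm y" using norm_triangle_ineq4[of x y] by simp
          also have "\<dots> \<le> (1 + norm x) * (1 + norm y)" by (simp add: algebra_simps)
          finally show "1 + norm (x - y) \<le> (1 + norm x) * (1 + norm y)" .
        qed simp
        also have "\<dots> = (C * (1 + norm x) ^ N) * (1 + norm y) powr real N"
          using add_pos_nonneg[OF zero_less_one norm_ge_zero[of y]] by (simp add: powr_realpow power_mult_distrib)
        finally show ?thesis .
      qed
      define G where "G = S' powr (1 / p) * (\<integral>x. norm (g x) powr p \<partial>lborel) powr (1 / p)"
      have gG: "norm (g x) \<le> G" for x
      proof -
        have "norm (g (x - 0)) \<le> S' powr (1 / p) * (1 + norm (0 :: 'a)) powr real N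
          * (\<integral>y. norm (g (x - y)) powr p * (1 + norm y) powr (- (real N * p)) \<partial>lborel) powr (1 / p)"
          by (rule peetre_small[OF p True of_nat_0_le_iff gm m rep S' bdd i])
        also have "\<dots> \<le> S' powr (1 / p) * (\<integral>y. norm (g (x - y)) powr p \<partial>lborel) powr (1 / p)"
        proof -
          have "(\<integral>y. norm (g (x - y)) powr p * (1 + norm y) powr (- (real N * p)) \<partial>lborel) \<le> (\<integral>y. norm (g (x - y)) powr p \<partial>lborel)"
          proof (rule integral_mono')
            show "integrable lborel (\<lambda>y. norm (g (x - y)) powr p)"
              using i gm by (subst lborel_integrable_reflect[of "\<lambda>y. norm (g y) powr p"]) simp_all
            fix y :: 'a
            have "(1 + norm y) powr (- (real N * p)) \<le> 1" using p by (intro powr_weight_le_one) simp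
            then show "norm (g (x - y)) powr p * (1 + norm y) powr (- (real N * p)) \<le> norm (g (x - y)) powr p"
              by (simp add: mult_left_le)
          qed simp
          moreover have "0 \<le> (\<integral>y. norm (g (x - y)) powr p * (1 + norm y) powr (- (real N * p)) \<partial>lborel)"
            by (intro integral_nonneg_AE) simp
          ultimately show ?thesis using p by (simp add: mult_left_mono powr_mono2)
        qed
        also have "(\<integral>y. norm (g (x - y)) powr p \<partial>lborel) = (\<integral>y. norm (g y) powr p \<partial>lborel)"
          using gm by (intro lborel_integral_reflect) measurable
        finally show ?thesis by (simp add: G_def)
      qed
      have bdd': "norm (g (x - y)) \<le> G * (1 + norm y) powr a" for y
      proof -
        have "0 \<le> G" using order_trans[OF norm_ge_zero gG[of 0]] .
        moreover have "1 \<le> (1 + norm y) powr a" using a by (intro ge_one_powr_ge_zero) auto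
        ultimately have "G * 1 \<le> G * (1 + norm y) powr a" by (intro mult_left_mono)
        with gG[of "x - y"] show ?thesis by simp
      qed
      show ?thesis by (rule peetre_small[OF p True a gm m rep S bdd' i])
    qed
    moreover have "0 < S powr (1 / p)" using S(1) by simp
    ultimately show ?thesis by blast
  qed
qed

section \<open>Restriction of band-limited functions to a hyperplane\<close>

lemma tensor_Pair:
  "tensor h (y :: 'a::euclidean_space, t :: real) = tensor (\<lambda>b. h (b, 0)) y * h (0, 1) t"
proof -
  have "tensor h (y, t) = (\<Prod>b\<in>(\<lambda>u. (u, 0)) ` Basis \<union> (\<lambda>v. (0, v)) ` Basis. h b ((y, t) \<bullet> b))"
    by (simp add: tensor_def Basis_prod_def)
  also have "\<dots> = (\<Prod>b\<in>(\<lambda>u. (u, 0)) ` Basis. h b ((y, t) \<bullet> b)) * (\<Prod>b\<in>(\<lambda>v. (0, v)) ` (Basis :: real set). h b ((y, t) \<bullet> b))"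
    by (intro prod.union_disjoint) (auto simp: nonzero_Basis)
  also have "(\<Prod>b\<in>(\<lambda>u. (u, 0 :: real)) ` (Basis :: 'a set). h b ((y, t) \<bullet> b)) = tensor (\<lambda>b. h (b, 0)) y"
    unfolding tensor_def by (subst prod.reindex) (auto simp: inj_on_def)
  also have "(\<Prod>b\<in>(\<lambda>v. (0 :: 'a, v)) ` (Basis :: real set). h b ((y, t) \<bullet> b)) = h (0, 1) t" by simp
  finally show ?thesis .
qed

lemma cutoff_kernel_Pair:
  "cutoff_kernel \<eta> (k, l) (y :: 'a::euclidean_space, t :: real) = cutoff_kernel \<eta> k y * ift (\<lambda>\<xi>. \<eta> (\<xi> - l)) 0 t"
  by (simp add: cutoff_kernel_def tensor_Pair)

lemma norm_cutoff_kernel: "cutoff \<eta> \<Longrightarrow> norm (cutoff_kernel \<eta> k x) = norm (cutoff_kernel \<eta> 0 x)"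
  by (subst cutoff_kernel_modulate) (simp_all add: norm_mult)

lemma norm_window_kernel: "cutoff \<eta> \<Longrightarrow> norm (window_kernel \<eta> k x) = norm (window_kernel \<eta> 0 x)"
  by (subst window_kernel_modulate) (simp_all add: norm_mult)

lemma box_reproduced_by:
  assumes \<eta>: "cutoff \<eta>" and k: "k \<in> int_lattice" and f: "f \<in> tempered_distributions"
  shows "reproduced_by (cutoff_kernel \<eta> 0) (box \<eta> k f)"
  unfolding reproduced_by_def
proof (intro conjI allI)
  show "continuous_on UNIV (box \<eta> k f)" by (rule box_continuous[OF \<eta> k f])
  show "\<exists>N C. \<forall>x. norm (box \<eta> k f x) \<le> C * (1 + norm x) ^ N" by (rule box_growth[OF \<eta> k f])
  fix w
  have "norm (box \<eta> k f w) \<le> (\<integral>x. norm (cutoff_kernel \<eta> k (w - x) * box \<eta> k f x) \<partial>lborel)"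
    by (subst box_reproduce[OF \<eta> k f]) (rule integral_norm_bound)
  then show "norm (box \<eta> k f w) \<le> (\<integral>x. norm (cutoff_kernel \<eta> 0 (w - x)) * norm (box \<eta> k f x) \<partial>lborel)"
    by (simp only: norm_mult norm_cutoff_kernel[OF \<eta>, of k])
qed

lemma kernel_measurable:
  assumes "cutoff \<eta>"
  shows "cutoff_kernel \<eta> k \<in> borel_measurable borel" "window_kernel \<eta> k \<in> borel_measurable borel"
  using schwartz_measurable cutoff_kernel_schwartz[OF assms] window_kernel_schwartz[OF assms] by blast+

lemma kernel_rapidly_decreasing:
  assumes "cutoff \<eta>"
  shows "rapidly_decreasing (cutoff_kernel \<eta> k)" "rapidly_decreasing (window_kernel \<eta> k)"
  using schwartz_rapidly_decreasing cutoff_kernel_schwartz[OF assms] window_kernel_schwartz[OF assms] by blast+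

lemma nn_integral_lborel_Pair:
  fixes F :: "'a::euclidean_space \<times> real \<Rightarrow> ennreal"
  assumes [measurable]: "F \<in> borel_measurable borel"
  shows "(\<integral>\<^sup>+z. F z \<partial>lborel) = (\<integral>\<^sup>+x. \<integral>\<^sup>+t. F (x, t) \<partial>lborel \<partial>lborel)"
proof -
  have "(\<integral>\<^sup>+x. \<integral>\<^sup>+t. F (x, t) \<partial>(lborel :: real measure) \<partial>(lborel :: 'a measure)) = (\<integral>\<^sup>+z. F z \<partial>(lborel \<Otimes>\<^sub>M lborel))"
    by (rule lborel.nn_integral_fst) (simp add: lborel_prod)
  then show ?thesis by (simp add: lborel_prod)
qed

lemma nn_integral_swap_lborel:
  fixes F :: "'a::euclidean_space \<Rightarrow> 'b::euclidean_space \<Rightarrow> ennreal"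
  assumes "(\<lambda>(x, y). F x y) \<in> borel_measurable borel"
  shows "(\<integral>\<^sup>+x. \<integral>\<^sup>+y. F x y \<partial>lborel \<partial>lborel) = (\<integral>\<^sup>+y. \<integral>\<^sup>+x. F x y \<partial>lborel \<partial>lborel)"
proof -
  have psf: "pair_sigma_finite (lborel :: 'a measure) (lborel :: 'b measure)" ..
  show ?thesis
    by (rule pair_sigma_finite.Fubini'[OF psf, symmetric]) (use assms in \<open>simp add: lborel_prod\<close>)
qed

lemma nn_integral_hyperplane_average:
  fixes g :: "'a::euclidean_space \<times> real \<Rightarrow> complex"
  assumes [measurable]: "g \<in> borel_measurable borel" and b: "0 \<le> b"
  shows "(\<integral>\<^sup>+x. \<integral>\<^sup>+y. ennreal (norm (g ((x, 0) - y)) powr p * (1 + norm y) powr (- b)) \<partial>lborel \<partial>lborel)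
    \<le> (\<integral>\<^sup>+y. ennreal ((1 + norm (y :: 'a)) powr (- b)) \<partial>lborel) * (\<integral>\<^sup>+z. ennreal (norm (g z) powr p) \<partial>lborel)"
proof -
  let ?w = "\<lambda>y :: 'a. ennreal ((1 + norm y) powr (- b))" and ?G = "\<lambda>z. ennreal (norm (g z) powr p)"
  have "(\<integral>\<^sup>+x. \<integral>\<^sup>+y. ennreal (norm (g ((x, 0) - y)) powr p * (1 + norm y) powr (- b)) \<partial>lborel \<partial>lborel)
    = (\<integral>\<^sup>+x. \<integral>\<^sup>+y. \<integral>\<^sup>+t. ennreal (norm (g ((x, 0) - (y, t))) powr p * (1 + norm (y, t)) powr (- b)) \<partial>lborel \<partial>lborel \<partial>lborel)"
    by (intro nn_integral_cong nn_integral_lborel_Pair) measurable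
  also have "\<dots> \<le> (\<integral>\<^sup>+x. \<integral>\<^sup>+y. \<integral>\<^sup>+t. ?w y * ?G (x - y, - t) \<partial>lborel \<partial>lborel \<partial>lborel)"
  proof (intro nn_integral_mono)
    fix x y :: 'a and t :: real
    have "norm y \<le> norm (y, t)" by (metis fst_conv norm_fst_le)
    then have "(1 + norm (y, t)) powr (- b) \<le> (1 + norm y) powr (- b)"
      using b by (intro powr_mono2') (auto simp: add_pos_nonneg)
    then have "norm (g (x - y, - t)) powr p * (1 + norm (y, t)) powr (- b) \<le> (1 + norm y) powr (- b) * norm (g (x - y, - t)) powr p"
      by (subst mult.commute) (intro mult_right_mono, simp_all)
    then show "ennreal (norm (g ((x, 0) - (y, t))) powr p * (1 + norm (y, t)) powr (- b)) \<le> ?w y * ?G (x - y, - t)"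
      by (simp add: ennreal_leI flip: ennreal_mult)
  qed
  also have "\<dots> = (\<integral>\<^sup>+x. \<integral>\<^sup>+y. ?w y * (\<integral>\<^sup>+t. ?G (x - y, t) \<partial>lborel) \<partial>lborel \<partial>lborel)"
  proof (intro nn_integral_cong)
    fix x y :: 'a
    have "(\<integral>\<^sup>+t. ?w y * ?G (x - y, - t) \<partial>lborel) = ?w y * (\<integral>\<^sup>+t. ?G (x - y, - t) \<partial>lborel)"
      by (rule nn_integral_cmult) measurable
    also have "(\<integral>\<^sup>+t. ?G (x - y, - t) \<partial>lborel) = (\<integral>\<^sup>+t. ?G (x - y, t) \<partial>lborel)"
      using lborel_nn_integral_reflect[of "\<lambda>t. ?G (x - y, t)" 0] by simp
    finally show "(\<integral>\<^sup>+t. ?w y * ?G (x - y, - t) \<partial>lborel) = ?w y * (\<integral>\<^sup>+t. ?G (x - y, t) \<partial>lborel)" .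
  qed
  also have "\<dots> = (\<integral>\<^sup>+y. \<integral>\<^sup>+x. ?w y * (\<integral>\<^sup>+t. ?G (x - y, t) \<partial>lborel) \<partial>lborel \<partial>lborel)"
    by (rule nn_integral_swap_lborel) (simp add: borel_prod[symmetric] case_prod_beta, measurable)
  also have "\<dots> = (\<integral>\<^sup>+y. ?w y * (\<integral>\<^sup>+x. \<integral>\<^sup>+t. ?G (x, t) \<partial>lborel \<partial>lborel) \<partial>lborel)"
  proof (intro nn_integral_cong)
    fix y :: 'a
    have "(\<integral>\<^sup>+x. ?w y * (\<integral>\<^sup>+t. ?G (x - y, t) \<partial>lborel) \<partial>lborel) = ?w y * (\<integral>\<^sup>+x. \<integral>\<^sup>+t. ?G (x - y, t) \<partial>lborel \<partial>lborel)"
      by (rule nn_integral_cmult) measurable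
    also have "(\<integral>\<^sup>+x. \<integral>\<^sup>+t. ?G (x - y, t) \<partial>lborel \<partial>lborel) = (\<integral>\<^sup>+x. \<integral>\<^sup>+t. ?G (x, t) \<partial>lborel \<partial>lborel)"
      using lborel_nn_integral_translate[of "\<lambda>x. \<integral>\<^sup>+t. ?G (x, t) \<partial>lborel" "- y"] by simp
    finally show "(\<integral>\<^sup>+x. ?w y * (\<integral>\<^sup>+t. ?G (x - y, t) \<partial>lborel) \<partial>lborel) = ?w y * (\<integral>\<^sup>+x. \<integral>\<^sup>+t. ?G (x, t) \<partial>lborel \<partial>lborel)" .
  qed
  also have "\<dots> = (\<integral>\<^sup>+y. ?w y \<partial>lborel) * (\<integral>\<^sup>+x. \<integral>\<^sup>+t. ?G (x, t) \<partial>lborel \<partial>lborel)"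
    by (rule nn_integral_multc) measurable
  also have "(\<integral>\<^sup>+x. \<integral>\<^sup>+t. ?G (x, t) \<partial>lborel \<partial>lborel) = (\<integral>\<^sup>+z. ?G z \<partial>lborel)"
    by (rule nn_integral_lborel_Pair[symmetric]) measurable
  finally show ?thesis .
qed

lemma nn_integral_powr_weight_finite:
  "(\<integral>\<^sup>+y. ennreal ((1 + norm (y :: 'a::euclidean_space)) powr (- real (2 * DIM('a)))) \<partial>lborel) < \<infinity>"
proof -
  have eq: "(1 + norm y) powr (- real (2 * DIM('a))) = inverse ((1 + norm y) ^ (2 * DIM('a)))" for y :: 'a
    using add_pos_nonneg[OF zero_less_one norm_ge_zero[of y]] unfolding powr_minus by (subst powr_realpow) auto
  have "(\<integral>\<^sup>+y. ennreal (inverse ((1 + norm (y :: 'a)) ^ (2 * DIM('a)))) \<partial>lborel) = ennreal (\<integral>y. inverse ((1 + norm (y :: 'a)) ^ (2 * DIM('a))) \<partial>lborel)"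
    by (intro nn_integral_eq_integral integrable_weight) auto
  then show ?thesis unfolding eq by simp
qed

definition slice_conv :: "(real \<Rightarrow> real) \<Rightarrow> 'a::euclidean_space \<Rightarrow> ('a \<times> real \<Rightarrow> complex) \<Rightarrow> 'a \<Rightarrow> complex" where
  "slice_conv \<eta> j g x = (\<integral>y. g (y, 0) * window_kernel \<eta> j (x - y) \<partial>lborel)"

lemma slice_conv_measurable:
  assumes \<eta>: "cutoff \<eta>" and g: "continuous_on UNIV (g :: 'a::euclidean_space \<times> real \<Rightarrow> complex)"
  shows "slice_conv \<eta> j g \<in> borel_measurable borel"
proof -
  note [measurable] = kernel_measurable[OF \<eta>]
  have [measurable]: "(\<lambda>y. g (y, 0)) \<in> borel_measurable borel"
    by (intro borel_measurable_continuous_onI continuous_on_compose2[OF g] continuous_intros) auto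
  show ?thesis unfolding slice_conv_def[abs_def] by measurable
qed

lemma slice_conv_pointwise:
  assumes \<eta>: "cutoff \<eta>" and g: "continuous_on UNIV (g :: 'a::euclidean_space \<times> real \<Rightarrow> complex)" and a: "0 \<le> a" and B0: "0 \<le> B"
    and le: "\<And>z. norm (g ((x, 0) - (z, 0))) \<le> B * (1 + norm z) powr a"
  shows "norm (slice_conv \<eta> j g x) \<le> B * (\<integral>z. (1 + norm z) powr a * norm (window_kernel \<eta> 0 (z :: 'a)) \<partial>lborel)"
    and "integrable lborel (\<lambda>y. g (y, 0) * window_kernel \<eta> j (x - y))"
proof -
  have [measurable]: "g \<in> borel_measurable borel" by (rule borel_measurable_continuous_onI[OF g])
  note [measurable] = kernel_measurable[OF \<eta>]
  have [measurable]: "(\<lambda>y. g (y, 0)) \<in> borel_measurable borel"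
    by (intro borel_measurable_continuous_onI continuous_on_compose2[OF g] continuous_intros) auto
  note J = rapidly_decreasing_powr_bound(2)[OF kernel_measurable(2)[OF \<eta>] kernel_rapidly_decreasing(2)[OF \<eta>], of a 0]
  have bound: "norm (g (x - z, 0) * window_kernel \<eta> j z) \<le> B * ((1 + norm z) powr a * norm (window_kernel \<eta> 0 z))" for z
  proof -
    have "norm (g (x - z, 0)) * norm (window_kernel \<eta> 0 z) \<le> (B * (1 + norm z) powr a) * norm (window_kernel \<eta> 0 z)"
      using le[of z] by (intro mult_right_mono) simp_all
    then show ?thesis by (simp only: norm_mult norm_window_kernel[OF \<eta>, of j] mult.assoc)
  qed
  have i: "integrable lborel (\<lambda>z. g (x - z, 0) * window_kernel \<eta> j z)"
  proof (rule Bochner_Integration.integrable_bound[OF integrable_mult_right[OF J, of B]])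
    show "AE z in lborel. norm (g (x - z, 0) * window_kernel \<eta> j z) \<le> norm (B * ((1 + norm z) powr a * norm (window_kernel \<eta> 0 z)))"
      using bound B0 by (intro AE_I2) (simp add: abs_mult)
  qed measurable
  have e: "(\<lambda>z. g (x - z, 0) * window_kernel \<eta> j z) = (\<lambda>z. (\<lambda>y. g (y, 0) * window_kernel \<eta> j (x - y)) (x - z))" by simp
  have m: "(\<lambda>y. g (y, 0) * window_kernel \<eta> j (x - y)) \<in> borel_measurable borel" by measurable
  show "integrable lborel (\<lambda>y. g (y, 0) * window_kernel \<eta> j (x - y))"
    using i unfolding e lborel_integrable_reflect[OF m] .
  have "slice_conv \<eta> j g x = (\<integral>z. g (x - z, 0) * window_kernel \<eta> j z \<partial>lborel)"
    unfolding slice_conv_def e by (rule lborel_integral_reflect[OF m, symmetric])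
  then have "norm (slice_conv \<eta> j g x) \<le> (\<integral>z. norm (g (x - z, 0) * window_kernel \<eta> j z) \<partial>lborel)"
    by (simp only: integral_norm_bound)
  also have "\<dots> \<le> (\<integral>z. B * ((1 + norm z) powr a * norm (window_kernel \<eta> 0 (z :: 'a))) \<partial>lborel)"
    by (intro integral_mono integrable_norm[OF i] integrable_mult_right[OF J] bound)
  finally show "norm (slice_conv \<eta> j g x) \<le> B * (\<integral>z. (1 + norm z) powr a * norm (window_kernel \<eta> 0 (z :: 'a)) \<partial>lborel)"
    by simp
qed

lemma ennpowr_powr:
  assumes "0 < r" "0 \<le> x"
  shows "ennpowr (ennreal x) r = ennreal (x powr r)"
  using assms by (simp add: ennpowr_def)

lemma ennpowr_mono:
  assumes "a \<le> b" "0 < r"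
  shows "ennpowr a r \<le> ennpowr b r"
proof (cases "b = \<infinity>")
  case False
  then have fin: "a \<noteq> \<infinity>" "b \<noteq> \<infinity>" using assms(1) by (auto simp: top_unique)
  then have "enn2real a \<le> enn2real b" using assms(1) by (intro enn2real_mono) (auto simp: less_top)
  then show ?thesis using fin assms(2) by (simp add: ennpowr_def ennreal_leI powr_mono2)
qed (simp add: ennpowr_def)

lemma continuous_le_esssup:
  fixes g :: "'a::euclidean_space \<Rightarrow> complex"
  assumes g: "continuous_on UNIV g"
  shows "ennreal (norm (g x)) \<le> esssup lborel (\<lambda>x. ennreal (norm (g x)))"
proof (rule ccontr)
  let ?E = "esssup lborel (\<lambda>x. ennreal (norm (g x)))"
  assume "\<not> ennreal (norm (g x)) \<le> ?E"
  then have lt: "?E < ennreal (norm (g x))" by simp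
  define e where "e = enn2real ?E"
  have E: "?E = ennreal e" using lt unfolding e_def by (metis ennreal_enn2real less_top top.not_eq_extremum order_less_trans ennreal_less_top)
  have e0: "0 \<le> e" by (simp add: e_def)
  have op: "open {y. e < norm (g y)}" using g by (intro open_Collect_less continuous_intros) auto
  have [measurable]: "g \<in> borel_measurable borel" by (rule borel_measurable_continuous_onI[OF g])
  have "AE y in lborel. ennreal (norm (g y)) \<le> ?E" by (rule esssup_AE) measurable
  then have "AE y in lborel. y \<notin> {y. e < norm (g y)}"
    unfolding E by eventually_elim (use e0 in \<open>simp add: ennreal_le_iff\<close>)
  moreover have "{y. e < norm (g y)} \<in> sets lborel" using op by simp
  ultimately have "{y. e < norm (g y)} \<in> null_sets lborel" by (simp add: AE_iff_null_sets)
  then have "negligible {y. e < norm (g y)}" by (simp add: negligible_iff_null_sets null_sets_completionI)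
  moreover have "x \<in> {y. e < norm (g y)}" using lt e0 unfolding E by (simp add: ennreal_less_iff)
  ultimately show False using open_not_negligible[OF op] by blast
qed

lemma Lp_norm_finite_exponent:
  fixes g :: "'a::euclidean_space \<Rightarrow> complex"
  assumes p: "0 < p" "p \<noteq> \<infinity>" and gm [measurable]: "g \<in> borel_measurable borel" and fin: "Lp_norm p g < \<infinity>"
  shows "integrable lborel (\<lambda>x. norm (g x) powr enn2real p)"
    and "Lp_norm p g = ennreal ((\<integral>x. norm (g x) powr enn2real p \<partial>lborel) powr (1 / enn2real p))"
proof -
  have r: "0 < enn2real p" using p by (simp add: enn2real_positive_iff less_top)
  have "(\<integral>\<^sup>+x. ennreal (norm (g x) powr enn2real p) \<partial>lborel) \<noteq> \<infinity>"
    using fin p by (auto simp: Lp_norm_def ennpowr_def split: if_splits)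
  then show i: "integrable lborel (\<lambda>x. norm (g x) powr enn2real p)"
    by (intro integrableI_bounded) (simp_all add: less_top)
  have "(\<integral>\<^sup>+x. ennreal (norm (g x) powr enn2real p) \<partial>lborel) = ennreal (\<integral>x. norm (g x) powr enn2real p \<partial>lborel)"
    by (intro nn_integral_eq_integral i) simp
  then show "Lp_norm p g = ennreal ((\<integral>x. norm (g x) powr enn2real p \<partial>lborel) powr (1 / enn2real p))"
    using p r by (simp add: Lp_norm_def ennpowr_powr)
qed

text \<open>The bound is uniform in \<open>j\<close> because the kernels of different frequencies differ by a
  unimodular factor.\<close>

theorem slice_conv_Lp:
  fixes \<eta> :: "real \<Rightarrow> real" and p :: ennreal
  assumes \<eta>: "cutoff \<eta>" and p: "0 < p"
  shows "\<exists>C>0. \<forall>g :: 'a::euclidean_space \<times> real \<Rightarrow> complex. reproduced_by (cutoff_kernel \<eta> 0) g \<longrightarrow> Lp_norm p g < \<infinity> \<longrightarrow>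
    (\<forall>j. Lp_norm p (slice_conv \<eta> j g) \<le> ennreal C * Lp_norm p g) \<and> (\<forall>x. norm (g x) \<le> C * enn2real (Lp_norm p g))"
proof (cases "p = \<infinity>")
  case True
  define J where "J = (\<integral>z. (1 + norm z) powr 0 * norm (window_kernel \<eta> 0 (z :: 'a)) \<partial>lborel)"
  have J0: "0 \<le> J" unfolding J_def by (intro integral_nonneg_AE) simp
  show ?thesis
  proof (intro exI[of _ "J + 1"] conjI allI impI)
    fix g :: "'a \<times> real \<Rightarrow> complex" and j x
    assume rg: "reproduced_by (cutoff_kernel \<eta> 0) g" and fin: "Lp_norm p g < \<infinity>"
    have cg: "continuous_on UNIV g" using rg by (simp add: reproduced_by_def)
    define A where "A = enn2real (Lp_norm p g)"
    have A: "Lp_norm p g = ennreal A" using fin by (simp add: A_def less_top)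
    have A0: "0 \<le> A" by (simp add: A_def)
    have gA: "norm (g x) \<le> A" for x
      using continuous_le_esssup[OF cg, of x] A A0 True by (simp add: Lp_norm_def ennreal_le_iff)
    then have "norm (g x) \<le> A * 1" by simp
    also have "\<dots> \<le> A * (J + 1)" using A0 J0 by (intro mult_left_mono) auto
    finally show "norm (g x) \<le> (J + 1) * enn2real (Lp_norm p g)" by (simp add: A_def mult.commute)
    have sc: "norm (slice_conv \<eta> j g x) \<le> A * (J + 1)" for x
    proof -
      have "norm (slice_conv \<eta> j g x) \<le> A * J" unfolding J_def
      proof (rule slice_conv_pointwise(1)[OF \<eta> cg order_refl A0])
        fix z show "norm (g ((x, 0) - (z, 0))) \<le> A * (1 + norm z) powr 0"
          using gA[of "(x, 0) - (z, 0)"] add_pos_nonneg[OF zero_less_one norm_ge_zero[of z]] by simp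
      qed
      also have "\<dots> \<le> A * (J + 1)" using A0 by (intro mult_left_mono) auto
      finally show ?thesis .
    qed
    have "Lp_norm p (slice_conv \<eta> j g) \<le> ennreal (A * (J + 1))"
    proof -
      note [measurable] = slice_conv_measurable[OF \<eta> cg, of j]
      have "esssup lborel (\<lambda>x. ennreal (norm (slice_conv \<eta> j g x))) \<le> ennreal (A * (J + 1))"
        by (rule esssup_I) (measurable, intro AE_I2 ennreal_leI sc)
      then show ?thesis using True by (simp add: Lp_norm_def)
    qed
    also have "\<dots> = ennreal (J + 1) * Lp_norm p g" unfolding A using A0 J0 by (subst ennreal_mult[symmetric]) (simp_all add: mult.commute)
    finally show "Lp_norm p (slice_conv \<eta> j g) \<le> ennreal (J + 1) * Lp_norm p g" .
  qed (use J0 in auto)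
next
  case False
  define r where "r = enn2real p"
  have r: "0 < r" using p False by (simp add: r_def enn2real_positive_iff less_top)
  define a where "a = real (2 * DIM('a)) / r"
  have a: "0 \<le> a" "a * r = real (2 * DIM('a))" using r by (simp_all add: a_def)
  obtain C where C: "0 < C" and peetre: "\<And>g x z. reproduced_by (cutoff_kernel \<eta> 0) (g :: 'a \<times> real \<Rightarrow> complex) \<Longrightarrow>
      integrable lborel (\<lambda>x. norm (g x) powr r) \<Longrightarrow>
      norm (g (x - z)) \<le> C * (1 + norm z) powr a
        * (\<integral>y. norm (g (x - y)) powr r * (1 + norm y) powr (- (a * r)) \<partial>lborel) powr (1 / r)"
    using peetre[OF kernel_measurable(1)[OF \<eta>] kernel_rapidly_decreasing(1)[OF \<eta>] r a(1), of 0] by blast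
  define J where "J = (\<integral>z. (1 + norm z) powr a * norm (window_kernel \<eta> 0 (z :: 'a)) \<partial>lborel)"
  have J0: "0 \<le> J" unfolding J_def by (intro integral_nonneg_AE) simp
  define W where "W = enn2real (\<integral>\<^sup>+y. ennreal ((1 + norm (y :: 'a)) powr (- (a * r))) \<partial>lborel)"
  have W: "(\<integral>\<^sup>+y. ennreal ((1 + norm (y :: 'a)) powr (- (a * r))) \<partial>lborel) = ennreal W"
    unfolding W_def a(2) using nn_integral_powr_weight_finite[where 'a='a] by (simp add: less_top)
  have W0: "0 \<le> W" by (simp add: W_def)
  define D where "D = C * J * W powr (1 / r) + C"
  have D0: "0 < D" using C J0 by (simp add: D_def add_nonneg_pos)
  show ?thesis
  proof (intro exI[of _ D] conjI allI impI D0)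
    fix g :: "'a \<times> real \<Rightarrow> complex" and j x
    assume rg: "reproduced_by (cutoff_kernel \<eta> 0) g" and fin: "Lp_norm p g < \<infinity>"
    have cg: "continuous_on UNIV g" using rg by (simp add: reproduced_by_def)
    have gm [measurable]: "g \<in> borel_measurable borel" by (rule borel_measurable_continuous_onI[OF cg])
    have i: "integrable lborel (\<lambda>x. norm (g x) powr r)"
      and A: "Lp_norm p g = ennreal ((\<integral>x. norm (g x) powr r \<partial>lborel) powr (1 / r))"
      using Lp_norm_finite_exponent[OF p False gm fin] by (simp_all add: r_def)
    define G where "G = (\<integral>x. norm (g x) powr r \<partial>lborel)"
    have G0: "0 \<le> G" unfolding G_def by (intro integral_nonneg_AE) simp
    define I where "I x = (\<integral>y. norm (g (x - y)) powr r * (1 + norm y) powr (- (a * r)) \<partial>lborel)" for x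
    have iI: "integrable lborel (\<lambda>y. norm (g (x - y)) powr r * (1 + norm y) powr (- (a * r)))" for x
      using a r by (intro integrable_powr_weight gm i) simp
    have I0: "0 \<le> I x" for x unfolding I_def by (intro integral_nonneg_AE) simp
    have IG: "I x \<le> G" for x
    proof -
      have "I x \<le> (\<integral>y. norm (g (x - y)) powr r \<partial>lborel)" unfolding I_def
      proof (rule integral_mono')
        show "integrable lborel (\<lambda>y. norm (g (x - y)) powr r)"
          using i by (subst lborel_integrable_reflect[of "\<lambda>y. norm (g y) powr r"]) simp_all
        fix y :: "'a \<times> real"
        have "(1 + norm y) powr (- (a * r)) \<le> 1" using a r by (intro powr_weight_le_one) simp
        then show "norm (g (x - y)) powr r * (1 + norm y) powr (- (a * r)) \<le> norm (g (x - y)) powr r"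
          by (simp add: mult_left_le)
      qed simp
      also have "\<dots> = G" unfolding G_def by (intro lborel_integral_reflect) measurable
      finally show ?thesis .
    qed
    have "norm (g (x - 0)) \<le> C * (1 + norm (0 :: 'a \<times> real)) powr a * I x powr (1 / r)"
      unfolding I_def by (rule peetre[OF rg i])
    also have "\<dots> \<le> C * G powr (1 / r)" using IG[of x] I0[of x] r C by (simp add: powr_mono2)
    also have "\<dots> \<le> D * G powr (1 / r)" using C J0 by (intro mult_right_mono) (auto simp: D_def)
    finally show "norm (g x) \<le> D * enn2real (Lp_norm p g)" by (simp add: A G_def)
    have sc: "norm (slice_conv \<eta> j g x) \<le> C * J * I (x, 0) powr (1 / r)" for x
    proof -
      have "norm (slice_conv \<eta> j g x) \<le> (C * I (x, 0) powr (1 / r)) * J" unfolding J_def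
      proof (rule slice_conv_pointwise(1)[OF \<eta> cg a(1)])
        show "0 \<le> C * I (x, 0) powr (1 / r)" using C by simp
        fix z :: 'a
        have "norm (g ((x, 0) - (z, 0))) \<le> C * (1 + norm (z, 0 :: real)) powr a * I (x, 0) powr (1 / r)"
          unfolding I_def by (rule peetre[OF rg i])
        then show "norm (g ((x, 0) - (z, 0))) \<le> C * I (x, 0) powr (1 / r) * (1 + norm z) powr a"
          by (simp add: norm_Pair mult_ac)
      qed
      then show ?thesis by (simp only: mult_ac)
    qed
    have "(\<integral>\<^sup>+x. ennreal (norm (slice_conv \<eta> j g x) powr r) \<partial>lborel) \<le> (\<integral>\<^sup>+x. ennreal ((C * J) powr r) * ennreal (I (x, 0)) \<partial>lborel)"
    proof (intro nn_integral_mono)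
      fix x
      have "norm (slice_conv \<eta> j g x) powr r \<le> (C * J * I (x, 0) powr (1 / r)) powr r"
        using sc r by (intro powr_mono2) auto
      also have "\<dots> = (C * J) powr r * I (x, 0)" using C J0 I0[of "(x, 0)"] r by (simp add: powr_mult powr_powr)
      finally show "ennreal (norm (slice_conv \<eta> j g x) powr r) \<le> ennreal ((C * J) powr r) * ennreal (I (x, 0))"
        using I0 by (simp add: ennreal_leI flip: ennreal_mult)
    qed
    also have "\<dots> = (\<integral>\<^sup>+x. ennreal ((C * J) powr r) * (\<integral>\<^sup>+y. ennreal (norm (g ((x, 0) - y)) powr r * (1 + norm y) powr (- (a * r))) \<partial>lborel) \<partial>lborel)"
      unfolding I_def by (subst nn_integral_eq_integral[OF iI]) auto
    also have "\<dots> = ennreal ((C * J) powr r) * (\<integral>\<^sup>+x. \<integral>\<^sup>+y. ennreal (norm (g ((x, 0) - y)) powr r * (1 + norm y) powr (- (a * r))) \<partial>lborel \<partial>lborel)"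
      by (rule nn_integral_cmult) measurable
    also have "\<dots> \<le> ennreal ((C * J) powr r) * (ennreal W * (\<integral>\<^sup>+z. ennreal (norm (g z) powr r) \<partial>lborel))"
      unfolding W[symmetric] using a r by (intro mult_left_mono nn_integral_hyperplane_average) auto
    also have "(\<integral>\<^sup>+z. ennreal (norm (g z) powr r) \<partial>lborel) = ennreal G"
      unfolding G_def by (intro nn_integral_eq_integral i) simp
    also have "ennreal ((C * J) powr r) * (ennreal W * ennreal G) = ennreal ((C * J) powr r * (W * G))"
      using W0 G0 by (simp add: ennreal_mult)
    finally have *: "(\<integral>\<^sup>+x. ennreal (norm (slice_conv \<eta> j g x) powr r) \<partial>lborel) \<le> ennreal ((C * J) powr r * (W * G))" .
    have "Lp_norm p (slice_conv \<eta> j g) \<le> ennpowr (ennreal ((C * J) powr r * (W * G))) (1 / r)"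
      using False r ennpowr_mono[OF *, of "1 / r"] by (simp add: Lp_norm_def r_def)
    also have "\<dots> = ennreal (C * J * W powr (1 / r) * G powr (1 / r))"
      using r W0 G0 C J0 by (simp add: ennpowr_powr powr_mult powr_powr)
    also have "\<dots> \<le> ennreal (D * G powr (1 / r))"
      using C by (intro ennreal_leI mult_right_mono) (auto simp: D_def)
    also have "\<dots> = ennreal D * Lp_norm p g" using D0 by (simp add: A G_def ennreal_mult)
    finally show "Lp_norm p (slice_conv \<eta> j g) \<le> ennreal D * Lp_norm p g" .
  qed
qed

section \<open>Almost orthogonality of the slices\<close>

lemma slice_conv_orthogonal:
  fixes f :: "('a::euclidean_space \<times> real) dist"
  assumes \<eta>: "cutoff \<eta>" and k: "(k, l) \<in> int_lattice" and f: "f \<in> tempered_distributions"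
    and G: "\<And>x. norm (box \<eta> (k, l) f x) \<le> G"
    and b: "b \<in> Basis" "3 \<le> \<bar>k \<bullet> b - j \<bullet> b\<bar>"
  shows "slice_conv \<eta> j (box \<eta> (k, l) f) x = 0"
proof -
  let ?g = "box \<eta> (k, l) f" and ?n = "2 * DIM('a \<times> real)"
  note [measurable] = kernel_measurable[OF \<eta>]
  have [measurable]: "?g \<in> borel_measurable borel" by (rule borel_measurable_continuous_onI[OF box_continuous[OF \<eta> k f]])
  obtain C where C: "\<And>z. (1 + norm z) ^ ?n * norm (cutoff_kernel \<eta> (k, l) z) \<le> C"
    using kernel_rapidly_decreasing(1)[OF \<eta>, of "(k, l)"] unfolding rapidly_decreasing_def by blast
  have C0: "0 \<le> C" using order_trans[OF _ C[of 0]] by simp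
  have G0: "0 \<le> G" using order_trans[OF norm_ge_zero G[of 0]] .
  let ?F = "\<lambda>y z. cutoff_kernel \<eta> (k, l) ((y, 0) - z) * ?g z * window_kernel \<eta> j (x - y)"
  have "slice_conv \<eta> j ?g x = (\<integral>y. \<integral>z. ?F y z \<partial>lborel \<partial>lborel)"
    unfolding slice_conv_def by (subst box_reproduce[OF \<eta> k f]) simp
  also have "\<dots> = (\<integral>z. \<integral>y. ?F y z \<partial>lborel \<partial>lborel)"
  proof (rule integral_swap_dominated[where A = "\<lambda>y. G * C * ((1 + norm y) ^ ?n * norm (window_kernel \<eta> j (x - y)))" and B = "\<lambda>z. inverse ((1 + norm z) ^ ?n)"])
    show "integrable lborel (\<lambda>z :: 'a \<times> real. inverse ((1 + norm z) ^ ?n))" by (rule integrable_weight)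
    have "rapidly_decreasing (\<lambda>y. window_kernel \<eta> j (x - y))"
      by (rule rapidly_decreasing_reflect[OF kernel_rapidly_decreasing(2)[OF \<eta>]])
    then show "integrable lborel (\<lambda>y. G * C * ((1 + norm y) ^ ?n * norm (window_kernel \<eta> j (x - y))))"
      by (intro integrable_mult_right integrable_rapidly_decreasing(2)) measurable
    fix y :: 'a and z :: "'a \<times> real"
    have pz: "0 < (1 + norm z) ^ ?n" by (intro zero_less_power) (simp add: add_pos_nonneg)
    have "(1 + norm z) ^ ?n * norm (cutoff_kernel \<eta> (k, l) ((y, 0) - z))
      \<le> (1 + norm (y, 0 :: real)) ^ ?n * ((1 + norm ((y, 0) - z)) ^ ?n * norm (cutoff_kernel \<eta> (k, l) ((y, 0) - z)))"
      unfolding mult.assoc[symmetric] by (intro mult_right_mono weight_shift_le) simp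
    also have "\<dots> \<le> (1 + norm (y, 0 :: real)) ^ ?n * C" by (intro mult_left_mono C) simp
    finally have le: "norm (cutoff_kernel \<eta> (k, l) ((y, 0) - z)) \<le> C * (1 + norm y) ^ ?n * inverse ((1 + norm z) ^ ?n)"
      using pz by (simp add: field_simps norm_Pair)
    have "norm (?F y z) \<le> (C * (1 + norm y) ^ ?n * inverse ((1 + norm z) ^ ?n)) * G * norm (window_kernel \<eta> j (x - y))"
      unfolding norm_mult using le C0 by (intro mult_right_mono mult_mono G) auto
    then show "norm (?F y z) \<le> G * C * ((1 + norm y) ^ ?n * norm (window_kernel \<eta> j (x - y))) * inverse ((1 + norm z) ^ ?n)"
      by (simp only: mult_ac)
  next
    show "(\<lambda>(y, z). ?F y z) \<in> borel_measurable (lborel \<Otimes>\<^sub>M lborel)" by measurable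
  qed
  also have "\<dots> = (\<integral>z. (0 :: complex) \<partial>(lborel :: ('a \<times> real) measure))"
  proof (rule Bochner_Integration.integral_cong)
    fix z :: "'a \<times> real"
    obtain z1 t where z: "z = (z1, t)" by force
    let ?c = "ift (\<lambda>\<xi>. \<eta> (\<xi> - l)) 0 (- t) * ?g z"
    have "(\<integral>y. ?F y z \<partial>lborel) = (\<integral>y. ?c * (cutoff_kernel \<eta> k (y - z1) * window_kernel \<eta> j (x - y)) \<partial>lborel)"
      by (simp add: z cutoff_kernel_Pair mult_ac)
    also have "\<dots> = ?c * (\<integral>y. cutoff_kernel \<eta> k (y - z1) * window_kernel \<eta> j (x - y) \<partial>lborel)"
      by (rule integral_mult_right_zero)
    also have "(\<integral>y. cutoff_kernel \<eta> k (y - z1) * window_kernel \<eta> j (x - y) \<partial>lborel)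
      = (\<integral>y. cutoff_kernel \<eta> k (x - y - z1) * window_kernel \<eta> j (x - (x - y)) \<partial>lborel)"
      by (rule lborel_integral_reflect[symmetric]) measurable
    also have "\<dots> = (\<integral>y. cutoff_kernel \<eta> k ((x - z1) - y) * window_kernel \<eta> j (y - 0) \<partial>lborel)"
      by (simp add: algebra_simps)
    also have "\<dots> = 0" by (rule kernel_orthogonal[OF \<eta> b])
    finally show "(\<integral>y. ?F y z \<partial>lborel) = 0" by simp
  qed simp
  also have "\<dots> = 0" by simp
  finally show ?thesis .
qed

section \<open>Decay of the pairing of a slice with a Schwartz function\<close>

lemma deriv_tower_translate:
  assumes "deriv_tower D"
  shows "deriv_tower (\<lambda>bs y. D bs (y + z))"
  unfolding deriv_tower_def
proof (intro allI impI)
  fix bs :: "'a list" and y :: 'a assume bs: "set bs \<subseteq> Basis"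
  have "((\<lambda>y. y + z) has_derivative (\<lambda>v. v)) (at y)" by (auto intro!: derivative_eq_intros)
  from has_derivative_compose[OF this deriv_towerD[OF assms bs]]
  show "((\<lambda>y. D bs (y + z)) has_derivative (\<lambda>v. \<Sum>b\<in>Basis. (v \<bullet> b) *\<^sub>R D (b # bs) (y + z))) (at y)" .
qed

lemma deriv_tower_cmult: "deriv_tower D \<Longrightarrow> deriv_tower (\<lambda>bs y. c * D bs y)"
  unfolding deriv_tower_def
proof (intro allI impI)
  fix bs :: "'a list" and y :: 'a
  assume "\<forall>bs y. set bs \<subseteq> Basis \<longrightarrow> (D bs has_derivative (\<lambda>v. \<Sum>b\<in>Basis. (v \<bullet> b) *\<^sub>R D (b # bs) y)) (at y)"
    and "set bs \<subseteq> Basis"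
  then have "(D bs has_derivative (\<lambda>v. \<Sum>b\<in>Basis. (v \<bullet> b) *\<^sub>R D (b # bs) y)) (at y)" by blast
  from has_derivative_mult_right[OF this, of c]
  show "((\<lambda>y. c * D bs y) has_derivative (\<lambda>v. \<Sum>b\<in>Basis. (v \<bullet> b) *\<^sub>R (c * D (b # bs) y))) (at y)"
    by (simp add: sum_distrib_left)
qed

lemma schwartz_tower_integrable:
  assumes "schwartz_tower (D :: 'a::euclidean_space list \<Rightarrow> 'a \<Rightarrow> complex)" "set bs \<subseteq> Basis"
  shows "D bs \<in> borel_measurable borel" "integrable lborel (D bs)"
proof -
  show "D bs \<in> borel_measurable borel"
    using assms by (intro borel_measurable_continuous_onI deriv_tower_continuous) (auto simp: schwartz_tower_def)
  then show "integrable lborel (D bs)"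
    using assms by (intro integrable_rapidly_decreasing(1)) (auto simp: schwartz_tower_def)
qed

text \<open>Translation invariance makes the integral of \<open>Q\<close> over the translates constant in the shift;
  differentiating that constant under the integral sign gives the claim.\<close>

lemma integral_derivative_zero:
  fixes Q :: "'a::euclidean_space list \<Rightarrow> 'a \<Rightarrow> complex"
  assumes Q: "schwartz_tower Q" and b: "b \<in> Basis"
  shows "(\<integral>y. Q [b] y \<partial>lborel) = 0"
proof -
  have tQ: "deriv_tower Q" using Q by (simp add: schwartz_tower_def)
  have "deriv_tower (\<lambda>bs y. \<integral>z. Q bs (y + z) \<partial>lborel)"
  proof (rule deriv_tower_integral)
    fix z show "deriv_tower (\<lambda>bs y. Q bs (y + z))" by (rule deriv_tower_translate[OF tQ])
  next
    fix bs :: "'a list" and y :: 'a assume bs: "set bs \<subseteq> Basis"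
    have [measurable]: "Q bs \<in> borel_measurable borel" by (rule schwartz_tower_integrable(1)[OF Q bs])
    show "(\<lambda>z. Q bs (y + z)) \<in> borel_measurable lborel" by measurable
    let ?n = "2 * DIM('a)"
    obtain C where C: "\<And>z. (1 + norm z) ^ ?n * norm (Q bs z) \<le> C"
      using Q bs unfolding schwartz_tower_def rapidly_decreasing_def by blast
    have C0: "0 \<le> C" using order_trans[OF _ C[of 0]] by simp
    have "norm (Q bs (y' + z)) \<le> (2 + norm y) ^ ?n * C * inverse ((1 + norm z) ^ ?n)" if y': "y' \<in> ball y 1" for y' z
    proof -
      have pz: "0 < (1 + norm z) ^ ?n" by (intro zero_less_power) (simp add: add_pos_nonneg)
      have ny: "norm y' \<le> 1 + norm y" using y' norm_triangle_sub[of y' y] by (simp add: dist_norm norm_minus_commute)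
      have "(1 + norm z) ^ ?n * norm (Q bs (y' + z)) \<le> (1 + norm (- y')) ^ ?n * (1 + norm (- y' - z)) ^ ?n * norm (Q bs (y' + z))"
        by (intro mult_right_mono weight_shift_le) simp
      also have "\<dots> = (1 + norm y') ^ ?n * ((1 + norm (y' + z)) ^ ?n * norm (Q bs (y' + z)))"
        using norm_minus_cancel[of "y' + z"] by (simp add: mult.assoc)
      also have "\<dots> \<le> (2 + norm y) ^ ?n * C"
        using ny by (intro mult_mono power_mono C) auto
      finally show ?thesis using pz by (simp add: field_simps)
    qed
    then show "\<exists>B. integrable lborel B \<and> (\<forall>z\<in>space lborel. \<forall>y'\<in>ball y 1. norm (Q bs (y' + z)) \<le> B z)"
      by (intro exI[of _ "\<lambda>z. (2 + norm y) ^ ?n * C * inverse ((1 + norm z) ^ ?n)"] conjI integrable_mult_right integrable_weight) auto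
  qed
  from deriv_towerD[OF this, of "[]" 0]
  have "((\<lambda>y. \<integral>z. Q [] (y + z) \<partial>lborel) has_derivative (\<lambda>v. \<Sum>c\<in>Basis. (v \<bullet> c) *\<^sub>R (\<integral>z. Q [c] (0 + z) \<partial>lborel))) (at 0)" by simp
  moreover have "(\<lambda>y. \<integral>z. Q [] (y + z) \<partial>lborel) = (\<lambda>y. \<integral>z. Q [] z \<partial>lborel)"
    using schwartz_tower_integrable(1)[OF Q, of "[]"] by (intro ext lborel_integral_translate) simp
  ultimately have "((\<lambda>y. \<integral>z. Q [] z \<partial>lborel) has_derivative (\<lambda>v. \<Sum>c\<in>Basis. (v \<bullet> c) *\<^sub>R (\<integral>z. Q [c] (0 + z) \<partial>lborel))) (at 0)"
    by (simp only:)
  from has_derivative_unique[OF this has_derivative_const]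
  have "(\<Sum>c\<in>Basis. (b \<bullet> c) *\<^sub>R (\<integral>z. Q [c] (0 + z) \<partial>lborel)) = 0" by (rule fun_cong)
  moreover have "(\<Sum>c\<in>Basis. (b \<bullet> c) *\<^sub>R (\<integral>z. Q [c] (0 + z) \<partial>lborel)) = (\<Sum>c\<in>Basis. if c = b then (\<integral>z. Q [c] z \<partial>lborel) else 0)"
    using b by (intro sum.cong) (auto simp: inner_Basis)
  ultimately show ?thesis using b by simp
qed

definition wave_tower :: "'a::euclidean_space \<Rightarrow> 'a list \<Rightarrow> 'a \<Rightarrow> complex" where
  "wave_tower k bs y = (\<Prod>b\<leftarrow>bs. \<i> * of_real (k \<bullet> b)) * cis (k \<bullet> y)"

lemma deriv_tower_wave: "deriv_tower (wave_tower k)"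
  unfolding deriv_tower_def
proof (intro allI impI)
  fix bs and y :: 'a
  have "((\<lambda>y. k \<bullet> y) has_derivative (\<lambda>v. k \<bullet> v)) (at y)" by (auto intro!: derivative_eq_intros)
  moreover have "((\<lambda>r. cis (1 * r)) has_derivative (\<lambda>x. x *\<^sub>R (\<i> * of_real 1 * cis (1 * (k \<bullet> y))))) (at (k \<bullet> y))"
    using has_vector_derivative_cis[of 1 "k \<bullet> y" UNIV] by (simp add: has_vector_derivative_def)
  ultimately have "((\<lambda>y. cis (1 * (k \<bullet> y))) has_derivative (\<lambda>v. (k \<bullet> v) *\<^sub>R (\<i> * of_real 1 * cis (1 * (k \<bullet> y))))) (at y)"
    by (rule has_derivative_compose)
  from has_derivative_mult_right[OF this, of "\<Prod>b\<leftarrow>bs. \<i> * of_real (k \<bullet> b)"]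
  have "(wave_tower k bs has_derivative (\<lambda>v. (\<Prod>b\<leftarrow>bs. \<i> * of_real (k \<bullet> b)) * ((k \<bullet> v) *\<^sub>R (\<i> * cis (k \<bullet> y))))) (at y)"
    by (simp add: wave_tower_def[abs_def])
  moreover have "(\<Prod>b\<leftarrow>bs. \<i> * of_real (k \<bullet> b)) * ((k \<bullet> v) *\<^sub>R (\<i> * cis (k \<bullet> y)))
    = (\<Sum>b\<in>Basis. (v \<bullet> b) *\<^sub>R wave_tower k (b # bs) y)" for v
  proof -
    have "complex_of_real (k \<bullet> v) = (\<Sum>b\<in>Basis. of_real (v \<bullet> b) * of_real (k \<bullet> b))"
      by (subst euclidean_inner) (simp add: mult.commute)
    then show ?thesis
      by (simp add: wave_tower_def scaleR_conv_of_real sum_distrib_left sum_distrib_right mult_ac)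
  qed
  ultimately show "(wave_tower k bs has_derivative (\<lambda>v. \<Sum>b\<in>Basis. (v \<bullet> b) *\<^sub>R wave_tower k (b # bs) y)) (at y)"
    by (simp only:)
qed

definition bounded_tower :: "('a::euclidean_space list \<Rightarrow> 'a \<Rightarrow> complex) \<Rightarrow> bool" where
  "bounded_tower A \<longleftrightarrow> deriv_tower A \<and> (\<forall>n. \<exists>B. \<forall>bs y. set bs \<subseteq> Basis \<longrightarrow> length bs \<le> n \<longrightarrow> norm (A bs y) \<le> B)"

lemma bounded_tower_wave: "bounded_tower (wave_tower k)"
  unfolding bounded_tower_def
proof (intro conjI allI deriv_tower_wave)
  fix n
  have "norm (wave_tower k bs y) \<le> (1 + norm k) ^ length bs" if "set bs \<subseteq> Basis" for bs y
    using that
  proof (induction bs)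
    case (Cons b bs)
    have "norm (wave_tower k (b # bs) y) = \<bar>k \<bullet> b\<bar> * norm (wave_tower k bs y)"
      by (simp add: wave_tower_def norm_mult)
    also have "\<dots> \<le> (1 + norm k) * (1 + norm k) ^ length bs"
      using Cons Basis_le_norm[of b k] by (intro mult_mono) auto
    finally show ?case by simp
  qed (simp add: wave_tower_def)
  moreover have "(1 + norm k) ^ m \<le> (1 + norm k) ^ n" if "m \<le> n" for m using that by (intro power_increasing) auto
  ultimately show "\<exists>B. \<forall>bs y. set bs \<subseteq> Basis \<longrightarrow> length bs \<le> n \<longrightarrow> norm (wave_tower k bs y) \<le> B"
    by (meson order_trans)
qed

lemma schwartz_tower_prod:
  fixes A D :: "'a::euclidean_space list \<Rightarrow> 'a \<Rightarrow> complex"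
  assumes A: "bounded_tower A" and D: "schwartz_tower D"
  shows "schwartz_tower (prod_tower A D)"
  unfolding schwartz_tower_def
proof safe
  show "deriv_tower (prod_tower A D)"
    using A D by (intro deriv_tower_prod) (simp_all add: bounded_tower_def schwartz_tower_def)
  fix bs :: "'a list" assume bs: "set bs \<subseteq> Basis"
  show "rapidly_decreasing (prod_tower A D bs)"
    unfolding rapidly_decreasing_def
  proof
    fix N
    let ?n = "max N (length bs)"
    obtain B where B: "\<And>cs y. set cs \<subseteq> Basis \<Longrightarrow> length cs \<le> ?n \<Longrightarrow> norm (A cs y) \<le> B"
      using A unfolding bounded_tower_def by blast
    obtain C where C: "\<And>cs y. set cs \<subseteq> Basis \<Longrightarrow> length cs \<le> ?n \<Longrightarrow> (1 + norm y) ^ ?n * norm (D cs y) \<le> C"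
      using schwartz_tower_uniform[OF D, of ?n] by metis
    have "(1 + norm y) ^ N * norm (prod_tower A D bs y) \<le> 2 ^ length bs * (B * C)" for y
    proof -
      have p: "0 < (1 + norm y) ^ ?n" by (intro zero_less_power) (simp add: add_pos_nonneg)
      have "norm (prod_tower A D bs y) \<le> 2 ^ length bs * (B * (C / (1 + norm y) ^ ?n))"
      proof (rule norm_prod_tower_le)
        fix cs assume cs: "set cs \<subseteq> set bs" "length cs \<le> length bs"
        then show "norm (A cs y) \<le> B" using bs by (intro B) auto
        have "(1 + norm y) ^ ?n * norm (D cs y) \<le> C" using cs bs by (intro C) auto
        then show "norm (D cs y) \<le> C / (1 + norm y) ^ ?n" using p by (simp add: field_simps)
      qed
      then have "(1 + norm y) ^ ?n * norm (prod_tower A D bs y) \<le> 2 ^ length bs * (B * C)"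
        using p by (simp add: field_simps)
      moreover have "(1 + norm y) ^ N * norm (prod_tower A D bs y) \<le> (1 + norm y) ^ ?n * norm (prod_tower A D bs y)"
        by (intro mult_right_mono power_increasing) auto
      ultimately show ?thesis by linarith
    qed
    then show "\<exists>C. \<forall>y. (1 + norm y) ^ N * norm (prod_tower A D bs y) \<le> C" by blast
  qed
qed

lemma schwartz_tower_append:
  assumes "schwartz_tower D" "set bs \<subseteq> Basis"
  shows "schwartz_tower (\<lambda>cs. D (cs @ bs))"
  using assms unfolding schwartz_tower_def deriv_tower_def by simp

lemma wave_by_parts:
  fixes u :: "'a::euclidean_space list \<Rightarrow> 'a \<Rightarrow> complex"
  assumes u: "schwartz_tower u" and b: "b \<in> Basis" and bs: "set bs \<subseteq> Basis"
  shows "\<i> * of_real (k \<bullet> b) * (\<integral>y. cis (k \<bullet> y) * u bs y \<partial>lborel) = - (\<integral>y. cis (k \<bullet> y) * u (b # bs) y \<partial>lborel)"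
proof -
  let ?D = "\<lambda>cs. u (cs @ bs)"
  have D: "schwartz_tower ?D" by (rule schwartz_tower_append[OF u bs])
  have i: "integrable lborel (\<lambda>y. cis (k \<bullet> y) * u cs y)" if cs: "set cs \<subseteq> Basis" for cs
  proof (rule Bochner_Integration.integrable_bound[OF schwartz_tower_integrable(2)[OF u cs]])
    have [measurable]: "u cs \<in> borel_measurable borel" by (rule schwartz_tower_integrable(1)[OF u cs])
    show "(\<lambda>y. cis (k \<bullet> y) * u cs y) \<in> borel_measurable lborel" by measurable
  qed (simp add: norm_mult)
  have "(\<integral>y. prod_tower (wave_tower k) ?D [b] y \<partial>lborel) = 0"
    by (rule integral_derivative_zero[OF schwartz_tower_prod[OF bounded_tower_wave D] b])
  moreover have "prod_tower (wave_tower k) ?D [b] y = \<i> * of_real (k \<bullet> b) * (cis (k \<bullet> y) * u bs y) + cis (k \<bullet> y) * u (b # bs) y" for y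
    by (simp add: prod_tower_def wave_tower_def)
  moreover have "(\<integral>y. \<i> * of_real (k \<bullet> b) * (cis (k \<bullet> y) * u bs y) + cis (k \<bullet> y) * u (b # bs) y \<partial>lborel)
    = \<i> * of_real (k \<bullet> b) * (\<integral>y. cis (k \<bullet> y) * u bs y \<partial>lborel) + (\<integral>y. cis (k \<bullet> y) * u (b # bs) y \<partial>lborel)"
    using i[of bs] i[of "b # bs"] b bs by (subst Bochner_Integration.integral_add) auto
  ultimately show ?thesis by (simp add: eq_neg_iff_add_eq_0)
qed

lemma wave_integral_decay:
  fixes u :: "'a::euclidean_space list \<Rightarrow> 'a \<Rightarrow> complex"
  assumes u: "schwartz_tower u" and b: "b \<in> Basis"
  shows "\<bar>k \<bullet> b\<bar> ^ M * norm (\<integral>y. cis (k \<bullet> y) * u [] y \<partial>lborel) \<le> (\<integral>y. norm (u (replicate M b) y) \<partial>lborel)"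
proof -
  have "\<bar>k \<bullet> b\<bar> ^ M * norm (\<integral>y. cis (k \<bullet> y) * u [] y \<partial>lborel) = norm (\<integral>y. cis (k \<bullet> y) * u (replicate M b) y \<partial>lborel)"
  proof (induction M)
    case (Suc M)
    have "set (replicate M b) \<subseteq> Basis" using b by (auto simp: set_replicate_conv_if)
    from arg_cong[OF wave_by_parts[OF u b this, of k], of norm] Suc show ?case
      by (simp add: norm_mult mult.assoc)
  qed simp
  also have "\<dots> \<le> (\<integral>y. norm (cis (k \<bullet> y) * u (replicate M b) y) \<partial>lborel)" by (rule integral_norm_bound)
  finally show ?thesis by (simp add: norm_mult)
qed

lemma
  fixes A :: "'a::euclidean_space \<Rightarrow> real" and B :: "real \<Rightarrow> real"
  assumes A: "integrable lborel A" and B: "integrable lborel B"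
  shows integrable_fst_snd: "integrable lborel (\<lambda>z. A (fst z) * B (snd z))"
    and integral_fst_snd: "(\<integral>z. A (fst z) * B (snd z) \<partial>lborel) = (\<integral>x. A x \<partial>lborel) * (\<integral>t. B t \<partial>lborel)"
proof -
  have psf: "pair_sigma_finite (lborel :: 'a measure) (lborel :: real measure)" ..
  have [measurable]: "A \<in> borel_measurable borel" "B \<in> borel_measurable borel"
    using borel_measurable_integrable[OF A] borel_measurable_integrable[OF B] by simp_all
  have i: "integrable (lborel \<Otimes>\<^sub>M lborel) (\<lambda>(x, y). A x * B y)"
    by (rule pair_sigma_finite.Fubini_integrable[OF psf]) (simp_all add: A B abs_mult)
  then show "integrable lborel (\<lambda>z. A (fst z) * B (snd z))" by (simp add: lborel_prod case_prod_unfold)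
  have "(\<integral>x. \<integral>t. A x * B t \<partial>lborel \<partial>lborel) = integral\<^sup>L (lborel \<Otimes>\<^sub>M lborel) (\<lambda>(x, t). A x * B t)"
    by (rule pair_sigma_finite.integral_fst[OF psf i])
  then show "(\<integral>z. A (fst z) * B (snd z) \<partial>lborel) = (\<integral>x. A x \<partial>lborel) * (\<integral>t. B t \<partial>lborel)"
    by (simp add: lborel_prod case_prod_unfold)
qed

lemma slice_pairing_decay:
  assumes \<eta>: "cutoff \<eta>"
  shows "\<exists>N C. 0 \<le> C \<and> (\<forall>(k :: 'a::euclidean_space) (l :: real) f G \<phi> b. (k, l) \<in> int_lattice \<longrightarrow> f \<in> tempered_distributions \<longrightarrow>
    (\<forall>x. norm (box \<eta> (k, l) f x) \<le> G) \<longrightarrow> \<phi> \<in> schwartz \<longrightarrow> b \<in> Basis \<longrightarrow>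
    \<bar>k \<bullet> b\<bar> ^ M * norm (\<integral>y. box \<eta> (k, l) f (y, 0) * \<phi> y \<partial>lborel) \<le> C * (G * schwartz_seminorm N \<phi>))"
proof -
  have [measurable]: "(fst :: 'a \<times> real \<Rightarrow> 'a) \<in> borel_measurable borel" "(snd :: 'a \<times> real \<Rightarrow> real) \<in> borel_measurable borel"
    by (intro borel_measurable_continuous_onI continuous_intros)+
  define d where "d = 2 * DIM('a)"
  define w where "w = (\<lambda>x :: 'a. inverse ((1 + norm x) ^ d))"
  have iw: "integrable lborel w" unfolding w_def d_def by (rule integrable_weight)
  have w0: "0 \<le> w x" for x unfolding w_def by simp
  have [measurable]: "w \<in> borel_measurable borel" unfolding w_def by measurable
  define W where "W = (\<integral>x. w x \<partial>lborel)"
  have W0: "0 \<le> W" unfolding W_def using w0 by (intro integral_nonneg_AE) simp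
  let ?E = "cutoff_tower \<eta> (0 :: 'a)"
  have E: "schwartz_tower ?E" by (rule schwartz_tower_cutoff[OF \<eta>])
  have tE: "deriv_tower ?E" using E by (simp add: schwartz_tower_def)
  define P where "P t = ift (\<lambda>\<xi>. \<eta> (\<xi> - 0)) 0 (- t)" for t
  have P: "integrable lborel P"
  proof -
    have "integrable lborel (\<lambda>t. ift (\<lambda>\<xi>. \<eta> (\<xi> - 0)) 0 (0 - t))"
      using integrable_ift[OF cutoff_shift_test_fun[OF \<eta>], of 0 0] ift_measurable[OF cutoff_shift_test_fun[OF \<eta>], of 0 0]
      by (subst lborel_integrable_reflect)
    then show ?thesis by (simp add: P_def[abs_def])
  qed
  have [measurable]: "P \<in> borel_measurable borel" using borel_measurable_integrable[OF P] by simp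
  define p where "p = (\<integral>t. norm (P t) \<partial>lborel)"
  have p0: "0 \<le> p" unfolding p_def by (intro integral_nonneg_AE) simp
  have "\<exists>C. 0 \<le> C \<and> (\<forall>bs x. set bs \<subseteq> Basis \<longrightarrow> length bs \<le> n \<longrightarrow> norm (?E bs x) \<le> C * w x)" for n
  proof -
    obtain C where C: "0 \<le> C" "\<And>bs x. set bs \<subseteq> Basis \<Longrightarrow> length bs \<le> n + d \<Longrightarrow> (1 + norm x) ^ (n + d) * norm (?E bs x) \<le> C"
      using schwartz_tower_uniform[OF E, of "n + d"] by metis
    have "norm (?E bs x) \<le> C * w x" if "set bs \<subseteq> Basis" "length bs \<le> n" for bs x
    proof -
      have pos: "0 < (1 + norm x) ^ d" by (intro zero_less_power) (simp add: add_pos_nonneg)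
      have "(1 + norm x) ^ d * norm (?E bs x) \<le> (1 + norm x) ^ (n + d) * norm (?E bs x)"
        by (intro mult_right_mono power_increasing) auto
      also have "\<dots> \<le> C" using that by (intro C) auto
      finally show ?thesis using pos by (simp add: w_def field_simps)
    qed
    with C(1) show ?thesis by (intro exI[of _ C] conjI allI impI)
  qed
  from choice[OF allI[OF this]] obtain c where
    c0: "\<forall>n. 0 \<le> c n \<and> (\<forall>bs x. set bs \<subseteq> Basis \<longrightarrow> length bs \<le> n \<longrightarrow> norm (?E bs x) \<le> c n * w x)" ..
  have c1: "0 \<le> c n" for n using c0 by simp
  have c2: "norm (?E bs x) \<le> c n * w x" if "set bs \<subseteq> Basis" "length bs \<le> n" for n bs x
    using c0 that by simp
    have Em: "?E bs \<in> borel_measurable borel" if "set bs \<subseteq> Basis" for bs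
    by (rule schwartz_tower_integrable(1)[OF E that])
  have main: "\<bar>k \<bullet> b\<bar> ^ M * norm (\<integral>y. box \<eta> (k, l) f (y, 0) * \<phi> y \<partial>lborel) \<le> (2 ^ M * (c M * W * p) * W) * (G * schwartz_seminorm (M + d) \<phi>)"
    if kl: "(k, l) \<in> int_lattice" and f: "f \<in> tempered_distributions"
      and G: "\<forall>x. norm (box \<eta> (k, l) f x) \<le> G" and \<phi>: "\<phi> \<in> schwartz" and b: "b \<in> Basis"
    for k :: 'a and l :: real and f G \<phi> b
  proof -
    let ?g = "box \<eta> (k, l) f"
    have G0: "0 \<le> G" using order_trans[OF norm_ge_zero G[rule_format, of 0]] .
    have [measurable]: "?g \<in> borel_measurable borel" by (rule borel_measurable_continuous_onI[OF box_continuous[OF \<eta> kl f]])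
    define q where "q z = cis (- ((k, l) \<bullet> z)) * ?g z * P (snd z)" for z
    have q: "norm (q z) \<le> G * norm (P (snd z))" for z
      unfolding q_def norm_mult norm_cis mult_1 by (intro mult_right_mono G[rule_format]) simp
    have [measurable]: "q \<in> borel_measurable borel" unfolding q_def by measurable
    define T where "T z bs y = q z * ?E bs (y + - fst z)" for z bs y
    define H where "H bs y = (\<integral>z. T z bs y \<partial>lborel)" for bs y
    have Tm: "(\<lambda>z. T z bs y) \<in> borel_measurable borel" if "set bs \<subseteq> Basis" for bs y
    proof -
      have [measurable]: "?E bs \<in> borel_measurable borel" by (rule Em[OF that])
      show ?thesis unfolding T_def by measurable
    qed
    have tH: "deriv_tower H"
      unfolding H_def
    proof (rule deriv_tower_integral)
      fix z show "deriv_tower (T z)"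
        unfolding T_def by (rule deriv_tower_cmult[OF deriv_tower_translate[OF tE]])
    next
      fix bs :: "'a list" and y :: 'a assume bs: "set bs \<subseteq> Basis"
      show "(\<lambda>z. T z bs y) \<in> borel_measurable lborel" using Tm[OF bs] by simp
      let ?B = "\<lambda>z. (c (length bs) * (2 + norm y) ^ d * G) * (w (fst z) * norm (P (snd z)))"
      have iB: "integrable lborel ?B"
        by (intro integrable_mult_right integrable_fst_snd iw integrable_norm P)
      have "norm (T z bs y') \<le> ?B z" if y': "y' \<in> ball y 1" for y' z
      proof -
        have ny: "norm y' \<le> 1 + norm y" using y' norm_triangle_sub[of y' y] by (simp add: dist_norm norm_minus_commute)
        have "(1 + norm (fst z)) ^ d \<le> (1 + norm y') ^ d * (1 + norm (y' - fst z)) ^ d" by (rule weight_shift_le)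
        also have "\<dots> \<le> (2 + norm y) ^ d * (1 + norm (y' - fst z)) ^ d"
          using ny by (intro mult_right_mono power_mono) auto
        finally have *: "(1 + norm (fst z)) ^ d \<le> (2 + norm y) ^ d * (1 + norm (y' - fst z)) ^ d" .
        have "w (y' - fst z) \<le> (2 + norm y) ^ d * w (fst z)"
        proof -
          have "0 < (1 + norm (fst z)) ^ d" "0 < (1 + norm (y' - fst z)) ^ d"
            by (intro zero_less_power, simp add: add_pos_nonneg)+
          with * show ?thesis by (simp add: w_def field_simps)
        qed
        then have "c (length bs) * w (y' - fst z) \<le> c (length bs) * ((2 + norm y) ^ d * w (fst z))"
          using c1 by (intro mult_left_mono)
        moreover have "norm (?E bs (y' + - fst z)) \<le> c (length bs) * w (y' - fst z)"
          using c2[OF bs order_refl, of "y' - fst z"] by simp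
        ultimately have "norm (?E bs (y' + - fst z)) \<le> c (length bs) * ((2 + norm y) ^ d * w (fst z))" by linarith
        then have "norm (T z bs y') \<le> (G * norm (P (snd z))) * (c (length bs) * ((2 + norm y) ^ d * w (fst z)))"
          unfolding T_def norm_mult using q G0 by (intro mult_mono) auto
        then show ?thesis by (simp only: mult_ac)
      qed
      with iB show "\<exists>B. integrable lborel B \<and> (\<forall>z\<in>space lborel. \<forall>y'\<in>ball y 1. norm (T z bs y') \<le> B z)"
        by (intro exI[of _ ?B] conjI ballI)
    qed
    have Hb: "norm (H bs y) \<le> G * (c n * W * p)" if bs: "set bs \<subseteq> Basis" "length bs \<le> n" for bs n y
    proof -
      let ?B = "\<lambda>z. (G * c n) * (w (y - fst z) * norm (P (snd z)))"
      have iw': "integrable lborel (\<lambda>x. w (y - x))" using iw by (subst lborel_integrable_reflect) simp_all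
      have iB: "integrable lborel ?B"
        by (intro integrable_mult_right integrable_fst_snd[of "\<lambda>x. w (y - x)"] iw' integrable_norm P)
      have "norm (T z bs y) \<le> ?B z" for z
      proof -
        have "norm (?E bs (y + - fst z)) \<le> c n * w (y - fst z)" using c2[OF bs, of "y - fst z"] by simp
        then have "norm (T z bs y) \<le> (G * norm (P (snd z))) * (c n * w (y - fst z))"
          unfolding T_def norm_mult using q G0 by (intro mult_mono) auto
        then show ?thesis by (simp only: mult_ac)
      qed
      then have "norm (H bs y) \<le> (\<integral>z. ?B z \<partial>lborel)"
        unfolding H_def using G0 c1 w0 by (intro integral_norm_bound[THEN order_trans] integral_mono'[OF iB]) auto
      also have "\<dots> = (G * c n) * ((\<integral>x. w (y - x) \<partial>lborel) * p)"
        unfolding integral_mult_right_zero p_def by (subst integral_fst_snd[OF iw' integrable_norm[OF P]]) simp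
      also have "(\<integral>x. w (y - x) \<partial>lborel) = W" unfolding W_def by (rule lborel_integral_reflect) measurable
      finally show ?thesis by (simp only: mult_ac)
    qed
    have bH: "bounded_tower H"
      unfolding bounded_tower_def
    proof (intro conjI allI tH)
      fix n show "\<exists>B. \<forall>bs y. set bs \<subseteq> Basis \<longrightarrow> length bs \<le> n \<longrightarrow> norm (H bs y) \<le> B"
        by (intro exI[of _ "G * (c n * W * p)"] allI impI Hb)
    qed
    let ?D = "\<lambda>bs. partial_derivs bs \<phi>"
    have D: "schwartz_tower ?D" by (rule schwartz_tower_of_schwartz[OF \<phi>])
    let ?u = "prod_tower H ?D"
    have u: "schwartz_tower ?u" by (rule schwartz_tower_prod[OF bH D])
    have gH: "?g (y, 0) = cis (k \<bullet> y) * H [] y" for y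
    proof -
      have "?g (y, 0) = (\<integral>z. cutoff_kernel \<eta> (k, l) ((y, 0) - z) * ?g z \<partial>lborel)" by (rule box_reproduce[OF \<eta> kl f])
      also have "\<dots> = (\<integral>z. cis (k \<bullet> y) * T z [] y \<partial>lborel)"
      proof (rule Bochner_Integration.integral_cong)
        fix z :: "'a \<times> real"
        obtain z1 t where z: "z = (z1, t)" by force
        have "cutoff_kernel \<eta> (k, l) ((y, 0) - z) = cis ((k, l) \<bullet> ((y, 0) - z)) * cutoff_kernel \<eta> 0 ((y, 0) - z)"
          by (rule cutoff_kernel_modulate[OF \<eta>])
        also have "cis ((k, l) \<bullet> ((y, 0) - z)) = cis (k \<bullet> y) * cis (- ((k, l) \<bullet> z))"
          by (simp add: cis_mult inner_diff_right)
        also have "cutoff_kernel \<eta> 0 ((y, 0) - z) = ?E [] (y + - fst z) * P (snd z)"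
          by (simp add: z zero_prod_def cutoff_kernel_Pair cutoff_tower_Nil[OF \<eta>] P_def)
        finally show "cutoff_kernel \<eta> (k, l) ((y, 0) - z) * ?g z = cis (k \<bullet> y) * T z [] y"
          by (simp add: T_def q_def mult_ac)
      qed simp
      also have "\<dots> = cis (k \<bullet> y) * H [] y" unfolding H_def by (rule integral_mult_right_zero)
      finally show ?thesis .
    qed
    define S where "S = schwartz_seminorm (M + d) \<phi>"
    have S0: "0 \<le> S" unfolding S_def by (rule schwartz_seminorm_nonneg[OF \<phi>])
    have Dw: "norm (?D ds y) \<le> S * w y" if "set ds \<subseteq> Basis" "length ds \<le> M" for ds y
    proof -
      have pos: "0 < (1 + norm y) ^ d" by (intro zero_less_power) (simp add: add_pos_nonneg)
      have "(1 + norm y) ^ d * norm (?D ds y) \<le> (1 + norm y) ^ (M + d) * norm (?D ds y)"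
        by (intro mult_right_mono power_increasing) auto
      also have "\<dots> \<le> S" unfolding S_def
        using schwartz_seminorm_ge[OF D, of ds "M + d" y] that by simp
      finally show ?thesis using pos by (simp add: w_def field_simps)
    qed
    have rep: "set (replicate M b) \<subseteq> Basis" "length (replicate M b) = M" using b by (auto simp: set_replicate_conv_if)
    have ub: "norm (?u (replicate M b) y) \<le> (2 ^ M * (G * (c M * W * p)) * S) * w y" for y
    proof -
      have "norm (?u (replicate M b) y) \<le> 2 ^ length (replicate M b) * (G * (c M * W * p) * (S * w y))"
        using rep b by (intro norm_prod_tower_le Hb Dw) auto
      then show ?thesis by (simp add: mult_ac)
    qed
    have "\<bar>k \<bullet> b\<bar> ^ M * norm (\<integral>y. cis (k \<bullet> y) * ?u [] y \<partial>lborel) \<le> (\<integral>y. norm (?u (replicate M b) y) \<partial>lborel)"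
      by (rule wave_integral_decay[OF u b])
    also have "\<dots> \<le> (\<integral>y. (2 ^ M * (G * (c M * W * p)) * S) * w y \<partial>lborel)"
      by (intro integral_mono integrable_norm schwartz_tower_integrable(2)[OF u rep(1)] integrable_mult_right iw ub)
    also have "\<dots> = (2 ^ M * (G * (c M * W * p)) * S) * W" unfolding W_def by (rule integral_mult_right_zero)
    also have "(\<lambda>y. cis (k \<bullet> y) * ?u [] y) = (\<lambda>y. ?g (y, 0) * \<phi> y)"
      by (simp add: gH mult.assoc)
    finally show ?thesis by (simp only: S_def mult_ac)
  qed
  have "0 \<le> 2 ^ M * (c M * W * p) * W" using c1 W0 p0 by simp
  then show ?thesis
    by (intro exI[of _ "M + d"] exI[of _ "2 ^ M * (c M * W * p) * W"] conjI allI impI) (assumption, rule main)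
qed

section \<open>Summation over lattices\<close>

lemma Ints_powr_sum_bounded:
  fixes \<theta> :: real
  assumes "1 < \<theta>"
  shows "\<exists>B\<ge>0. \<forall>F :: real set. finite F \<longrightarrow> F \<subseteq> \<int> \<longrightarrow> (\<Sum>l\<in>F. (1 + \<bar>l\<bar>) powr (- \<theta>)) \<le> B"
proof -
  let ?f = "\<lambda>n::nat. (1 + real n) powr (- \<theta>)"
  have "summable (\<lambda>n. real (Suc n) powr (- \<theta>))"
    using assms by (subst summable_Suc_iff) (simp add: summable_real_powr_iff)
  then have sf: "summable ?f" by (simp add: add.commute)
  have half: "(\<Sum>l\<in>F. (1 + \<bar>l\<bar>) powr (- \<theta>)) \<le> (\<Sum>n. ?f n)"
    if F: "finite F" "F \<subseteq> \<int>" and inj: "inj_on (\<lambda>l. nat \<lfloor>\<bar>l\<bar>\<rfloor>) F" for F :: "real set"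
  proof -
    have "(\<Sum>l\<in>F. (1 + \<bar>l\<bar>) powr (- \<theta>)) = (\<Sum>l\<in>F. ?f (nat \<lfloor>\<bar>l\<bar>\<rfloor>))"
    proof (rule sum.cong)
      fix l assume "l \<in> F"
      then obtain i where "l = of_int i" using F(2) by (auto elim: Ints_cases)
      then show "(1 + \<bar>l\<bar>) powr (- \<theta>) = ?f (nat \<lfloor>\<bar>l\<bar>\<rfloor>)" by (simp flip: of_int_abs)
    qed simp
    also have "\<dots> = (\<Sum>n\<in>(\<lambda>l. nat \<lfloor>\<bar>l\<bar>\<rfloor>) ` F. ?f n)" by (rule sum.reindex_cong[OF inj, symmetric]) simp_all
    also have "\<dots> \<le> (\<Sum>n. ?f n)" using F(1) by (intro sum_le_suminf sf) auto
    finally show ?thesis .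
  qed
  have "(\<Sum>l\<in>F. (1 + \<bar>l\<bar>) powr (- \<theta>)) \<le> 2 * (\<Sum>n. ?f n)" if F: "finite F" "F \<subseteq> \<int>" for F :: "real set"
  proof -
    have injp: "inj_on (\<lambda>l. nat \<lfloor>\<bar>l\<bar>\<rfloor>) {l\<in>F. 0 \<le> l}" and injn: "inj_on (\<lambda>l. nat \<lfloor>\<bar>l\<bar>\<rfloor>) {l\<in>F. l < 0}"
    proof -
      have "x = y" if xy: "x \<in> \<int>" "y \<in> \<int>" "nat \<lfloor>\<bar>x\<bar>\<rfloor> = nat \<lfloor>\<bar>y\<bar>\<rfloor>" "0 \<le> x \<longleftrightarrow> 0 \<le> y" for x y :: real
      proof -
        obtain i where "x = of_int i" using xy(1) by (rule Ints_cases)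
        moreover obtain j where "y = of_int j" using xy(2) by (rule Ints_cases)
        ultimately show ?thesis using xy(3,4) by (auto simp: abs_if split: if_splits simp flip: of_int_minus)
      qed
      then show "inj_on (\<lambda>l. nat \<lfloor>\<bar>l\<bar>\<rfloor>) {l\<in>F. 0 \<le> l}" "inj_on (\<lambda>l. nat \<lfloor>\<bar>l\<bar>\<rfloor>) {l\<in>F. l < 0}"
        using F(2) by (auto intro!: inj_onI simp: not_le[symmetric])
    qed
    have "F = {l\<in>F. 0 \<le> l} \<union> {l\<in>F. l < 0}" by auto
    then have "(\<Sum>l\<in>F. (1 + \<bar>l\<bar>) powr (- \<theta>)) = (\<Sum>l\<in>{l\<in>F. 0 \<le> l}. (1 + \<bar>l\<bar>) powr (- \<theta>)) + (\<Sum>l\<in>{l\<in>F. l < 0}. (1 + \<bar>l\<bar>) powr (- \<theta>))"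
      using F(1) by (subst sum.union_disjoint[symmetric]) auto
    also have "\<dots> \<le> (\<Sum>n. ?f n) + (\<Sum>n. ?f n)"
      using F by (intro add_mono half injp injn) auto
    finally show ?thesis by simp
  qed
  moreover have "0 \<le> 2 * (\<Sum>n. ?f n)" by (simp add: suminf_nonneg sf)
  ultimately show ?thesis by blast
qed

definition lattice_weight :: "'a::euclidean_space \<Rightarrow> real" where
  "lattice_weight k = (\<Prod>b\<in>Basis. inverse (1 + (k \<bullet> b)\<^sup>2))"

lemma lattice_weight_pos: "0 < lattice_weight k"
  unfolding lattice_weight_def by (intro prod_pos) (auto intro: add_pos_nonneg)

lemma lattice_weight_sum_bounded:
  "\<exists>B\<ge>0. \<forall>F. finite F \<longrightarrow> F \<subseteq> int_lattice \<longrightarrow> (\<Sum>k\<in>F. lattice_weight (k :: 'a::euclidean_space)) \<le> B"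
proof -
  obtain B where B: "0 \<le> B" "\<And>F :: real set. finite F \<Longrightarrow> F \<subseteq> \<int> \<Longrightarrow> (\<Sum>l\<in>F. (1 + \<bar>l\<bar>) powr (- 2)) \<le> B"
    using Ints_powr_sum_bounded[of 2] by auto
  have one: "(\<Sum>l\<in>F. inverse (1 + l\<^sup>2)) \<le> 2 * B" if "finite F" "F \<subseteq> \<int>" for F :: "real set"
  proof -
    have "inverse (1 + l\<^sup>2) \<le> 2 * (1 + \<bar>l\<bar>) powr (- 2)" for l :: real
    proof -
      have "(1 + \<bar>l\<bar>)\<^sup>2 \<le> 2 * (1 + l\<^sup>2)" using sum_squares_bound[of 1 "\<bar>l\<bar>"] by (simp add: power2_sum)
      moreover have e: "(1 + \<bar>l\<bar>) powr (- 2) = inverse ((1 + \<bar>l\<bar>)\<^sup>2)"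
        by (simp add: powr_minus add_pos_nonneg)
      moreover have "0 < (1 + \<bar>l\<bar>)\<^sup>2" "0 < 1 + l\<^sup>2" by (auto intro: add_pos_nonneg zero_less_power)
      ultimately show ?thesis unfolding e by (simp add: field_simps)
    qed
    then have "(\<Sum>l\<in>F. inverse (1 + l\<^sup>2)) \<le> (\<Sum>l\<in>F. 2 * (1 + \<bar>l\<bar>) powr (- 2))" by (rule sum_mono)
    also have "\<dots> \<le> 2 * B" using B(2)[OF that] by (simp flip: sum_distrib_left)
    finally show ?thesis .
  qed
  have "(\<Sum>k\<in>F. lattice_weight k) \<le> (2 * B) ^ DIM('a)" if F: "finite F" "F \<subseteq> int_lattice" for F :: "'a set"
  proof -
    let ?c = "\<lambda>k :: 'a. restrict (\<lambda>b. k \<bullet> b) Basis" and ?R = "\<lambda>b. (\<lambda>k. k \<bullet> b) ` F"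
    have inj: "inj_on ?c F"
    proof (rule inj_onI)
      fix k k' assume eq: "?c k = ?c k'"
      show "k = k'"
      proof (rule euclidean_eqI)
        fix b :: 'a assume "b \<in> Basis"
        then show "k \<bullet> b = k' \<bullet> b" using fun_cong[OF eq, of b] by simp
      qed
    qed
    have "(\<Sum>k\<in>F. lattice_weight k) = (\<Sum>k\<in>F. \<Prod>b\<in>Basis. inverse (1 + (?c k b)\<^sup>2))"
      unfolding lattice_weight_def by (intro sum.cong prod.cong) auto
    also have "\<dots> = (\<Sum>h\<in>?c ` F. \<Prod>b\<in>Basis. inverse (1 + (h b)\<^sup>2))"
      by (rule sum.reindex_cong[OF inj, symmetric]) simp_all
    finally have eq: "(\<Sum>k\<in>F. lattice_weight k) = (\<Sum>h\<in>?c ` F. \<Prod>b\<in>Basis. inverse (1 + (h b)\<^sup>2))" .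
    have "?c ` F \<subseteq> (\<Pi>\<^sub>E b\<in>Basis. ?R b)" by auto
    then have "(\<Sum>h\<in>?c ` F. \<Prod>b\<in>Basis. inverse (1 + (h b)\<^sup>2)) \<le> (\<Sum>h\<in>(\<Pi>\<^sub>E b\<in>Basis. ?R b). \<Prod>b\<in>Basis. inverse (1 + (h b)\<^sup>2))"
      using F(1) by (intro sum_mono2 finite_PiE) (auto intro!: prod_nonneg)
    also have "\<dots> = (\<Prod>b\<in>Basis. \<Sum>l\<in>?R b. inverse (1 + l\<^sup>2))"
      using F(1) by (intro prod_sum_PiE[symmetric]) auto
    also have "\<dots> \<le> (\<Prod>b\<in>(Basis :: 'a set). 2 * B)"
      using F by (intro prod_mono conjI sum_nonneg one) (auto simp: int_lattice_def)
    finally show ?thesis unfolding eq by simp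
  qed
  moreover have "0 \<le> (2 * B) ^ DIM('a)" using B(1) by simp
  ultimately show ?thesis by blast
qed

lemma lattice_weight_decay:
  fixes k :: "'a::euclidean_space"
  assumes X: "0 \<le> X" "X \<le> Y" and dec: "\<And>b. b \<in> Basis \<Longrightarrow> \<bar>k \<bullet> b\<bar> ^ (2 * DIM('a)) * X \<le> Y"
  shows "X \<le> 2 ^ Suc DIM('a) * Y * lattice_weight k"
proof -
  define m where "m = Max ((\<lambda>b. \<bar>k \<bullet> b\<bar>) ` (Basis :: 'a set))"
  have "m \<in> (\<lambda>b. \<bar>k \<bullet> b\<bar>) ` (Basis :: 'a set)" unfolding m_def by (intro Max_in) auto
  then obtain b where b: "b \<in> Basis" "m = \<bar>k \<bullet> b\<bar>" by auto
  have m: "\<bar>k \<bullet> c\<bar> \<le> m" if "c \<in> Basis" for c unfolding m_def using that by (intro Max_ge) auto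
  have m0: "0 \<le> m" using b by simp
  have "(\<Prod>c\<in>(Basis :: 'a set). 1 + (k \<bullet> c)\<^sup>2) \<le> (\<Prod>c\<in>(Basis :: 'a set). 1 + m\<^sup>2)"
  proof (intro prod_mono conjI)
    fix c :: 'a assume "c \<in> Basis"
    from power_mono[OF m[OF this] abs_ge_zero, of 2] show "1 + (k \<bullet> c)\<^sup>2 \<le> 1 + m\<^sup>2" by simp
  qed (simp add: add_nonneg_nonneg)
  also have "\<dots> = (1 + m\<^sup>2) ^ DIM('a)" by simp
  also have "\<dots> \<le> 2 ^ DIM('a) * (1 + (m\<^sup>2) ^ DIM('a))" by (rule one_plus_power_le) simp
  finally have "(\<Prod>c\<in>(Basis :: 'a set). 1 + (k \<bullet> c)\<^sup>2) * X \<le> 2 ^ DIM('a) * (1 + (m\<^sup>2) ^ DIM('a)) * X"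
    using X(1) by (rule mult_right_mono)
  also have "\<dots> = 2 ^ DIM('a) * (X + m ^ (2 * DIM('a)) * X)"
    unfolding power_mult[symmetric] by (simp only: distrib_right mult_1 mult.assoc)
  also have "\<dots> \<le> 2 ^ DIM('a) * (Y + Y)"
    using X dec[OF b(1)] b(2) by (intro mult_left_mono add_mono) auto
  finally have *: "(\<Prod>c\<in>(Basis :: 'a set). 1 + (k \<bullet> c)\<^sup>2) * X \<le> 2 ^ Suc DIM('a) * Y" by simp
  have pos: "0 < (\<Prod>c\<in>(Basis :: 'a set). 1 + (k \<bullet> c)\<^sup>2)" by (intro prod_pos) (auto intro: add_pos_nonneg)
  have "lattice_weight k = inverse (\<Prod>c\<in>(Basis :: 'a set). 1 + (k \<bullet> c)\<^sup>2)"
    unfolding lattice_weight_def by (rule prod_inversef[unfolded comp_def])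
  then show ?thesis using * pos by (simp add: field_simps)
qed

section \<open>The quasi-triangle inequality in Lebesgue spaces\<close>

lemma sum_powr_le_powr_sum:
  fixes x :: "'i \<Rightarrow> real"
  assumes r: "1 \<le> r" and x: "\<And>i. i \<in> I \<Longrightarrow> 0 \<le> x i" and I: "finite I"
  shows "(\<Sum>i\<in>I. x i powr r) \<le> (\<Sum>i\<in>I. x i) powr r"
proof (cases "(\<Sum>i\<in>I. x i) = 0")
  case True
  then have "\<forall>i\<in>I. x i = 0" using sum_nonneg_eq_0_iff[OF I] x by blast
  then show ?thesis by simp
next
  case False
  define S where "S = (\<Sum>i\<in>I. x i)"
  have S: "0 < S" using False sum_nonneg[of I x] x by (simp add: S_def less_le)
  have "x i powr r \<le> S powr r * (x i / S)" if i: "i \<in> I" for i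
  proof -
    have le: "x i \<le> S" unfolding S_def by (rule member_le_sum[OF i _ I]) (use x in auto)
    have "x i powr r = S powr r * (x i / S) powr r" using S x[OF i] by (simp add: powr_divide)
    also have "\<dots> \<le> S powr r * (x i / S) powr 1"
      using S x[OF i] le r by (intro mult_left_mono powr_mono') auto
    finally show ?thesis using S x[OF i] by simp
  qed
  then have "(\<Sum>i\<in>I. x i powr r) \<le> (\<Sum>i\<in>I. S powr r * (x i / S))" by (rule sum_mono)
  also have "\<dots> = S powr r" using S by (simp add: S_def[symmetric] flip: sum_distrib_left sum_divide_distrib)
  finally show ?thesis by (simp add: S_def)
qed

lemma powr_sum_le_sum_powr:
  fixes x :: "'i \<Rightarrow> real"
  assumes r: "0 < r" "r \<le> 1" and x: "\<And>i. i \<in> I \<Longrightarrow> 0 \<le> x i" and I: "finite I"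
  shows "(\<Sum>i\<in>I. x i) powr r \<le> (\<Sum>i\<in>I. x i powr r)"
proof -
  have "(\<Sum>i\<in>I. (x i powr r) powr (1 / r)) \<le> (\<Sum>i\<in>I. x i powr r) powr (1 / r)"
    using r I by (intro sum_powr_le_powr_sum) auto
  moreover have "(\<Sum>i\<in>I. (x i powr r) powr (1 / r)) = (\<Sum>i\<in>I. x i)"
    using r x by (intro sum.cong) (auto simp: powr_powr)
  ultimately have "(\<Sum>i\<in>I. x i) powr r \<le> ((\<Sum>i\<in>I. x i powr r) powr (1 / r)) powr r"
    using r x by (intro powr_mono2) (auto intro: sum_nonneg)
  also have "\<dots> = (\<Sum>i\<in>I. x i powr r)" using r by (simp add: powr_powr sum_nonneg)
  finally show ?thesis .
qed

text \<open>Jensen's inequality up to a constant: the terms with \<open>t i\<close> at most half the mean contribute at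
  most half of it.\<close>

lemma weighted_mean_powr_le:
  fixes t w :: "'i \<Rightarrow> real"
  assumes p: "1 \<le> p" and t: "\<And>i. i \<in> I \<Longrightarrow> 0 \<le> t i" and w: "\<And>i. i \<in> I \<Longrightarrow> 0 \<le> w i" "(\<Sum>i\<in>I. w i) = 1"
  shows "(\<Sum>i\<in>I. w i * t i) powr p \<le> 2 powr p * (\<Sum>i\<in>I. w i * t i powr p)"
proof (cases "(\<Sum>i\<in>I. w i * t i) = 0")
  case True
  then show ?thesis using w t by (auto intro!: sum_nonneg mult_nonneg_nonneg)
next
  case False
  define X where "X = (\<Sum>i\<in>I. w i * t i)"
  have X: "0 < X" using False w t unfolding X_def by (metis (no_types, lifting) less_le mult_nonneg_nonneg sum_nonneg)
  have pt: "t i \<le> X / 2 + (X / 2) powr (1 - p) * t i powr p" if i: "i \<in> I" for i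
  proof (cases "t i \<le> X / 2")
    case True
    have "0 \<le> (X / 2) powr (1 - p) * t i powr p" by simp
    with True show ?thesis by linarith
  next
    case F: False
    have "t i = t i powr (1 - p) * t i powr p" using F X by (simp flip: powr_add)
    also have "\<dots> \<le> (X / 2) powr (1 - p) * t i powr p"
      using F X p by (intro mult_right_mono powr_mono2') auto
    finally show ?thesis using X by simp
  qed
  have "X \<le> (\<Sum>i\<in>I. w i * (X / 2 + (X / 2) powr (1 - p) * t i powr p))"
    unfolding X_def using w(1) by (intro sum_mono mult_left_mono pt[unfolded X_def]) auto
  also have "\<dots> = (\<Sum>i\<in>I. w i) * (X / 2) + (X / 2) powr (1 - p) * (\<Sum>i\<in>I. w i * t i powr p)"
    by (simp add: distrib_left sum.distrib sum_distrib_left sum_distrib_right mult_ac)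
  finally have "X / 2 \<le> (X / 2) powr (1 - p) * (\<Sum>i\<in>I. w i * t i powr p)" by (simp add: w(2))
  then have "(X / 2) powr (p - 1) * (X / 2) \<le> (X / 2) powr (p - 1) * ((X / 2) powr (1 - p) * (\<Sum>i\<in>I. w i * t i powr p))"
    by (intro mult_left_mono) auto
  also have "\<dots> = (\<Sum>i\<in>I. w i * t i powr p)" using X by (simp flip: powr_add mult.assoc)
  also have "(X / 2) powr (p - 1) * (X / 2) = (X / 2) powr p" using X powr_add[of "X / 2" "p - 1" 1] by simp
  finally have "(X / 2) powr p \<le> (\<Sum>i\<in>I. w i * t i powr p)" .
  then have "2 powr p * (X / 2) powr p \<le> 2 powr p * (\<Sum>i\<in>I. w i * t i powr p)" by (intro mult_left_mono) auto
  moreover have "2 powr p * (X / 2) powr p = X powr p" using X by (simp flip: powr_mult)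
  ultimately show ?thesis unfolding X_def[symmetric] by (simp only:)
qed

definition Lp_index :: "ennreal \<Rightarrow> real" where
  "Lp_index p = (if p = \<infinity> then 1 else min (enn2real p) 1)"

lemma Lp_index: "0 < p \<Longrightarrow> 0 < Lp_index p" "Lp_index p \<le> 1"
  by (auto simp: Lp_index_def enn2real_positive_iff less_top)

lemma ennpowr_le_iff:
  assumes "0 < r" "0 \<le> R"
  shows "ennpowr S (1 / r) \<le> ennreal R \<longleftrightarrow> S \<le> ennreal (R powr r)"
proof (cases S)
  case (real x)
  have "x powr (1 / r) \<le> R \<longleftrightarrow> x \<le> R powr r"
  proof
    assume "x powr (1 / r) \<le> R"
    from powr_mono2[OF less_imp_le[OF assms(1)] _ this] show "x \<le> R powr r" using real assms by (simp add: powr_powr)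
  next
    assume "x \<le> R powr r"
    from powr_mono2[OF _ real(1) this, of "1 / r"] show "x powr (1 / r) \<le> R" using assms by (simp add: powr_powr)
  qed
  then show ?thesis using real assms by (simp add: ennpowr_powr ennreal_le_iff)
next
  case top
  then show ?thesis by (simp add: ennpowr_def top_unique)
qed

lemma Lp_norm_le_iff:
  assumes p: "0 < p" "p \<noteq> \<infinity>" and a: "0 \<le> a"
  shows "Lp_norm p h \<le> ennreal a \<longleftrightarrow> (\<integral>\<^sup>+x. ennreal (norm (h x) powr enn2real p) \<partial>lborel) \<le> ennreal (a powr enn2real p)"
proof -
  have "0 < enn2real p" using p by (simp add: enn2real_positive_iff less_top)
  then show ?thesis using p a by (simp add: Lp_norm_def ennpowr_le_iff)
qed

lemma Lp_norm_finite_sum_pos: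
  fixes h :: "'i \<Rightarrow> 'a::euclidean_space \<Rightarrow> complex"
  assumes p: "0 < p" and I: "finite I" and hm: "\<And>i. i \<in> I \<Longrightarrow> h i \<in> borel_measurable borel"
    and a: "\<And>i. i \<in> I \<Longrightarrow> 0 < a i" and h: "\<And>i. i \<in> I \<Longrightarrow> Lp_norm p (h i) \<le> ennreal (a i)"
  shows "Lp_norm p (\<lambda>x. \<Sum>i\<in>I. h i x) \<le> ennreal (2 * (\<Sum>i\<in>I. a i powr Lp_index p) powr (1 / Lp_index p))"
proof (cases "I = {}")
  case True
  have "esssup (lborel :: 'a measure) (\<lambda>x. 0 :: ennreal) \<le> 0" by (rule esssup_I) auto
  with True show ?thesis by (auto simp: Lp_norm_def ennpowr_def)
next
  case ne: False
  have a0: "\<And>i. i \<in> I \<Longrightarrow> 0 \<le> a i" using a less_imp_le by blast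
  have mS [measurable]: "(\<lambda>x. \<Sum>i\<in>I. h i x) \<in> borel_measurable borel" using hm by measurable
  show ?thesis
  proof (cases "p = \<infinity>")
    case True
    have "AE x in lborel. \<forall>i\<in>I. ennreal (norm (h i x)) \<le> ennreal (a i)"
    proof (rule AE_finite_allI[OF I])
      fix i assume i: "i \<in> I"
      have ae: "AE x in lborel. ennreal (norm (h i x)) \<le> esssup lborel (\<lambda>x. ennreal (norm (h i x)))" by (rule esssup_AE)
      have le: "esssup lborel (\<lambda>x. ennreal (norm (h i x))) \<le> ennreal (a i)" using h[OF i] True by (simp add: Lp_norm_def)
      from ae show "AE x in lborel. ennreal (norm (h i x)) \<le> ennreal (a i)" by eventually_elim (rule order_trans[OF _ le])
    qed
    then have "AE x in lborel. ennreal (norm (\<Sum>i\<in>I. h i x)) \<le> ennreal (2 * (\<Sum>i\<in>I. a i))"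
    proof eventually_elim
      case (elim x)
      have "norm (\<Sum>i\<in>I. h i x) \<le> (\<Sum>i\<in>I. a i)"
        using elim a0 by (intro sum_norm_le) (auto simp: ennreal_le_iff)
      also have "\<dots> \<le> 2 * (\<Sum>i\<in>I. a i)" using sum_nonneg[of I a] a0 by simp
      finally show ?case by (rule ennreal_leI)
    qed
    then have "esssup lborel (\<lambda>x. ennreal (norm (\<Sum>i\<in>I. h i x))) \<le> ennreal (2 * (\<Sum>i\<in>I. a i))"
      by (intro esssup_I) measurable
    then show ?thesis using True a0 by (simp add: Lp_norm_def Lp_index_def sum_nonneg)
  next
    case False
    define r where "r = enn2real p"
    have r: "0 < r" using p False by (simp add: r_def enn2real_positive_iff less_top)
    have hi: "(\<integral>\<^sup>+x. ennreal (norm (h i x) powr r) \<partial>lborel) \<le> ennreal (a i powr r)" if "i \<in> I" for i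
      using Lp_norm_le_iff[OF p False a0[OF that], of "h i"] h[OF that] by (simp add: r_def)
    have S0: "0 \<le> (\<Sum>i\<in>I. a i powr \<rho>)" for \<rho> by (intro sum_nonneg) simp
    show ?thesis
    proof (cases "r \<le> 1")
      case True
      then have ix: "Lp_index p = r" using False by (simp add: Lp_index_def r_def)
      have "(\<integral>\<^sup>+x. ennreal (norm (\<Sum>i\<in>I. h i x) powr r) \<partial>lborel) \<le> (\<integral>\<^sup>+x. (\<Sum>i\<in>I. ennreal (norm (h i x) powr r)) \<partial>lborel)"
      proof (rule nn_integral_mono)
        fix x
        have "norm (\<Sum>i\<in>I. h i x) powr r \<le> (\<Sum>i\<in>I. norm (h i x)) powr r"
          using r by (intro powr_mono2 norm_sum) auto
        also have "\<dots> \<le> (\<Sum>i\<in>I. norm (h i x) powr r)" using r True I by (intro powr_sum_le_sum_powr) auto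
        finally show "ennreal (norm (\<Sum>i\<in>I. h i x) powr r) \<le> (\<Sum>i\<in>I. ennreal (norm (h i x) powr r))"
          by (simp add: sum_ennreal ennreal_leI)
      qed
      also have "\<dots> = (\<Sum>i\<in>I. \<integral>\<^sup>+x. ennreal (norm (h i x) powr r) \<partial>lborel)"
        using hm by (intro nn_integral_sum) simp
      also have "\<dots> \<le> (\<Sum>i\<in>I. ennreal (a i powr r))" by (rule sum_mono[OF hi])
      also have "\<dots> = ennreal (\<Sum>i\<in>I. a i powr r)" by (simp add: sum_ennreal)
      also have "\<dots> \<le> ennreal ((2 * (\<Sum>i\<in>I. a i powr r) powr (1 / r)) powr r)"
      proof (rule ennreal_leI)
        have "(\<Sum>i\<in>I. a i powr r) = ((\<Sum>i\<in>I. a i powr r) powr (1 / r)) powr r" using r S0 by (simp add: powr_powr)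
        also have "\<dots> \<le> (2 * (\<Sum>i\<in>I. a i powr r) powr (1 / r)) powr r" using r by (intro powr_mono2) auto
        finally show "(\<Sum>i\<in>I. a i powr r) \<le> (2 * (\<Sum>i\<in>I. a i powr r) powr (1 / r)) powr r" .
      qed
      finally show ?thesis unfolding ix by (subst Lp_norm_le_iff[OF p False]) (simp_all add: r_def)
    next
      case r1: False
      then have ix: "Lp_index p = 1" using False by (simp add: Lp_index_def r_def)
      define A where "A = (\<Sum>i\<in>I. a i)"
      have A: "0 < A" unfolding A_def using a ne I by (intro sum_pos)
      have "(\<integral>\<^sup>+x. ennreal (norm (\<Sum>i\<in>I. h i x) powr r) \<partial>lborel)
        \<le> (\<integral>\<^sup>+x. ennreal ((2 * A) powr r) * (\<Sum>i\<in>I. ennreal (a i / A * a i powr (- r)) * ennreal (norm (h i x) powr r)) \<partial>lborel)"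
      proof (rule nn_integral_mono)
        fix x
        have "norm (\<Sum>i\<in>I. h i x) \<le> (\<Sum>i\<in>I. norm (h i x))" by (rule norm_sum)
        also have "\<dots> = A * (\<Sum>i\<in>I. a i / A * (norm (h i x) / a i))"
          unfolding sum_distrib_left using A a by (intro sum.cong) (auto simp: less_imp_neq[THEN not_sym])
        finally have "norm (\<Sum>i\<in>I. h i x) powr r \<le> (A * (\<Sum>i\<in>I. a i / A * (norm (h i x) / a i))) powr r"
          using r by (intro powr_mono2) auto
        also have "\<dots> = A powr r * (\<Sum>i\<in>I. a i / A * (norm (h i x) / a i)) powr r"
          by (rule powr_mult)
        also have "\<dots> \<le> A powr r * (2 powr r * (\<Sum>i\<in>I. a i / A * (norm (h i x) / a i) powr r))"
          using A a0 r1 by (intro mult_left_mono weighted_mean_powr_le) (auto simp: A_def simp flip: sum_divide_distrib)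
        also have "(\<Sum>i\<in>I. a i / A * (norm (h i x) / a i) powr r) = (\<Sum>i\<in>I. a i / A * a i powr (- r) * norm (h i x) powr r)"
          using a0 by (intro sum.cong) (auto simp: powr_divide powr_minus divide_simps)
        also have "A powr r * (2 powr r * (\<Sum>i\<in>I. a i / A * a i powr (- r) * norm (h i x) powr r))
          = (2 * A) powr r * (\<Sum>i\<in>I. a i / A * a i powr (- r) * norm (h i x) powr r)"
          using A by (simp add: powr_mult mult_ac)
        finally have "ennreal (norm (\<Sum>i\<in>I. h i x) powr r) \<le> ennreal ((2 * A) powr r * (\<Sum>i\<in>I. a i / A * a i powr (- r) * norm (h i x) powr r))"
          by (rule ennreal_leI)
        also have "\<dots> = ennreal ((2 * A) powr r) * ennreal (\<Sum>i\<in>I. a i / A * a i powr (- r) * norm (h i x) powr r)"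
          using A a0 by (intro ennreal_mult) (auto intro!: sum_nonneg)
        also have "ennreal (\<Sum>i\<in>I. a i / A * a i powr (- r) * norm (h i x) powr r) = (\<Sum>i\<in>I. ennreal (a i / A * a i powr (- r)) * ennreal (norm (h i x) powr r))"
        proof -
          have "(\<Sum>i\<in>I. ennreal (a i / A * a i powr (- r)) * ennreal (norm (h i x) powr r)) = (\<Sum>i\<in>I. ennreal (a i / A * a i powr (- r) * norm (h i x) powr r))"
            using A a0 by (intro sum.cong refl ennreal_mult[symmetric] mult_nonneg_nonneg divide_nonneg_pos) auto
          also have "\<dots> = ennreal (\<Sum>i\<in>I. a i / A * a i powr (- r) * norm (h i x) powr r)"
            using A a0 by (intro sum_ennreal mult_nonneg_nonneg divide_nonneg_pos) auto
          finally show ?thesis by (rule sym)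
        qed
        finally show "ennreal (norm (\<Sum>i\<in>I. h i x) powr r) \<le> ennreal ((2 * A) powr r) * (\<Sum>i\<in>I. ennreal (a i / A * a i powr (- r)) * ennreal (norm (h i x) powr r))" .
      qed
      also have "\<dots> = ennreal ((2 * A) powr r) * (\<Sum>i\<in>I. ennreal (a i / A * a i powr (- r)) * (\<integral>\<^sup>+x. ennreal (norm (h i x) powr r) \<partial>lborel))"
        using hm by (simp add: nn_integral_cmult nn_integral_sum)
      also have "\<dots> \<le> ennreal ((2 * A) powr r) * (\<Sum>i\<in>I. ennreal (a i / A * a i powr (- r)) * ennreal (a i powr r))"
        by (intro mult_left_mono sum_mono hi) auto
      also have "(\<Sum>i\<in>I. ennreal (a i / A * a i powr (- r)) * ennreal (a i powr r)) = (\<Sum>i\<in>I. ennreal (a i / A))"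
      proof (rule sum.cong)
        fix i assume i: "i \<in> I"
        have "a i powr (- r) * a i powr r = 1" using a[OF i] by (simp flip: powr_add)
        then have e: "a i / A * a i powr (- r) * a i powr r = a i / A" by (simp only: mult.assoc mult_1_right)
        have "ennreal (a i / A * a i powr (- r)) * ennreal (a i powr r) = ennreal (a i / A * a i powr (- r) * a i powr r)"
          using A a0[OF i] by (intro ennreal_mult[symmetric]) auto
        then show "ennreal (a i / A * a i powr (- r)) * ennreal (a i powr r) = ennreal (a i / A)" unfolding e .
      qed simp
      also have "(\<Sum>i\<in>I. ennreal (a i / A)) = 1"
        using A a0 by (subst sum_ennreal) (auto simp: A_def simp flip: sum_divide_distrib)
      finally have "(\<integral>\<^sup>+x. ennreal (norm (\<Sum>i\<in>I. h i x) powr r) \<partial>lborel) \<le> ennreal ((2 * A) powr r)" by simp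
      then have "Lp_norm p (\<lambda>x. \<Sum>i\<in>I. h i x) \<le> ennreal (2 * A)"
        using A by (subst Lp_norm_le_iff[OF p False]) (simp_all add: r_def)
      then show ?thesis unfolding ix using A a0 by (simp add: A_def)
    qed
  qed
qed

lemma Lp_norm_finite_sum:
  fixes h :: "'i \<Rightarrow> 'a::euclidean_space \<Rightarrow> complex"
  assumes p: "0 < p" and I: "finite I" and hm: "\<And>i. i \<in> I \<Longrightarrow> h i \<in> borel_measurable borel"
    and a: "\<And>i. i \<in> I \<Longrightarrow> 0 \<le> a i" and h: "\<And>i. i \<in> I \<Longrightarrow> Lp_norm p (h i) \<le> ennreal (a i)"
  shows "Lp_norm p (\<lambda>x. \<Sum>i\<in>I. h i x) \<le> ennreal (2 * (\<Sum>i\<in>I. a i powr Lp_index p) powr (1 / Lp_index p))"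
proof -
  let ?\<rho> = "Lp_index p"
  have \<rho>: "0 < ?\<rho>" using Lp_index(1)[OF p] .
  let ?b = "\<lambda>n. 2 * (\<Sum>i\<in>I. (a i + inverse (real (Suc n))) powr ?\<rho>) powr (1 / ?\<rho>)"
  have le: "Lp_norm p (\<lambda>x. \<Sum>i\<in>I. h i x) \<le> ennreal (?b n)" for n
  proof (rule Lp_norm_finite_sum_pos[OF p I hm])
    fix i assume i: "i \<in> I"
    have "0 < inverse (real (Suc n))" by simp
    then show "0 < a i + inverse (real (Suc n))" using a[OF i] by linarith
    have "ennreal (a i) \<le> ennreal (a i + inverse (real (Suc n)))" by (intro ennreal_leI) simp
    with h[OF i] show "Lp_norm p (h i) \<le> ennreal (a i + inverse (real (Suc n)))" by (rule order_trans)
  qed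
  have "?b \<longlonglongrightarrow> 2 * (\<Sum>i\<in>I. (a i + 0) powr ?\<rho>) powr (1 / ?\<rho>)"
  proof (intro tendsto_mult tendsto_const tendsto_powr' tendsto_sum tendsto_add LIMSEQ_inverse_real_of_nat)
    fix i assume i: "i \<in> I"
    show "a i + 0 \<noteq> 0 \<or> 0 < ?\<rho> \<and> (\<forall>\<^sub>F n in sequentially. 0 \<le> a i + inverse (real (Suc n)))"
      using \<rho> a[OF i] by (intro disjI2 conjI always_eventually allI) auto
  next
    show "(\<Sum>i\<in>I. (a i + 0) powr ?\<rho>) \<noteq> 0 \<or> 0 < 1 / ?\<rho> \<and> (\<forall>\<^sub>F n in sequentially. 0 \<le> (\<Sum>i\<in>I. (a i + inverse (real (Suc n))) powr ?\<rho>))"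
      using \<rho> by (intro disjI2 conjI always_eventually allI) (auto intro: sum_nonneg)
  qed
  then have "(\<lambda>n. ennreal (?b n)) \<longlonglongrightarrow> ennreal (2 * (\<Sum>i\<in>I. (a i + 0) powr ?\<rho>) powr (1 / ?\<rho>))"
    by (rule tendsto_ennrealI)
  from LIMSEQ_le_const[OF this] le show ?thesis by (simp add: exI[of _ 0])
qed

lemma Lp_norm_limit_le:
  fixes S :: "nat \<Rightarrow> 'a::euclidean_space \<Rightarrow> complex"
  assumes p: "0 < p" and Sm [measurable]: "\<And>n. S n \<in> borel_measurable borel"
    and lim: "\<And>x. (\<lambda>n. S n x) \<longlonglongrightarrow> H x" and T: "0 \<le> T" "\<And>n. Lp_norm p (S n) \<le> ennreal T"
  shows "Lp_norm p H \<le> ennreal T"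
proof -
  have [measurable]: "H \<in> borel_measurable borel" by (rule borel_measurable_LIMSEQ_metric[OF Sm lim])
  show ?thesis
  proof (cases "p = \<infinity>")
    case True
    have "AE x in lborel. \<forall>n. ennreal (norm (S n x)) \<le> ennreal T"
    proof (subst AE_all_countable, intro allI)
      fix n
      have ae: "AE x in lborel. ennreal (norm (S n x)) \<le> esssup lborel (\<lambda>x. ennreal (norm (S n x)))" by (rule esssup_AE)
      have le: "esssup lborel (\<lambda>x. ennreal (norm (S n x))) \<le> ennreal T" using T(2)[of n] True by (simp add: Lp_norm_def)
      from ae show "AE x in lborel. ennreal (norm (S n x)) \<le> ennreal T" by eventually_elim (rule order_trans[OF _ le])
    qed
    then have "AE x in lborel. ennreal (norm (H x)) \<le> ennreal T"
    proof eventually_elim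
      case (elim x)
      have "(\<lambda>n. norm (S n x)) \<longlonglongrightarrow> norm (H x)" by (intro tendsto_norm lim)
      moreover have "\<forall>n\<ge>0. norm (S n x) \<le> T" using elim T(1) by (simp add: ennreal_le_iff)
      ultimately have "norm (H x) \<le> T" using LIMSEQ_le_const2 by blast
      then show ?case by (rule ennreal_leI)
    qed
    then have "esssup lborel (\<lambda>x. ennreal (norm (H x))) \<le> ennreal T" by (intro esssup_I) measurable
    then show ?thesis using True by (simp add: Lp_norm_def)
  next
    case False
    have r: "0 < enn2real p" using p False by (simp add: enn2real_positive_iff less_top)
    have "(\<integral>\<^sup>+x. ennreal (norm (H x) powr enn2real p) \<partial>lborel) = (\<integral>\<^sup>+x. liminf (\<lambda>n. ennreal (norm (S n x) powr enn2real p)) \<partial>lborel)"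
    proof (rule nn_integral_cong)
      fix x
      have "(\<lambda>n. ennreal (norm (S n x) powr enn2real p)) \<longlonglongrightarrow> ennreal (norm (H x) powr enn2real p)"
        using r by (intro tendsto_ennrealI tendsto_powr' tendsto_norm lim tendsto_const) auto
      then show "ennreal (norm (H x) powr enn2real p) = liminf (\<lambda>n. ennreal (norm (S n x) powr enn2real p))"
        using lim_imp_Liminf by (metis sequentially_bot)
    qed
    also have "\<dots> \<le> liminf (\<lambda>n. \<integral>\<^sup>+x. ennreal (norm (S n x) powr enn2real p) \<partial>lborel)"
      by (rule nn_integral_liminf) measurable
    also have "\<dots> \<le> ennreal (T powr enn2real p)"
    proof -
      have "(\<integral>\<^sup>+x. ennreal (norm (S n x) powr enn2real p) \<partial>lborel) \<le> ennreal (T powr enn2real p)" for n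
        using Lp_norm_le_iff[OF p False T(1), of "S n"] T(2)[of n] by simp
      then have "liminf (\<lambda>n. \<integral>\<^sup>+x. ennreal (norm (S n x) powr enn2real p) \<partial>lborel) \<le> liminf (\<lambda>n::nat. ennreal (T powr enn2real p))"
        by (intro Liminf_mono always_eventually allI)
      then show ?thesis by (simp add: Liminf_const)
    qed
    finally show ?thesis using Lp_norm_le_iff[OF p False T(1), of H] by simp
  qed
qed

lemma Lp_norm_has_sum:
  fixes h :: "'i \<Rightarrow> 'a::euclidean_space \<Rightarrow> complex"
  assumes p: "0 < p" and K: "countable K" and hm: "\<And>i. i \<in> K \<Longrightarrow> h i \<in> borel_measurable borel"
    and a: "\<And>i. i \<in> K \<Longrightarrow> 0 \<le> a i" and h: "\<And>i. i \<in> K \<Longrightarrow> Lp_norm p (h i) \<le> ennreal (a i)"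
    and sum: "\<And>x. ((\<lambda>i. h i x) has_sum H x) K"
    and T: "\<And>F. finite F \<Longrightarrow> F \<subseteq> K \<Longrightarrow> (\<Sum>i\<in>F. a i powr Lp_index p) \<le> T powr Lp_index p" "0 \<le> T"
  shows "Lp_norm p H \<le> ennreal (2 * T)"
proof -
  have \<rho>: "0 < Lp_index p" using Lp_index(1)[OF p] .
  define E where "E n = K \<inter> {i. to_nat_on K i \<le> n}" for n
  have fin: "finite (E n)" for n
  proof -
    have "inj_on (to_nat_on K) (E n)" using inj_on_to_nat_on[OF K] by (rule inj_on_subset) (auto simp: E_def)
    moreover have "finite (to_nat_on K ` E n)" by (rule finite_subset[of _ "{..n}"]) (auto simp: E_def)
    ultimately show ?thesis using finite_imageD by blast
  qed
  have flim: "filterlim E (finite_subsets_at_top K) sequentially"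
    unfolding filterlim_finite_subsets_at_top
  proof (intro allI impI)
    fix X assume X: "finite X \<and> X \<subseteq> K"
    have "\<forall>\<^sub>F n in sequentially. \<forall>i\<in>X. to_nat_on K i \<le> n"
      using X by (intro eventually_ball_finite ballI eventually_ge_at_top) auto
    then show "\<forall>\<^sub>F n in sequentially. finite (E n) \<and> X \<subseteq> E n \<and> E n \<subseteq> K"
      by eventually_elim (use X fin in \<open>auto simp: E_def\<close>)
  qed
  show ?thesis
  proof (rule Lp_norm_limit_le[OF p, of "\<lambda>n x. \<Sum>i\<in>E n. h i x"])
    show "(\<lambda>x. \<Sum>i\<in>E n. h i x) \<in> borel_measurable borel" for n
      using hm by (intro borel_measurable_sum) (auto simp: E_def)
    show "(\<lambda>n. \<Sum>i\<in>E n. h i x) \<longlonglongrightarrow> H x" for x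
      using filterlim_compose[OF sum[of x, unfolded has_sum_def] flim] .
    fix n
    have "Lp_norm p (\<lambda>x. \<Sum>i\<in>E n. h i x) \<le> ennreal (2 * (\<Sum>i\<in>E n. a i powr Lp_index p) powr (1 / Lp_index p))"
      by (rule Lp_norm_finite_sum[OF p fin]) (use hm a h in \<open>auto simp: E_def\<close>)
    also have "\<dots> \<le> ennreal (2 * T)"
    proof (intro ennreal_leI mult_left_mono)
      have "(\<Sum>i\<in>E n. a i powr Lp_index p) \<le> T powr Lp_index p" by (rule T(1)[OF fin]) (auto simp: E_def)
      then have "(\<Sum>i\<in>E n. a i powr Lp_index p) powr (1 / Lp_index p) \<le> (T powr Lp_index p) powr (1 / Lp_index p)"
        using \<rho> by (intro powr_mono2) (auto intro: sum_nonneg)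
      then show "(\<Sum>i\<in>E n. a i powr Lp_index p) powr (1 / Lp_index p) \<le> T" using \<rho> T(2) by (simp add: powr_powr)
    qed simp
    finally show "Lp_norm p (\<lambda>x. \<Sum>i\<in>E n. h i x) \<le> ennreal (2 * T)" .
  qed (use T(2) in simp)
qed

section \<open>Sequence spaces\<close>

definition lq_bound :: "ennreal \<Rightarrow> ('k \<Rightarrow> real) \<Rightarrow> 'k set \<Rightarrow> real \<Rightarrow> bool" where
  "lq_bound q X K R \<longleftrightarrow> (if q = \<infinity> then \<forall>k\<in>K. X k \<le> R
     else \<forall>F. finite F \<longrightarrow> F \<subseteq> K \<longrightarrow> (\<Sum>k\<in>F. X k powr enn2real q) \<le> R powr enn2real q)"

lemma lq_bound_pointwise:
  assumes q: "0 < q" and X: "\<And>k. k \<in> K \<Longrightarrow> 0 \<le> X k" and R: "0 \<le> R" and b: "lq_bound q X K R" and k: "k \<in> K"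
  shows "X k \<le> R"
proof (cases "q = \<infinity>")
  case True
  then show ?thesis using b k by (simp add: lq_bound_def)
next
  case False
  have r: "0 < enn2real q" using q False by (simp add: enn2real_positive_iff less_top)
  have "(\<Sum>k\<in>{k}. X k powr enn2real q) \<le> R powr enn2real q"
    using b False k unfolding lq_bound_def by (metis empty_subsetI finite.emptyI finite_insert insert_subset)
  then have "(X k powr enn2real q) powr (1 / enn2real q) \<le> (R powr enn2real q) powr (1 / enn2real q)"
    using r by (intro powr_mono2[where a = "1 / enn2real q"]) simp_all
  then show ?thesis using r R X[OF k] by (simp add: powr_powr)
qed

lemma lq_bound_cmult:
  assumes c: "0 \<le> c" and b: "lq_bound q X K R"
  shows "lq_bound q (\<lambda>k. c * X k) K (c * R)"
proof (cases "q = \<infinity>")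
  case True
  then show ?thesis using b c by (auto simp: lq_bound_def intro: mult_left_mono)
next
  case False
  have "(\<Sum>k\<in>F. (c * X k) powr enn2real q) \<le> (c * R) powr enn2real q" if F: "finite F" "F \<subseteq> K" for F
  proof -
    have "(\<Sum>k\<in>F. X k powr enn2real q) \<le> R powr enn2real q" using b False F by (auto simp: lq_bound_def)
    then have "c powr enn2real q * (\<Sum>k\<in>F. X k powr enn2real q) \<le> c powr enn2real q * R powr enn2real q"
      by (intro mult_left_mono) auto
    then show ?thesis by (simp add: powr_mult sum_distrib_left)
  qed
  then show ?thesis using False by (simp add: lq_bound_def)
qed

lemma lq_bound_finite_Max:
  fixes y :: "'a::ab_group_add \<Rightarrow> real"
  assumes q: "0 < q" and E: "finite E" "E \<noteq> {}" and y: "\<And>k. 0 \<le> y k" and R: "0 \<le> R"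
    and K: "\<And>j e. j \<in> K \<Longrightarrow> e \<in> E \<Longrightarrow> j + e \<in> K" and b: "lq_bound q y K R"
  shows "lq_bound q (\<lambda>j. MAX e\<in>E. y (j + e)) K ((if q = \<infinity> then 1 else real (card E) powr (1 / enn2real q)) * R)"
proof (cases "q = \<infinity>")
  case True
  have "(MAX e\<in>E. y (j + e)) \<le> R" if "j \<in> K" for j
  proof -
    have "y (j + e) \<le> R" if "e \<in> E" for e using b True K[OF \<open>j \<in> K\<close> that] by (simp add: lq_bound_def)
    then show ?thesis using E by simp
  qed
  then show ?thesis using True by (simp add: lq_bound_def)
next
  case False
  define r where "r = enn2real q"
  have r: "0 < r" using q False by (simp add: r_def enn2real_positive_iff less_top)
  have "(\<Sum>j\<in>F. (MAX e\<in>E. y (j + e)) powr r) \<le> (real (card E) powr (1 / r) * R) powr r" if F: "finite F" "F \<subseteq> K" for F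
  proof -
    have "(MAX e\<in>E. y (j + e)) powr r \<le> (\<Sum>e\<in>E. y (j + e) powr r)" for j
    proof -
      have "(MAX e\<in>E. y (j + e)) \<in> (\<lambda>e. y (j + e)) ` E" using E by (intro Max_in) auto
      then obtain e where e: "e \<in> E" "(MAX e\<in>E. y (j + e)) = y (j + e)" by auto
      show ?thesis unfolding e(2) using e(1) E by (intro member_le_sum) auto
    qed
    then have "(\<Sum>j\<in>F. (MAX e\<in>E. y (j + e)) powr r) \<le> (\<Sum>j\<in>F. \<Sum>e\<in>E. y (j + e) powr r)" by (rule sum_mono)
    also have "\<dots> = (\<Sum>e\<in>E. \<Sum>j\<in>F. y (j + e) powr r)" by (rule sum.swap)
    also have "\<dots> \<le> (\<Sum>e\<in>E. R powr r)"
    proof (rule sum_mono)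
      fix e assume e: "e \<in> E"
      have "(\<Sum>j\<in>F. y (j + e) powr r) = (\<Sum>k\<in>(\<lambda>j. j + e) ` F. y k powr r)"
        by (subst sum.reindex) (auto intro: inj_onI)
      also have "\<dots> \<le> R powr r"
      proof -
        have "(\<lambda>j. j + e) ` F \<subseteq> K" using F K[OF _ e] by blast
        then show ?thesis using b False F(1) by (simp add: lq_bound_def r_def)
      qed
      finally show "(\<Sum>j\<in>F. y (j + e) powr r) \<le> R powr r" .
    qed
    also have "\<dots> = (real (card E) powr (1 / r) * R) powr r" using r by (simp add: powr_mult powr_powr)
    finally show ?thesis .
  qed
  then show ?thesis using False by (simp add: lq_bound_def r_def)
qed

lemma young_powr:
  fixes b w :: real
  assumes "0 \<le> b" "0 \<le> w" "0 < \<rho>" "\<rho> < q"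
  shows "(w * b) powr \<rho> \<le> b powr q + w powr (\<rho> * (q / (q - \<rho>)))"
proof (cases "w powr \<rho> \<le> b powr (q - \<rho>)")
  case True
  have "(w * b) powr \<rho> = w powr \<rho> * b powr \<rho>" by (rule powr_mult)
  also have "\<dots> \<le> b powr (q - \<rho>) * b powr \<rho>" using True by (rule mult_right_mono) simp
  also have "\<dots> = b powr q" by (simp flip: powr_add)
  finally show ?thesis by (rule order_trans) simp
next
  case False
  then have "(b powr (q - \<rho>)) powr (\<rho> / (q - \<rho>)) \<le> (w powr \<rho>) powr (\<rho> / (q - \<rho>))"
    using assms by (intro powr_mono2) auto
  then have le: "b powr \<rho> \<le> w powr (\<rho> * (\<rho> / (q - \<rho>)))" using assms by (simp add: powr_powr)
  have "(w * b) powr \<rho> = w powr \<rho> * b powr \<rho>" by (rule powr_mult)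
  also have "\<dots> \<le> w powr \<rho> * w powr (\<rho> * (\<rho> / (q - \<rho>)))" using le by (rule mult_left_mono) simp
  also have "\<dots> = w powr (\<rho> + \<rho> * (\<rho> / (q - \<rho>)))" by (simp add: powr_add)
  also have "\<rho> + \<rho> * (\<rho> / (q - \<rho>)) = \<rho> * (q / (q - \<rho>))" using assms by (simp add: field_simps)
  finally show ?thesis by (rule order_trans) simp
qed

lemma has_sum_finite_sum:
  fixes f :: "'k \<Rightarrow> 'l \<Rightarrow> 'b::topological_comm_monoid_add"
  assumes "finite F" "\<And>k. k \<in> F \<Longrightarrow> (f k has_sum s k) A"
  shows "((\<lambda>l. \<Sum>k\<in>F. f k l) has_sum (\<Sum>k\<in>F. s k)) A"
  using assms by (induction F) (auto intro: has_sum_add)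

lemma lq_bound_rows:
  fixes X :: "'k \<Rightarrow> real \<Rightarrow> real"
  assumes q: "0 < q" "q \<noteq> \<infinity>" and R: "0 \<le> R" and b: "lq_bound q (\<lambda>(k, l). X k l) (K \<times> \<int>) R"
  defines "y \<equiv> \<lambda>k. if k \<in> K then (\<Sum>\<^sub>\<infinity>l\<in>\<int>. X k l powr enn2real q) powr (1 / enn2real q) else 0"
  shows "lq_bound q y K R"
    and "\<And>k L. k \<in> K \<Longrightarrow> finite L \<Longrightarrow> L \<subseteq> \<int> \<Longrightarrow> (\<Sum>l\<in>L. X k l powr enn2real q) \<le> y k powr enn2real q"
proof -
  define r where "r = enn2real q"
  have r: "0 < r" using q by (simp add: r_def enn2real_positive_iff less_top)
  have fin: "(\<Sum>k\<in>F. \<Sum>l\<in>L. X k l powr r) \<le> R powr r" if F: "finite F" "F \<subseteq> K" "finite L" "L \<subseteq> \<int>" for F L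
  proof -
    have "(\<Sum>z\<in>F \<times> L. (case z of (k, l) \<Rightarrow> X k l) powr r) \<le> R powr r"
      using b q(2) F unfolding lq_bound_def r_def by (auto simp: Sigma_mono)
    moreover have "(\<Sum>z\<in>F \<times> L. (case z of (k, l) \<Rightarrow> X k l) powr r) = (\<Sum>k\<in>F. \<Sum>l\<in>L. X k l powr r)"
      by (simp add: sum.cartesian_product case_prod_unfold)
    ultimately show ?thesis by simp
  qed
  have sm: "(\<lambda>l. X k l powr r) summable_on \<int>" if k: "k \<in> K" for k
  proof (rule nonneg_bdd_above_summable_on)
    show "bdd_above (sum (\<lambda>l. X k l powr r) ` {F. F \<subseteq> \<int> \<and> finite F})"
      using fin[of "{k}"] k by (intro bdd_aboveI[of _ "R powr r"]) auto
  qed simp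
  have y: "y k powr r = (\<Sum>\<^sub>\<infinity>l\<in>\<int>. X k l powr r)" if "k \<in> K" for k
    using that r by (simp add: y_def r_def powr_powr infsum_nonneg)
  show "(\<Sum>l\<in>L. X k l powr enn2real q) \<le> y k powr enn2real q" if "k \<in> K" "finite L" "L \<subseteq> \<int>" for k L
    using finite_sum_le_infsum[OF sm[OF that(1)] that(2,3)] y[OF that(1)] by (simp add: r_def)
  have "(\<Sum>k\<in>F. y k powr r) \<le> R powr r" if F: "finite F" "F \<subseteq> K" for F
  proof -
    have "((\<lambda>l. \<Sum>k\<in>F. X k l powr r) has_sum (\<Sum>k\<in>F. y k powr r)) \<int>"
      using F(1)
    proof (rule has_sum_finite_sum)
      fix k assume "k \<in> F"
      then have k: "k \<in> K" using F by auto
      show "((\<lambda>l. X k l powr r) has_sum y k powr r) \<int>" unfolding y[OF k] by (rule has_sum_infsum[OF sm[OF k]])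
    qed
    then show ?thesis
    proof (rule has_sum_le_finite_sums)
      fix L :: "real set" assume "finite L" "L \<subseteq> \<int>"
      then show "(\<Sum>l\<in>L. \<Sum>k\<in>F. X k l powr r) \<le> R powr r" by (subst sum.swap) (rule fin[OF F])
    qed
  qed
  then show "lq_bound q y K R" using q(2) by (simp add: lq_bound_def r_def)
qed

text \<open>The condition on \<open>\<sigma>\<close> is the summability over \<open>\<int>\<close> of \<open>(1 + \<bar>l\<bar>) powr (- \<sigma> * \<rho>)\<close> to the power dual
  to \<open>q / \<rho>\<close>, which is what Hoelder's inequality needs when \<open>\<rho> < q\<close>.\<close>

definition trace_loss :: "real \<Rightarrow> ennreal \<Rightarrow> real \<Rightarrow> bool" where
  "trace_loss \<rho> q \<sigma> \<longleftrightarrow> 0 \<le> \<sigma> \<and> (if q = \<infinity> then 1 < \<sigma> * \<rho>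
     else \<rho> < enn2real q \<longrightarrow> 1 < \<sigma> * (\<rho> * (enn2real q / (enn2real q - \<rho>))))"

lemma weighted_rows:
  assumes q: "0 < q" and \<rho>: "0 < \<rho>" and \<sigma>: "trace_loss \<rho> q \<sigma>"
  shows "\<exists>C>0. \<forall>(X :: 'k \<Rightarrow> real \<Rightarrow> real) K R. (\<forall>k l. 0 \<le> X k l) \<longrightarrow> 0 \<le> R \<longrightarrow> lq_bound q (\<lambda>(k, l). X k l) (K \<times> \<int>) R \<longrightarrow>
    (\<exists>y. (\<forall>k. 0 \<le> y k) \<and> lq_bound q y K R \<and>
      (\<forall>k\<in>K. \<forall>L. finite L \<longrightarrow> L \<subseteq> \<int> \<longrightarrow> (\<Sum>l\<in>L. ((1 + \<bar>l\<bar>) powr (- \<sigma>) * X k l) powr \<rho>) \<le> (C * y k) powr \<rho>))"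
proof (cases "q = \<infinity>")
  case True
  then have s1: "1 < \<sigma> * \<rho>" using \<sigma> by (simp add: trace_loss_def)
  obtain B where B: "0 \<le> B" "\<And>F :: real set. finite F \<Longrightarrow> F \<subseteq> \<int> \<Longrightarrow> (\<Sum>l\<in>F. (1 + \<bar>l\<bar>) powr (- (\<sigma> * \<rho>))) \<le> B"
    using Ints_powr_sum_bounded[OF s1] by auto
  show ?thesis
  proof (intro exI[of _ "(1 + B) powr (1 / \<rho>)"] conjI allI impI)
    show "0 < (1 + B) powr (1 / \<rho>)" using B(1) by simp
    fix X :: "'k \<Rightarrow> real \<Rightarrow> real" and K R
    assume X: "\<forall>k l. 0 \<le> X k l" and R: "0 \<le> R" and b: "lq_bound q (\<lambda>(k, l). X k l) (K \<times> \<int>) R"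
    have XR: "X k l \<le> R" if "k \<in> K" "l \<in> \<int>" for k l using b that True by (auto simp: lq_bound_def)
    show "\<exists>y. (\<forall>k. 0 \<le> y k) \<and> lq_bound q y K R \<and> (\<forall>k\<in>K. \<forall>L. finite L \<longrightarrow> L \<subseteq> \<int> \<longrightarrow>
        (\<Sum>l\<in>L. ((1 + \<bar>l\<bar>) powr (- \<sigma>) * X k l) powr \<rho>) \<le> ((1 + B) powr (1 / \<rho>) * y k) powr \<rho>)"
    proof (intro exI[of _ "\<lambda>_. R"] conjI allI ballI impI)
      show "lq_bound q (\<lambda>_. R) K R" using True by (simp add: lq_bound_def)
      fix k :: 'k and L :: "real set" assume k: "k \<in> K" and L: "finite L" "L \<subseteq> \<int>"
      have "(\<Sum>l\<in>L. ((1 + \<bar>l\<bar>) powr (- \<sigma>) * X k l) powr \<rho>) \<le> (\<Sum>l\<in>L. ((1 + \<bar>l\<bar>) powr (- \<sigma>) * R) powr \<rho>)"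
        using X XR[OF k] L \<rho> by (intro sum_mono powr_mono2 mult_left_mono) auto
      also have "\<dots> = (\<Sum>l\<in>L. (1 + \<bar>l\<bar>) powr (- (\<sigma> * \<rho>))) * R powr \<rho>"
        by (simp add: powr_mult powr_powr sum_distrib_right)
      also have "\<dots> \<le> (1 + B) * R powr \<rho>" using B(2)[OF L] by (intro mult_right_mono) auto
      also have "\<dots> = ((1 + B) powr (1 / \<rho>) * R) powr \<rho>" using \<rho> B(1) by (simp add: powr_mult powr_powr)
      finally show "(\<Sum>l\<in>L. ((1 + \<bar>l\<bar>) powr (- \<sigma>) * X k l) powr \<rho>) \<le> ((1 + B) powr (1 / \<rho>) * R) powr \<rho>" .
    qed (use R in auto)
  qed
next
  case fin: False
  define r where "r = enn2real q"
  have r: "0 < r" using q fin by (simp add: r_def enn2real_positive_iff less_top)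
  define \<theta> where "\<theta> = r / (r - \<rho>)"
  have "\<exists>C>0. \<forall>X Y L. (\<forall>l. 0 \<le> X l) \<longrightarrow> 0 \<le> Y \<longrightarrow> finite L \<longrightarrow> L \<subseteq> \<int> \<longrightarrow> (\<Sum>l\<in>L. X l powr r) \<le> Y powr r \<longrightarrow>
    (\<Sum>l\<in>L. ((1 + \<bar>l\<bar>) powr (- \<sigma>) * X l) powr \<rho>) \<le> (C * Y) powr \<rho>"
  proof (cases "r \<le> \<rho>")
    case True
    show ?thesis
    proof (intro exI[of _ 1] conjI allI impI)
      fix X :: "real \<Rightarrow> real" and Y :: real and L :: "real set"
      assume X: "\<forall>l. 0 \<le> X l" and Y: "0 \<le> Y" and L: "finite L" "L \<subseteq> \<int>" and le: "(\<Sum>l\<in>L. X l powr r) \<le> Y powr r"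
      have "(\<Sum>l\<in>L. ((1 + \<bar>l\<bar>) powr (- \<sigma>) * X l) powr \<rho>) \<le> (\<Sum>l\<in>L. (X l powr r) powr (\<rho> / r))"
      proof (rule sum_mono)
        fix l :: real
        have "1 + \<bar>l\<bar> \<noteq> 0" using abs_ge_zero[of l] by linarith
        moreover have "(1 + \<bar>l\<bar>) powr (- \<sigma>) \<le> (1 + \<bar>l\<bar>) powr 0"
          using \<sigma> by (intro powr_mono) (auto simp: trace_loss_def)
        ultimately have "(1 + \<bar>l\<bar>) powr (- \<sigma>) \<le> 1" by simp
        then have "(1 + \<bar>l\<bar>) powr (- \<sigma>) * X l \<le> 1 * X l" using X by (intro mult_right_mono) auto
        then have "((1 + \<bar>l\<bar>) powr (- \<sigma>) * X l) powr \<rho> \<le> X l powr \<rho>" using X \<rho> by (intro powr_mono2) auto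
        also have "X l powr \<rho> = (X l powr r) powr (\<rho> / r)" using r by (simp add: powr_powr)
        finally show "((1 + \<bar>l\<bar>) powr (- \<sigma>) * X l) powr \<rho> \<le> (X l powr r) powr (\<rho> / r)" .
      qed
      also have "\<dots> \<le> (\<Sum>l\<in>L. X l powr r) powr (\<rho> / r)"
        using True r L by (intro sum_powr_le_powr_sum) auto
      also have "\<dots> \<le> (Y powr r) powr (\<rho> / r)" using le r \<rho> by (intro powr_mono2) (auto intro: sum_nonneg)
      also have "\<dots> = (1 * Y) powr \<rho>" using r by (simp add: powr_powr)
      finally show "(\<Sum>l\<in>L. ((1 + \<bar>l\<bar>) powr (- \<sigma>) * X l) powr \<rho>) \<le> (1 * Y) powr \<rho>" .
    qed simp
  next
    case False
    then have s1: "1 < \<sigma> * (\<rho> * \<theta>)" using \<sigma> fin by (simp add: trace_loss_def r_def \<theta>_def)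
    obtain B where B: "0 \<le> B" "\<And>F :: real set. finite F \<Longrightarrow> F \<subseteq> \<int> \<Longrightarrow> (\<Sum>l\<in>F. (1 + \<bar>l\<bar>) powr (- (\<sigma> * (\<rho> * \<theta>)))) \<le> B"
      using Ints_powr_sum_bounded[OF s1] by auto
    show ?thesis
    proof (intro exI[of _ "(1 + B) powr (1 / \<rho>)"] conjI allI impI)
      show "0 < (1 + B) powr (1 / \<rho>)" using B(1) by simp
      fix X :: "real \<Rightarrow> real" and Y :: real and L :: "real set"
      assume X: "\<forall>l. 0 \<le> X l" and Y: "0 \<le> Y" and L: "finite L" "L \<subseteq> \<int>" and le: "(\<Sum>l\<in>L. X l powr r) \<le> Y powr r"
      show "(\<Sum>l\<in>L. ((1 + \<bar>l\<bar>) powr (- \<sigma>) * X l) powr \<rho>) \<le> ((1 + B) powr (1 / \<rho>) * Y) powr \<rho>"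
      proof (cases "Y = 0")
        case True
        then have "(\<Sum>l\<in>L. X l powr r) = 0" using le r by (intro antisym sum_nonneg) auto
        then have "\<forall>l\<in>L. X l powr r = 0" using L(1) by (subst (asm) sum_nonneg_eq_0_iff) auto
        then show ?thesis using True by simp
      next
        case F: False
        then have Y: "0 < Y" using Y by simp
        have "(\<Sum>l\<in>L. ((1 + \<bar>l\<bar>) powr (- \<sigma>) * X l) powr \<rho>) = Y powr \<rho> * (\<Sum>l\<in>L. ((1 + \<bar>l\<bar>) powr (- \<sigma>) * (X l / Y)) powr \<rho>)"
          unfolding sum_distrib_left using Y by (intro sum.cong) (simp_all flip: powr_mult)
        also have "\<dots> \<le> Y powr \<rho> * (\<Sum>l\<in>L. (X l / Y) powr r + ((1 + \<bar>l\<bar>) powr (- \<sigma>)) powr (\<rho> * \<theta>))"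
          unfolding \<theta>_def using X Y \<rho> False by (intro mult_left_mono sum_mono young_powr) auto
        also have "\<dots> = Y powr \<rho> * ((\<Sum>l\<in>L. X l powr r) / Y powr r + (\<Sum>l\<in>L. (1 + \<bar>l\<bar>) powr (- (\<sigma> * (\<rho> * \<theta>)))))"
          by (simp add: sum.distrib sum_divide_distrib powr_divide powr_powr)
        also have "\<dots> \<le> Y powr \<rho> * (1 + B)"
          using le Y B(2)[OF L] by (intro mult_left_mono add_mono) auto
        also have "\<dots> = ((1 + B) powr (1 / \<rho>) * Y) powr \<rho>" using \<rho> B(1) by (simp add: powr_mult powr_powr)
        finally show ?thesis .
      qed
    qed
  qed
  then obtain C where C: "0 < C" "\<And>X Y L. (\<forall>l. 0 \<le> X l) \<Longrightarrow> 0 \<le> Y \<Longrightarrow> finite L \<Longrightarrow> L \<subseteq> \<int> \<Longrightarrow> (\<Sum>l\<in>L. X l powr r) \<le> Y powr r \<Longrightarrow>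
    (\<Sum>l\<in>L. ((1 + \<bar>l\<bar>) powr (- \<sigma>) * X l) powr \<rho>) \<le> (C * Y) powr \<rho>" by meson
  show ?thesis
  proof (intro exI[of _ C] conjI allI impI)
    fix X :: "'k \<Rightarrow> real \<Rightarrow> real" and K R
    assume X: "\<forall>k l. 0 \<le> X k l" and R: "0 \<le> R" and b: "lq_bound q (\<lambda>(k, l). X k l) (K \<times> \<int>) R"
    let ?y = "\<lambda>k. if k \<in> K then (\<Sum>\<^sub>\<infinity>l\<in>\<int>. X k l powr enn2real q) powr (1 / enn2real q) else 0"
    note rows = lq_bound_rows[OF q fin R b]
    show "\<exists>y. (\<forall>k. 0 \<le> y k) \<and> lq_bound q y K R \<and> (\<forall>k\<in>K. \<forall>L. finite L \<longrightarrow> L \<subseteq> \<int> \<longrightarrow>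
        (\<Sum>l\<in>L. ((1 + \<bar>l\<bar>) powr (- \<sigma>) * X k l) powr \<rho>) \<le> (C * y k) powr \<rho>)"
    proof (intro exI[of _ ?y] conjI allI ballI impI)
      show "0 \<le> ?y k" for k by simp
      show "lq_bound q ?y K R" by (rule rows(1))
      fix k :: 'k and L :: "real set" assume k: "k \<in> K" and L: "finite L" "L \<subseteq> \<int>"
      show "(\<Sum>l\<in>L. ((1 + \<bar>l\<bar>) powr (- \<sigma>) * X k l) powr \<rho>) \<le> (C * ?y k) powr \<rho>"
      proof (rule C(2)[OF _ _ L])
        show "(\<Sum>l\<in>L. X k l powr r) \<le> ?y k powr r" unfolding r_def by (rule rows(2)[OF k L])
      qed (use X in auto)
    qed
  qed (rule C(1))
qed

section \<open>Modulation norms\<close>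

lemma modulation_norm_le_iff:
  assumes q: "0 < q" "q \<noteq> \<infinity>" and R: "0 \<le> R"
  shows "modulation_norm \<eta> s p q f \<le> ennreal R \<longleftrightarrow>
    (\<forall>F. finite F \<longrightarrow> F \<subseteq> int_lattice \<longrightarrow> (\<Sum>k\<in>F. ennreal (japanese_bracket k powr (enn2real q * s)) *
             ennpowr (Lp_norm p (box \<eta> k f)) (enn2real q)) \<le> ennreal (R powr enn2real q))"
proof -
  have r: "0 < enn2real q" using q by (simp add: enn2real_positive_iff less_top)
  show ?thesis
    using q(2) unfolding modulation_norm_def
    by (simp add: ennpowr_le_iff[OF r R] nonneg_infsum_complete SUP_le_iff) blast
qed

lemma modulation_norm_le:
  assumes q: "0 < q" and R: "0 \<le> R" and B: "\<And>k. k \<in> int_lattice \<Longrightarrow> 0 \<le> B k"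
    "\<And>k. k \<in> int_lattice \<Longrightarrow> Lp_norm p (box \<eta> k f) \<le> ennreal (B k)"
    and b: "lq_bound q (\<lambda>k. japanese_bracket k powr s * B k) int_lattice R"
  shows "modulation_norm \<eta> s p q f \<le> ennreal R"
proof (cases "q = \<infinity>")
  case True
  have "ennreal (japanese_bracket k powr s) * Lp_norm p (box \<eta> k f) \<le> ennreal R" if k: "k \<in> int_lattice" for k
  proof -
    have "ennreal (japanese_bracket k powr s) * Lp_norm p (box \<eta> k f) \<le> ennreal (japanese_bracket k powr s) * ennreal (B k)"
      by (intro mult_left_mono B(2) k) simp
    also have "\<dots> = ennreal (japanese_bracket k powr s * B k)" using B(1)[OF k] by (simp add: ennreal_mult)
    also have "\<dots> \<le> ennreal R" using b True k by (intro ennreal_leI) (simp add: lq_bound_def)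
    finally show ?thesis .
  qed
  then show ?thesis using True by (simp add: modulation_norm_def SUP_le_iff)
next
  case False
  have r: "0 < enn2real q" using q False by (simp add: enn2real_positive_iff less_top)
  show ?thesis
    unfolding modulation_norm_le_iff[OF q False R]
  proof (intro allI impI)
    fix F :: "'a set" assume F: "finite F" "F \<subseteq> int_lattice"
    have "(\<Sum>k\<in>F. ennreal (japanese_bracket k powr (enn2real q * s)) * ennpowr (Lp_norm p (box \<eta> k f)) (enn2real q))
      \<le> (\<Sum>k\<in>F. ennreal ((japanese_bracket k powr s * B k) powr enn2real q))"
    proof (rule sum_mono)
      fix k assume "k \<in> F"
      then have k: "k \<in> int_lattice" using F by auto
      have "ennpowr (Lp_norm p (box \<eta> k f)) (enn2real q) \<le> ennreal (B k powr enn2real q)"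
        using ennpowr_mono[OF B(2)[OF k] r] by (simp add: ennpowr_powr[OF r B(1)[OF k]])
      then have "ennreal (japanese_bracket k powr (enn2real q * s)) * ennpowr (Lp_norm p (box \<eta> k f)) (enn2real q)
        \<le> ennreal (japanese_bracket k powr (enn2real q * s)) * ennreal (B k powr enn2real q)"
        by (intro mult_left_mono) simp_all
      also have "\<dots> = ennreal ((japanese_bracket k powr s * B k) powr enn2real q)"
        by (simp add: powr_mult powr_powr ennreal_mult mult.commute[of s])
      finally show "ennreal (japanese_bracket k powr (enn2real q * s)) * ennpowr (Lp_norm p (box \<eta> k f)) (enn2real q)
        \<le> ennreal ((japanese_bracket k powr s * B k) powr enn2real q)" .
    qed
    also have "\<dots> = ennreal (\<Sum>k\<in>F. (japanese_bracket k powr s * B k) powr enn2real q)" by (simp add: sum_ennreal)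
    also have "\<dots> \<le> ennreal (R powr enn2real q)" using b False F by (intro ennreal_leI) (auto simp: lq_bound_def)
    finally show "(\<Sum>k\<in>F. ennreal (japanese_bracket k powr (enn2real q * s)) * ennpowr (Lp_norm p (box \<eta> k f)) (enn2real q))
      \<le> ennreal (R powr enn2real q)" .
  qed
qed

lemma japanese_bracket_ge_1: "1 \<le> japanese_bracket k"
  by (simp add: japanese_bracket_def)

lemma modulation_norm_finite:
  assumes q: "0 < q" and R: "0 \<le> R" and le: "modulation_norm \<eta> s p q f \<le> ennreal R"
  shows "\<And>k. k \<in> int_lattice \<Longrightarrow> Lp_norm p (box \<eta> k f) < \<infinity>"
    and "lq_bound q (\<lambda>k. japanese_bracket k powr s * enn2real (Lp_norm p (box \<eta> k f))) int_lattice R"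
proof -
  have jb: "0 < japanese_bracket k powr t" for k :: 'a and t using japanese_bracket_ge_1[of k] by simp
  have "(\<forall>k\<in>int_lattice. Lp_norm p (box \<eta> k f) < \<infinity>) \<and>
    lq_bound q (\<lambda>k. japanese_bracket k powr s * enn2real (Lp_norm p (box \<eta> k f))) int_lattice R"
  proof (cases "q = \<infinity>")
    case True
    have le': "ennreal (japanese_bracket k powr s) * Lp_norm p (box \<eta> k f) \<le> ennreal R" if k: "k \<in> int_lattice" for k
      using le True k by (simp add: modulation_norm_def SUP_le_iff)
    have fin: "Lp_norm p (box \<eta> k f) < \<infinity>" if k: "k \<in> int_lattice" for k
    proof (rule ccontr)
      assume "\<not> ?thesis"
      then have "Lp_norm p (box \<eta> k f) = \<top>" by (metis infinity_ennreal_def less_top)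
      then show False using le'[OF k] jb[of k s] by (simp add: ennreal_mult_top top_unique)
    qed
    have "japanese_bracket k powr s * enn2real (Lp_norm p (box \<eta> k f)) \<le> R" if k: "k \<in> int_lattice" for k
    proof -
      have "ennreal (enn2real (Lp_norm p (box \<eta> k f))) = Lp_norm p (box \<eta> k f)" using fin[OF k] by (simp add: less_top)
      then have "ennreal (japanese_bracket k powr s * enn2real (Lp_norm p (box \<eta> k f))) \<le> ennreal R"
        using le'[OF k] by (simp add: ennreal_mult)
      then show ?thesis using R by (simp add: ennreal_le_iff)
    qed
    then show ?thesis using True fin by (simp add: lq_bound_def)
  next
    case False
    have r: "0 < enn2real q" using q False by (simp add: enn2real_positive_iff less_top)
    note le' = le[unfolded modulation_norm_le_iff[OF q False R], rule_format]
    have fin: "Lp_norm p (box \<eta> k f) < \<infinity>" if k: "k \<in> int_lattice" for k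
    proof (rule ccontr)
      assume "\<not> ?thesis"
      then have "Lp_norm p (box \<eta> k f) = \<top>" by (metis infinity_ennreal_def less_top)
      then show False using le'[of "{k}"] k jb[of k "enn2real q * s"]
        by (simp add: ennpowr_def ennreal_mult_top top_unique)
    qed
    have "(\<Sum>k\<in>F. (japanese_bracket k powr s * enn2real (Lp_norm p (box \<eta> k f))) powr enn2real q) \<le> R powr enn2real q"
      if F: "finite F" "F \<subseteq> int_lattice" for F
    proof -
      have "(\<Sum>k\<in>F. ennreal (japanese_bracket k powr (enn2real q * s)) * ennpowr (Lp_norm p (box \<eta> k f)) (enn2real q))
        = (\<Sum>k\<in>F. ennreal ((japanese_bracket k powr s * enn2real (Lp_norm p (box \<eta> k f))) powr enn2real q))"
      proof (rule sum.cong[OF refl])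
        fix k assume "k \<in> F"
        then have "Lp_norm p (box \<eta> k f) < \<infinity>" using F fin by auto
        then have "ennpowr (Lp_norm p (box \<eta> k f)) (enn2real q) = ennreal (enn2real (Lp_norm p (box \<eta> k f)) powr enn2real q)"
          by (simp add: ennpowr_def less_top)
        then show "ennreal (japanese_bracket k powr (enn2real q * s)) * ennpowr (Lp_norm p (box \<eta> k f)) (enn2real q)
          = ennreal ((japanese_bracket k powr s * enn2real (Lp_norm p (box \<eta> k f))) powr enn2real q)"
          by (simp add: powr_mult powr_powr ennreal_mult mult.commute[of s])
      qed
      then have "ennreal (\<Sum>k\<in>F. (japanese_bracket k powr s * enn2real (Lp_norm p (box \<eta> k f))) powr enn2real q) \<le> ennreal (R powr enn2real q)"
        using le'[OF F] by (simp add: sum_ennreal)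
      then show ?thesis by (simp add: ennreal_le_iff)
    qed
    then show ?thesis using False fin by (simp add: lq_bound_def)
  qed
  then show "\<And>k. k \<in> int_lattice \<Longrightarrow> Lp_norm p (box \<eta> k f) < \<infinity>"
    and "lq_bound q (\<lambda>k. japanese_bracket k powr s * enn2real (Lp_norm p (box \<eta> k f))) int_lattice R" by blast+
qed

section \<open>The trace\<close>

lemma int_lattice_Pair: "(k, l :: real) \<in> int_lattice \<longleftrightarrow> k \<in> int_lattice \<and> l \<in> \<int>"
  by (auto simp: int_lattice_def Basis_prod_def)

lemma countable_int_lattice: "countable (int_lattice :: 'a::euclidean_space set)"
  unfolding int_lattice_eq by (intro countable_image countable_PiE) (auto simp: Ints_def)

lemma int_lattice_add: "j \<in> int_lattice \<Longrightarrow> k \<in> int_lattice \<Longrightarrow> j + k \<in> int_lattice"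
  by (simp add: int_lattice_def inner_add_left)

lemma int_lattice_diff: "j \<in> int_lattice \<Longrightarrow> k \<in> int_lattice \<Longrightarrow> j - k \<in> int_lattice"
  by (simp add: int_lattice_def inner_diff_left)

definition lattice_neighbours :: "'a::euclidean_space set" where
  "lattice_neighbours = {e \<in> int_lattice. \<forall>b\<in>Basis. \<bar>e \<bullet> b\<bar> < 3}"

lemma finite_lattice_neighbours: "finite (lattice_neighbours :: 'a::euclidean_space set)"
proof (rule finite_subset)
  show "lattice_neighbours \<subseteq> {e :: 'a. \<forall>b\<in>Basis. e \<bullet> b \<in> {j \<in> \<int>. \<bar>0 - j\<bar> < 3}}"
    by (auto simp: lattice_neighbours_def int_lattice_def)
  show "finite {e :: 'a. \<forall>b\<in>Basis. e \<bullet> b \<in> {j \<in> \<int>. \<bar>0 - j\<bar> < 3}}"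
    unfolding coordinates_image by (intro finite_imageI finite_PiE finite_Ints_bounded) simp
qed

lemma zero_in_lattice_neighbours: "0 \<in> lattice_neighbours"
  by (simp add: lattice_neighbours_def int_lattice_def)

lemma japanese_bracket_shift: "japanese_bracket j \<le> sqrt 2 * japanese_bracket e * japanese_bracket (j + e)"
proof -
  have "norm j \<le> norm (j + e) + norm e" using norm_triangle_ineq4[of "j + e" e] by simp
  then have "(norm j)\<^sup>2 \<le> (norm (j + e) + norm e)\<^sup>2" by (intro power_mono) auto
  also have "\<dots> \<le> 2 * (norm (j + e))\<^sup>2 + 2 * (norm e)\<^sup>2"
    using sum_squares_bound[of "norm (j + e)" "norm e"] by (simp add: power2_sum)
  finally have "1 + (norm j)\<^sup>2 \<le> 2 + 2 * (norm (j + e))\<^sup>2 + 2 * (norm e)\<^sup>2 + 2 * ((norm e)\<^sup>2 * (norm (j + e))\<^sup>2)"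
    using mult_nonneg_nonneg[OF zero_le_power2[of "norm e"] zero_le_power2[of "norm (j + e)"]] by linarith
  also have "\<dots> = 2 * (1 + (norm e)\<^sup>2) * (1 + (norm (j + e))\<^sup>2)" by (simp add: algebra_simps)
  finally have "1 + (norm j)\<^sup>2 \<le> 2 * (1 + (norm e)\<^sup>2) * (1 + (norm (j + e))\<^sup>2)" .
  then show ?thesis unfolding japanese_bracket_def real_sqrt_mult[symmetric] by (rule real_sqrt_le_mono)
qed

lemma japanese_bracket_Pair_ge:
  shows "japanese_bracket k \<le> japanese_bracket (k, l :: real)" "1 + \<bar>l\<bar> \<le> 2 * japanese_bracket (k, l)"
proof -
  have n: "(norm (k, l))\<^sup>2 = (norm k)\<^sup>2 + l\<^sup>2" by (simp add: norm_Pair)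
  show "japanese_bracket k \<le> japanese_bracket (k, l)"
    unfolding japanese_bracket_def n by (intro real_sqrt_le_mono) simp
  have "\<bar>l\<bar> \<le> japanese_bracket (k, l)"
    unfolding japanese_bracket_def n by (rule real_le_rsqrt) (simp add: add_nonneg_nonneg)
  then show "1 + \<bar>l\<bar> \<le> 2 * japanese_bracket (k, l)" using japanese_bracket_ge_1[of "(k, l)"] by linarith
qed

lemma schwartz_seminorm_mono:
  assumes \<phi>: "\<phi> \<in> schwartz" and "N \<le> M"
  shows "schwartz_seminorm N \<phi> \<le> schwartz_seminorm M (\<phi> :: 'a::euclidean_space \<Rightarrow> complex)"
proof -
  note t = schwartz_tower_of_schwartz[OF \<phi>]
  have nil: "partial_derivs [] \<phi> = \<phi>" by (simp add: partial_derivs_def)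
  have "schwartz_seminorm N (partial_derivs [] \<phi>) \<le> schwartz_seminorm M (partial_derivs [] \<phi>)"
  proof (rule schwartz_seminorm_le)
    show "deriv_tower (\<lambda>bs. partial_derivs bs \<phi>)" using t by (simp add: schwartz_tower_def)
    fix bs :: "'a list" and x :: 'a assume bs: "set bs \<subseteq> Basis" "length bs \<le> N"
    have "(1 + norm x) ^ N * norm (partial_derivs bs \<phi> x) \<le> (1 + norm x) ^ M * norm (partial_derivs bs \<phi> x)"
      using assms(2) by (intro mult_right_mono power_increasing) auto
    also have "\<dots> \<le> schwartz_seminorm M (partial_derivs [] \<phi>)"
      using bs assms(2) by (intro schwartz_seminorm_ge[OF t]) auto
    finally show "(1 + norm x) ^ N * norm (partial_derivs bs \<phi> x) \<le> schwartz_seminorm M (partial_derivs [] \<phi>)" .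
  qed
  then show ?thesis unfolding nil .
qed

lemma trace_term_bound:
  assumes \<eta>: "cutoff \<eta>" and p: "0 < p"
  shows "\<exists>N C. 0 \<le> C \<and> (\<forall>(k :: 'a::euclidean_space) (l :: real) f \<phi>. (k, l) \<in> int_lattice \<longrightarrow> f \<in> tempered_distributions \<longrightarrow>
    Lp_norm p (box \<eta> (k, l) f) < \<infinity> \<longrightarrow> \<phi> \<in> schwartz \<longrightarrow>
    norm (trace_term \<eta> f (k, l) \<phi>) \<le> C * (schwartz_seminorm N \<phi> * (lattice_weight k * enn2real (Lp_norm p (box \<eta> (k, l) f)))))"
proof -
  obtain C0 where C0: "0 < C0" "\<forall>g :: 'a \<times> real \<Rightarrow> complex. reproduced_by (cutoff_kernel \<eta> 0) g \<longrightarrow> Lp_norm p g < \<infinity> \<longrightarrow>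
    (\<forall>j. Lp_norm p (slice_conv \<eta> j g) \<le> ennreal C0 * Lp_norm p g) \<and> (\<forall>x. norm (g x) \<le> C0 * enn2real (Lp_norm p g))"
    using slice_conv_Lp[OF \<eta> p] by auto
  obtain N1 C1 where C1: "0 \<le> C1" "\<forall>(k :: 'a) (l :: real) f G \<phi> b. (k, l) \<in> int_lattice \<longrightarrow> f \<in> tempered_distributions \<longrightarrow>
    (\<forall>x. norm (box \<eta> (k, l) f x) \<le> G) \<longrightarrow> \<phi> \<in> schwartz \<longrightarrow> b \<in> Basis \<longrightarrow>
    \<bar>k \<bullet> b\<bar> ^ (2 * DIM('a)) * norm (\<integral>y. box \<eta> (k, l) f (y, 0) * \<phi> y \<partial>lborel) \<le> C1 * (G * schwartz_seminorm N1 \<phi>)"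
    using slice_pairing_decay[OF \<eta>, where 'a = 'a and M = "2 * DIM('a)"] by (elim exE conjE) (rule that)
  obtain N2 C2 where C2: "0 \<le> C2" "\<forall>(k :: 'a) (l :: real) f G \<phi> b. (k, l) \<in> int_lattice \<longrightarrow> f \<in> tempered_distributions \<longrightarrow>
    (\<forall>x. norm (box \<eta> (k, l) f x) \<le> G) \<longrightarrow> \<phi> \<in> schwartz \<longrightarrow> b \<in> Basis \<longrightarrow>
    \<bar>k \<bullet> b\<bar> ^ 0 * norm (\<integral>y. box \<eta> (k, l) f (y, 0) * \<phi> y \<partial>lborel) \<le> C2 * (G * schwartz_seminorm N2 \<phi>)"
    using slice_pairing_decay[OF \<eta>, where 'a = 'a and M = 0] by (elim exE conjE) (rule that)
  define N where "N = max N1 N2"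
  show ?thesis
  proof (intro exI[of _ N] exI[of _ "2 ^ Suc DIM('a) * ((C1 + C2) * C0)"] conjI allI impI)
    show "0 \<le> 2 ^ Suc DIM('a) * ((C1 + C2) * C0)" using C0 C1 C2 by simp
    fix k :: 'a and l :: real and f :: "('a \<times> real) dist" and \<phi> :: "'a \<Rightarrow> complex"
    assume k: "(k, l) \<in> int_lattice" and f: "f \<in> tempered_distributions" and fin: "Lp_norm p (box \<eta> (k, l) f) < \<infinity>" and \<phi>: "\<phi> \<in> schwartz"
    define A where "A = enn2real (Lp_norm p (box \<eta> (k, l) f))"
    have G: "\<forall>x. norm (box \<eta> (k, l) f x) \<le> C0 * A"
      unfolding A_def by (rule conjunct2[OF C0(2)[rule_format, OF box_reproduced_by[OF \<eta> k f] fin]])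
    have A0: "0 \<le> A" by (simp add: A_def)
    let ?X = "norm (\<integral>y. box \<eta> (k, l) f (y, 0) * \<phi> y \<partial>lborel)" and ?Y = "(C1 + C2) * (C0 * A * schwartz_seminorm N \<phi>)"
    have S: "schwartz_seminorm N1 \<phi> \<le> schwartz_seminorm N \<phi>" "schwartz_seminorm N2 \<phi> \<le> schwartz_seminorm N \<phi>" "0 \<le> schwartz_seminorm N \<phi>"
      by (auto simp: N_def intro: schwartz_seminorm_mono[OF \<phi>] schwartz_seminorm_nonneg[OF \<phi>])
    have le1: "C1 * (C0 * A * schwartz_seminorm N1 \<phi>) \<le> ?Y"
      using C0(1) C1(1) C2(1) A0 S by (intro mult_mono order_refl mult_nonneg_nonneg schwartz_seminorm_nonneg \<phi>) linarith+
    have le2: "C2 * (C0 * A * schwartz_seminorm N2 \<phi>) \<le> ?Y"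
      using C0(1) C1(1) C2(1) A0 S by (intro mult_mono order_refl mult_nonneg_nonneg schwartz_seminorm_nonneg \<phi>) linarith+
    have "?X \<le> 2 ^ Suc DIM('a) * ?Y * lattice_weight k"
    proof (rule lattice_weight_decay)
      obtain b :: 'a where b: "b \<in> Basis" using nonempty_Basis by blast
      have "?X \<le> C2 * (C0 * A * schwartz_seminorm N2 \<phi>)" using C2(2)[rule_format, OF k f G[rule_format] \<phi> b] by simp
      then show "?X \<le> ?Y" using le2 by (rule order_trans)
      fix b :: 'a assume b: "b \<in> Basis"
      show "\<bar>k \<bullet> b\<bar> ^ (2 * DIM('a)) * ?X \<le> ?Y"
        using order_trans[OF C1(2)[rule_format, OF k f G[rule_format] \<phi> b] le1] .
    qed simp
    also have "\<dots> = 2 ^ Suc DIM('a) * ((C1 + C2) * C0) * (schwartz_seminorm N \<phi> * (lattice_weight k * A))" by (simp only: mult_ac)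
    finally show "norm (trace_term \<eta> f (k, l) \<phi>) \<le> 2 ^ Suc DIM('a) * ((C1 + C2) * C0) * (schwartz_seminorm N \<phi> * (lattice_weight k * enn2real (Lp_norm p (box \<eta> (k, l) f))))"
      by (simp only: A_def trace_term_def dist_of_fun_def)
  qed
qed

lemma bounded_dist_tempered:
  fixes g :: "'a::euclidean_space \<Rightarrow> complex"
  assumes g: "continuous_on UNIV g" "\<And>x. norm (g x) \<le> G"
    and b: "\<And>\<phi>. \<phi> \<in> schwartz \<Longrightarrow> norm (dist_of_fun g \<phi>) \<le> C * schwartz_seminorm N \<phi>"
  shows "dist_of_fun g \<in> tempered_distributions"
proof -
  have [measurable]: "g \<in> borel_measurable borel" using g(1) by (rule borel_measurable_continuous_onI)
  have G: "0 \<le> G" using order_trans[OF norm_ge_zero g(2)] .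
  have int: "integrable lborel (\<lambda>x. g x * \<phi> x)" if \<phi>: "\<phi> \<in> schwartz" for \<phi>
  proof -
    note [measurable] = schwartz_measurable[OF \<phi>]
    have "integrable lborel (\<lambda>x. G * norm (\<phi> x))"
      using integrable_rapidly_decreasing(1)[OF schwartz_measurable[OF \<phi>] schwartz_rapidly_decreasing[OF \<phi>]] by simp
    then show ?thesis
    proof (rule Bochner_Integration.integrable_bound)
      show "AE x in lborel. norm (g x * \<phi> x) \<le> norm (G * norm (\<phi> x))"
        using g(2) G by (intro AE_I2) (simp add: norm_mult abs_mult mult_right_mono)
    qed measurable
  qed
  show ?thesis
    unfolding tempered_distributions_def mem_Collect_eq
  proof (intro conjI ballI allI)
    show "\<exists>N C. \<forall>\<phi>\<in>schwartz. norm (dist_of_fun g \<phi>) \<le> C * schwartz_seminorm N \<phi>" using b by blast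
    fix \<phi> :: "'a \<Rightarrow> complex" and c assume \<phi>: "\<phi> \<in> schwartz"
    show "dist_of_fun g (\<lambda>x. c * \<phi> x) = c * dist_of_fun g \<phi>"
      unfolding dist_of_fun_def mult.left_commute[of _ c] by (rule Bochner_Integration.integral_mult_right_zero)
    fix \<psi> :: "'a \<Rightarrow> complex" assume \<psi>: "\<psi> \<in> schwartz"
    show "dist_of_fun g (\<lambda>x. \<phi> x + \<psi> x) = dist_of_fun g \<phi> + dist_of_fun g \<psi>"
      unfolding dist_of_fun_def distrib_left by (rule Bochner_Integration.integral_add[OF int[OF \<phi>] int[OF \<psi>]])
  qed
qed

lemma has_trace_of_row_bound:
  fixes f :: "('a::euclidean_space \<times> real) dist"
  assumes \<eta>: "cutoff \<eta>" and p: "0 < p" and f: "f \<in> tempered_distributions"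
    and fin: "\<And>k. k \<in> int_lattice \<Longrightarrow> Lp_norm p (box \<eta> k f) < \<infinity>"
    and rows: "\<And>k L. k \<in> int_lattice \<Longrightarrow> finite L \<Longrightarrow> L \<subseteq> \<int> \<Longrightarrow> (\<Sum>l\<in>L. enn2real (Lp_norm p (box \<eta> (k, l) f))) \<le> D" and D: "0 \<le> D"
  shows "has_trace \<eta> f"
proof -
  define A where "A k = enn2real (Lp_norm p (box \<eta> k f))" for k
  obtain N C where C: "0 \<le> C" "\<forall>(k :: 'a) (l :: real) f \<phi>. (k, l) \<in> int_lattice \<longrightarrow> f \<in> tempered_distributions \<longrightarrow>
    Lp_norm p (box \<eta> (k, l) f) < \<infinity> \<longrightarrow> \<phi> \<in> schwartz \<longrightarrow>
    norm (trace_term \<eta> f (k, l) \<phi>) \<le> C * (schwartz_seminorm N \<phi> * (lattice_weight k * enn2real (Lp_norm p (box \<eta> (k, l) f))))"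
    using trace_term_bound[OF \<eta> p] by metis
  have tb: "norm (trace_term \<eta> f k \<phi>) \<le> C * (schwartz_seminorm N \<phi> * (lattice_weight (fst k) * A k))"
    if "k \<in> int_lattice" "\<phi> \<in> schwartz" for k \<phi>
    using C(2)[rule_format, of "fst k" "snd k" f \<phi>] f fin[OF that(1)] that by (simp add: A_def)
  obtain B where B: "0 \<le> B" "\<And>F :: 'a set. finite F \<Longrightarrow> F \<subseteq> int_lattice \<Longrightarrow> (\<Sum>k\<in>F. lattice_weight k) \<le> B"
    using lattice_weight_sum_bounded by auto
  have sum_le: "(\<Sum>k\<in>F. norm (trace_term \<eta> f k \<phi>)) \<le> (C * (B * D)) * schwartz_seminorm N \<phi>"
    if F: "finite F" "F \<subseteq> int_lattice" and \<phi>: "\<phi> \<in> schwartz" for F \<phi>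
  proof -
    have S: "0 \<le> schwartz_seminorm N \<phi>" by (rule schwartz_seminorm_nonneg[OF \<phi>])
    have sub: "fst ` F \<subseteq> int_lattice" "snd ` F \<subseteq> \<int>" using F(2) int_lattice_Pair by fastforce+
    have "(\<Sum>k\<in>F. lattice_weight (fst k) * A k) \<le> (\<Sum>k\<in>fst ` F \<times> snd ` F. lattice_weight (fst k) * A k)"
    proof (rule sum_mono2)
      show "finite (fst ` F \<times> snd ` F)" using F(1) by simp
      show "F \<subseteq> fst ` F \<times> snd ` F" by (simp add: subset_fst_snd)
      show "0 \<le> lattice_weight (fst k) * A k" for k
        using less_imp_le[OF lattice_weight_pos[of "fst k"]] by (simp add: A_def)
    qed
    also have "\<dots> = (\<Sum>k\<in>fst ` F. lattice_weight k * (\<Sum>l\<in>snd ` F. A (k, l)))"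
      by (simp add: sum.cartesian_product sum_distrib_left case_prod_unfold)
    also have "\<dots> \<le> (\<Sum>k\<in>fst ` F. lattice_weight k * D)"
      using rows sub F(1) unfolding A_def
      by (intro sum_mono mult_left_mono less_imp_le[OF lattice_weight_pos]) auto
    also have "\<dots> = (\<Sum>k\<in>fst ` F. lattice_weight k) * D" by (simp add: sum_distrib_right)
    also have "\<dots> \<le> B * D" using B(2)[of "fst ` F"] F(1) sub D by (intro mult_right_mono) auto
    finally have *: "(\<Sum>k\<in>F. lattice_weight (fst k) * A k) \<le> B * D" .
    have "(\<Sum>k\<in>F. norm (trace_term \<eta> f k \<phi>)) \<le> (\<Sum>k\<in>F. C * (schwartz_seminorm N \<phi> * (lattice_weight (fst k) * A k)))"
      using F \<phi> by (intro sum_mono tb) auto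
    also have "\<dots> = C * (schwartz_seminorm N \<phi> * (\<Sum>k\<in>F. lattice_weight (fst k) * A k))" by (simp add: sum_distrib_left)
    also have "\<dots> \<le> C * (schwartz_seminorm N \<phi> * (B * D))" using C(1) S * by (intro mult_left_mono)
    finally show ?thesis by (simp only: mult_ac)
  qed
  have sm: "(\<lambda>k. norm (trace_term \<eta> f k \<phi>)) summable_on int_lattice" if "\<phi> \<in> schwartz" for \<phi>
    using sum_le[OF _ _ that] by (intro nonneg_bdd_above_summable_on bdd_aboveI[of _ "(C * (B * D)) * schwartz_seminorm N \<phi>"]) auto
  have sum: "(\<lambda>k. trace_term \<eta> f k \<phi>) summable_on int_lattice" if "\<phi> \<in> schwartz" for \<phi>
    by (rule abs_summable_summable[OF sm[OF that]])
  have tt: "trace_term \<eta> f k \<in> tempered_distributions" if k: "k \<in> int_lattice" for k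
    unfolding trace_term_def
  proof (rule bounded_dist_tempered)
    show "continuous_on UNIV (\<lambda>y. box \<eta> k f (y, 0))"
      by (intro continuous_on_compose2[OF box_continuous[OF \<eta> k f]] continuous_intros) auto
    obtain C0 where C0: "0 < C0" "\<forall>g :: 'a \<times> real \<Rightarrow> complex. reproduced_by (cutoff_kernel \<eta> 0) g \<longrightarrow> Lp_norm p g < \<infinity> \<longrightarrow>
      (\<forall>j. Lp_norm p (slice_conv \<eta> j g) \<le> ennreal C0 * Lp_norm p g) \<and> (\<forall>x. norm (g x) \<le> C0 * enn2real (Lp_norm p g))"
      using slice_conv_Lp[OF \<eta> p] by auto
    show "norm (box \<eta> k f (y, 0)) \<le> (SUP y. norm (box \<eta> k f (y, 0)))" for y
    proof (rule cSUP_upper)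
      show "bdd_above (range (\<lambda>y. norm (box \<eta> k f (y, 0))))"
        using C0(2)[rule_format, OF box_reproduced_by[OF \<eta> k f] fin[OF k]] by (intro bdd_aboveI2) blast
    qed simp
    show "norm (dist_of_fun (\<lambda>y. box \<eta> k f (y, 0)) \<phi>) \<le> (C * (lattice_weight (fst k) * A k)) * schwartz_seminorm N \<phi>"
      if "\<phi> \<in> schwartz" for \<phi>
      using tb[OF k that] by (simp add: trace_term_def mult_ac)
  qed
  have "Tr \<eta> f \<in> tempered_distributions"
    unfolding tempered_distributions_def mem_Collect_eq
  proof (intro conjI ballI allI)
    show "\<exists>N C. \<forall>\<phi>\<in>schwartz. norm (Tr \<eta> f \<phi>) \<le> C * schwartz_seminorm N \<phi>"
    proof (intro exI[of _ N] exI[of _ "C * (B * D)"] ballI)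
      fix \<phi> :: "'a \<Rightarrow> complex" assume \<phi>: "\<phi> \<in> schwartz"
      have "norm (Tr \<eta> f \<phi>) \<le> (\<Sum>\<^sub>\<infinity>k\<in>int_lattice. norm (trace_term \<eta> f k \<phi>))"
        unfolding Tr_def by (rule norm_infsum_bound[OF sm[OF \<phi>]])
      also have "\<dots> \<le> C * (B * D) * schwartz_seminorm N \<phi>"
        by (rule infsum_le_finite_sums[OF sm[OF \<phi>] sum_le[OF _ _ \<phi>]])
      finally show "norm (Tr \<eta> f \<phi>) \<le> C * (B * D) * schwartz_seminorm N \<phi>" .
    qed
    fix \<phi> :: "'a \<Rightarrow> complex" and c assume \<phi>: "\<phi> \<in> schwartz"
    have "Tr \<eta> f (\<lambda>x. c * \<phi> x) = (\<Sum>\<^sub>\<infinity>k\<in>int_lattice. c * trace_term \<eta> f k \<phi>)"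
      unfolding Tr_def by (intro infsum_cong tempered_cmult tt \<phi>)
    also have "\<dots> = c * Tr \<eta> f \<phi>" unfolding Tr_def by (rule infsum_cmult_right')
    finally show "Tr \<eta> f (\<lambda>x. c * \<phi> x) = c * Tr \<eta> f \<phi>" .
    fix \<psi> :: "'a \<Rightarrow> complex" assume \<psi>: "\<psi> \<in> schwartz"
    have "Tr \<eta> f (\<lambda>x. \<phi> x + \<psi> x) = (\<Sum>\<^sub>\<infinity>k\<in>int_lattice. trace_term \<eta> f k \<phi> + trace_term \<eta> f k \<psi>)"
      unfolding Tr_def by (intro infsum_cong tempered_add tt \<phi> \<psi>)
    also have "\<dots> = Tr \<eta> f \<phi> + Tr \<eta> f \<psi>" unfolding Tr_def by (rule infsum_add[OF sum[OF \<phi>] sum[OF \<psi>]])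
    finally show "Tr \<eta> f (\<lambda>x. \<phi> x + \<psi> x) = Tr \<eta> f \<phi> + Tr \<eta> f \<psi>" .
  qed
  moreover have "((\<lambda>k. trace_term \<eta> f k \<phi>) has_sum Tr \<eta> f \<phi>) int_lattice" if "\<phi> \<in> schwartz" for \<phi>
    unfolding Tr_def by (rule has_sum_infsum[OF sum[OF that]])
  ultimately show ?thesis using tt by (simp add: has_trace_def tempered_has_sum_def)
qed

lemma Lp_norm_box_Tr:
  assumes \<eta>: "cutoff \<eta>" and p: "0 < p"
  shows "\<exists>C>0. \<forall>(f :: ('a::euclidean_space \<times> real) dist) j T. f \<in> tempered_distributions \<longrightarrow> has_trace \<eta> f \<longrightarrow> j \<in> int_lattice \<longrightarrow>
    (\<forall>k\<in>int_lattice. Lp_norm p (box \<eta> k f) < \<infinity>) \<longrightarrow> 0 \<le> T \<longrightarrow>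
    (\<forall>F. finite F \<longrightarrow> F \<subseteq> (\<lambda>e. j + e) ` lattice_neighbours \<times> \<int> \<longrightarrow> (\<Sum>k\<in>F. enn2real (Lp_norm p (box \<eta> k f)) powr Lp_index p) \<le> T powr Lp_index p) \<longrightarrow>
    Lp_norm p (box \<eta> j (Tr \<eta> f)) \<le> ennreal (C * T)"
proof -
  obtain C0 where C0: "0 < C0" "\<forall>g :: 'a \<times> real \<Rightarrow> complex. reproduced_by (cutoff_kernel \<eta> 0) g \<longrightarrow> Lp_norm p g < \<infinity> \<longrightarrow>
    (\<forall>j. Lp_norm p (slice_conv \<eta> j g) \<le> ennreal C0 * Lp_norm p g) \<and> (\<forall>x. norm (g x) \<le> C0 * enn2real (Lp_norm p g))"
    using slice_conv_Lp[OF \<eta> p] by auto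
  show ?thesis
  proof (intro exI[of _ "2 * C0"] conjI allI impI)
    show "0 < 2 * C0" using C0(1) by simp
    fix f :: "('a \<times> real) dist" and j :: 'a and T :: real
    assume f: "f \<in> tempered_distributions" and tr: "has_trace \<eta> f" and j: "j \<in> int_lattice"
      and fin: "\<forall>k\<in>int_lattice. Lp_norm p (box \<eta> k f) < \<infinity>" and T: "0 \<le> T"
      and le: "\<forall>F. finite F \<longrightarrow> F \<subseteq> (\<lambda>e. j + e) ` lattice_neighbours \<times> \<int> \<longrightarrow>
        (\<Sum>k\<in>F. enn2real (Lp_norm p (box \<eta> k f)) powr Lp_index p) \<le> T powr Lp_index p"
    define A where "A k = enn2real (Lp_norm p (box \<eta> k f))" for k
    have A: "0 \<le> A k" "k \<in> int_lattice \<Longrightarrow> Lp_norm p (box \<eta> k f) = ennreal (A k)" for k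
      using fin by (auto simp: A_def less_top)
    let ?K = "(\<lambda>e. j + e) ` lattice_neighbours \<times> (\<int> :: real set)"
    have Kl: "?K \<subseteq> int_lattice"
    proof
      fix z assume "z \<in> ?K"
      then obtain e l where z: "z = (j + e, l)" "e \<in> lattice_neighbours" "l \<in> \<int>" by auto
      then show "z \<in> int_lattice" unfolding z(1) int_lattice_Pair using int_lattice_add[OF j] by (simp add: lattice_neighbours_def)
    qed
    have Trt: "Tr \<eta> f \<in> tempered_distributions"
      and hs: "\<And>\<phi>. \<phi> \<in> schwartz \<Longrightarrow> ((\<lambda>k. trace_term \<eta> f k \<phi>) has_sum Tr \<eta> f \<phi>) int_lattice"
      using tr by (auto simp: has_trace_def tempered_has_sum_def)
    have "Lp_norm p (box \<eta> j (Tr \<eta> f)) \<le> ennreal (2 * (C0 * T))"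
    proof (rule Lp_norm_has_sum[OF p, where K = ?K and h = "\<lambda>k. slice_conv \<eta> j (box \<eta> k f)" and a = "\<lambda>k. C0 * A k"])
      show "countable ?K" using countable_subset[OF Kl countable_int_lattice] .
      show "0 \<le> C0 * T" using C0(1) T by simp
      fix k assume "k \<in> ?K"
      then have k: "k \<in> int_lattice" using Kl by blast
      show "slice_conv \<eta> j (box \<eta> k f) \<in> borel_measurable borel" by (rule slice_conv_measurable[OF \<eta> box_continuous[OF \<eta> k f]])
      show "0 \<le> C0 * A k" using C0(1) A(1) by simp
      show "Lp_norm p (slice_conv \<eta> j (box \<eta> k f)) \<le> ennreal (C0 * A k)"
        using C0(2)[rule_format, OF box_reproduced_by[OF \<eta> k f] fin[rule_format, OF k]] C0(1) A(1)[of k] A(2)[OF k] by (simp add: ennreal_mult)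
    next
      fix F assume F: "finite F" "F \<subseteq> ?K"
      have "(\<Sum>k\<in>F. (C0 * A k) powr Lp_index p) = C0 powr Lp_index p * (\<Sum>k\<in>F. A k powr Lp_index p)"
        by (simp add: powr_mult sum_distrib_left)
      also have "\<dots> \<le> C0 powr Lp_index p * T powr Lp_index p"
        using le F by (intro mult_left_mono) (auto simp: A_def)
      finally show "(\<Sum>k\<in>F. (C0 * A k) powr Lp_index p) \<le> (C0 * T) powr Lp_index p" by (simp add: powr_mult)
    next
      fix x
      have sw: "(\<lambda>y. window_kernel \<eta> j (x - y)) \<in> schwartz"
        using schwartz_tower_in_schwartz[OF schwartz_tower_reflect[OF schwartz_tower_window[OF \<eta>, of j], of x]]
        by (simp add: window_tower_Nil[OF \<eta>])
      have sum: "((\<lambda>k. slice_conv \<eta> j (box \<eta> k f) x) has_sum box \<eta> j (Tr \<eta> f) x) int_lattice"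
        using hs[OF sw] by (simp add: trace_term_def dist_of_fun_def slice_conv_def box_eq[OF \<eta> j Trt])
      have zero: "slice_conv \<eta> j (box \<eta> k f) x = 0" if k: "k \<in> int_lattice - ?K" for k
      proof -
        obtain k1 l where kl: "k = (k1, l)" by (cases k)
        have k1: "k1 \<in> int_lattice" "l \<in> \<int>" using k by (auto simp: kl int_lattice_Pair)
        have "k1 - j \<notin> lattice_neighbours"
        proof
          assume "k1 - j \<in> lattice_neighbours"
          then have "k1 \<in> (\<lambda>e. j + e) ` lattice_neighbours" by (intro image_eqI[of _ _ "k1 - j"]) simp_all
          then show False using k k1 by (simp add: kl)
        qed
        then obtain b where b: "b \<in> Basis" "3 \<le> \<bar>(k1 - j) \<bullet> b\<bar>"
          using int_lattice_diff[OF k1(1) j] by (auto simp: lattice_neighbours_def not_less)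
        have kk: "(k1, l) \<in> int_lattice" using k kl by simp
        have G: "\<And>x. norm (box \<eta> (k1, l) f x) \<le> C0 * A (k1, l)"
          using conjunct2[OF C0(2)[rule_format, OF box_reproduced_by[OF \<eta> kk f] fin[rule_format, OF kk]]] by (simp only: A_def)
        show ?thesis unfolding kl
          by (rule slice_conv_orthogonal[OF \<eta> kk f G b(1)]) (use b(2) in \<open>simp add: inner_diff_left\<close>)
      qed
      have "((\<lambda>k. slice_conv \<eta> j (box \<eta> k f) x) has_sum box \<eta> j (Tr \<eta> f) x) int_lattice \<longleftrightarrow>
        ((\<lambda>k. slice_conv \<eta> j (box \<eta> k f) x) has_sum box \<eta> j (Tr \<eta> f) x) ?K"
        by (rule has_sum_cong_neutral) (use Kl zero in blast)+
      then show "((\<lambda>k. slice_conv \<eta> j (box \<eta> k f) x) has_sum box \<eta> j (Tr \<eta> f) x) ?K" using sum by (rule iffD1)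
    qed
    then show "Lp_norm p (box \<eta> j (Tr \<eta> f)) \<le> ennreal (2 * C0 * T)" by (simp only: mult.assoc)
  qed
qed

lemma lattice_rows:
  assumes q: "0 < q" and \<rho>: "0 < \<rho>" and \<sigma>: "trace_loss \<rho> q \<sigma>" and s: "0 \<le> s"
  shows "\<exists>C>0. \<forall>(A :: 'a::euclidean_space \<times> real \<Rightarrow> real) R. (\<forall>z. 0 \<le> A z) \<longrightarrow> 0 \<le> R \<longrightarrow>
    lq_bound q (\<lambda>k. japanese_bracket k powr (s + \<sigma>) * A k) int_lattice R \<longrightarrow>
    (\<exists>y. (\<forall>k. 0 \<le> y k) \<and> lq_bound q y int_lattice R \<and>
      (\<forall>k\<in>int_lattice. \<forall>L. finite L \<longrightarrow> L \<subseteq> \<int> \<longrightarrow>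
        (\<Sum>l\<in>L. A (k, l) powr \<rho>) \<le> (C * (japanese_bracket k powr (- s) * y k)) powr \<rho>))"
proof -
  obtain C where C: "0 < C" "\<forall>(X :: 'a \<Rightarrow> real \<Rightarrow> real) K R. (\<forall>k l. 0 \<le> X k l) \<longrightarrow> 0 \<le> R \<longrightarrow> lq_bound q (\<lambda>(k, l). X k l) (K \<times> \<int>) R \<longrightarrow>
    (\<exists>y. (\<forall>k. 0 \<le> y k) \<and> lq_bound q y K R \<and>
      (\<forall>k\<in>K. \<forall>L. finite L \<longrightarrow> L \<subseteq> \<int> \<longrightarrow> (\<Sum>l\<in>L. ((1 + \<bar>l\<bar>) powr (- \<sigma>) * X k l) powr \<rho>) \<le> (C * y k) powr \<rho>))"
    using weighted_rows[OF q \<rho> \<sigma>, where 'k = 'a] by (elim exE conjE) (rule that)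
  have lat: "(int_lattice :: ('a \<times> real) set) = int_lattice \<times> \<int>" using int_lattice_Pair by auto
  have \<sigma>0: "0 \<le> \<sigma>" using \<sigma> by (simp add: trace_loss_def)
  show ?thesis
  proof (intro exI[of _ "2 powr \<sigma> * C"] conjI allI impI)
    show "0 < 2 powr \<sigma> * C" using C(1) by simp
    fix A :: "'a \<times> real \<Rightarrow> real" and R
    assume A: "\<forall>z. 0 \<le> A z" and R: "0 \<le> R" and b: "lq_bound q (\<lambda>k. japanese_bracket k powr (s + \<sigma>) * A k) int_lattice R"
    define X where "X k l = japanese_bracket (k, l) powr (s + \<sigma>) * A (k, l)" for k :: 'a and l :: real
    have X: "\<forall>k l. 0 \<le> X k l" using A by (simp add: X_def)
    have "(\<lambda>k. japanese_bracket k powr (s + \<sigma>) * A k) = (\<lambda>(k, l). X k l)" by (auto simp: X_def)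
    then have "lq_bound q (\<lambda>(k, l). X k l) (int_lattice \<times> \<int>) R" using b by (simp only: lat)
    from C(2)[rule_format, OF X[rule_format] R this] obtain y where y: "\<forall>k. 0 \<le> y k" "lq_bound q y int_lattice R"
      "\<forall>k\<in>int_lattice. \<forall>L. finite L \<longrightarrow> L \<subseteq> \<int> \<longrightarrow> (\<Sum>l\<in>L. ((1 + \<bar>l\<bar>) powr (- \<sigma>) * X k l) powr \<rho>) \<le> (C * y k) powr \<rho>"
      by (elim exE conjE) (rule that)
    have le: "A (k, l) \<le> (2 powr \<sigma> * japanese_bracket k powr (- s)) * ((1 + \<bar>l\<bar>) powr (- \<sigma>) * X k l)" for k :: 'a and l :: real
    proof -
      have jp: "0 < japanese_bracket k" "0 < japanese_bracket (k, l)" "0 < (1 + \<bar>l\<bar>) / 2"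
        using japanese_bracket_ge_1[of k] japanese_bracket_ge_1[of "(k, l)"] by auto
      have "A (k, l) = (japanese_bracket (k, l) powr (- s) * japanese_bracket (k, l) powr (- \<sigma>)) * X k l"
        using jp by (simp add: X_def flip: powr_add mult.assoc)
      also have "\<dots> \<le> (japanese_bracket k powr (- s) * ((1 + \<bar>l\<bar>) / 2) powr (- \<sigma>)) * X k l"
        using jp s \<sigma>0 X japanese_bracket_Pair_ge(1)[of k l] japanese_bracket_Pair_ge(2)[of l k] by (intro mult_right_mono mult_mono powr_mono2') auto
      also have "((1 + \<bar>l\<bar>) / 2) powr (- \<sigma>) = 2 powr \<sigma> * (1 + \<bar>l\<bar>) powr (- \<sigma>)"
        by (simp add: powr_divide powr_minus divide_simps)
      finally show ?thesis by (simp only: mult_ac)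
    qed
    show "\<exists>y. (\<forall>k. 0 \<le> y k) \<and> lq_bound q y int_lattice R \<and>
      (\<forall>k\<in>int_lattice. \<forall>L. finite L \<longrightarrow> L \<subseteq> \<int> \<longrightarrow>
        (\<Sum>l\<in>L. A (k, l) powr \<rho>) \<le> (2 powr \<sigma> * C * (japanese_bracket k powr (- s) * y k)) powr \<rho>)"
    proof (intro exI[of _ y] conjI ballI allI impI)
      fix k :: 'a and L :: "real set" assume k: "k \<in> int_lattice" and L: "finite L" "L \<subseteq> \<int>"
      have "(\<Sum>l\<in>L. A (k, l) powr \<rho>) \<le> (\<Sum>l\<in>L. ((2 powr \<sigma> * japanese_bracket k powr (- s)) * ((1 + \<bar>l\<bar>) powr (- \<sigma>) * X k l)) powr \<rho>)"
        using A \<rho> by (intro sum_mono powr_mono2 le) auto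
      also have "\<dots> = (2 powr \<sigma> * japanese_bracket k powr (- s)) powr \<rho> * (\<Sum>l\<in>L. ((1 + \<bar>l\<bar>) powr (- \<sigma>) * X k l) powr \<rho>)"
        unfolding sum_distrib_left by (intro sum.cong refl powr_mult)
      also have "\<dots> \<le> (2 powr \<sigma> * japanese_bracket k powr (- s)) powr \<rho> * (C * y k) powr \<rho>"
        using y(3)[rule_format, OF k L] by (rule mult_left_mono) simp
      also have "\<dots> = (2 powr \<sigma> * C * (japanese_bracket k powr (- s) * y k)) powr \<rho>"
        by (simp only: powr_mult mult_ac)
      finally show "(\<Sum>l\<in>L. A (k, l) powr \<rho>) \<le> (2 powr \<sigma> * C * (japanese_bracket k powr (- s) * y k)) powr \<rho>" .
    qed (use y(1,2) in auto)
  qed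
qed

theorem trace_bounded:
  fixes p q :: ennreal
  assumes \<eta>: "cutoff \<eta>" and p: "0 < p" and q: "0 < q" and s: "0 \<le> s" and \<sigma>: "trace_loss (Lp_index p) q \<sigma>"
  shows "\<exists>C>0. \<forall>(f :: ('a::euclidean_space \<times> real) dist) R. f \<in> tempered_distributions \<longrightarrow> 0 \<le> R \<longrightarrow>
    modulation_norm \<eta> (s + \<sigma>) p q f \<le> ennreal R \<longrightarrow>
    has_trace \<eta> f \<and> modulation_norm \<eta> s p q (Tr \<eta> f) \<le> ennreal (C * R)"
proof -
  define \<rho> where "\<rho> = Lp_index p"
  have \<rho>: "0 < \<rho>" "\<rho> \<le> 1" using Lp_index[of p] p by (auto simp: \<rho>_def)
  obtain C1 where C1: "0 < C1" "\<forall>(f :: ('a \<times> real) dist) j T. f \<in> tempered_distributions \<longrightarrow> has_trace \<eta> f \<longrightarrow> j \<in> int_lattice \<longrightarrow>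
    (\<forall>k\<in>int_lattice. Lp_norm p (box \<eta> k f) < \<infinity>) \<longrightarrow> 0 \<le> T \<longrightarrow>
    (\<forall>F. finite F \<longrightarrow> F \<subseteq> (\<lambda>e. j + e) ` lattice_neighbours \<times> \<int> \<longrightarrow> (\<Sum>k\<in>F. enn2real (Lp_norm p (box \<eta> k f)) powr Lp_index p) \<le> T powr Lp_index p) \<longrightarrow>
    Lp_norm p (box \<eta> j (Tr \<eta> f)) \<le> ennreal (C1 * T)"
    using Lp_norm_box_Tr[OF \<eta> p, where 'a = 'a] by (elim exE conjE) (rule that)
  obtain C2 where C2: "0 < C2" "\<forall>(A :: 'a \<times> real \<Rightarrow> real) R. (\<forall>z. 0 \<le> A z) \<longrightarrow> 0 \<le> R \<longrightarrow>
    lq_bound q (\<lambda>k. japanese_bracket k powr (s + \<sigma>) * A k) int_lattice R \<longrightarrow>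
    (\<exists>y. (\<forall>k. 0 \<le> y k) \<and> lq_bound q y int_lattice R \<and>
      (\<forall>k\<in>int_lattice. \<forall>L. finite L \<longrightarrow> L \<subseteq> \<int> \<longrightarrow>
        (\<Sum>l\<in>L. A (k, l) powr \<rho>) \<le> (C2 * (japanese_bracket k powr (- s) * y k)) powr \<rho>))"
    using lattice_rows[OF q \<rho>(1) \<sigma>[folded \<rho>_def] s, where 'a = 'a] by (elim exE conjE) (rule that)
  let ?E = "lattice_neighbours :: 'a set"
  have E: "finite ?E" "?E \<noteq> {}" using finite_lattice_neighbours zero_in_lattice_neighbours by auto
  define m where "m = real (card ?E)"
  have m: "0 < m" using E by (simp add: m_def card_gt_0_iff)
  define c where "c = (\<Sum>e\<in>?E. sqrt 2 * japanese_bracket e)"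
  have jb: "0 < japanese_bracket k" for k :: 'a using japanese_bracket_ge_1[of k] by simp
  have cle: "sqrt 2 * japanese_bracket e \<le> c" if "e \<in> ?E" for e
    unfolding c_def using E jb that by (intro member_le_sum) (auto intro: less_imp_le)
  have c0: "0 < c" using cle[OF zero_in_lattice_neighbours] jb[of 0] by (smt (verit) mult_pos_pos real_sqrt_gt_zero)
  have shift: "japanese_bracket (j + e) powr (- s) \<le> c powr s * japanese_bracket j powr (- s)" if e: "e \<in> ?E" for j e :: 'a
  proof -
    have "japanese_bracket j \<le> c * japanese_bracket (j + e)"
      using order_trans[OF japanese_bracket_shift[of j e] mult_right_mono[OF cle[OF e] less_imp_le[OF jb]]] .
    then have "japanese_bracket j / c \<le> japanese_bracket (j + e)" using c0 by (simp add: divide_le_eq mult.commute)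
    then have "japanese_bracket (j + e) powr (- s) \<le> (japanese_bracket j / c) powr (- s)"
      using s c0 jb by (intro powr_mono2') auto
    also have "\<dots> = c powr s * japanese_bracket j powr (- s)" by (simp add: powr_divide powr_minus divide_simps)
    finally show ?thesis .
  qed
  define D where "D = m powr (1 / \<rho>) * (C2 * c powr s)"
  have D: "0 < D" using m C2(1) c0 by (simp add: D_def)
  define mq where "mq = (if q = \<infinity> then 1 else m powr (1 / enn2real q))"
  have mq: "0 < mq" using m by (simp add: mq_def)
  show ?thesis
  proof (intro exI[of _ "C1 * D * mq"] conjI allI impI)
    show "0 < C1 * D * mq" using C1(1) D mq by simp
    fix f :: "('a \<times> real) dist" and R :: real
    assume f: "f \<in> tempered_distributions" and R: "0 \<le> R" and le: "modulation_norm \<eta> (s + \<sigma>) p q f \<le> ennreal R"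
    note fin = modulation_norm_finite(1)[OF q R le]
    define A where "A k = enn2real (Lp_norm p (box \<eta> k f))" for k
    have A: "0 \<le> A k" for k by (simp add: A_def)
    from C2(2)[rule_format, OF A R modulation_norm_finite(2)[OF q R le, folded A_def]]
    obtain y where y: "\<forall>k. 0 \<le> y k" "lq_bound q y int_lattice R"
      "\<forall>k\<in>int_lattice. \<forall>L. finite L \<longrightarrow> L \<subseteq> \<int> \<longrightarrow>
        (\<Sum>l\<in>L. A (k, l) powr \<rho>) \<le> (C2 * (japanese_bracket k powr (- s) * y k)) powr \<rho>"
      by (elim exE conjE) (rule that)
    have yR: "y k \<le> R" if "k \<in> int_lattice" for k
      using lq_bound_pointwise[OF q _ R y(2) that] y(1) by simp
    show tr: "has_trace \<eta> f"
    proof (rule has_trace_of_row_bound[OF \<eta> p f fin, where D = "C2 * R"])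
      show "0 \<le> C2 * R" using C2(1) R by simp
      fix k :: 'a and L :: "real set" assume k: "k \<in> int_lattice" and L: "finite L" "L \<subseteq> \<int>"
      have "japanese_bracket k powr (- s) \<le> 1 powr (- s)"
        using japanese_bracket_ge_1[of k] s by (intro powr_mono2') auto
      then have j1: "japanese_bracket k powr (- s) * y k \<le> 1 * R" using y(1) yR[OF k] by (intro mult_mono) auto
      have "(\<Sum>l\<in>L. A (k, l)) = (\<Sum>l\<in>L. (A (k, l) powr \<rho>) powr (1 / \<rho>))" using \<rho> A by (simp add: powr_powr)
      also have "\<dots> \<le> (\<Sum>l\<in>L. A (k, l) powr \<rho>) powr (1 / \<rho>)" using \<rho> L by (intro sum_powr_le_powr_sum) auto
      also have "\<dots> \<le> ((C2 * (japanese_bracket k powr (- s) * y k)) powr \<rho>) powr (1 / \<rho>)"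
        using y(3)[rule_format, OF k L] \<rho> by (intro powr_mono2[where a = "1 / \<rho>"] sum_nonneg) auto
      also have "\<dots> = C2 * (japanese_bracket k powr (- s) * y k)" using \<rho> C2(1) y(1) by (simp add: powr_powr)
      also have "\<dots> \<le> C2 * R" using j1 C2(1) by simp
      finally show "(\<Sum>l\<in>L. enn2real (Lp_norm p (box \<eta> (k, l) f))) \<le> C2 * R" by (simp only: A_def)
    qed
    define M where "M j = (MAX e\<in>?E. y (j + e))" for j :: 'a
    have yM: "y (j + e) \<le> M j" if "e \<in> ?E" for j e :: 'a unfolding M_def using E that by (intro Max_ge) auto
    have M0: "0 \<le> M j" for j :: 'a using order_trans[OF _ yM[OF zero_in_lattice_neighbours]] y(1) by simp
    define T where "T j = D * (japanese_bracket j powr (- s) * M j)" for j :: 'a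
    have T0: "0 \<le> T j" for j :: 'a using D M0 by (simp add: T_def)
    have "modulation_norm \<eta> s p q (Tr \<eta> f) \<le> ennreal (C1 * D * (mq * R))"
    proof (rule modulation_norm_le[OF q, where B = "\<lambda>j. C1 * T j"])
      show "0 \<le> C1 * D * (mq * R)" using C1(1) D mq R by simp
      have "(\<lambda>j. japanese_bracket j powr s * (C1 * T j)) = (\<lambda>j. (C1 * D) * M j)"
      proof
        fix j :: 'a
        have "japanese_bracket j powr s * japanese_bracket j powr (- s) = 1" using jb[of j] by (simp flip: powr_add)
        moreover have "japanese_bracket j powr s * (C1 * T j) = (japanese_bracket j powr s * japanese_bracket j powr (- s)) * ((C1 * D) * M j)"
          by (simp only: T_def mult_ac)
        ultimately show "japanese_bracket j powr s * (C1 * T j) = (C1 * D) * M j" by simp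
      qed
      moreover have "lq_bound q M int_lattice (mq * R)"
        unfolding M_def mq_def m_def
      proof (rule lq_bound_finite_Max[OF q E _ R _ y(2)])
        show "0 \<le> y k" for k using y(1) by simp
        show "j + e \<in> int_lattice" if "j \<in> int_lattice" "e \<in> ?E" for j e
          using that by (simp add: lattice_neighbours_def int_lattice_add)
      qed
      ultimately show "lq_bound q (\<lambda>j. japanese_bracket j powr s * (C1 * T j)) int_lattice (C1 * D * (mq * R))"
        using C1(1) D by (simp only:) (rule lq_bound_cmult, simp_all)
      fix j :: 'a assume j: "j \<in> int_lattice"
      show "0 \<le> C1 * T j" using C1(1) T0 by simp
      show "Lp_norm p (box \<eta> j (Tr \<eta> f)) \<le> ennreal (C1 * T j)"
      proof (rule C1(2)[rule_format, OF f tr j fin T0], assumption)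
        fix F :: "('a \<times> real) set" assume F: "finite F" "F \<subseteq> (\<lambda>e. j + e) ` ?E \<times> \<int>"
        have L: "finite (snd ` F)" "snd ` F \<subseteq> \<int>" using F by auto
        have "(\<Sum>k\<in>F. A k powr \<rho>) \<le> (\<Sum>k\<in>(\<lambda>e. j + e) ` ?E \<times> snd ` F. A k powr \<rho>)"
        proof (rule sum_mono2)
          show "finite ((\<lambda>e. j + e) ` ?E \<times> snd ` F)" using E F(1) by simp
          show "F \<subseteq> (\<lambda>e. j + e) ` ?E \<times> snd ` F" using F(2) by force
        qed simp
        also have "\<dots> = (\<Sum>k\<in>(\<lambda>e. j + e) ` ?E. \<Sum>l\<in>snd ` F. A (k, l) powr \<rho>)"
          by (simp add: sum.cartesian_product case_prod_unfold)
        also have "\<dots> = (\<Sum>e\<in>?E. \<Sum>l\<in>snd ` F. A (j + e, l) powr \<rho>)"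
          by (subst sum.reindex) (auto intro: inj_onI)
        also have "\<dots> \<le> (\<Sum>e\<in>?E. (C2 * (c powr s * japanese_bracket j powr (- s) * M j)) powr \<rho>)"
        proof (rule sum_mono)
          fix e assume e: "e \<in> ?E"
          have je: "j + e \<in> int_lattice" using e j by (simp add: lattice_neighbours_def int_lattice_add)
          have "(\<Sum>l\<in>snd ` F. A (j + e, l) powr \<rho>) \<le> (C2 * (japanese_bracket (j + e) powr (- s) * y (j + e))) powr \<rho>"
            by (rule y(3)[rule_format, OF je L])
          also have "\<dots> \<le> (C2 * (c powr s * japanese_bracket j powr (- s) * M j)) powr \<rho>"
            using C2(1) \<rho> y(1) shift[OF e] yM[OF e] by (intro powr_mono2[where a = \<rho>] mult_left_mono mult_mono) auto
          finally show "(\<Sum>l\<in>snd ` F. A (j + e, l) powr \<rho>) \<le> (C2 * (c powr s * japanese_bracket j powr (- s) * M j)) powr \<rho>" .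
        qed
        also have "\<dots> = m * (C2 * (c powr s * japanese_bracket j powr (- s) * M j)) powr \<rho>" by (simp add: m_def)
        also have "\<dots> = (m powr (1 / \<rho>)) powr \<rho> * (C2 * (c powr s * japanese_bracket j powr (- s) * M j)) powr \<rho>"
          using m \<rho> by (simp add: powr_powr)
        also have "\<dots> = T j powr \<rho>" unfolding T_def D_def powr_mult[symmetric] by (simp only: mult_ac)
        finally show "(\<Sum>k\<in>F. enn2real (Lp_norm p (box \<eta> k f)) powr Lp_index p) \<le> T j powr Lp_index p"
          by (simp only: A_def \<rho>_def)
      qed
    qed
    then show "modulation_norm \<eta> s p q (Tr \<eta> f) \<le> ennreal (C1 * D * mq * R)" by (simp only: mult.assoc)
  qed
qed

lemma ennreal_Lp_index: "ennreal (Lp_index p) = min p 1"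
proof (cases p)
  case (real x)
  then show ?thesis by (auto simp: Lp_index_def min_def ennreal_le_1)
next
  case top
  then show ?thesis by (simp add: Lp_index_def min_def top_unique)
qed

lemma trace_loss_exponent:
  fixes p q :: ennreal
  assumes p: "0 < p" and q: "0 < q" and \<epsilon>: "0 < \<epsilon>"
  shows "trace_loss (Lp_index p) q (enn2real (1 / min p (min q 1)) - enn2real (1 / q) + \<epsilon>)"
proof -
  define \<rho> where "\<rho> = Lp_index p"
  have \<rho>: "0 < \<rho>" using Lp_index(1)[OF p] by (simp add: \<rho>_def)
  have inv: "enn2real (1 / ennreal x) = 1 / x" if "0 < x" for x
  proof -
    have "1 / ennreal x = ennreal (1 / x)" using divide_ennreal[of 1 x] that by simp
    then show ?thesis using that by simp
  qed
  have mn: "min p (min q 1) = min (ennreal \<rho>) q" unfolding \<rho>_def ennreal_Lp_index by (simp add: min.assoc min.commute min.left_commute)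
  show ?thesis
  proof (cases "q = \<infinity>")
    case True
    have "min p (min q 1) = ennreal \<rho>" unfolding mn using True by (simp add: min_def)
    then have "enn2real (1 / min p (min q 1)) - enn2real (1 / q) + \<epsilon> = 1 / \<rho> + \<epsilon>" using True inv[OF \<rho>] by simp
    then show ?thesis using True \<rho> \<epsilon> by (simp add: trace_loss_def field_simps flip: \<rho>_def)
  next
    case False
    define r where "r = enn2real q"
    have r: "0 < r" "q = ennreal r" using q False by (auto simp: r_def enn2real_positive_iff less_top)
    have "min p (min q 1) = ennreal (min \<rho> r)" unfolding mn unfolding r(2) using \<rho> r(1) by (simp add: min_def ennreal_le_iff)
    then have e: "enn2real (1 / min p (min q 1)) - enn2real (1 / q) + \<epsilon> = 1 / min \<rho> r - 1 / r + \<epsilon>"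
      using inv[of "min \<rho> r"] inv[of r] \<rho> r by simp
    have "1 / r \<le> 1 / min \<rho> r" using \<rho> r(1) by (intro divide_left_mono) auto
    then have "0 \<le> 1 / min \<rho> r - 1 / r + \<epsilon>" using \<epsilon> by linarith
    moreover have "1 < (1 / min \<rho> r - 1 / r + \<epsilon>) * (\<rho> * (r / (r - \<rho>)))" if lt: "\<rho> < r"
    proof -
      have "(1 / min \<rho> r - 1 / r + \<epsilon>) * (\<rho> * (r / (r - \<rho>))) = 1 + \<epsilon> * (\<rho> * (r / (r - \<rho>)))"
        using lt \<rho> r(1) by (simp add: min_def field_simps)
      moreover have "0 < \<epsilon> * (\<rho> * (r / (r - \<rho>)))" using \<epsilon> \<rho> r(1) lt by simp
      ultimately show ?thesis by linarith
    qed
    ultimately show ?thesis unfolding e trace_loss_def using False by (simp add: \<rho>_def r_def)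
  qed
qed

theorem corollary1p3:
  fixes \<eta> :: "real \<Rightarrow> real" and p q :: ennreal and s \<epsilon> :: real
  assumes "cutoff \<eta>" and "0 < p" and "0 < q" and "0 \<le> s" and "0 < \<epsilon>"
  shows "\<exists>C>0. \<forall>f \<in> (modulation_space \<eta>
             (s + enn2real (1 / min p (min q 1)) - enn2real (1 / q) + \<epsilon>) p q
             :: ((real ^ 'm::finite) \<times> real) dist set).
           has_trace \<eta> f \<and>
           Tr \<eta> f \<in> modulation_space \<eta> s p q \<and>
           modulation_norm \<eta> s p q (Tr \<eta> f) \<le> ennreal C *
             modulation_norm \<eta>
               (s + enn2real (1 / min p (min q 1)) - enn2real (1 / q) + \<epsilon>) p q f"
proof -
  let ?t = "s + enn2real (1 / min p (min q 1)) - enn2real (1 / q) + \<epsilon>"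
  have t: "?t = s + (enn2real (1 / min p (min q 1)) - enn2real (1 / q) + \<epsilon>)" by simp
  obtain C where C: "0 < C" "\<forall>(f :: ((real ^ 'm) \<times> real) dist) R. f \<in> tempered_distributions \<longrightarrow> 0 \<le> R \<longrightarrow>
    modulation_norm \<eta> ?t p q f \<le> ennreal R \<longrightarrow>
    has_trace \<eta> f \<and> modulation_norm \<eta> s p q (Tr \<eta> f) \<le> ennreal (C * R)"
    using trace_bounded[OF assms(1-4) trace_loss_exponent[OF assms(2,3,5)], where 'a = "real ^ 'm", folded t]
    by (elim exE conjE) (rule that)
  show ?thesis
  proof (intro exI[of _ C] conjI ballI)
    show "0 < C" by (rule C(1))
    fix f :: "((real ^ 'm) \<times> real) dist"
    assume f: "f \<in> modulation_space \<eta> ?t p q"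
    define R where "R = enn2real (modulation_norm \<eta> ?t p q f)"
    have R: "0 \<le> R" "modulation_norm \<eta> ?t p q f = ennreal R"
      using f by (auto simp: modulation_space_def R_def less_top)
    have ft: "f \<in> tempered_distributions" using f by (simp add: modulation_space_def)
    from C(2)[rule_format, OF ft R(1) eq_refl[OF R(2)]]
    have tr: "has_trace \<eta> f" and le: "modulation_norm \<eta> s p q (Tr \<eta> f) \<le> ennreal (C * R)" by auto
    show "has_trace \<eta> f" by (rule tr)
    show "modulation_norm \<eta> s p q (Tr \<eta> f) \<le> ennreal C * modulation_norm \<eta> ?t p q f"
      using le R C(1) by (simp add: ennreal_mult)
    have "modulation_norm \<eta> s p q (Tr \<eta> f) < \<infinity>" using le by (rule le_less_trans) simp
    then show "Tr \<eta> f \<in> modulation_space \<eta> s p q"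
      using tr by (simp add: modulation_space_def has_trace_def tempered_has_sum_def)
  qed
qed

end
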